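(* Let $X$ be a compact oriented manifold with conical singularities, $M=reg(X)$ endowed with a conic metric $g$, let $P_i\in \mathrm{Diff}_0^{\mu,\nu}(M,E_i,E_{i+1})$ ($i=0,\dots,n$) form an elliptic complex of differential cone operators and let $T=(T_0,\dots,T_n)$, $T_i=\phi_i\circ f^*$, be a geometric endomorphism of it. Then: 1. for each $i$ and each $\psi\in C_c^\infty(M,E_i)$ we have $T_i(\psi)\in C_c^\infty(M,E_i)$; 2. for each $i$, $T_i$ extends to a bounded operator from $L^2(M,E_i)$ to itself (still denoted $T_i$); 3. if $T_i^*:L^2(M,E_i)\to L^2(M,E_i)$ is the adjoint of $T_i$, then $T_i^*(\psi)\in C_c^\infty(M,E_i)$ for each $\psi\in C_c^\infty(M,E_i)$.
   Context: **Conical manifolds.** A compact manifold with conical singularities $X$ is a compact metrizable space with a finite subset $sing(X)$ such that $M=reg(X)=X\setminus sing(X)$ is a smooth manifold, and each $q\in sing(X)$ has an open neighbourhood $U_q$, a closed manifold $L_q$ (the link) and a homeomorphism $\chi_q:U_q\to C_2(L_q)=L_q\times[0,2)/(L_q\times\{0\})$ sending $q$ to the vertex and restricting to a diffeomorphism $U_q\setminus\{q\}\to(0,2)\times L_q$. $\overline M$ is the compact manifold with boundary with interior $M$, boundary $N=\bigsqcup_q L_q$ and collars $[0,2)\times L_q$; the blow-down map $\overline M\to X$ is a diffeomorphism of the interior onto $reg(X)$ and collapses $L_q\subset\partial\overline M$ to $q$. A conic metric is a Riemannian metric $g$ on $M$ which near each $q$ has (for suitable $\chi_q$) the form $dr^2+r^2h_q(r)$,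 with $h_q(r)$ Riemannian metrics on $L_q$ depending smoothly on $r$ up to $0$. **Bundles and operators.** $E_0,\dots,E_n$ are vector bundles over $\overline M$ with (Riemannian or Hermitian) metrics nondegenerate up to the boundary; $L^2(M,E_i)$ is defined by $g$ and these metrics. $\mathrm{Diff}_0^{\mu,\nu}(M,E,F)$ ($\nu>0$) is the set of differential operators $P:C_c^\infty(M,E)\to C_c^\infty(M,F)$ which on a collar $(0,\epsilon)\times N$ have the form $P=x^{-\nu}\sum_{k=0}^\mu A_k(x)(-x\partial_x)^k$ with $A_k\in C^\infty([0,\epsilon),\mathrm{Diff}^{\mu-k}(N,E|_N,F|_N))$. Operators $P_i$ with $P_{i+1}P_i=0$ (and $P_n=0$) form an elliptic complex if the complex is elliptic on $M$ in the usual sense and the sequence $0\to\pi^*E_0\to\cdots\to\pi^*E_n\to0$ with maps $x^\nu\sigma^\mu(P_i)(x,p,x^{-1}\tau,\xi)$ is exact, up to $x=0$, for $(\tau,\xi)\neq0$, $\tau\in\mathbb R$, $\xi\in T^*_pN$. **Geometric endomorphism.** $T=(T_0,\dots,T_n)$, $T_i=\phi_i\circ f^*$ acting on $C^\infty(M,E_i)$, where $f:\overline M\to\overline M$ is a diffeomorphism whose induced map $f:X\to X$ fixes every point of $sing(X)$, $\phi_i:f^*E_i\to E_i$ are bundle homomorphisms over $\overline M$, and $P_i\circ T_i=T_{i+1}\circ P_i$. *)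

theory Defs
  imports "HOL-Analysis.Analysis"
begin

section \<open>Smooth functions on subsets of Euclidean space\<close>

definition pd :: "'n \<Rightarrow> (real^'n \<Rightarrow> 'b) \<Rightarrow> real^'n \<Rightarrow> 'b::real_normed_vector"
  where "pd i f = (\<lambda>x. frechet_derivative f (at x) (axis i 1))"

definition pds :: "'n list \<Rightarrow> (real^'n \<Rightarrow> 'b) \<Rightarrow> real^'n \<Rightarrow> 'b::real_normed_vector"
  where "pds is f = foldr pd is f"

definition smooth_open :: "(real^'n) set \<Rightarrow> (real^'n \<Rightarrow> 'b::real_normed_vector) \<Rightarrow> bool"
  where "smooth_open U f \<longleftrightarrow> open U \<and> (\<forall>is. \<forall>x\<in>U. pds is f differentiable (at x))"

text \<open>On an arbitrary subset, smooth means: locally the restriction of a smooth function defined on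
  an open set.  For relatively open subsets of a closed half-space this is smoothness up to the
  boundary, for relatively open subsets of a hyperplane it is smoothness along the hyperplane.\<close>

definition smooth_on :: "(real^'n) set \<Rightarrow> (real^'n \<Rightarrow> 'b::real_normed_vector) \<Rightarrow> bool"
  where "smooth_on S f \<longleftrightarrow>
    (\<forall>x\<in>S. \<exists>U F. x \<in> U \<and> smooth_open U F \<and> (\<forall>y\<in>S \<inter> U. F y = f y))"


section \<open>Manifolds\<close>

text \<open>All manifolds are modelled on a subset \<open>H\<close> of \<open>real^'n\<close>: on everything (no boundary, dimension
  \<open>CARD('n)\<close>), on the closed half-space (with boundary, dimension \<open>CARD('n)\<close>), or on the hyperplane
  (no boundary, dimension \<open>CARD('n) - 1\<close>, possibly \<open>0\<close>).  The distinguished coordinate \<open>rad\<close> plays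
  the role of the boundary defining function \<open>x\<close>.\<close>

definition rad :: "'n::{finite,wellorder}"
  where "rad = (LEAST i. True)"

definition halfspace :: "(real^'n::{finite,wellorder}) set"
  where "halfspace = {v. 0 \<le> v $ rad}"

definition hyperplane :: "(real^'n::{finite,wellorder}) set"
  where "hyperplane = {v. v $ rad = 0}"

type_synonym 'n rmat = "((real, 'n) vec, 'n) vec"

type_synonym ('p, 'n) chart = "'p set \<times> ('p \<Rightarrow> real^'n)"

definition chart_inv :: "('p, 'n) chart \<Rightarrow> real^'n \<Rightarrow> 'p"
  where "chart_inv c = inv_into (fst c) (snd c)"

definition chart_of :: "(real^'n) set \<Rightarrow> 'p topology \<Rightarrow> ('p, 'n) chart \<Rightarrow> bool"
  where "chart_of H T c \<longleftrightarrow>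
    openin T (fst c) \<and> openin (top_of_set H) (snd c ` fst c) \<and>
    homeomorphic_map (subtopology T (fst c)) (top_of_set (snd c ` fst c)) (snd c)"

definition compatible :: "('p, 'n::finite) chart \<Rightarrow> ('p, 'n) chart \<Rightarrow> bool"
  where "compatible c d \<longleftrightarrow>
    smooth_on (snd c ` (fst c \<inter> fst d)) (snd d \<circ> chart_inv c) \<and>
    smooth_on (snd d ` (fst c \<inter> fst d)) (snd c \<circ> chart_inv d)"

text \<open>A smooth structure is a maximal atlas.\<close>

definition manifold :: "(real^'n::finite) set \<Rightarrow> 'p topology \<Rightarrow> ('p, 'n) chart set \<Rightarrow> bool"
  where "manifold H T A \<longleftrightarrow>
    Hausdorff_space T \<and> second_countable T \<and>
    (\<forall>c\<in>A. chart_of H T c) \<and> (\<Union>c\<in>A. fst c) = topspace T \<and>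
    (\<forall>c\<in>A. \<forall>d\<in>A. compatible c d) \<and>
    (\<forall>c. chart_of H T c \<and> (\<forall>d\<in>A. compatible c d) \<longrightarrow> c \<in> A)"

definition restrict_atlas :: "'p set \<Rightarrow> ('p, 'n) chart set \<Rightarrow> ('p, 'n) chart set"
  where "restrict_atlas W A = (\<lambda>c. (fst c \<inter> W, snd c)) ` A"

definition smooth_map ::
  "'p topology \<Rightarrow> ('p, 'n::finite) chart set \<Rightarrow> 'q topology \<Rightarrow> ('q, 'm::finite) chart set \<Rightarrow> ('p \<Rightarrow> 'q) \<Rightarrow> bool"
  where "smooth_map T A T' A' f \<longleftrightarrow> continuous_map T T' f \<and>
    (\<forall>c\<in>A. \<forall>d\<in>A'. smooth_on (snd c ` (fst c \<inter> f -` fst d)) (snd d \<circ> f \<circ> chart_inv c))"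

definition diffeo ::
  "'p topology \<Rightarrow> ('p, 'n::finite) chart set \<Rightarrow> 'q topology \<Rightarrow> ('q, 'm::finite) chart set \<Rightarrow> ('p \<Rightarrow> 'q) \<Rightarrow> bool"
  where "diffeo T A T' A' f \<longleftrightarrow>
    (\<exists>h. homeomorphic_maps T T' f h \<and> smooth_map T A T' A' f \<and> smooth_map T' A' T A h)"

definition smooth_fun ::
  "('p, 'n::finite) chart set \<Rightarrow> 'p set \<Rightarrow> ('p \<Rightarrow> 'b::real_normed_vector) \<Rightarrow> bool"
  where "smooth_fun A W u \<longleftrightarrow> (\<forall>c\<in>A. smooth_on (snd c ` (fst c \<inter> W)) (u \<circ> chart_inv c))"

text \<open>The cylinder \<open>I \<times> L\<close> over a manifold \<open>L\<close> modelled on the hyperplane; its charts are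
  \<open>(r, y) \<mapsto> (r, \<lambda>(y))\<close>.\<close>

definition cyl_top :: "real set \<Rightarrow> 'l topology \<Rightarrow> (real \<times> 'l) topology"
  where "cyl_top I L = prod_topology (top_of_set I) L"

definition cyl_chart :: "real set \<Rightarrow> ('l, 'n::{finite,wellorder}) chart \<Rightarrow> (real \<times> 'l, 'n) chart"
  where "cyl_chart I c = (I \<times> fst c, \<lambda>(r, y). axis rad r + snd c y)"

definition cyl_atlas ::
  "real set \<Rightarrow> ('l, 'n::{finite,wellorder}) chart set \<Rightarrow> (real \<times> 'l, 'n) chart set"
  where "cyl_atlas I A = cyl_chart I ` A"

text \<open>The open cone \<open>[0,2) \<times> L / {0} \<times> L\<close> with the quotient topology; \<open>None\<close> is the vertex.\<close>

definition collapse :: "real \<times> 'l \<Rightarrow> (real \<times> 'l) option"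
  where "collapse z = (if fst z = 0 then None else Some z)"

definition cone_top :: "'l topology \<Rightarrow> (real \<times> 'l) option topology"
  where "cone_top L = topology (\<lambda>W. W \<subseteq> collapse ` ({0..<2} \<times> topspace L) \<and>
    openin (cyl_top {0..<2} L) {z \<in> {0..<2} \<times> topspace L. collapse z \<in> W})"


section \<open>Compact manifolds with conical singularities\<close>

text \<open>\<open>cspace\<close> is \<open>X\<close>, \<open>csing\<close> is \<open>sing(X)\<close> and \<open>creg\<close> the smooth structure of \<open>reg(X)\<close>; \<open>clink q\<close>,
  \<open>clatlas q\<close>, \<open>cnbhd q\<close>, \<open>cchart q\<close> are the link \<open>L\<^sub>q\<close> with its smooth structure, the neighbourhood
  \<open>U\<^sub>q\<close> and the map \<open>\<chi>\<^sub>q\<close>.  The remaining components are the manifold with boundary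
  \<open>cres\<close> (with atlas \<open>catlas\<close>) obtained by blowing up the singular points, the blow-down map
  \<open>cblow\<close> and the collars \<open>ccollar q\<close>.\<close>

record ('x, 'l, 'p, 'n) conical =
  cspace :: "'x topology"
  csing :: "'x set"
  creg :: "('x, 'n) chart set"
  clink :: "'x \<Rightarrow> 'l topology"
  clatlas :: "'x \<Rightarrow> ('l, 'n) chart set"
  cnbhd :: "'x \<Rightarrow> 'x set"
  cchart :: "'x \<Rightarrow> 'x \<Rightarrow> (real \<times> 'l) option"
  cres :: "'p topology"
  catlas :: "('p, 'n) chart set"
  cblow :: "'p \<Rightarrow> 'x"
  ccollar :: "'x \<Rightarrow> real \<times> 'l \<Rightarrow> 'p"

definition reg_top :: "('x, 'l, 'p, 'n::{finite,wellorder}) conical \<Rightarrow> 'x topology"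
  where "reg_top C = subtopology (cspace C) (topspace (cspace C) - csing C)"

definition conical_singularities :: "('x, 'l, 'p, 'n::{finite,wellorder}) conical \<Rightarrow> bool"
  where "conical_singularities C \<longleftrightarrow>
    compact_space (cspace C) \<and> metrizable_space (cspace C) \<and>
    finite (csing C) \<and> csing C \<subseteq> topspace (cspace C) \<and>
    manifold UNIV (reg_top C) (creg C) \<and>
    (\<forall>q\<in>csing C.
      compact_space (clink C q) \<and> manifold hyperplane (clink C q) (clatlas C q) \<and>
      openin (cspace C) (cnbhd C q) \<and> q \<in> cnbhd C q \<and>
      cnbhd C q - {q} \<subseteq> topspace (cspace C) - csing C \<and>
      homeomorphic_map (subtopology (cspace C) (cnbhd C q)) (cone_top (clink C q)) (cchart C q) \<and>
      cchart C q q = None \<and>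
      diffeo (subtopology (cspace C) (cnbhd C q - {q})) (restrict_atlas (cnbhd C q - {q}) (creg C))
             (cyl_top {0<..<2} (clink C q)) (cyl_atlas {0<..<2} (clatlas C q))
             (the \<circ> cchart C q))"

text \<open>The interior of the resolved manifold; it is identified with \<open>M = reg(X)\<close> by the blow-down map.\<close>

definition cint :: "('x, 'l, 'p, 'n::{finite,wellorder}) conical \<Rightarrow> 'p set"
  where "cint C = {p. \<exists>c\<in>catlas C. p \<in> fst c \<and> 0 < snd c p $ rad}"

definition resolution :: "('x, 'l, 'p, 'n::{finite,wellorder}) conical \<Rightarrow> bool"
  where "resolution C \<longleftrightarrow>
    compact_space (cres C) \<and> manifold halfspace (cres C) (catlas C) \<and>
    continuous_map (cres C) (cspace C) (cblow C) \<and>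
    diffeo (subtopology (cres C) (cint C)) (restrict_atlas (cint C) (catlas C))
           (reg_top C) (creg C) (cblow C) \<and>
    (\<forall>p\<in>topspace (cres C) - cint C. cblow C p \<in> csing C) \<and>
    (\<forall>q\<in>csing C.
      diffeo (cyl_top {0..<2} (clink C q)) (cyl_atlas {0..<2} (clatlas C q))
             (subtopology (cres C) {p \<in> topspace (cres C). cblow C p \<in> cnbhd C q})
             (restrict_atlas {p \<in> topspace (cres C). cblow C p \<in> cnbhd C q} (catlas C))
             (ccollar C q) \<and>
      (\<forall>z\<in>{0..<2} \<times> topspace (clink C q). cchart C q (cblow C (ccollar C q z)) = collapse z))"

definition conical_manifold :: "('x, 'l, 'p, 'n::{finite,wellorder}) conical \<Rightarrow> bool"
  where "conical_manifold C \<longleftrightarrow> conical_singularities C \<and> resolution C"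

definition jacobian :: "('p, 'n::finite) chart \<Rightarrow> ('p, 'n) chart \<Rightarrow> 'p \<Rightarrow> 'n rmat"
  where "jacobian c d p = matrix (frechet_derivative (snd d \<circ> chart_inv c) (at (snd c p)))"

definition orientation ::
  "('x, 'l, 'p, 'n::{finite,wellorder}) conical \<Rightarrow> ('x, 'n) chart set \<Rightarrow> bool"
  where "orientation C Or \<longleftrightarrow> Or \<subseteq> creg C \<and> (\<Union>c\<in>Or. fst c) = topspace (reg_top C) \<and>
    (\<forall>c\<in>Or. \<forall>d\<in>Or. \<forall>p\<in>fst c \<inter> fst d. 0 < det (jacobian c d p))"


section \<open>Conic metrics and their volume\<close>

text \<open>A Riemannian metric on \<open>M\<close> is given by its component matrices in all charts, subject to the
  tensor transformation law.\<close>

definition riemannian_metric ::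
  "('x, 'l, 'p, 'n::{finite,wellorder}) conical \<Rightarrow> (('p, 'n) chart \<Rightarrow> 'p \<Rightarrow> 'n rmat) \<Rightarrow> bool"
  where "riemannian_metric C g \<longleftrightarrow> (\<forall>c\<in>catlas C.
    smooth_fun (catlas C) (fst c \<inter> cint C) (g c) \<and>
    (\<forall>p\<in>fst c \<inter> cint C. transpose (g c p) = g c p \<and> (\<forall>v. v \<noteq> 0 \<longrightarrow> 0 < v \<bullet> (g c p *v v))) \<and>
    (\<forall>d\<in>catlas C. \<forall>p\<in>fst c \<inter> fst d \<inter> cint C.
      g c p = transpose (jacobian c d p) ** g d p ** jacobian c d p))"

definition collar ::
  "('x, 'l, 'p, 'n::{finite,wellorder}) conical \<Rightarrow> 'x \<Rightarrow> real \<Rightarrow> (real \<times> 'l \<Rightarrow> 'p) \<Rightarrow> bool"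
  where "collar C q \<epsilon> k \<longleftrightarrow> 0 < \<epsilon> \<and>
    (let W = k ` ({0..<\<epsilon>} \<times> topspace (clink C q)) in
      openin (cres C) W \<and>
      diffeo (cyl_top {0..<\<epsilon>} (clink C q)) (cyl_atlas {0..<\<epsilon>} (clatlas C q))
             (subtopology (cres C) W) (restrict_atlas W (catlas C)) k \<and>
      k ` ({0} \<times> topspace (clink C q)) = {p \<in> topspace (cres C). cblow C p = q})"

definition collar_chart ::
  "real \<Rightarrow> (real \<times> 'l \<Rightarrow> 'p) \<Rightarrow> ('l, 'n::{finite,wellorder}) chart \<Rightarrow> ('p, 'n) chart"
  where "collar_chart \<epsilon> k l =
    (k ` ({0..<\<epsilon>} \<times> fst l), \<lambda>p. snd (cyl_chart {0..<\<epsilon>} l) (inv_into ({0..<\<epsilon>} \<times> fst l) k p))"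

definition tangential :: "real^'n::{finite,wellorder} \<Rightarrow> real^'n::_"
  where "tangential v = v - axis rad (v $ rad)"

text \<open>Near \<open>q\<close>, in the coordinates \<open>(r, y)\<close> of some collar, the metric is \<open>dr\<^sup>2 + r\<^sup>2 h(r)\<close>.  Only
  the components of \<open>h\<close> along the hyperplane matter.  They are stated in each chart of the link;
  that they transform as a tensor on the link follows for \<open>r > 0\<close> from the transformation law of
  \<open>g\<close>, and for \<open>r = 0\<close> by continuity.\<close>

definition conic_metric ::
  "('x, 'l, 'p, 'n::{finite,wellorder}) conical \<Rightarrow> (('p, 'n) chart \<Rightarrow> 'p \<Rightarrow> 'n rmat) \<Rightarrow> bool"
  where "conic_metric C g \<longleftrightarrow> riemannian_metric C g \<and>
    (\<forall>q\<in>csing C. \<exists>\<epsilon> k. collar C q \<epsilon> k \<and>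
      (\<forall>l\<in>clatlas C q. let c = collar_chart \<epsilon> k l in
        \<exists>h :: 'p \<Rightarrow> 'n rmat. smooth_fun (catlas C) (fst c) h \<and>
          (\<forall>p\<in>fst c. transpose (h p) = h p \<and>
            (\<forall>v\<in>hyperplane. v \<noteq> 0 \<longrightarrow> 0 < v \<bullet> (h p *v v))) \<and>
          (\<forall>p\<in>fst c \<inter> cint C. \<forall>u v. u \<bullet> (g c p *v v) =
            u $ rad * v $ rad + (snd c p $ rad)\<^sup>2 * (tangential u \<bullet> (h p *v tangential v)))))"

text \<open>The Riemannian measure on \<open>M\<close>; since \<open>M\<close> is second countable there is exactly one such measure.\<close>

definition riemannian_volume ::
  "('x, 'l, 'p, 'n::{finite,wellorder}) conical \<Rightarrow> (('p, 'n) chart \<Rightarrow> 'p \<Rightarrow> 'n rmat) \<Rightarrow>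
   'p measure \<Rightarrow> bool"
  where "riemannian_volume C g vol \<longleftrightarrow>
    space vol = cint C \<and>
    sets vol = sigma_sets (cint C) {W. openin (cres C) W \<and> W \<subseteq> cint C} \<and>
    (\<forall>c\<in>catlas C. \<forall>A\<in>sets vol. A \<subseteq> fst c \<longrightarrow>
      emeasure vol A =
        (\<integral>\<^sup>+x. ennreal (sqrt (det (g c (chart_inv c x)))) * indicator (snd c ` A) x \<partial>lborel))"


section \<open>Vector bundles and sections\<close>

text \<open>Real and complex bundles are treated simultaneously: \<open>K\<close> is \<open>\<real>\<close> or \<open>UNIV\<close>, as a set of complex
  numbers.  The fibres are \<open>K\<close>-subspaces of the space of all complex sequences; as they carry no
  joint topology or smooth structure other than the one given by the local trivialisations, this
  is no restriction on the bundle.  A local trivialisation \<open>(W, k, \<Phi>)\<close> of rank \<open>k\<close> over the open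
  set \<open>W\<close> consists of linear isomorphisms \<open>\<Phi> p\<close> from the fibre over \<open>p\<close> onto \<open>K\<^sup>k\<close>.\<close>

type_synonym cvec = "nat \<Rightarrow> complex"

definition coord_space :: "complex set \<Rightarrow> nat \<Rightarrow> cvec set"
  where "coord_space K k = {v. (\<forall>j. v j \<in> K) \<and> (\<forall>j\<ge>k. v j = 0)}"

definition K_subspace :: "complex set \<Rightarrow> cvec set \<Rightarrow> bool"
  where "K_subspace K F \<longleftrightarrow> (\<lambda>j. 0) \<in> F \<and> (\<forall>v\<in>F. \<forall>w\<in>F. (\<lambda>j. v j + w j) \<in> F) \<and>
    (\<forall>a\<in>K. \<forall>v\<in>F. (\<lambda>j. a * v j) \<in> F)"

definition K_linear_on :: "complex set \<Rightarrow> cvec set \<Rightarrow> (cvec \<Rightarrow> cvec) \<Rightarrow> bool"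
  where "K_linear_on K F \<phi> \<longleftrightarrow>
    (\<forall>v\<in>F. \<forall>w\<in>F. \<phi> (\<lambda>j. v j + w j) = (\<lambda>j. \<phi> v j + \<phi> w j)) \<and>
    (\<forall>a\<in>K. \<forall>v\<in>F. \<phi> (\<lambda>j. a * v j) = (\<lambda>j. a * \<phi> v j))"

type_synonym 'p triv = "'p set \<times> nat \<times> ('p \<Rightarrow> cvec \<Rightarrow> cvec)"

definition tdom :: "'p triv \<Rightarrow> 'p set"
  where "tdom t = fst t"

definition trank :: "'p triv \<Rightarrow> nat"
  where "trank t = fst (snd t)"

definition tmap :: "'p triv \<Rightarrow> 'p \<Rightarrow> cvec \<Rightarrow> cvec"
  where "tmap t = snd (snd t)"

record 'p vbundle =
  fibre :: "'p \<Rightarrow> cvec set"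
  trivs :: "'p triv set"
  fmetric :: "'p \<Rightarrow> cvec \<Rightarrow> cvec \<Rightarrow> complex"

definition vector_bundle ::
  "complex set \<Rightarrow> ('x, 'l, 'p, 'n::{finite,wellorder}) conical \<Rightarrow> 'p vbundle \<Rightarrow> bool"
  where "vector_bundle K C E \<longleftrightarrow>
    (\<forall>p\<in>topspace (cres C). K_subspace K (fibre E p)) \<and>
    (\<Union>t\<in>trivs E. tdom t) = topspace (cres C) \<and>
    (\<forall>t\<in>trivs E. openin (cres C) (tdom t) \<and>
      (\<forall>p\<in>tdom t. bij_betw (tmap t p) (fibre E p) (coord_space K (trank t)) \<and>
        K_linear_on K (fibre E p) (tmap t p))) \<and>
    (\<forall>t\<in>trivs E. \<forall>t'\<in>trivs E. \<exists>G :: nat \<Rightarrow> nat \<Rightarrow> 'p \<Rightarrow> complex.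
      (\<forall>l j. smooth_fun (catlas C) (tdom t \<inter> tdom t') (G l j)) \<and>
      (\<forall>p\<in>tdom t \<inter> tdom t'. \<forall>v\<in>fibre E p. \<forall>l<trank t'.
        tmap t' p v l = (\<Sum>j<trank t. G l j p * tmap t p v j)))"

text \<open>Riemannian (\<open>K = \<real>\<close>) or Hermitian (\<open>K = UNIV\<close>) metric, linear in the first argument, smooth and
  nondegenerate up to the boundary.\<close>

definition bundle_metric ::
  "complex set \<Rightarrow> ('x, 'l, 'p, 'n::{finite,wellorder}) conical \<Rightarrow> 'p vbundle \<Rightarrow> bool"
  where "bundle_metric K C E \<longleftrightarrow>
    (\<forall>p\<in>topspace (cres C). \<forall>v\<in>fibre E p.
      (v \<noteq> (\<lambda>j. 0) \<longrightarrow> 0 < Re (fmetric E p v v)) \<and>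
      (\<forall>w\<in>fibre E p. fmetric E p v w \<in> K \<and> fmetric E p w v = cnj (fmetric E p v w) \<and>
        (\<forall>u\<in>fibre E p. fmetric E p (\<lambda>j. v j + w j) u = fmetric E p v u + fmetric E p w u) \<and>
        (\<forall>a\<in>K. fmetric E p (\<lambda>j. a * v j) w = a * fmetric E p v w))) \<and>
    (\<forall>t\<in>trivs E. \<exists>H :: nat \<Rightarrow> nat \<Rightarrow> 'p \<Rightarrow> complex.
      (\<forall>l j. smooth_fun (catlas C) (tdom t) (H l j)) \<and>
      (\<forall>p\<in>tdom t. \<forall>v\<in>fibre E p. \<forall>w\<in>fibre E p. fmetric E p v w =
        (\<Sum>l<trank t. \<Sum>j<trank t. H l j p * tmap t p v l * cnj (tmap t p w j))))"

definition metric_bundle ::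
  "complex set \<Rightarrow> ('x, 'l, 'p, 'n::{finite,wellorder}) conical \<Rightarrow> 'p vbundle \<Rightarrow> bool"
  where "metric_bundle K C E \<longleftrightarrow> vector_bundle K C E \<and> bundle_metric K C E"

text \<open>Sections over \<open>M\<close> are extended by \<open>0\<close> to all of the point type.\<close>

definition sections :: "('x, 'l, 'p, 'n::{finite,wellorder}) conical \<Rightarrow> 'p vbundle \<Rightarrow> ('p \<Rightarrow> cvec) set"
  where "sections C E =
    {s. (\<forall>p\<in>cint C. s p \<in> fibre E p) \<and> (\<forall>p. p \<notin> cint C \<longrightarrow> s p = (\<lambda>j. 0))}"

definition smooth_sections ::
  "('x, 'l, 'p, 'n::{finite,wellorder}) conical \<Rightarrow> 'p vbundle \<Rightarrow> ('p \<Rightarrow> cvec) set"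
  where "smooth_sections C E = {s \<in> sections C E. \<forall>t\<in>trivs E. \<forall>j<trank t.
    smooth_fun (catlas C) (tdom t \<inter> cint C) (\<lambda>p. tmap t p (s p) j)}"

definition Cc_sections ::
  "('x, 'l, 'p, 'n::{finite,wellorder}) conical \<Rightarrow> 'p vbundle \<Rightarrow> ('p \<Rightarrow> cvec) set"
  where "Cc_sections C E = {s \<in> smooth_sections C E.
    \<exists>Q. compactin (cres C) Q \<and> Q \<subseteq> cint C \<and> (\<forall>p. p \<notin> Q \<longrightarrow> s p = (\<lambda>j. 0))}"


section \<open>The spaces \<open>L\<^sup>2(M, E)\<close>\<close>

text \<open>Elements of \<open>L\<^sup>2(M, E)\<close> are represented by square integrable sections, and equality in
  \<open>L\<^sup>2(M, E)\<close> is equality almost everywhere.\<close>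

definition L2_sections ::
  "('x, 'l, 'p, 'n::{finite,wellorder}) conical \<Rightarrow> 'p measure \<Rightarrow> 'p vbundle \<Rightarrow> ('p \<Rightarrow> cvec) set"
  where "L2_sections C vol E = {s \<in> sections C E.
    (\<forall>t\<in>trivs E. \<forall>j<trank t. (\<lambda>p. tmap t p (s p) j) \<in>
      borel_measurable (restrict_space vol (tdom t \<inter> cint C))) \<and>
    integrable vol (\<lambda>p. fmetric E p (s p) (s p))}"

definition L2_inner ::
  "'p measure \<Rightarrow> 'p vbundle \<Rightarrow> ('p \<Rightarrow> cvec) \<Rightarrow> ('p \<Rightarrow> cvec) \<Rightarrow> complex"
  where "L2_inner vol E s t = (\<integral>p. fmetric E p (s p) (t p) \<partial>vol)"

definition L2_norm :: "'p measure \<Rightarrow> 'p vbundle \<Rightarrow> ('p \<Rightarrow> cvec) \<Rightarrow> real"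
  where "L2_norm vol E s = sqrt (Re (L2_inner vol E s s))"

definition L2_eq :: "'p measure \<Rightarrow> ('p \<Rightarrow> cvec) \<Rightarrow> ('p \<Rightarrow> cvec) \<Rightarrow> bool"
  where "L2_eq vol s t \<longleftrightarrow> (AE p in vol. s p = t p)"

text \<open>Linearity and boundedness imply that such an operator respects equality almost everywhere.\<close>

definition L2_bounded_operator ::
  "complex set \<Rightarrow> ('x, 'l, 'p, 'n::{finite,wellorder}) conical \<Rightarrow> 'p measure \<Rightarrow> 'p vbundle \<Rightarrow>
   (('p \<Rightarrow> cvec) \<Rightarrow> 'p \<Rightarrow> cvec) \<Rightarrow> bool"
  where "L2_bounded_operator K C vol E B \<longleftrightarrow>
    (\<forall>s\<in>L2_sections C vol E. B s \<in> L2_sections C vol E) \<and>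
    (\<forall>s\<in>L2_sections C vol E. \<forall>t\<in>L2_sections C vol E.
      L2_eq vol (B (\<lambda>p j. s p j + t p j)) (\<lambda>p j. B s p j + B t p j)) \<and>
    (\<forall>a\<in>K. \<forall>s\<in>L2_sections C vol E. L2_eq vol (B (\<lambda>p j. a * s p j)) (\<lambda>p j. a * B s p j)) \<and>
    (\<exists>b. \<forall>s\<in>L2_sections C vol E. L2_norm vol E (B s) \<le> b * L2_norm vol E s)"

definition L2_adjoint ::
  "complex set \<Rightarrow> ('x, 'l, 'p, 'n::{finite,wellorder}) conical \<Rightarrow> 'p measure \<Rightarrow> 'p vbundle \<Rightarrow>
   (('p \<Rightarrow> cvec) \<Rightarrow> 'p \<Rightarrow> cvec) \<Rightarrow> (('p \<Rightarrow> cvec) \<Rightarrow> 'p \<Rightarrow> cvec) \<Rightarrow> bool"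
  where "L2_adjoint K C vol E B B' \<longleftrightarrow> L2_bounded_operator K C vol E B' \<and>
    (\<forall>s\<in>L2_sections C vol E. \<forall>t\<in>L2_sections C vol E.
      L2_inner vol E (B s) t = L2_inner vol E s (B' t))"


section \<open>Differential cone operators\<close>

text \<open>Partial derivatives are indexed by words in the coordinate indices instead of multi-indices.
  The coefficients are then not unique, but the operator determines the sums over all words with
  the same underlying multi-index, and hence the symbols below.\<close>

definition words :: "'n set \<Rightarrow> nat \<Rightarrow> 'n list set"
  where "words I m = {is. set is \<subseteq> I \<and> length is \<le> m}"

definition top_words :: "'n set \<Rightarrow> nat \<Rightarrow> 'n list set"
  where "top_words I m = {is. set is \<subseteq> I \<and> length is = m}"

definition word_eval :: "'n list \<Rightarrow> real^'n \<Rightarrow> complex"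
  where "word_eval is \<xi> = of_real (\<Prod>i\<leftarrow>is. \<xi> $ i)"

definition section_coord ::
  "('p, 'n) chart \<Rightarrow> 'p triv \<Rightarrow> ('p \<Rightarrow> cvec) \<Rightarrow> nat \<Rightarrow> real^'n \<Rightarrow> complex"
  where "section_coord c t \<psi> j = (\<lambda>x. tmap t (chart_inv c x) (\<psi> (chart_inv c x)) j)"

definition local_form ::
  "complex set \<Rightarrow> ('x, 'l, 'p, 'n::{finite,wellorder}) conical \<Rightarrow> 'p vbundle \<Rightarrow> nat \<Rightarrow>
   (('p \<Rightarrow> cvec) \<Rightarrow> 'p \<Rightarrow> cvec) \<Rightarrow> ('p, 'n) chart \<Rightarrow> 'p triv \<Rightarrow> 'p triv \<Rightarrow>
   ('n list \<Rightarrow> nat \<Rightarrow> nat \<Rightarrow> 'p \<Rightarrow> complex) \<Rightarrow> bool"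
  where "local_form K C E \<mu> P c t t' a \<longleftrightarrow>
    (let W = fst c \<inter> tdom t \<inter> tdom t' \<inter> cint C in
      (\<forall>is l j. smooth_fun (catlas C) W (a is l j) \<and> a is l j ` W \<subseteq> K) \<and>
      (\<forall>\<psi>\<in>Cc_sections C E. \<forall>p\<in>W. \<forall>l<trank t'. tmap t' p (P \<psi> p) l =
        (\<Sum>j<trank t. \<Sum>is\<in>words UNIV \<mu>.
          a is l j p * pds is (section_coord c t \<psi> j) (snd c p))))"

definition diff_operator ::
  "complex set \<Rightarrow> ('x, 'l, 'p, 'n::{finite,wellorder}) conical \<Rightarrow> nat \<Rightarrow> 'p vbundle \<Rightarrow> 'p vbundle \<Rightarrow>
   (('p \<Rightarrow> cvec) \<Rightarrow> 'p \<Rightarrow> cvec) \<Rightarrow> bool"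
  where "diff_operator K C \<mu> E F P \<longleftrightarrow>
    (\<forall>\<psi>\<in>Cc_sections C E. P \<psi> \<in> Cc_sections C F) \<and>
    (\<forall>c\<in>catlas C. \<forall>t\<in>trivs E. \<forall>t'\<in>trivs F. \<exists>a. local_form K C E \<mu> P c t t' a)"

definition euler :: "(real^'n::{finite,wellorder} \<Rightarrow> complex) \<Rightarrow> real^'n::_ \<Rightarrow> complex"
  where "euler u = (\<lambda>x. - ((x $ rad) *\<^sub>R pd rad u x))"

text \<open>\<open>P = x\<^bsup>-\<nu>\<^esup> \<Sum>\<^sub>m A\<^sub>m(x) (-x\<partial>\<^sub>x)\<^sup>m\<close> in collar coordinates \<open>(x, y)\<close>, where \<open>A\<^sub>m(x)\<close> is a differential operator
  of order at most \<open>\<mu> - m\<close> in \<open>y\<close> with coefficients \<open>a m\<close> smooth up to \<open>x = 0\<close> (the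
  set \<open>W\<close> below contains the boundary points).\<close>

definition cone_form ::
  "complex set \<Rightarrow> ('x, 'l, 'p, 'n::{finite,wellorder}) conical \<Rightarrow> 'p vbundle \<Rightarrow> nat \<Rightarrow> real \<Rightarrow>
   (('p \<Rightarrow> cvec) \<Rightarrow> 'p \<Rightarrow> cvec) \<Rightarrow> ('p, 'n) chart \<Rightarrow> 'p triv \<Rightarrow> 'p triv \<Rightarrow>
   (nat \<Rightarrow> 'n list \<Rightarrow> nat \<Rightarrow> nat \<Rightarrow> 'p \<Rightarrow> complex) \<Rightarrow> bool"
  where "cone_form K C E \<mu> \<nu> P c t t' a \<longleftrightarrow>
    (let W = fst c \<inter> tdom t \<inter> tdom t' in
      (\<forall>m is l j. smooth_fun (catlas C) W (a m is l j) \<and> a m is l j ` W \<subseteq> K) \<and>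
      (\<forall>\<psi>\<in>Cc_sections C E. \<forall>p\<in>W \<inter> cint C. \<forall>l<trank t'. tmap t' p (P \<psi> p) l =
        of_real ((snd c p $ rad) powr (- \<nu>)) *
        (\<Sum>j<trank t. \<Sum>m\<le>\<mu>. \<Sum>is\<in>words (UNIV - {rad}) (\<mu> - m).
          a m is l j p * pds is ((euler ^^ m) (section_coord c t \<psi> j)) (snd c p))))"

definition cone_operator ::
  "complex set \<Rightarrow> ('x, 'l, 'p, 'n::{finite,wellorder}) conical \<Rightarrow> nat \<Rightarrow> real \<Rightarrow> 'p vbundle \<Rightarrow>
   'p vbundle \<Rightarrow> (('p \<Rightarrow> cvec) \<Rightarrow> 'p \<Rightarrow> cvec) \<Rightarrow> bool"
  where "cone_operator K C \<mu> \<nu> E F P \<longleftrightarrow> diff_operator K C \<mu> E F P \<and>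
    (\<forall>q\<in>csing C. \<exists>\<epsilon>\<in>{0<..2}. \<forall>l\<in>clatlas C q. \<forall>t\<in>trivs E. \<forall>t'\<in>trivs F.
      \<exists>a. cone_form K C E \<mu> \<nu> P (collar_chart \<epsilon> (ccollar C q) l) t t' a)"


section \<open>Elliptic complexes\<close>

text \<open>The symbols in local trivialisations.  The factor \<open>\<i>\<^sup>\<mu>\<close> common to all components is omitted: it does
  not affect exactness, and without it the symbol of a real operator is real.\<close>

definition symbol ::
  "nat \<Rightarrow> ('n list \<Rightarrow> nat \<Rightarrow> nat \<Rightarrow> 'p \<Rightarrow> complex) \<Rightarrow> nat \<Rightarrow> nat \<Rightarrow> 'p \<Rightarrow> real^'n::finite \<Rightarrow> cvec \<Rightarrow> cvec"
  where "symbol \<mu> a k k' p \<xi> v = (\<lambda>l. if l < k'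
    then \<Sum>j<k. (\<Sum>is\<in>top_words UNIV \<mu>. a is l j p * word_eval is \<xi>) * v j else 0)"

text \<open>\<open>x\<^sup>\<nu> \<sigma>\<^sup>\<mu>(P)(x, y, x\<^sup>-\<^sup>1\<tau>, \<xi>)\<close>, with \<open>\<tau>\<close> and \<open>\<xi>\<close> the \<open>rad\<close> and the remaining components of
  \<open>\<zeta>\<close>; the symbol of \<open>-x\<partial>\<^sub>x\<close> at \<open>x\<^sup>-\<^sup>1\<tau>\<close> is \<open>-\<tau>\<close> up to the factor \<open>\<i>\<close>, so that the powers of
  \<open>x\<close> cancel.\<close>

definition cone_symbol ::
  "nat \<Rightarrow> (nat \<Rightarrow> 'n list \<Rightarrow> nat \<Rightarrow> nat \<Rightarrow> 'p \<Rightarrow> complex) \<Rightarrow> nat \<Rightarrow> nat \<Rightarrow> 'p \<Rightarrow>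
   real^'n::{finite,wellorder} \<Rightarrow> cvec \<Rightarrow> cvec"
  where "cone_symbol \<mu> a k k' p \<zeta> v = (\<lambda>l. if l < k'
    then \<Sum>j<k. (\<Sum>m\<le>\<mu>. \<Sum>is\<in>top_words (UNIV - {rad}) (\<mu> - m).
      a m is l j p * of_real ((- (\<zeta> $ rad)) ^ m) * word_eval is \<zeta>) * v j else 0)"

text \<open>Exactness of \<open>0 \<rightarrow> K\<^bsup>k 0\<^esup> \<rightarrow> \<dots> \<rightarrow> K\<^bsup>k n\<^esup> \<rightarrow> 0\<close> with maps \<open>\<sigma> 0, \<dots>, \<sigma> (n-1)\<close>.\<close>

definition exact_sequence ::
  "complex set \<Rightarrow> nat \<Rightarrow> (nat \<Rightarrow> nat) \<Rightarrow> (nat \<Rightarrow> cvec \<Rightarrow> cvec) \<Rightarrow> bool"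
  where "exact_sequence K n k \<sigma> \<longleftrightarrow> (\<forall>i\<le>n.
    {v \<in> coord_space K (k i). i < n \<longrightarrow> \<sigma> i v = (\<lambda>j. 0)} =
    (if i = 0 then {\<lambda>j. 0} else \<sigma> (i - 1) ` coord_space K (k (i - 1))))"

definition elliptic_interior ::
  "complex set \<Rightarrow> ('x, 'l, 'p, 'n::{finite,wellorder}) conical \<Rightarrow> nat \<Rightarrow> nat \<Rightarrow> (nat \<Rightarrow> 'p vbundle) \<Rightarrow>
   (nat \<Rightarrow> ('p \<Rightarrow> cvec) \<Rightarrow> 'p \<Rightarrow> cvec) \<Rightarrow> bool"
  where "elliptic_interior K C \<mu> n E P \<longleftrightarrow>
    (\<forall>c\<in>catlas C. \<forall>t. (\<forall>i\<le>n. t i \<in> trivs (E i)) \<longrightarrow>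
      (\<exists>a. (\<forall>i<n. local_form K C (E i) \<mu> (P i) c (t i) (t (Suc i)) (a i)) \<and>
        (\<forall>p\<in>fst c \<inter> (\<Inter>i\<in>{..n}. tdom (t i)) \<inter> cint C. \<forall>\<xi>. \<xi> \<noteq> 0 \<longrightarrow>
          exact_sequence K n (\<lambda>i. trank (t i))
            (\<lambda>i. symbol \<mu> (a i) (trank (t i)) (trank (t (Suc i))) p \<xi>))))"

definition elliptic_boundary ::
  "complex set \<Rightarrow> ('x, 'l, 'p, 'n::{finite,wellorder}) conical \<Rightarrow> nat \<Rightarrow> real \<Rightarrow> nat \<Rightarrow>
   (nat \<Rightarrow> 'p vbundle) \<Rightarrow> (nat \<Rightarrow> ('p \<Rightarrow> cvec) \<Rightarrow> 'p \<Rightarrow> cvec) \<Rightarrow> bool"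
  where "elliptic_boundary K C \<mu> \<nu> n E P \<longleftrightarrow>
    (\<forall>q\<in>csing C. \<exists>\<epsilon>\<in>{0<..2}. \<forall>l\<in>clatlas C q. \<forall>t. (\<forall>i\<le>n. t i \<in> trivs (E i)) \<longrightarrow>
      (let c = collar_chart \<epsilon> (ccollar C q) l in
        \<exists>a. (\<forall>i<n. cone_form K C (E i) \<mu> \<nu> (P i) c (t i) (t (Suc i)) (a i)) \<and>
          (\<forall>p\<in>fst c \<inter> (\<Inter>i\<in>{..n}. tdom (t i)). \<forall>\<zeta>. \<zeta> \<noteq> 0 \<longrightarrow>
            exact_sequence K n (\<lambda>i. trank (t i))
              (\<lambda>i. cone_symbol \<mu> (a i) (trank (t i)) (trank (t (Suc i))) p \<zeta>))))"

text \<open>The last operator \<open>P n\<close> is the zero operator into the zero bundle and is not mentioned.\<close>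

definition elliptic_cone_complex ::
  "complex set \<Rightarrow> ('x, 'l, 'p, 'n::{finite,wellorder}) conical \<Rightarrow> nat \<Rightarrow> real \<Rightarrow> nat \<Rightarrow>
   (nat \<Rightarrow> 'p vbundle) \<Rightarrow> (nat \<Rightarrow> ('p \<Rightarrow> cvec) \<Rightarrow> 'p \<Rightarrow> cvec) \<Rightarrow> bool"
  where "elliptic_cone_complex K C \<mu> \<nu> n E P \<longleftrightarrow>
    (\<forall>i<n. cone_operator K C \<mu> \<nu> (E i) (E (Suc i)) (P i)) \<and>
    (\<forall>i. Suc i < n \<longrightarrow> (\<forall>\<psi>\<in>Cc_sections C (E i). P (Suc i) (P i \<psi>) = (\<lambda>p j. 0))) \<and>
    elliptic_interior K C \<mu> n E P \<and> elliptic_boundary K C \<mu> \<nu> n E P"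


section \<open>Geometric endomorphisms\<close>

definition bundle_hom_pullback ::
  "complex set \<Rightarrow> ('x, 'l, 'p, 'n::{finite,wellorder}) conical \<Rightarrow> ('p \<Rightarrow> 'p) \<Rightarrow> 'p vbundle \<Rightarrow>
   ('p \<Rightarrow> cvec \<Rightarrow> cvec) \<Rightarrow> bool"
  where "bundle_hom_pullback K C f E \<phi> \<longleftrightarrow>
    (\<forall>p\<in>topspace (cres C). \<phi> p ` fibre E (f p) \<subseteq> fibre E p \<and> K_linear_on K (fibre E (f p)) (\<phi> p)) \<and>
    (\<forall>t\<in>trivs E. \<forall>t'\<in>trivs E. \<exists>m :: nat \<Rightarrow> nat \<Rightarrow> 'p \<Rightarrow> complex.
      (\<forall>l j. smooth_fun (catlas C) (f -` tdom t \<inter> tdom t') (m l j)) \<and>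
      (\<forall>p\<in>f -` tdom t \<inter> tdom t'. \<forall>v\<in>fibre E (f p). \<forall>l<trank t'.
        tmap t' p (\<phi> p v) l = (\<Sum>j<trank t. m l j p * tmap t (f p) v j)))"

definition geom_op ::
  "('x, 'l, 'p, 'n::{finite,wellorder}) conical \<Rightarrow> ('p \<Rightarrow> 'p) \<Rightarrow> ('p \<Rightarrow> cvec \<Rightarrow> cvec) \<Rightarrow>
   ('p \<Rightarrow> cvec) \<Rightarrow> 'p \<Rightarrow> cvec"
  where "geom_op C f \<phi> \<psi> = (\<lambda>p. if p \<in> cint C then \<phi> p (\<psi> (f p)) else (\<lambda>j. 0))"

definition geometric_endomorphism ::
  "complex set \<Rightarrow> ('x, 'l, 'p, 'n::{finite,wellorder}) conical \<Rightarrow> nat \<Rightarrow> (nat \<Rightarrow> 'p vbundle) \<Rightarrow>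
   (nat \<Rightarrow> ('p \<Rightarrow> cvec) \<Rightarrow> 'p \<Rightarrow> cvec) \<Rightarrow> ('p \<Rightarrow> 'p) \<Rightarrow> (nat \<Rightarrow> 'p \<Rightarrow> cvec \<Rightarrow> cvec) \<Rightarrow> bool"
  where "geometric_endomorphism K C n E P f \<phi> \<longleftrightarrow>
    diffeo (cres C) (catlas C) (cres C) (catlas C) f \<and>
    (\<exists>fX. (\<forall>p\<in>topspace (cres C). fX (cblow C p) = cblow C (f p)) \<and> (\<forall>q\<in>csing C. fX q = q)) \<and>
    (\<forall>i\<le>n. bundle_hom_pullback K C f (E i) (\<phi> i)) \<and>
    (\<forall>i<n. \<forall>\<psi>\<in>Cc_sections C (E i).
      P i (geom_op C f (\<phi> i) \<psi>) = geom_op C f (\<phi> (Suc i)) (P i \<psi>))"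

definition L2_extension ::
  "complex set \<Rightarrow> ('x, 'l, 'p, 'n::{finite,wellorder}) conical \<Rightarrow> 'p measure \<Rightarrow> 'p vbundle \<Rightarrow>
   (('p \<Rightarrow> cvec) \<Rightarrow> 'p \<Rightarrow> cvec) \<Rightarrow> (('p \<Rightarrow> cvec) \<Rightarrow> 'p \<Rightarrow> cvec) \<Rightarrow> bool"
  where "L2_extension K C vol E T B \<longleftrightarrow> L2_bounded_operator K C vol E B \<and>
    (\<forall>\<psi>\<in>Cc_sections C E. L2_eq vol (B \<psi>) (T \<psi>))"

end

theory Submission
  imports Defs
begin

text \<open>Everything is about the operator \<open>T s = \<phi> (s \<circ> f)\<close> on sections over the interior \<open>M\<close> of the compact
  manifold with boundary, where \<open>f\<close> is a diffeomorphism of that manifold with inverse \<open>h\<close>, and \<open>\<phi>\<close> is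
  a bundle homomorphism that is smooth up to the boundary.

  By invariance of domain, \<open>f\<close> maps the interior onto itself (\<open>homeomorphism_cint\<close>).  If \<open>s\<close> vanishes
  outside a compact subset \<open>Q\<close> of \<open>M\<close>, then \<open>T s\<close> vanishes outside the compact subset \<open>h Q\<close> of \<open>M\<close>, and
  it is smooth because \<open>\<phi>\<close> and \<open>f\<close> are.  This is the first claim (\<open>geom_op_Cc\<close>).

  For boundedness, \<open>\<bar>T s\<bar>\<^sup>2(p) \<le> B \<bar>s\<bar>\<^sup>2(f p)\<close> with a constant \<open>B\<close>, as \<open>\<phi>\<close> is smooth up to the boundary of a
  compact manifold (\<open>bundle_hom_bounded\<close>).  The integral of \<open>\<bar>s\<bar>\<^sup>2 \<circ> f\<close> is the integral of \<open>\<delta> \<bar>s\<bar>\<^sup>2\<close>, where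
  \<open>\<delta>\<close> is the Jacobian of \<open>h\<close> with respect to the Riemannian volume (\<open>distr_eq_density\<close>).  The function
  \<open>\<delta>\<close> is positive and smooth on \<open>M\<close>; the point is that it stays bounded near the boundary
  (\<open>dens_bounded\<close>), although the metric degenerates there.  With \<open>n\<close> the dimension of \<open>M\<close>, in collar
  coordinates \<open>(r, y)\<close> with \<open>g = dr\<^sup>2 + r\<^sup>2 k(r)\<close> the volume density is \<open>r\<^sup>n\<^sup>-\<^sup>1\<close> times a positive function
  that is smooth up to \<open>r = 0\<close>, so \<open>\<delta>\<close> is a bounded function times the \<open>n - 1\<close>st power of the quotient of
  \<open>r \<circ> h\<close> and \<open>r\<close>.
  As \<open>h\<close> preserves the boundary, \<open>r \<circ> h\<close> vanishes where \<open>r\<close> does, and the mean value theorem bounds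
  the quotient (\<open>local_Jacobian_and_radius_bound\<close>).

  The same substitution shows that the adjoint of \<open>T\<close> is \<open>u \<mapsto> \<delta> \<phi>\<^sup>* (u \<circ> h)\<close> with the fibrewise adjoint
  \<open>\<phi>\<^sup>*\<close> of \<open>\<phi>\<close> (\<open>geom_adjoint_inner\<close>).  Since local orthogonal frames that are smooth up to the boundary
  exist by Gram--Schmidt, \<open>\<phi>\<^sup>*\<close> is again a smooth bundle homomorphism (\<open>adjoint_hom_pullback\<close>).  So the
  adjoint is an operator of the same kind as \<open>T\<close>, multiplied by a smooth bounded function; it is
  bounded and preserves the smooth sections with compact support by what was already said.

  Finally, an extension of \<open>T\<close> and its adjoint are only given abstractly, as some bounded operator that
  agrees with \<open>T\<close> on smooth sections with compact support, and some operator with the adjoint property.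
  Two bounded operators that agree on these sections agree almost everywhere on every square
  integrable section (\<open>agree_all\<close>), which is the density of the smooth sections with compact support;
  and adjoints are unique almost everywhere (\<open>L2_adjoint_unique\<close>).\<close>


section \<open>Smooth functions of several real variables\<close>

text \<open>Finite order of differentiability, so that smoothness can be proved by induction on the order.\<close>

definition diff_upto :: "nat \<Rightarrow> (real^'n) set \<Rightarrow> (real^'n \<Rightarrow> 'b::real_normed_vector) \<Rightarrow> bool"
  where "diff_upto k U f \<longleftrightarrow> (\<forall>is. length is \<le> k \<longrightarrow> (\<forall>x\<in>U. pds is f differentiable (at x)))"

lemma smooth_open_iff_diff_upto: "smooth_open U f \<longleftrightarrow> open U \<and> (\<forall>k. diff_upto k U f)"
  unfolding smooth_open_def diff_upto_def by blast

lemma pds_snoc: "pds (is @ [i]) f = pds is (pd i f)"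
  by (simp add: pds_def)

lemma diff_upto_0: "diff_upto 0 U f \<longleftrightarrow> (\<forall>x\<in>U. f differentiable (at x))"
  by (simp add: diff_upto_def pds_def)

lemma diff_upto_Suc:
  "diff_upto (Suc k) U f \<longleftrightarrow> (\<forall>x\<in>U. f differentiable (at x)) \<and> (\<forall>i. diff_upto k U (pd i f))"
proof
  assume *: "diff_upto (Suc k) U f"
  have "pds is (pd i f) differentiable (at x)" if "length is \<le> k" "x \<in> U" for "is" i x
    using *[unfolded diff_upto_def, rule_format, of "is @ [i]" x] that by (simp add: pds_snoc)
  moreover have "f differentiable (at x)" if "x \<in> U" for x
    using *[unfolded diff_upto_def, rule_format, of "[]" x] that by (simp add: pds_def)
  ultimately show "(\<forall>x\<in>U. f differentiable (at x)) \<and> (\<forall>i. diff_upto k U (pd i f))"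
    by (simp add: diff_upto_def)
next
  assume *: "(\<forall>x\<in>U. f differentiable (at x)) \<and> (\<forall>i. diff_upto k U (pd i f))"
  show "diff_upto (Suc k) U f"
    unfolding diff_upto_def
  proof (intro allI impI ballI)
    fix "is" :: "'a list" and x assume "length is \<le> Suc k" "x \<in> U"
    then show "pds is f differentiable (at x)"
      using * by (cases "is" rule: rev_cases) (auto simp: pds_snoc diff_upto_def, simp add: pds_def)
  qed
qed

lemma diff_upto_mono: "diff_upto k U f \<Longrightarrow> j \<le> k \<Longrightarrow> V \<subseteq> U \<Longrightarrow> diff_upto j V f"
  unfolding diff_upto_def by (meson order_trans subsetD)

lemma diff_upto_imp_differentiable: "diff_upto k U f \<Longrightarrow> x \<in> U \<Longrightarrow> f differentiable (at x)"
  using diff_upto_mono[of k U f 0 U] by (simp add: diff_upto_0)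

lemma differentiable_eq_on:
  assumes "open U" "x \<in> U" "\<And>y. y \<in> U \<Longrightarrow> f y = g y"
  shows "(f has_derivative D) (at x) \<longleftrightarrow> (g has_derivative D) (at x)"
  using assms has_derivative_transform_within_open[of _ D x UNIV U] by metis

lemma pd_eq_on:
  assumes "open U" "x \<in> U" "\<And>y. y \<in> U \<Longrightarrow> f y = g y"
  shows "pd i f x = pd i g x"
  unfolding pd_def frechet_derivative_def using differentiable_eq_on[OF assms] by simp

lemma diff_upto_cong:
  assumes "open U" "\<And>y. y \<in> U \<Longrightarrow> f y = g y" "diff_upto k U f"
  shows "diff_upto k U g"
  using assms(2,3)
proof (induction k arbitrary: f g)
  case 0
  then show ?case
    using differentiable_eq_on[OF assms(1) _ 0(1)] by (simp add: diff_upto_0 differentiable_def)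
next
  case (Suc k)
  have "\<forall>x\<in>U. g differentiable (at x)"
    using Suc.prems differentiable_eq_on[OF assms(1) _ Suc.prems(1)]
    by (simp add: diff_upto_Suc differentiable_def)
  moreover have "diff_upto k U (pd i g)" for i
  proof (rule Suc.IH[of "pd i f"])
    show "pd i f y = pd i g y" if "y \<in> U" for y
      by (rule pd_eq_on[OF assms(1) that Suc.prems(1)])
    show "diff_upto k U (pd i f)"
      using Suc.prems(2) by (simp add: diff_upto_Suc)
  qed
  ultimately show ?case by (simp add: diff_upto_Suc)
qed

text \<open>All closure properties below are proved by the same induction on the order: the function is
  differentiable, and its partial derivatives are given by a formula whose ingredients are already
  known to have one derivative less.\<close>

lemma diff_upto_step:
  assumes "open U" "\<And>x. x \<in> U \<Longrightarrow> (f has_derivative D x) (at x)"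
    and "\<And>i. diff_upto k U (\<lambda>x. D x (axis i 1))"
  shows "diff_upto (Suc k) U f"
proof -
  have "pd i f x = D x (axis i 1)" if "x \<in> U" for i x
    using frechet_derivative_at[OF assms(2)[OF that]] by (simp add: pd_def)
  then have "diff_upto k U (pd i f)" for i
    by (intro diff_upto_cong[OF assms(1) _ assms(3)]) simp
  then show ?thesis
    using assms(2) by (auto simp: diff_upto_Suc differentiable_def)
qed

lemma has_derivative_frechet:
  "diff_upto k U f \<Longrightarrow> x \<in> U \<Longrightarrow> (f has_derivative frechet_derivative f (at x)) (at x)"
  using diff_upto_imp_differentiable frechet_derivative_works by blast

lemma diff_upto_pd: "diff_upto (Suc k) U f \<Longrightarrow> diff_upto k U (\<lambda>x. frechet_derivative f (at x) (axis i 1))"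
  by (simp add: diff_upto_Suc flip: pd_def)

lemma diff_upto_const: "diff_upto k U (\<lambda>x. c)"
proof (induction k arbitrary: c)
  case (Suc k)
  have "pd i (\<lambda>x. c) = (\<lambda>x. 0)" for i :: 'a
    by (simp add: pd_def)
  then show ?case by (simp add: diff_upto_Suc Suc)
qed (simp add: diff_upto_0)

lemma diff_upto_linear:
  assumes "open U" "bounded_linear L" "diff_upto k U f"
  shows "diff_upto k U (\<lambda>x. L (f x))"
  using assms(3)
proof (induction k arbitrary: f)
  case 0
  then show ?case
    using bounded_linear.has_derivative[OF assms(2)]
    unfolding diff_upto_0 differentiable_def by blast
next
  case (Suc k)
  show ?case
    by (rule diff_upto_step[OF assms(1) bounded_linear.has_derivative[OF assms(2)
          has_derivative_frechet[OF Suc.prems]]])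
      (auto intro!: Suc.IH diff_upto_pd Suc.prems)
qed

lemma diff_upto_id: "diff_upto k U (\<lambda>x. x)"
proof (cases k)
  case (Suc j)
  have "pd i (\<lambda>x. x) = (\<lambda>x. axis i 1)" for i :: 'a
    by (simp add: pd_def)
  then show ?thesis by (simp add: Suc diff_upto_Suc diff_upto_const)
qed (simp add: diff_upto_0)

lemma diff_upto_add:
  assumes "open U" "diff_upto k U f" "diff_upto k U g"
  shows "diff_upto k U (\<lambda>x. f x + g x)"
  using assms(2,3)
proof (induction k arbitrary: f g)
  case 0
  then show ?case by (simp add: diff_upto_0)
next
  case (Suc k)
  show ?case
    by (rule diff_upto_step[OF assms(1) has_derivative_add[OF
          has_derivative_frechet[OF Suc.prems(1)] has_derivative_frechet[OF Suc.prems(2)]]])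
      (auto intro!: Suc.IH diff_upto_pd Suc.prems)
qed

lemma diff_upto_sum:
  assumes "open U" "\<And>j. j \<in> J \<Longrightarrow> diff_upto k U (f j)"
  shows "diff_upto k U (\<lambda>x. \<Sum>j\<in>J. f j x)"
  using assms(2)
  by (induction J rule: infinite_finite_induct)
    (auto intro!: diff_upto_const diff_upto_add assms(1))

lemma diff_upto_bilinear:
  assumes "open U" "bounded_bilinear B" "diff_upto k U f" "diff_upto k U g"
  shows "diff_upto k U (\<lambda>x. B (f x) (g x))"
  using assms(3,4)
proof (induction k arbitrary: f g)
  case 0
  show ?case
    unfolding diff_upto_0 differentiable_def
    using bounded_bilinear.FDERIV[OF assms(2) has_derivative_frechet[OF 0(1)]
        has_derivative_frechet[OF 0(2)]] by blast
next
  case (Suc k)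
  have "diff_upto k U f" "diff_upto k U g"
    by (rule diff_upto_mono[OF Suc.prems(1)] diff_upto_mono[OF Suc.prems(2)]; simp)+
  then show ?case
    by (intro diff_upto_step[OF assms(1) bounded_bilinear.FDERIV[OF assms(2)
          has_derivative_frechet[OF Suc.prems(1)] has_derivative_frechet[OF Suc.prems(2)]]]
          diff_upto_add Suc.IH diff_upto_pd Suc.prems assms(1))
qed

lemma diff_upto_compose:
  fixes f :: "real^'n \<Rightarrow> real^'m" and g :: "real^'m \<Rightarrow> 'b::real_normed_vector"
  assumes "open U" "open V" "f ` U \<subseteq> V" "diff_upto k U f" "diff_upto k V g"
  shows "diff_upto k U (\<lambda>x. g (f x))"
  using assms(4,5)
proof (induction k arbitrary: g)
  case 0
  then show ?case using assms(3) differentiable_chain_at[of f _ g]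
    unfolding diff_upto_0 o_def by blast
next
  case (Suc k)
  have D: "((\<lambda>x. g (f x)) has_derivative
      (\<lambda>h. frechet_derivative g (at (f x)) (frechet_derivative f (at x) h))) (at x)" if "x \<in> U" for x
    using diff_chain_at[OF has_derivative_frechet[OF Suc.prems(1) that], of g]
      has_derivative_frechet[OF Suc.prems(2)] assms(3) that by (auto simp: o_def)
  have expand: "frechet_derivative g (at (f x)) v = (\<Sum>j\<in>UNIV. v $ j *\<^sub>R pd j g (f x))"
    if "x \<in> U" for x v
  proof -
    have lin: "linear (frechet_derivative g (at (f x)))"
      using has_derivative_frechet[OF Suc.prems(2)] assms(3) that has_derivative_linear by blast
    have "frechet_derivative g (at (f x)) v =
      frechet_derivative g (at (f x)) (\<Sum>j\<in>UNIV. v $ j *\<^sub>R axis j 1)"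
      by (simp add: basis_expansion flip: scalar_mult_eq_scaleR)
    also have "\<dots> = (\<Sum>j\<in>UNIV. v $ j *\<^sub>R pd j g (f x))"
      by (simp add: linear_sum[OF lin] linear_scale[OF lin] pd_def)
    finally show ?thesis .
  qed
  show ?case
  proof (rule diff_upto_step[OF assms(1) D])
    fix i
    have "diff_upto k U f"
      by (rule diff_upto_mono[OF Suc.prems(1)]) auto
    \<comment> \<open>The chain rule in terms of partial derivatives; here \<open>g\<close> enters only through the functions
      \<open>pd j g\<close>, to which the induction hypothesis applies.\<close>
    then have "diff_upto k U (\<lambda>x. \<Sum>j\<in>UNIV. (pd i f x $ j) *\<^sub>R pd j g (f x))"
      using Suc.prems
      by (intro diff_upto_sum assms(1) diff_upto_bilinear[OF _ bounded_bilinear_scaleR]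
          diff_upto_linear[OF _ bounded_linear_vec_nth] Suc.IH)
        (auto simp: diff_upto_Suc)
    then show "diff_upto k U
        (\<lambda>x. frechet_derivative g (at (f x)) (frechet_derivative f (at x) (axis i 1)))"
      by (rule diff_upto_cong[OF assms(1), rotated]) (simp add: expand pd_def)
  qed
qed

lemma diff_upto_inverse:
  fixes f :: "real^'n \<Rightarrow> 'b::real_normed_field"
  assumes "open U" "\<And>x. x \<in> U \<Longrightarrow> f x \<noteq> 0" "diff_upto k U f"
  shows "diff_upto k U (\<lambda>x. inverse (f x))"
  using assms(3)
proof (induction k)
  case 0
  then show ?case using assms(2) by (simp add: diff_upto_0 differentiable_inverse)
next
  case (Suc k)
  have IH: "diff_upto k U (\<lambda>x. inverse (f x))"
    using Suc diff_upto_mono by (metis le_SucI order_refl)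
  have "diff_upto k U (\<lambda>x. inverse (f x) * frechet_derivative f (at x) (axis i 1) * inverse (f x))" for i
    by (intro diff_upto_bilinear[OF assms(1) bounded_bilinear_mult] IH diff_upto_pd Suc.prems)
  from diff_upto_linear[OF assms(1) bounded_linear_minus[OF bounded_linear_ident] this]
  show ?case
    by (intro diff_upto_step[OF assms(1) Deriv.has_derivative_inverse[OF assms(2)
          has_derivative_frechet[OF Suc.prems]]]) auto
qed

lemma diff_upto_sqrt:
  fixes f :: "real^'n \<Rightarrow> real"
  assumes "open U" "\<And>x. x \<in> U \<Longrightarrow> 0 < f x" "diff_upto k U f"
  shows "diff_upto k U (\<lambda>x. sqrt (f x))"
  using assms(3)
proof (induction k)
  case 0
  have "((\<lambda>x. sqrt (f x)) has_derivative (\<lambda>h. frechet_derivative f (at x) h * (inverse (sqrt (f x)) / 2))) (at x)"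
    if "x \<in> U" for x
    using has_derivative_frechet[OF 0 that] assms(2)[OF that]
    by (auto intro!: derivative_eq_intros simp: field_simps)
  then show ?case by (auto simp: diff_upto_0 differentiable_def)
next
  case (Suc k)
  have IH: "diff_upto k U (\<lambda>x. sqrt (f x))"
    using Suc diff_upto_mono by (metis le_SucI order_refl)
  have D: "((\<lambda>x. sqrt (f x)) has_derivative (\<lambda>h. frechet_derivative f (at x) h * (inverse (sqrt (f x)) * (1/2)))) (at x)"
    if "x \<in> U" for x
    using has_derivative_frechet[OF Suc.prems that] assms(2)[OF that]
    by (auto intro!: derivative_eq_intros simp: field_simps)
  have "sqrt (f x) \<noteq> 0" if "x \<in> U" for x
    using assms(2)[OF that] by simp
  then show ?case
    by (intro diff_upto_step[OF assms(1) D] diff_upto_bilinear[OF assms(1) bounded_bilinear_mult]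
        diff_upto_pd Suc.prems diff_upto_const diff_upto_inverse[OF assms(1) _ IH]) auto
qed

subsection \<open>The flat function\<close>

text \<open>The functions \<open>p(1/x) e\<^sup>-\<^sup>1\<^sup>/\<^sup>x\<close>, continued by \<open>0\<close> to \<open>x \<le> 0\<close>, form a family closed under
  differentiation; hence all of them are smooth, in particular the one with \<open>p = 1\<close>.\<close>

definition flat_poly :: "real poly \<Rightarrow> real \<Rightarrow> real"
  where "flat_poly p x = (if 0 < x then poly p (1 / x) * exp (- (1 / x)) else 0)"

lemma tendsto_poly_exp_minus: "((\<lambda>y. poly p y * exp (- y)) \<longlongrightarrow> 0) at_top" for p :: "real poly"
proof -
  have eq: "(\<lambda>y. poly p y * exp (- y)) = (\<lambda>y. \<Sum>i\<le>degree p. coeff p i * (y ^ i / exp y))"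
    by (rule ext) (simp add: poly_altdef exp_minus sum_distrib_right divide_inverse mult.assoc)
  show ?thesis
    unfolding eq by (intro tendsto_null_sum tendsto_mult_right_zero tendsto_power_div_exp_0)
qed

lemma flat_poly_tendsto_0: "(flat_poly p \<longlongrightarrow> 0) (at 0)"
proof -
  have "((\<lambda>x. poly p (inverse x) * exp (- inverse x)) \<longlongrightarrow> 0) (at_right 0)"
    by (rule filterlim_compose[OF tendsto_poly_exp_minus filterlim_inverse_at_top_right])
  moreover have "\<forall>\<^sub>F x in at_right 0. poly p (inverse x) * exp (- inverse x) = flat_poly p x"
    by (auto simp: eventually_at_filter flat_poly_def inverse_eq_divide)
  ultimately have "(flat_poly p \<longlongrightarrow> 0) (at_right 0)"
    by (rule Lim_transform_eventually)
  moreover have "(flat_poly p \<longlongrightarrow> 0) (at_left 0)"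
    by (rule tendsto_eventually) (auto simp: eventually_at_filter flat_poly_def)
  ultimately show ?thesis by (simp add: filterlim_split_at)
qed

text \<open>With \<open>y = 1/x\<close>, the derivative of \<open>p(y) e\<^sup>-\<^sup>y\<close> with respect to \<open>x\<close> is \<open>y\<^sup>2 (p(y) - p'(y)) e\<^sup>-\<^sup>y\<close>.  At
  \<open>x = 0\<close> the difference quotient is \<open>y p(y) e\<^sup>-\<^sup>y\<close>, which tends to \<open>0\<close>.\<close>

lemma flat_poly_has_derivative:
  "(flat_poly p has_real_derivative flat_poly ([:0, 0, 1:] * (p - pderiv p)) x) (at x)"
proof (cases "x = 0")
  case True
  have "((\<lambda>h. flat_poly ([:0, 1:] * p) h) \<longlongrightarrow> 0) (at 0)"
    by (rule flat_poly_tendsto_0)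
  moreover have "(flat_poly p (0 + h) - flat_poly p 0) / h = flat_poly ([:0, 1:] * p) h" for h
    by (simp add: flat_poly_def)
  ultimately show ?thesis using True by (simp add: DERIV_def) (simp add: flat_poly_def)
next
  case False
  show ?thesis
  proof (cases "0 < x")
    case True
    have "((\<lambda>y. poly p (1 / y) * exp (- (1 / y))) has_real_derivative
        poly p (1 / x) * (exp (- (1 / x)) * (1 / x\<^sup>2)) +
        poly (pderiv p) (1 / x) * (- (1 / x\<^sup>2)) * exp (- (1 / x))) (at x)"
    proof (rule DERIV_mult')
      have "((\<lambda>y. 1 / y) has_real_derivative - (1 / x\<^sup>2)) (at x)"
        using True by (auto intro!: derivative_eq_intros simp: power2_eq_square)
      from DERIV_chain2[OF poly_DERIV this]
      show "((\<lambda>y. poly p (1 / y)) has_real_derivative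
          poly (pderiv p) (1 / x) * (- (1 / x\<^sup>2))) (at x)" .
      show "((\<lambda>y. exp (- (1 / y))) has_real_derivative exp (- (1 / x)) * (1 / x\<^sup>2)) (at x)"
        using True by (auto intro!: derivative_eq_intros simp: power2_eq_square)
    qed
    also have "poly p (1 / x) * (exp (- (1 / x)) * (1 / x\<^sup>2)) +
        poly (pderiv p) (1 / x) * (- (1 / x\<^sup>2)) * exp (- (1 / x)) =
        flat_poly ([:0, 0, 1:] * (p - pderiv p)) x"
      using True by (simp add: flat_poly_def power2_eq_square algebra_simps)
    finally show ?thesis
      by (rule has_field_derivative_transform_within_open[where S = "{0<..}"])
        (use True in \<open>auto simp: flat_poly_def\<close>)
  next
    case F: False
    have "((\<lambda>x. 0) has_real_derivative flat_poly ([:0, 0, 1:] * (p - pderiv p)) x) (at x)"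
      using F by (simp add: flat_poly_def)
    then show ?thesis
      by (rule has_field_derivative_transform_within_open[where S = "{..<0}"])
        (use F False in \<open>auto simp: flat_poly_def\<close>)
  qed
qed

lemma diff_upto_flat_poly:
  fixes f :: "real^'n \<Rightarrow> real"
  assumes "open U" "diff_upto k U f"
  shows "diff_upto k U (\<lambda>x. flat_poly p (f x))"
  using assms(2)
proof (induction k arbitrary: p)
  case 0
  then show ?case
    using has_derivative_compose[OF has_derivative_frechet[OF 0]
        flat_poly_has_derivative[unfolded has_field_derivative_def]]
    unfolding diff_upto_0 differentiable_def by blast
next
  case (Suc k)
  have D: "((\<lambda>x. flat_poly p (f x)) has_derivative
      (\<lambda>h. flat_poly ([:0, 0, 1:] * (p - pderiv p)) (f x) * frechet_derivative f (at x) h)) (at x)"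
    if "x \<in> U" for x
    using has_derivative_compose[OF has_derivative_frechet[OF Suc.prems that]
        flat_poly_has_derivative[unfolded has_field_derivative_def, of p "f x"]] by simp
  show ?case
    by (intro diff_upto_step[OF assms(1) D] diff_upto_bilinear[OF assms(1) bounded_bilinear_mult]
        diff_upto_pd Suc.prems Suc.IH diff_upto_mono[OF Suc.prems]) auto
qed

definition flat :: "real \<Rightarrow> real"
  where "flat = flat_poly 1"

lemma flat_pos: "0 < x \<Longrightarrow> flat x = exp (- (1 / x))"
  and flat_nonpos: "x \<le> 0 \<Longrightarrow> flat x = 0"
  by (simp_all add: flat_def flat_poly_def)

subsection \<open>Smoothness on arbitrary subsets\<close>

lemma smooth_on_subset: "smooth_on S f \<Longrightarrow> T \<subseteq> S \<Longrightarrow> smooth_on T f"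
  unfolding smooth_on_def by (meson IntI Int_iff subsetD)

lemma smooth_on_cong: "smooth_on S f \<Longrightarrow> (\<And>x. x \<in> S \<Longrightarrow> f x = g x) \<Longrightarrow> smooth_on S g"
  unfolding smooth_on_def by (metis IntD1)

lemma smooth_open_subset: "smooth_open U f \<Longrightarrow> open V \<Longrightarrow> V \<subseteq> U \<Longrightarrow> smooth_open V f"
  unfolding smooth_open_def by blast

lemma smooth_on_local:
  assumes "\<And>x. x \<in> S \<Longrightarrow> \<exists>V. open V \<and> x \<in> V \<and> smooth_on (S \<inter> V) f"
  shows "smooth_on S f"
  unfolding smooth_on_def
proof
  fix x assume "x \<in> S"
  then obtain V where V: "open V" "x \<in> V" "smooth_on (S \<inter> V) f" using assms by blast
  then obtain U F where UF: "x \<in> U" "smooth_open U F" "\<forall>y\<in>S \<inter> V \<inter> U. F y = f y"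
    using \<open>x \<in> S\<close> unfolding smooth_on_def by blast
  have "open (U \<inter> V)" using UF(2) V(1) by (auto simp: smooth_open_def)
  then have "smooth_open (U \<inter> V) F" using smooth_open_subset[OF UF(2)] by blast
  then show "\<exists>U F. x \<in> U \<and> smooth_open U F \<and> (\<forall>y\<in>S \<inter> U. F y = f y)"
    using UF V by blast
qed

lemma smooth_open_imp_smooth_on: "smooth_open U f \<Longrightarrow> smooth_on U f"
  unfolding smooth_on_def by (metis IntD1)

lemma smooth_on_imp_smooth_open:
  assumes "open S" "smooth_on S f"
  shows "smooth_open S f"
  unfolding smooth_open_iff_diff_upto diff_upto_def
proof (intro conjI allI impI ballI assms(1))
  fix k x and "is" :: "'a list" assume "x \<in> S"
  then obtain U F where U: "x \<in> U" "smooth_open U F" "\<forall>y\<in>S \<inter> U. F y = f y"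
    using assms(2) unfolding smooth_on_def by blast
  have o: "open (S \<inter> U)" using assms(1) U(2) by (auto simp: smooth_open_def)
  have "diff_upto (length is) (S \<inter> U) F"
    using U(2) by (auto simp: smooth_open_def diff_upto_def)
  then have "diff_upto (length is) (S \<inter> U) f"
    by (rule diff_upto_cong[OF o, rotated]) (use U in auto)
  then show "pds is f differentiable (at x)" using U(1) \<open>x \<in> S\<close> by (auto simp: diff_upto_def)
qed

lemma smooth_on_open_iff: "open S \<Longrightarrow> smooth_on S f \<longleftrightarrow> smooth_open S f"
  using smooth_on_imp_smooth_open smooth_open_imp_smooth_on by blast

lemma smooth_open_continuous:
  assumes "smooth_open U f" shows "continuous_on U f"
proof (rule continuous_at_imp_continuous_on, intro ballI)
  fix x assume "x \<in> U"
  then have "f differentiable (at x)"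
    using assms diff_upto_imp_differentiable smooth_open_iff_diff_upto by blast
  then show "isCont f x" by (rule differentiable_imp_continuous_within)
qed

lemma smooth_open_vimage:
  assumes "smooth_open U F" "open V"
  shows "open (U \<inter> F -` V)"
proof -
  have "open U" using assms(1) by (simp add: smooth_open_def)
  then have "open (F -` V \<inter> U)"
    using smooth_open_continuous[OF assms(1)] assms(2) continuous_on_open_vimage by blast
  then show ?thesis by (simp add: Int_commute)
qed

text \<open>Every closure property of smooth functions on open sets that is uniform in the order passes to
  arbitrary sets, by applying it to local extensions.  The open set \<open>V\<close> accounts for operations that
  are smooth on a part of the space only, such as division.\<close>

lemma smooth_on_lift1:
  fixes f :: "real^'n \<Rightarrow> 'b::real_normed_vector" and \<Phi> :: "'b \<Rightarrow> 'c::real_normed_vector"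
  assumes "\<And>U (F :: real^'n \<Rightarrow> 'b) k. open U \<Longrightarrow> F ` U \<subseteq> V \<Longrightarrow> diff_upto k U F \<Longrightarrow> diff_upto k U (\<lambda>x. \<Phi> (F x))"
    and "open V" "smooth_on S f" "\<And>x. x \<in> S \<Longrightarrow> f x \<in> V"
  shows "smooth_on S (\<lambda>x. \<Phi> (f x))"
  unfolding smooth_on_def
proof
  fix x assume x: "x \<in> S"
  then obtain U F where U: "x \<in> U" "smooth_open U F" "\<forall>y\<in>S \<inter> U. F y = f y"
    using assms(3) unfolding smooth_on_def by blast
  let ?U = "U \<inter> F -` V"
  have o: "open ?U" using smooth_open_vimage[OF U(2) assms(2)] .
  then have "smooth_open ?U F" using smooth_open_subset[OF U(2)] by blast
  then have "smooth_open ?U (\<lambda>x. \<Phi> (F x))"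
    unfolding smooth_open_iff_diff_upto by (auto intro!: assms(1))
  moreover have "x \<in> ?U" using U x assms(4) by auto
  ultimately show "\<exists>U F. x \<in> U \<and> smooth_open U F \<and> (\<forall>y\<in>S \<inter> U. F y = \<Phi> (f y))"
    using U(3) by (intro exI[of _ ?U] exI[of _ "\<lambda>x. \<Phi> (F x)"]) auto
qed

lemma smooth_on_lift2:
  fixes f :: "real^'n \<Rightarrow> 'b::real_normed_vector" and g :: "real^'n \<Rightarrow> 'c::real_normed_vector"
    and \<Phi> :: "'b \<Rightarrow> 'c \<Rightarrow> 'd::real_normed_vector"
  assumes "\<And>U (F :: real^'n \<Rightarrow> 'b) (G :: real^'n \<Rightarrow> 'c) k. open U \<Longrightarrow> diff_upto k U F \<Longrightarrow> diff_upto k U G \<Longrightarrow> diff_upto k U (\<lambda>x. \<Phi> (F x) (G x))"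
    and "smooth_on S f" "smooth_on S g"
  shows "smooth_on S (\<lambda>x. \<Phi> (f x) (g x))"
  unfolding smooth_on_def
proof
  fix x assume "x \<in> S"
  then obtain U F where U: "x \<in> U" "smooth_open U F" "\<forall>y\<in>S \<inter> U. F y = f y"
    using assms(2) unfolding smooth_on_def by blast
  obtain V G where V: "x \<in> V" "smooth_open V G" "\<forall>y\<in>S \<inter> V. G y = g y"
    using assms(3) \<open>x \<in> S\<close> unfolding smooth_on_def by blast
  have "open (U \<inter> V)" using U V by (auto simp: smooth_open_def)
  then have "smooth_open (U \<inter> V) F" "smooth_open (U \<inter> V) G"
    using smooth_open_subset U(2) V(2) by blast+
  then show "\<exists>U F. x \<in> U \<and> smooth_open U F \<and> (\<forall>y\<in>S \<inter> U. F y = \<Phi> (f y) (g y))"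
    using assms(1) U V
    by (intro exI[of _ "U \<inter> V"] exI[of _ "\<lambda>x. \<Phi> (F x) (G x)"]) (auto simp: smooth_open_iff_diff_upto)
qed

lemma smooth_on_const: "smooth_on S (\<lambda>x. c)"
  unfolding smooth_on_def smooth_open_iff_diff_upto
  by (intro ballI exI[of _ UNIV] exI[of _ "\<lambda>x. c"]) (auto intro: diff_upto_const)

lemma smooth_on_id: "smooth_on S (\<lambda>x. x)"
  unfolding smooth_on_def smooth_open_iff_diff_upto
  by (intro ballI exI[of _ UNIV] exI[of _ "\<lambda>x. x"]) (auto intro: diff_upto_id)

lemma smooth_on_linear: "bounded_linear L \<Longrightarrow> smooth_on S f \<Longrightarrow> smooth_on S (\<lambda>x. L (f x))"
  by (rule smooth_on_lift1[where V=UNIV]) (auto intro: diff_upto_linear)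

lemma smooth_on_flat: "smooth_on S f \<Longrightarrow> smooth_on S (\<lambda>x. flat (f x))"
  unfolding flat_def by (rule smooth_on_lift1[where V=UNIV]) (auto intro: diff_upto_flat_poly)

lemma smooth_on_add: "smooth_on S f \<Longrightarrow> smooth_on S g \<Longrightarrow> smooth_on S (\<lambda>x. f x + g x)"
  by (rule smooth_on_lift2) (auto intro: diff_upto_add)

lemma smooth_on_mult:
  fixes f :: "real^'n \<Rightarrow> 'b::real_normed_algebra"
  shows "smooth_on S f \<Longrightarrow> smooth_on S g \<Longrightarrow> smooth_on S (\<lambda>x. f x * g x)"
  by (rule smooth_on_lift2) (auto intro: diff_upto_bilinear[OF _ bounded_bilinear_mult])

lemma smooth_on_minus: "smooth_on S f \<Longrightarrow> smooth_on S (\<lambda>x. - f x)"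
  by (rule smooth_on_linear[OF bounded_linear_minus[OF bounded_linear_ident]])

lemma smooth_on_diff: "smooth_on S f \<Longrightarrow> smooth_on S g \<Longrightarrow> smooth_on S (\<lambda>x. f x - g x)"
  using smooth_on_add[OF _ smooth_on_minus, of S f g] by simp

lemma smooth_on_cnj: "smooth_on S f \<Longrightarrow> smooth_on S (\<lambda>x. cnj (f x))"
  by (rule smooth_on_linear[OF bounded_linear_cnj])

lemma smooth_on_of_real:
  "smooth_on S f \<Longrightarrow> smooth_on S (\<lambda>x. of_real (f x) :: complex)"
  by (rule smooth_on_linear[OF bounded_linear_of_real])

lemma smooth_on_nth: "smooth_on S f \<Longrightarrow> smooth_on S (\<lambda>x. f x $ i)"
  by (rule smooth_on_linear[OF bounded_linear_vec_nth])

lemma smooth_on_sum: "(\<And>j. j \<in> J \<Longrightarrow> smooth_on S (f j)) \<Longrightarrow> smooth_on S (\<lambda>x. \<Sum>j\<in>J. f j x)"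
  by (induction J rule: infinite_finite_induct) (auto intro: smooth_on_const smooth_on_add)

lemma smooth_on_prod:
  fixes f :: "'j \<Rightarrow> real^'n \<Rightarrow> 'b::{real_normed_algebra,comm_ring_1}"
  shows "(\<And>j. j \<in> J \<Longrightarrow> smooth_on S (f j)) \<Longrightarrow> smooth_on S (\<lambda>x. \<Prod>j\<in>J. f j x)"
  by (induction J rule: infinite_finite_induct) (auto intro: smooth_on_const smooth_on_mult)

lemma smooth_on_inverse:
  fixes f :: "real^'n \<Rightarrow> 'b::real_normed_field"
  shows "smooth_on S f \<Longrightarrow> (\<And>x. x \<in> S \<Longrightarrow> f x \<noteq> 0) \<Longrightarrow> smooth_on S (\<lambda>x. inverse (f x))"
  by (rule smooth_on_lift1[where V="- {0}"]) (auto intro!: diff_upto_inverse)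

lemma smooth_on_divide:
  fixes f :: "real^'n \<Rightarrow> 'b::real_normed_field"
  shows "smooth_on S f \<Longrightarrow> smooth_on S g \<Longrightarrow> (\<And>x. x \<in> S \<Longrightarrow> g x \<noteq> 0) \<Longrightarrow> smooth_on S (\<lambda>x. f x / g x)"
  unfolding divide_inverse by (intro smooth_on_mult smooth_on_inverse)

lemma smooth_on_sqrt:
  "smooth_on S f \<Longrightarrow> (\<And>x. x \<in> S \<Longrightarrow> 0 < f x) \<Longrightarrow> smooth_on S (\<lambda>x. sqrt (f x))"
  by (rule smooth_on_lift1[where V="{0<..}"]) (auto intro!: diff_upto_sqrt)

lemma smooth_on_compose:
  fixes f :: "real^'n \<Rightarrow> real^'m"
  assumes "smooth_on S f" "smooth_on T g" "\<And>x. x \<in> S \<Longrightarrow> f x \<in> T"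
  shows "smooth_on S (\<lambda>x. g (f x))"
  unfolding smooth_on_def
proof
  fix x assume x: "x \<in> S"
  then obtain U F where U: "x \<in> U" "smooth_open U F" "\<forall>y\<in>S \<inter> U. F y = f y"
    using assms(1) unfolding smooth_on_def by blast
  obtain V G where V: "f x \<in> V" "smooth_open V G" "\<forall>y\<in>T \<inter> V. G y = g y"
    using assms(2,3) x unfolding smooth_on_def by blast
  define W where "W = U \<inter> F -` V"
  define H where "H = (\<lambda>x. G (F x))"
  have o: "open W"
    using smooth_open_vimage[OF U(2)] V(2) by (simp add: smooth_open_def W_def)
  have "smooth_open W F" using smooth_open_subset[OF U(2) o] by (simp add: W_def)
  moreover have "F ` W \<subseteq> V" by (auto simp: W_def)
  ultimately have "smooth_open W H"
    using V(2) diff_upto_compose[OF o, of V F _ G] unfolding smooth_open_iff_diff_upto H_def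
    by simp
  moreover have "x \<in> W" using U V x by (simp add: W_def)
  moreover have "\<forall>y\<in>S \<inter> W. H y = g (f y)"
  proof
    fix y assume y: "y \<in> S \<inter> W"
    then have "F y = f y" "f y \<in> T" "F y \<in> V" using U(3) assms(3)[of y] by (auto simp: W_def)
    then show "H y = g (f y)" using V(3) by (simp add: H_def)
  qed
  ultimately show "\<exists>U F. x \<in> U \<and> smooth_open U F \<and> (\<forall>y\<in>S \<inter> U. F y = g (f y))"
    by blast
qed

lemma smooth_on_pd:
  assumes "open S" "smooth_on S f"
  shows "smooth_on S (pd i f)"
proof -
  have "diff_upto (Suc k) S f" for k
    using assms by (simp add: smooth_on_open_iff smooth_open_iff_diff_upto)
  then show ?thesis
    using assms(1) by (simp add: smooth_on_open_iff smooth_open_iff_diff_upto diff_upto_Suc)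
qed

lemma smooth_on_has_derivative:
  assumes "open S" "smooth_on S f" "x \<in> S"
  shows "(f has_derivative frechet_derivative f (at x)) (at x)"
proof -
  have "diff_upto 0 S f"
    using assms by (simp add: smooth_on_open_iff smooth_open_iff_diff_upto)
  then show ?thesis using assms(3) by (rule has_derivative_frechet)
qed

lemma smooth_on_continuous: "smooth_on S f \<Longrightarrow> continuous_on S f"
proof (unfold continuous_on_eq_continuous_within, intro ballI)
  fix x assume S: "smooth_on S f" "x \<in> S"
  then obtain U F where U: "x \<in> U" "smooth_open U F" "\<forall>y\<in>S \<inter> U. F y = f y"
    unfolding smooth_on_def by blast
  have o: "open U" using U(2) by (simp add: smooth_open_def)
  have "continuous_on (S \<inter> U) F"
    by (rule continuous_on_subset[OF smooth_open_continuous[OF U(2)]]) simp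
  then have "continuous_on (S \<inter> U) f"
    by (rule continuous_on_eq) (use U(3) in auto)
  then have "continuous (at x within S \<inter> U) f"
    using U(1) S(2) continuous_on_eq_continuous_within by blast
  moreover have "at x within S \<inter> U = at x within S"
    by (rule at_within_nhd[of x U]) (use U(1) o in auto)
  ultimately show "continuous (at x within S) f" by simp
qed

section \<open>Charts and smooth functions on the resolved manifold\<close>

lemma open_subset_halfspace:
  fixes S :: "(real^'n::{finite,wellorder}) set"
  assumes "open S" "S \<subseteq> halfspace" "x \<in> S"
  shows "0 < x $ rad"
proof (rule ccontr)
  assume "\<not> 0 < x $ rad"
  then have 0: "x $ rad = 0" using assms by (auto simp: halfspace_def)
  obtain e where e: "0 < e" "ball x e \<subseteq> S" using assms openE by blast
  let ?y = "x - axis rad (e/2)"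
  have "axis rad (e/2) = (e/2) *\<^sub>R (axis rad 1 :: (real, 'n) vec)" by (simp add: vec_eq_iff axis_def)
  then have "?y \<in> ball x e" using e by (simp add: dist_norm)
  then have "?y \<in> halfspace" using e assms(2) by blast
  then show False using 0 e by (simp add: halfspace_def axis_def)
qed

locale conical_mfd =
  fixes C :: "('x, 'l, 'p, 'n::{finite,wellorder}) conical"
  assumes conical: "conical_manifold C"
begin

lemma manifold_res: "manifold halfspace (cres C) (catlas C)"
  and compact_res: "compact_space (cres C)"
  using conical by (auto simp: conical_manifold_def resolution_def)

lemma chart: "c \<in> catlas C \<Longrightarrow> chart_of halfspace (cres C) c"
  using manifold_res by (simp add: manifold_def)

lemma chart_openin: "c \<in> catlas C \<Longrightarrow> openin (cres C) (fst c)"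
  using chart by (auto simp: chart_of_def)

lemma chart_subset: "c \<in> catlas C \<Longrightarrow> fst c \<subseteq> topspace (cres C)"
  using chart_openin openin_subset by blast

lemma chart_exists:
  assumes "p \<in> topspace (cres C)" shows "\<exists>c\<in>catlas C. p \<in> fst c"
proof -
  have "(\<Union>c\<in>catlas C. fst c) = topspace (cres C)"
    using manifold_res by (simp add: manifold_def)
  then show ?thesis using assms by blast
qed

lemma chart_compatible: "c \<in> catlas C \<Longrightarrow> d \<in> catlas C \<Longrightarrow>
    smooth_on (snd c ` (fst c \<inter> fst d)) (snd d \<circ> chart_inv c)"
  using manifold_res by (simp add: manifold_def compatible_def)

lemma chart_homeo: "c \<in> catlas C \<Longrightarrow>
    homeomorphic_map (subtopology (cres C) (fst c)) (top_of_set (snd c ` fst c)) (snd c)"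
  using chart by (auto simp: chart_of_def)

lemma chart_inj: "c \<in> catlas C \<Longrightarrow> inj_on (snd c) (fst c)"
  using homeomorphic_imp_injective_map[OF chart_homeo] chart_subset
  by (metis topspace_subtopology_subset)

lemma chart_inv_chart: "c \<in> catlas C \<Longrightarrow> p \<in> fst c \<Longrightarrow> chart_inv c (snd c p) = p"
  by (simp add: chart_inv_def chart_inj)

lemma chart_inv_chart_pair: "(W, \<kappa>) \<in> catlas C \<Longrightarrow> p \<in> W \<Longrightarrow> chart_inv (W, \<kappa>) (\<kappa> p) = p"
  using chart_inv_chart by fastforce

lemma chart_halfspace: "c \<in> catlas C \<Longrightarrow> snd c ` fst c \<subseteq> halfspace"
  using chart[of c] openin_imp_subset unfolding chart_of_def by blast

lemma chart_image_openin:
  assumes "c \<in> catlas C" "openin (cres C) W"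
  shows "openin (top_of_set halfspace) (snd c ` (fst c \<inter> W))"
proof -
  have "openin (subtopology (cres C) (fst c)) (fst c \<inter> W)"
    using assms(2) by (simp add: openin_subtopology_Int2)
  then have "openin (top_of_set (snd c ` fst c)) (snd c ` (fst c \<inter> W))"
    using homeomorphic_map_openness[OF chart_homeo[OF assms(1)], of "fst c \<inter> W"]
      chart_subset[OF assms(1)] by (auto simp: topspace_subtopology_subset)
  moreover have "openin (top_of_set halfspace) (snd c ` fst c)"
    using chart assms(1) by (auto simp: chart_of_def)
  ultimately show ?thesis using openin_trans by blast
qed

lemma chart_continuous:
  assumes "c \<in> catlas C"
  shows "continuous_map (subtopology (cres C) (fst c)) euclidean (snd c)"
  using homeomorphic_imp_continuous_map[OF chart_homeo[OF assms]]
    continuous_map_into_fulltopology by blast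

lemma chart_vimage_openin:
  assumes "c \<in> catlas C" "open V" "openin (cres C) W"
  shows "openin (cres C) {p \<in> fst c \<inter> W. snd c p \<in> V}"
proof -
  have "{p \<in> topspace (subtopology (cres C) (fst c)). snd c p \<in> V} = {p \<in> fst c. snd c p \<in> V}"
    using chart_subset[OF assms(1)] by auto
  moreover have "openin (subtopology (cres C) (fst c)) {p \<in> topspace (subtopology (cres C) (fst c)). snd c p \<in> V}"
    by (rule openin_continuous_map_preimage[OF chart_continuous[OF assms(1)]]) (simp add: assms(2))
  ultimately have "openin (cres C) {p \<in> fst c. snd c p \<in> V}"
    using openin_open_subtopology[OF chart_openin[OF assms(1)]] by simp
  from openin_Int[OF this assms(3)] show ?thesis
    by (rule back_subst) auto
qed

lemma chart_inv_continuous: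
  assumes "c \<in> catlas C"
  shows "continuous_map (top_of_set (snd c ` fst c)) (cres C) (chart_inv c)"
proof -
  obtain g where g: "homeomorphic_maps (subtopology (cres C) (fst c)) (top_of_set (snd c ` fst c)) (snd c) g"
    using chart_homeo[OF assms] homeomorphic_map_maps by blast
  then have "continuous_map (top_of_set (snd c ` fst c)) (cres C) g"
    by (auto simp: homeomorphic_maps_def continuous_map_into_fulltopology)
  moreover have "g x = chart_inv c x" if "x \<in> snd c ` fst c" for x
    using g that chart_inv_chart[OF assms] chart_subset[OF assms]
    by (auto simp: homeomorphic_maps_def)
  ultimately show ?thesis by (auto elim!: continuous_map_eq)
qed

lemma chart_image_open_pos:
  assumes "c \<in> catlas C" "openin (cres C) W"
  shows "open (snd c ` (fst c \<inter> W) \<inter> {x. 0 < x $ rad})"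
proof -
  obtain O' where O: "open O'" "snd c ` (fst c \<inter> W) = halfspace \<inter> O'"
    using chart_image_openin[OF assms] by (auto simp: openin_open)
  have "snd c ` (fst c \<inter> W) \<inter> {x. 0 < x $ rad} = O' \<inter> {x. 0 < x $ rad}"
    unfolding O(2) by (auto simp: halfspace_def)
  moreover have "open {x :: (real, 'n) vec. 0 < x $ rad}"
    by (intro open_Collect_less continuous_intros)
  ultimately show ?thesis using O(1) by (simp add: open_Int)
qed

text \<open>Invariance of domain: a homeomorphism cannot move an interior point to the boundary, since
  the image of a small open ball would be an open subset of the Euclidean space that is contained
  in the closed half-space but not in its interior.\<close>

lemma homeomorphism_rad_pos:
  assumes f: "homeomorphic_maps (cres C) (cres C) f h" and c: "c \<in> catlas C" and d: "d \<in> catlas C"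
    and p: "p \<in> fst c" "f p \<in> fst d" "0 < snd c p $ rad"
  shows "0 < snd d (f p) $ rad"
proof -
  have fc: "continuous_map (cres C) (cres C) f" using f by (simp add: homeomorphic_maps_def)
  define W where "W = {p \<in> topspace (cres C). f p \<in> fst d}"
  have W: "openin (cres C) W"
    unfolding W_def using fc chart_openin[OF d] openin_continuous_map_preimage by blast
  define S where "S = snd c ` (fst c \<inter> W) \<inter> {x. 0 < x $ rad}"
  have "open S" unfolding S_def by (rule chart_image_open_pos[OF c W])
  have Sub: "S \<subseteq> snd c ` fst c" by (auto simp: S_def)
  define F where "F = snd d \<circ> (f \<circ> chart_inv c)"
  have "continuous_map (top_of_set S) (subtopology (cres C) (fst d)) (f \<circ> chart_inv c)"
    unfolding continuous_map_in_subtopology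
  proof
    have "continuous_map (top_of_set S) (cres C) (chart_inv c)"
      using continuous_map_from_subtopology_mono[OF chart_inv_continuous[OF c] Sub] by simp
    then show "continuous_map (top_of_set S) (cres C) (f \<circ> chart_inv c)"
      using fc continuous_map_compose by blast
    show "f \<circ> chart_inv c \<in> topspace (top_of_set S) \<rightarrow> fst d"
      by (auto simp: S_def chart_inv_chart[OF c] W_def)
  qed
  then have "continuous_map (top_of_set S) euclidean F"
    unfolding F_def using chart_continuous[OF d] continuous_map_compose by blast
  then have cont: "continuous_on S F" by simp
  have inj: "inj_on F S"
  proof (rule inj_onI)
    fix x y assume x: "x \<in> S" and y: "y \<in> S" and eq: "F x = F y"
    obtain a where a: "x = snd c a" "a \<in> fst c" "f a \<in> fst d" using x by (auto simp: S_def W_def)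
    obtain b where b: "y = snd c b" "b \<in> fst c" "f b \<in> fst d" using y by (auto simp: S_def W_def)
    have "f a = f b"
      using eq inj_onD[OF chart_inj[OF d]] a b by (simp add: F_def chart_inv_chart[OF c])
    then have "a = b"
      using f a(2) b(2) chart_subset[OF c] by (metis homeomorphic_maps_def subsetD)
    then show "x = y" using a b by simp
  qed
  have "open (F ` S)" using invariance_of_domain[OF cont \<open>open S\<close> inj] .
  moreover have "F ` S \<subseteq> halfspace"
  proof -
    have "F ` S \<subseteq> snd d ` fst d" by (auto simp: F_def S_def W_def chart_inv_chart[OF c])
    with chart_halfspace[OF d] show ?thesis by blast
  qed
  moreover have "snd d (f p) \<in> F ` S"
  proof -
    have "snd c p \<in> S" using p chart_subset[OF c] by (auto simp: S_def W_def)
    moreover have "F (snd c p) = snd d (f p)" using p by (simp add: F_def chart_inv_chart[OF c])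
    ultimately show ?thesis by (metis imageI)
  qed
  ultimately show ?thesis by (rule open_subset_halfspace)
qed

text \<open>Being interior is defined by the existence of a chart; invariance of domain, applied to the identity
  map, shows that every chart detects it.\<close>

lemma cint_iff:
  assumes "c \<in> catlas C" "p \<in> fst c"
  shows "p \<in> cint C \<longleftrightarrow> 0 < snd c p $ rad"
proof
  assume "p \<in> cint C"
  then obtain d where "d \<in> catlas C" "p \<in> fst d" "0 < snd d p $ rad" by (auto simp: cint_def)
  moreover have "homeomorphic_maps (cres C) (cres C) (\<lambda>p. p) (\<lambda>p. p)"
    by (simp add: homeomorphic_maps_def)
  ultimately show "0 < snd c p $ rad"
    using homeomorphism_rad_pos[of "\<lambda>p. p" "\<lambda>p. p" d c p] assms by simp
qed (use assms in \<open>auto simp: cint_def\<close>)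

lemma cint_subset: "cint C \<subseteq> topspace (cres C)"
  using chart_subset by (auto simp: cint_def)

lemma cint_openin: "openin (cres C) (cint C)"
proof -
  have "cint C = (\<Union>c\<in>catlas C. {p \<in> fst c \<inter> topspace (cres C). snd c p \<in> {x. 0 < x $ rad}})"
    using chart_subset by (auto simp: cint_def)
  moreover have "open {x :: (real, 'n) vec. 0 < x $ rad}"
    by (intro open_Collect_less continuous_intros)
  then have "openin (cres C) {p \<in> fst c \<inter> topspace (cres C). snd c p \<in> {x. 0 < x $ rad}}"
    if "c \<in> catlas C" for c
    using chart_vimage_openin[OF that _ openin_topspace] by blast
  ultimately show ?thesis by (metis (no_types, lifting) imageE openin_Union)
qed

lemma homeomorphism_cint:
  assumes f: "homeomorphic_maps (cres C) (cres C) f h" and p: "p \<in> cint C"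
  shows "f p \<in> cint C"
proof -
  have "f p \<in> topspace (cres C)"
    using f p cint_subset by (auto simp: homeomorphic_maps_def continuous_map_def)
  then obtain d where d: "d \<in> catlas C" "f p \<in> fst d" using chart_exists by blast
  obtain c where "c \<in> catlas C" "p \<in> fst c" "0 < snd c p $ rad" using p by (auto simp: cint_def)
  then show ?thesis using homeomorphism_rad_pos[OF f _ d(1) _ d(2)] d unfolding cint_def by blast
qed

lemma chart_image_open:
  assumes "c \<in> catlas C" "openin (cres C) W" "W \<subseteq> fst c \<inter> cint C"
  shows "open (snd c ` W)"
proof -
  have "snd c ` (fst c \<inter> W) \<inter> {x. 0 < x $ rad} = snd c ` W"
    using assms cint_iff[OF assms(1)] by auto
  then show ?thesis using chart_image_open_pos[OF assms(1,2)] by simp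
qed

subsection \<open>Smooth functions\<close>

lemma smooth_fun_subset: "smooth_fun (catlas C) W u \<Longrightarrow> V \<subseteq> W \<Longrightarrow> smooth_fun (catlas C) V u"
  unfolding smooth_fun_def by (meson Int_mono image_mono order_refl smooth_on_subset)

lemma smooth_fun_cong:
  assumes "smooth_fun (catlas C) W u" "\<And>p. p \<in> W \<Longrightarrow> u p = v p"
  shows "smooth_fun (catlas C) W v"
  unfolding smooth_fun_def
proof
  fix c assume c: "c \<in> catlas C"
  then have "smooth_on (snd c ` (fst c \<inter> W)) (u \<circ> chart_inv c)"
    using assms(1) by (simp add: smooth_fun_def)
  then show "smooth_on (snd c ` (fst c \<inter> W)) (v \<circ> chart_inv c)"
    by (rule smooth_on_cong) (auto simp: chart_inv_chart[OF c] assms(2))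
qed

lemma smooth_fun_const: "smooth_fun (catlas C) W (\<lambda>p. a)"
  by (simp add: smooth_fun_def o_def smooth_on_const)

lemma smooth_fun_add: "smooth_fun (catlas C) W u \<Longrightarrow> smooth_fun (catlas C) W v \<Longrightarrow>
    smooth_fun (catlas C) W (\<lambda>p. u p + v p)"
  by (auto simp: smooth_fun_def o_def intro!: smooth_on_add)

lemma smooth_fun_diff: "smooth_fun (catlas C) W u \<Longrightarrow> smooth_fun (catlas C) W v \<Longrightarrow>
    smooth_fun (catlas C) W (\<lambda>p. u p - v p)"
  by (auto simp: smooth_fun_def o_def intro!: smooth_on_diff)

lemma smooth_fun_mult:
  fixes u :: "'p \<Rightarrow> 'b::real_normed_algebra"
  shows "smooth_fun (catlas C) W u \<Longrightarrow> smooth_fun (catlas C) W v \<Longrightarrow>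
    smooth_fun (catlas C) W (\<lambda>p. u p * v p)"
  by (auto simp: smooth_fun_def o_def intro!: smooth_on_mult)

lemma smooth_fun_divide:
  fixes u :: "'p \<Rightarrow> 'b::real_normed_field"
  shows "smooth_fun (catlas C) W u \<Longrightarrow> smooth_fun (catlas C) W v \<Longrightarrow>
    (\<And>p. p \<in> W \<Longrightarrow> v p \<noteq> 0) \<Longrightarrow> smooth_fun (catlas C) W (\<lambda>p. u p / v p)"
  by (auto simp: smooth_fun_def o_def chart_inv_chart_pair intro!: smooth_on_divide)

lemma smooth_fun_cnj: "smooth_fun (catlas C) W u \<Longrightarrow> smooth_fun (catlas C) W (\<lambda>p. cnj (u p))"
  by (auto simp: smooth_fun_def o_def intro!: smooth_on_cnj)

lemma smooth_fun_of_real: "smooth_fun (catlas C) W u \<Longrightarrow>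
    smooth_fun (catlas C) W (\<lambda>p. of_real (u p) :: complex)"
  by (auto simp: smooth_fun_def o_def intro!: smooth_on_of_real)

lemma smooth_fun_sqrt: "smooth_fun (catlas C) W u \<Longrightarrow> (\<And>p. p \<in> W \<Longrightarrow> 0 < u p) \<Longrightarrow>
    smooth_fun (catlas C) W (\<lambda>p. sqrt (u p))"
  by (auto simp: smooth_fun_def o_def chart_inv_chart_pair intro!: smooth_on_sqrt)

lemma smooth_fun_nth: "smooth_fun (catlas C) W u \<Longrightarrow> smooth_fun (catlas C) W (\<lambda>p. u p $ i)"
  by (auto simp: smooth_fun_def o_def intro!: smooth_on_linear[OF bounded_linear_vec_nth])

lemma smooth_fun_sum: "(\<And>j. j \<in> J \<Longrightarrow> smooth_fun (catlas C) W (u j)) \<Longrightarrow>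
    smooth_fun (catlas C) W (\<lambda>p. \<Sum>j\<in>J. u j p)"
  by (auto simp: smooth_fun_def o_def intro!: smooth_on_sum)

lemma smooth_fun_local:
  assumes "\<And>p. p \<in> W \<Longrightarrow> p \<in> topspace (cres C) \<Longrightarrow>
    \<exists>V. openin (cres C) V \<and> p \<in> V \<and> smooth_fun (catlas C) (W \<inter> V) u"
  shows "smooth_fun (catlas C) W u"
  unfolding smooth_fun_def
proof (intro ballI smooth_on_local)
  fix c x assume c: "c \<in> catlas C" and "x \<in> snd c ` (fst c \<inter> W)"
  then obtain p where p: "x = snd c p" "p \<in> fst c" "p \<in> W" by blast
  then obtain V where V: "openin (cres C) V" "p \<in> V" "smooth_fun (catlas C) (W \<inter> V) u"
    using assms chart_subset[OF c] by blast
  obtain O' where O: "open O'" "snd c ` (fst c \<inter> V) = halfspace \<inter> O'"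
    using chart_image_openin[OF c V(1)] by (auto simp: openin_open)
  have "snd c ` (fst c \<inter> W) \<inter> O' \<subseteq> snd c ` (fst c \<inter> W) \<inter> snd c ` (fst c \<inter> V)"
    using O(2) chart_halfspace[OF c] by blast
  also have "\<dots> \<subseteq> snd c ` (fst c \<inter> (W \<inter> V))"
    using inj_onD[OF chart_inj[OF c]] by (auto simp: image_iff)
  finally have "smooth_on (snd c ` (fst c \<inter> W) \<inter> O') (u \<circ> chart_inv c)"
    using V(3) c smooth_on_subset unfolding smooth_fun_def by blast
  moreover have "x \<in> O'" using O(2) p V(2) by blast
  ultimately show "\<exists>V. open V \<and> x \<in> V \<and> smooth_on (snd c ` (fst c \<inter> W) \<inter> V) (u \<circ> chart_inv c)"
    using O(1) by blast
qed

text \<open>Smoothness has to be checked in one chart only, because the coordinate changes are smooth.\<close>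

lemma smooth_fun_of_chart:
  assumes c: "c \<in> catlas C" "W \<subseteq> fst c" "smooth_on (snd c ` W) (\<lambda>x. u (chart_inv c x))"
  shows "smooth_fun (catlas C) W u"
  unfolding smooth_fun_def
proof
  fix d assume d: "d \<in> catlas C"
  have "smooth_on (snd d ` (fst d \<inter> W)) (snd c \<circ> chart_inv d)"
    by (rule smooth_on_subset[OF chart_compatible[OF d c(1)]]) (use c(2) in blast)
  then have "smooth_on (snd d ` (fst d \<inter> W)) (\<lambda>x. u (chart_inv c ((snd c \<circ> chart_inv d) x)))"
    by (rule smooth_on_compose[OF _ c(3)]) (auto simp: chart_inv_chart[OF d])
  then show "smooth_on (snd d ` (fst d \<inter> W)) (u \<circ> chart_inv d)"
    by (rule smooth_on_cong)
      (use c(2) in \<open>auto simp: chart_inv_chart[OF d] chart_inv_chart[OF c(1)]\<close>)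
qed

lemma smooth_fun_pullback:
  assumes f: "smooth_map (cres C) (catlas C) (cres C) (catlas C) f" and u: "smooth_fun (catlas C) W u"
  shows "smooth_fun (catlas C) (f -` W) (\<lambda>p. u (f p))"
proof (rule smooth_fun_local)
  have fc: "continuous_map (cres C) (cres C) f" using f by (simp add: smooth_map_def)
  fix p assume p: "p \<in> f -` W" "p \<in> topspace (cres C)"
  have "f p \<in> topspace (cres C)" using fc p(2) by (auto simp: continuous_map_def)
  then obtain d where d: "d \<in> catlas C" "f p \<in> fst d" using chart_exists by blast
  define V where "V = {p \<in> topspace (cres C). f p \<in> fst d}"
  have V: "openin (cres C) V"
    unfolding V_def using fc chart_openin[OF d(1)] openin_continuous_map_preimage by blast
  have "smooth_fun (catlas C) (f -` W \<inter> V) (\<lambda>p. u (f p))"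
    unfolding smooth_fun_def
  proof
    fix c assume c: "c \<in> catlas C"
    let ?S = "snd c ` (fst c \<inter> (f -` W \<inter> V))"
    have "smooth_on (snd c ` (fst c \<inter> f -` fst d)) (snd d \<circ> f \<circ> chart_inv c)"
      using f c d by (simp add: smooth_map_def)
    then have "smooth_on ?S (snd d \<circ> f \<circ> chart_inv c)"
      by (rule smooth_on_subset) (auto simp: V_def)
    moreover have "smooth_on (snd d ` (fst d \<inter> W)) (u \<circ> chart_inv d)"
      using u d by (simp add: smooth_fun_def)
    ultimately have "smooth_on ?S (\<lambda>x. (u \<circ> chart_inv d) ((snd d \<circ> f \<circ> chart_inv c) x))"
      by (rule smooth_on_compose) (auto simp: chart_inv_chart[OF c] V_def)
    then show "smooth_on ?S ((\<lambda>p. u (f p)) \<circ> chart_inv c)"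
      by (rule smooth_on_cong)
        (auto simp: V_def chart_inv_chart[OF d(1)] chart_inv_chart[OF c])
  qed
  moreover have "p \<in> V" using p d(2) by (simp add: V_def)
  ultimately show "\<exists>V. openin (cres C) V \<and> p \<in> V \<and> smooth_fun (catlas C) (f -` W \<inter> V) (\<lambda>p. u (f p))"
    using V by (intro exI[of _ V] conjI)
qed

text \<open>Smooth functions are continuous; this form also yields local boundedness and Borel measurability.\<close>

lemma smooth_fun_vimage_openin:
  assumes u: "smooth_fun (catlas C) W u" and W: "openin (cres C) W" and V: "open V"
  shows "openin (cres C) {p \<in> W. u p \<in> V}"
proof (subst openin_subopen, intro ballI)
  fix p assume "p \<in> {p \<in> W. u p \<in> V}"
  then have p: "p \<in> W" "u p \<in> V" by auto
  then obtain c where c: "c \<in> catlas C" "p \<in> fst c"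
    using chart_exists openin_subset[OF W] by blast
  have "continuous_on (snd c ` (fst c \<inter> W)) (u \<circ> chart_inv c)"
    using u c smooth_on_continuous unfolding smooth_fun_def by blast
  then obtain O' where O: "open O'"
    "(u \<circ> chart_inv c) -` V \<inter> snd c ` (fst c \<inter> W) = O' \<inter> snd c ` (fst c \<inter> W)"
    using V by (metis continuous_on_open_invariant Int_commute)
  have "{q \<in> fst c \<inter> W. snd c q \<in> O'} \<subseteq> {p \<in> W. u p \<in> V}"
  proof
    fix q assume q: "q \<in> {q \<in> fst c \<inter> W. snd c q \<in> O'}"
    then have "snd c q \<in> (u \<circ> chart_inv c) -` V \<inter> snd c ` (fst c \<inter> W)" using O(2) by blast
    then show "q \<in> {p \<in> W. u p \<in> V}" using q by (simp add: chart_inv_chart[OF c(1)])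
  qed
  moreover have "p \<in> {q \<in> fst c \<inter> W. snd c q \<in> O'}"
  proof -
    have "snd c p \<in> (u \<circ> chart_inv c) -` V \<inter> snd c ` (fst c \<inter> W)"
      using p c by (simp add: chart_inv_chart[OF c(1)])
    then show ?thesis using O(2) p c by blast
  qed
  ultimately show "\<exists>T. openin (cres C) T \<and> p \<in> T \<and> T \<subseteq> {p \<in> W. u p \<in> V}"
    using chart_vimage_openin[OF c(1) O(1) W] by blast
qed

lemma smooth_fun_locally_bounded:
  assumes u: "smooth_fun (catlas C) W u" and W: "openin (cres C) W" and p: "p \<in> W"
  shows "\<exists>V B. openin (cres C) V \<and> p \<in> V \<and> V \<subseteq> W \<and> (\<forall>q\<in>V. norm (u q) \<le> B)"
proof (intro exI conjI ballI)
  let ?V = "{q \<in> W. u q \<in> ball (u p) 1}"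
  show "openin (cres C) ?V" by (rule smooth_fun_vimage_openin[OF u W open_ball])
  show "p \<in> ?V" using p by simp
  show "?V \<subseteq> W" by blast
  fix q assume "q \<in> ?V"
  then have "norm (u q - u p) < 1" by (simp add: dist_norm norm_minus_commute)
  then show "norm (u q) \<le> norm (u p) + 1" using norm_triangle_ineq2[of "u q" "u p"] by simp
qed

end

section \<open>Bundles with a metric\<close>

locale metric_bundle_mfd = conical_mfd C for C :: "('x, 'l, 'p, 'n::{finite,wellorder}) conical" +
  fixes K :: "complex set" and E :: "'p vbundle"
  assumes K: "K = \<real> \<or> K = UNIV" and metric: "metric_bundle K C E"
begin

lemma K_0 [simp]: "0 \<in> K" and K_1 [simp]: "1 \<in> K"
  using K by auto

lemma K_of_real [simp]: "complex_of_real r \<in> K"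
  using K by auto

lemma K_minus: "a \<in> K \<Longrightarrow> - a \<in> K"
  and K_divide: "a \<in> K \<Longrightarrow> b \<in> K \<Longrightarrow> a / b \<in> K"
  using K by auto

lemma fibre_zero: "p \<in> topspace (cres C) \<Longrightarrow> (\<lambda>j. 0) \<in> fibre E p"
  and fibre_add: "p \<in> topspace (cres C) \<Longrightarrow> v \<in> fibre E p \<Longrightarrow> w \<in> fibre E p \<Longrightarrow>
    (\<lambda>j. v j + w j) \<in> fibre E p"
  and fibre_scale: "p \<in> topspace (cres C) \<Longrightarrow> a \<in> K \<Longrightarrow> v \<in> fibre E p \<Longrightarrow> (\<lambda>j. a * v j) \<in> fibre E p"
  using metric by (auto simp: metric_bundle_def vector_bundle_def K_subspace_def)

lemma fibre_sum:
  assumes "p \<in> topspace (cres C)" "\<And>i. i \<in> J \<Longrightarrow> a i \<in> K" "\<And>i. i \<in> J \<Longrightarrow> v i \<in> fibre E p"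
  shows "(\<lambda>j. \<Sum>i\<in>J. a i * v i j) \<in> fibre E p"
  using assms(2,3)
proof (induction J rule: infinite_finite_induct)
  case (insert i J)
  then have "(\<lambda>j. a i * v i j + (\<Sum>i\<in>J. a i * v i j)) \<in> fibre E p"
    by (intro fibre_add fibre_scale assms(1)) auto
  then show ?case using insert.hyps by simp
qed (simp_all add: fibre_zero assms(1))

lemma fibre_diff:
  assumes "p \<in> topspace (cres C)" "v \<in> fibre E p" "w \<in> fibre E p"
  shows "(\<lambda>j. v j - w j) \<in> fibre E p"
  using fibre_add[OF assms(1,2) fibre_scale[OF assms(1) K_minus[OF K_1] assms(3)]] by simp

lemma linear_zero: "K_linear_on K F \<Phi> \<Longrightarrow> v \<in> F \<Longrightarrow> \<Phi> (\<lambda>j. 0) = (\<lambda>j. 0)"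
proof -
  assume "K_linear_on K F \<Phi>" "v \<in> F"
  then have "\<Phi> (\<lambda>j. 0 * v j) = (\<lambda>j. 0 * \<Phi> v j)"
    using K_0 unfolding K_linear_on_def by blast
  then show ?thesis by simp
qed

lemma linear_sum:
  assumes "p \<in> topspace (cres C)" "K_linear_on K (fibre E p) \<Phi>"
    and "\<And>i. i \<in> J \<Longrightarrow> a i \<in> K" "\<And>i. i \<in> J \<Longrightarrow> v i \<in> fibre E p"
  shows "\<Phi> (\<lambda>j. \<Sum>i\<in>J. a i * v i j) = (\<lambda>j. \<Sum>i\<in>J. a i * \<Phi> (v i) j)"
  using assms(3,4)
proof (induction J rule: infinite_finite_induct)
  case (insert i J)
  have mem: "(\<lambda>j. a i * v i j) \<in> fibre E p" "(\<lambda>j. \<Sum>i\<in>J. a i * v i j) \<in> fibre E p"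
    using insert.prems by (auto intro!: fibre_scale fibre_sum assms(1))
  have "\<Phi> (\<lambda>j. \<Sum>i\<in>insert i J. a i * v i j) = \<Phi> (\<lambda>j. a i * v i j + (\<Sum>i\<in>J. a i * v i j))"
    using insert.hyps by simp
  also have "\<dots> = (\<lambda>j. \<Phi> (\<lambda>j. a i * v i j) j + \<Phi> (\<lambda>j. \<Sum>i\<in>J. a i * v i j) j)"
    using assms(2) mem by (simp add: K_linear_on_def)
  also have "\<dots> = (\<lambda>j. \<Sum>i\<in>insert i J. a i * \<Phi> (v i) j)"
    using assms(2) insert by (simp add: K_linear_on_def)
  finally show ?case .
qed (simp_all add: linear_zero[OF assms(2) fibre_zero[OF assms(1)]])

lemma triv_openin: "t \<in> trivs E \<Longrightarrow> openin (cres C) (tdom t)"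
  using metric by (auto simp: metric_bundle_def vector_bundle_def)

lemma triv_subset: "t \<in> trivs E \<Longrightarrow> tdom t \<subseteq> topspace (cres C)"
  using triv_openin openin_subset by blast

lemma triv_exists:
  assumes "p \<in> topspace (cres C)" shows "\<exists>t\<in>trivs E. p \<in> tdom t"
proof -
  have "(\<Union>t\<in>trivs E. tdom t) = topspace (cres C)"
    using metric by (simp add: metric_bundle_def vector_bundle_def)
  then show ?thesis using assms by blast
qed

lemma triv_bij: "t \<in> trivs E \<Longrightarrow> p \<in> tdom t \<Longrightarrow>
    bij_betw (tmap t p) (fibre E p) (coord_space K (trank t))"
  and triv_linear: "t \<in> trivs E \<Longrightarrow> p \<in> tdom t \<Longrightarrow> K_linear_on K (fibre E p) (tmap t p)"
  using metric by (auto simp: metric_bundle_def vector_bundle_def)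

lemma triv_coord: "t \<in> trivs E \<Longrightarrow> p \<in> tdom t \<Longrightarrow> v \<in> fibre E p \<Longrightarrow>
    tmap t p v \<in> coord_space K (trank t)"
  using triv_bij bij_betwE by blast

lemma triv_coord_K: "t \<in> trivs E \<Longrightarrow> p \<in> tdom t \<Longrightarrow> v \<in> fibre E p \<Longrightarrow> tmap t p v j \<in> K"
  and triv_coord_0: "t \<in> trivs E \<Longrightarrow> p \<in> tdom t \<Longrightarrow> v \<in> fibre E p \<Longrightarrow> trank t \<le> j \<Longrightarrow> tmap t p v j = 0"
  using triv_coord by (auto simp: coord_space_def)

lemma triv_add: "t \<in> trivs E \<Longrightarrow> p \<in> tdom t \<Longrightarrow> v \<in> fibre E p \<Longrightarrow> w \<in> fibre E p \<Longrightarrow>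
    tmap t p (\<lambda>j. v j + w j) = (\<lambda>j. tmap t p v j + tmap t p w j)"
  and triv_scale: "t \<in> trivs E \<Longrightarrow> p \<in> tdom t \<Longrightarrow> a \<in> K \<Longrightarrow> v \<in> fibre E p \<Longrightarrow>
    tmap t p (\<lambda>j. a * v j) = (\<lambda>j. a * tmap t p v j)"
  using triv_linear by (auto simp: K_linear_on_def)

lemma triv_zero: "t \<in> trivs E \<Longrightarrow> p \<in> tdom t \<Longrightarrow> tmap t p (\<lambda>j. 0) = (\<lambda>j. 0)"
  using linear_zero[OF triv_linear fibre_zero] triv_subset by blast

lemma triv_sum:
  assumes "t \<in> trivs E" "p \<in> tdom t"
    and "\<And>i. i \<in> J \<Longrightarrow> a i \<in> K" "\<And>i. i \<in> J \<Longrightarrow> v i \<in> fibre E p"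
  shows "tmap t p (\<lambda>j. \<Sum>i\<in>J. a i * v i j) = (\<lambda>j. \<Sum>i\<in>J. a i * tmap t p (v i) j)"
  using linear_sum[OF _ triv_linear[OF assms(1,2)]] assms triv_subset by blast

lemma triv_inj: "t \<in> trivs E \<Longrightarrow> p \<in> tdom t \<Longrightarrow> v \<in> fibre E p \<Longrightarrow> w \<in> fibre E p \<Longrightarrow>
    (\<And>j. j < trank t \<Longrightarrow> tmap t p v j = tmap t p w j) \<Longrightarrow> v = w"
proof -
  assume *: "t \<in> trivs E" "p \<in> tdom t" "v \<in> fibre E p" "w \<in> fibre E p"
    "\<And>j. j < trank t \<Longrightarrow> tmap t p v j = tmap t p w j"
  then have "tmap t p v = tmap t p w"
    using triv_coord_0 by (metis ext leI)
  then show "v = w" using triv_bij[OF *(1,2)] *(3,4) by (metis bij_betw_def inj_onD)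
qed

definition frame :: "'p triv \<Rightarrow> nat \<Rightarrow> 'p \<Rightarrow> cvec"
  where "frame t j p = inv_into (fibre E p) (tmap t p) (\<lambda>l. if l = j then 1 else 0)"

lemma frame:
  assumes "t \<in> trivs E" "p \<in> tdom t" "j < trank t"
  shows frame_fibre: "frame t j p \<in> fibre E p"
    and tmap_frame: "tmap t p (frame t j p) = (\<lambda>l. if l = j then 1 else 0)"
proof -
  have "(\<lambda>l. if l = j then 1 else 0) \<in> tmap t p ` fibre E p"
    using triv_bij[OF assms(1,2)] assms(3) by (auto simp: bij_betw_def coord_space_def)
  then show "frame t j p \<in> fibre E p" "tmap t p (frame t j p) = (\<lambda>l. if l = j then 1 else 0)"
    unfolding frame_def by (simp_all add: inv_into_into f_inv_into_f)
qed

lemma frame_expansion: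
  assumes "t \<in> trivs E" "p \<in> tdom t" "v \<in> fibre E p"
  shows "v = (\<lambda>i. \<Sum>j<trank t. tmap t p v j * frame t j p i)"
proof (rule triv_inj[OF assms(1,2,3)])
  have p: "p \<in> topspace (cres C)" using assms triv_subset by blast
  show "(\<lambda>i. \<Sum>j<trank t. tmap t p v j * frame t j p i) \<in> fibre E p"
    by (rule fibre_sum[OF p]) (auto simp: triv_coord_K assms frame_fibre)
  fix l assume "l < trank t"
  then show "tmap t p v l = tmap t p (\<lambda>i. \<Sum>j<trank t. tmap t p v j * frame t j p i) l"
    by (subst triv_sum[OF assms(1,2)])
      (auto simp: triv_coord_K assms frame_fibre tmap_frame if_distrib cong: if_cong)
qed

subsection \<open>The fibre metric\<close>

definition nsq :: "'p \<Rightarrow> cvec \<Rightarrow> real"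
  where "nsq p v = Re (fmetric E p v v)"

lemma metric_K: "p \<in> topspace (cres C) \<Longrightarrow> v \<in> fibre E p \<Longrightarrow> w \<in> fibre E p \<Longrightarrow> fmetric E p v w \<in> K"
  and metric_cnj: "p \<in> topspace (cres C) \<Longrightarrow> v \<in> fibre E p \<Longrightarrow> w \<in> fibre E p \<Longrightarrow>
    fmetric E p w v = cnj (fmetric E p v w)"
  and metric_add: "p \<in> topspace (cres C) \<Longrightarrow> v \<in> fibre E p \<Longrightarrow> w \<in> fibre E p \<Longrightarrow> u \<in> fibre E p \<Longrightarrow>
    fmetric E p (\<lambda>j. v j + w j) u = fmetric E p v u + fmetric E p w u"
  and metric_scale: "p \<in> topspace (cres C) \<Longrightarrow> v \<in> fibre E p \<Longrightarrow> w \<in> fibre E p \<Longrightarrow> a \<in> K \<Longrightarrow>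
    fmetric E p (\<lambda>j. a * v j) w = a * fmetric E p v w"
  and metric_pos: "p \<in> topspace (cres C) \<Longrightarrow> v \<in> fibre E p \<Longrightarrow> v \<noteq> (\<lambda>j. 0) \<Longrightarrow> 0 < nsq p v"
  using metric unfolding metric_bundle_def bundle_metric_def nsq_def by blast+

lemma metric_zero: "p \<in> topspace (cres C) \<Longrightarrow> w \<in> fibre E p \<Longrightarrow> fmetric E p (\<lambda>j. 0) w = 0"
  using metric_scale[of p w w 0] by simp

lemma metric_zero_right: "p \<in> topspace (cres C) \<Longrightarrow> w \<in> fibre E p \<Longrightarrow> fmetric E p w (\<lambda>j. 0) = 0"
  using metric_cnj[of p "\<lambda>j. 0" w] metric_zero[of p w] fibre_zero by simp

lemma metric_sum:
  assumes "p \<in> topspace (cres C)" "w \<in> fibre E p"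
    and "\<And>i. i \<in> J \<Longrightarrow> a i \<in> K" "\<And>i. i \<in> J \<Longrightarrow> v i \<in> fibre E p"
  shows "fmetric E p (\<lambda>j. \<Sum>i\<in>J. a i * v i j) w = (\<Sum>i\<in>J. a i * fmetric E p (v i) w)"
  using assms(3,4)
proof (induction J rule: infinite_finite_induct)
  case (insert i J)
  have mem: "(\<lambda>j. a i * v i j) \<in> fibre E p" "(\<lambda>j. \<Sum>i\<in>J. a i * v i j) \<in> fibre E p"
    using insert.prems by (auto intro!: fibre_scale fibre_sum assms(1))
  show ?case using insert metric_add[OF assms(1) mem assms(2)] metric_scale[OF assms(1) _ assms(2)]
    by simp
qed (simp_all add: metric_zero assms)

lemma metric_add_right: "p \<in> topspace (cres C) \<Longrightarrow> v \<in> fibre E p \<Longrightarrow> w \<in> fibre E p \<Longrightarrow> u \<in> fibre E p \<Longrightarrow>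
    fmetric E p u (\<lambda>j. v j + w j) = fmetric E p u v + fmetric E p u w"
  using metric_cnj[of p _ u] metric_add[of p v w u] fibre_add by simp

lemma metric_scale_right: "p \<in> topspace (cres C) \<Longrightarrow> v \<in> fibre E p \<Longrightarrow> w \<in> fibre E p \<Longrightarrow> a \<in> K \<Longrightarrow>
    fmetric E p w (\<lambda>j. a * v j) = cnj a * fmetric E p w v"
  using metric_cnj[of p _ w] metric_scale[of p v w a] fibre_scale by simp

lemma metric_sum_right:
  assumes "p \<in> topspace (cres C)" "w \<in> fibre E p"
    and "\<And>i. i \<in> J \<Longrightarrow> a i \<in> K" "\<And>i. i \<in> J \<Longrightarrow> v i \<in> fibre E p"
  shows "fmetric E p w (\<lambda>j. \<Sum>i\<in>J. a i * v i j) = (\<Sum>i\<in>J. cnj (a i) * fmetric E p w (v i))"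
proof -
  have "fmetric E p w (\<lambda>j. \<Sum>i\<in>J. a i * v i j) = cnj (\<Sum>i\<in>J. a i * fmetric E p (v i) w)"
    using metric_cnj[OF assms(1) fibre_sum[of p J a v] assms(2)] metric_sum[of p w J a v] assms
    by simp
  also have "\<dots> = (\<Sum>i\<in>J. cnj (a i) * fmetric E p w (v i))"
    using metric_cnj[OF assms(1) assms(4) assms(2)] by (simp add: cnj_sum)
  finally show ?thesis .
qed

lemma metric_self: "p \<in> topspace (cres C) \<Longrightarrow> v \<in> fibre E p \<Longrightarrow> fmetric E p v v = of_real (nsq p v)"
  using metric_cnj[of p v v] by (simp add: nsq_def complex_eq_iff)

lemma nsq_nonneg: "p \<in> topspace (cres C) \<Longrightarrow> v \<in> fibre E p \<Longrightarrow> 0 \<le> nsq p v"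
  using metric_pos[of p v] metric_zero[of p v] by (cases "v = (\<lambda>j. 0)") (auto simp: nsq_def)

lemma nsq_eq_0: "p \<in> topspace (cres C) \<Longrightarrow> v \<in> fibre E p \<Longrightarrow> nsq p v = 0 \<longleftrightarrow> v = (\<lambda>j. 0)"
  using metric_pos[of p v] metric_zero[of p v] by (cases "v = (\<lambda>j. 0)") (auto simp: nsq_def)

lemma nsq_zero: "p \<in> topspace (cres C) \<Longrightarrow> nsq p (\<lambda>j. 0) = 0"
  by (simp add: nsq_eq_0 fibre_zero)

lemma nsq_scale: "p \<in> topspace (cres C) \<Longrightarrow> a \<in> K \<Longrightarrow> v \<in> fibre E p \<Longrightarrow>
    nsq p (\<lambda>j. a * v j) = (cmod a)\<^sup>2 * nsq p v"
proof -
  assume *: "p \<in> topspace (cres C)" "a \<in> K" "v \<in> fibre E p"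
  have "fmetric E p (\<lambda>j. a * v j) (\<lambda>j. a * v j) = (a * cnj a) * fmetric E p v v"
    using * fibre_scale by (simp add: metric_scale metric_scale_right)
  then have "of_real (nsq p (\<lambda>j. a * v j)) = complex_of_real ((cmod a)\<^sup>2 * nsq p v)"
    using * fibre_scale complex_norm_square[of a] by (simp add: metric_self)
  then show ?thesis using of_real_eq_iff by blast
qed

lemma nsq_add_eq:
  assumes "p \<in> topspace (cres C)" "v \<in> fibre E p" "w \<in> fibre E p"
  shows "nsq p (\<lambda>j. v j + w j) = nsq p v + nsq p w + 2 * Re (fmetric E p v w)"
  using assms metric_cnj[OF assms] fibre_add[OF assms]
  by (simp add: nsq_def metric_add metric_add_right)

lemma nsq_diff_eq:
  assumes "p \<in> topspace (cres C)" "v \<in> fibre E p" "w \<in> fibre E p"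
  shows "nsq p (\<lambda>j. v j - w j) = nsq p v + nsq p w - 2 * Re (fmetric E p v w)"
proof -
  have m: "(-1) \<in> K" using K_minus[OF K_1] .
  have "nsq p (\<lambda>j. v j + (-1) * w j) = nsq p v + nsq p (\<lambda>j. (-1) * w j) + 2 * Re (fmetric E p v (\<lambda>j. (-1) * w j))"
    by (rule nsq_add_eq[OF assms(1,2) fibre_scale[OF assms(1) m assms(3)]])
  then show ?thesis
    using nsq_scale[OF assms(1) m assms(3)] metric_scale_right[OF assms(1,3,2) m] by simp
qed

lemma nsq_add_le:
  assumes "p \<in> topspace (cres C)" "v \<in> fibre E p" "w \<in> fibre E p"
  shows "nsq p (\<lambda>j. v j + w j) \<le> 2 * nsq p v + 2 * nsq p w"
  using nsq_add_eq[OF assms] nsq_diff_eq[OF assms] nsq_nonneg[OF assms(1) fibre_diff[OF assms]]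
  by linarith

lemma Cauchy_Schwarz:
  assumes "p \<in> topspace (cres C)" "v \<in> fibre E p" "w \<in> fibre E p"
  shows "(cmod (fmetric E p v w))\<^sup>2 \<le> nsq p v * nsq p w"
proof (cases "w = (\<lambda>j. 0)")
  case True
  then show ?thesis using assms by (simp add: metric_zero_right nsq_zero)
next
  case False
  then have pos: "0 < nsq p w" using assms metric_pos by blast
  define a where "a = fmetric E p v w / of_real (nsq p w)"
  have a: "a \<in> K" unfolding a_def by (intro K_divide metric_K assms K_of_real)
  have "0 \<le> nsq p (\<lambda>j. v j - a * w j)"
    by (intro nsq_nonneg fibre_diff fibre_scale assms a)
  also have "\<dots> = nsq p v + (cmod a)\<^sup>2 * nsq p w - 2 * Re (cnj a * fmetric E p v w)"
    using nsq_diff_eq[OF assms(1,2) fibre_scale[OF assms(1) a assms(3)]] assms a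
    by (simp add: nsq_scale metric_scale_right)
  also have "cnj a * fmetric E p v w = of_real ((cmod (fmetric E p v w))\<^sup>2 / nsq p w)"
    by (simp add: a_def complex_norm_square mult.commute del: of_real_power)
  also have "(cmod a)\<^sup>2 * nsq p w = (cmod (fmetric E p v w))\<^sup>2 / nsq p w"
    using pos by (simp add: a_def norm_divide power_divide power2_eq_square)
  finally show ?thesis using pos by (simp add: field_simps)
qed

lemma metric_le:
  assumes "p \<in> topspace (cres C)" "v \<in> fibre E p" "w \<in> fibre E p"
  shows "cmod (fmetric E p v w) \<le> sqrt (nsq p v) * sqrt (nsq p w)"
  using real_le_rsqrt[OF Cauchy_Schwarz[OF assms]] by (simp add: real_sqrt_mult)

lemma metric_coord:
  assumes "t \<in> trivs E"
  obtains H :: "nat \<Rightarrow> nat \<Rightarrow> 'p \<Rightarrow> complex" where "\<And>l j. smooth_fun (catlas C) (tdom t) (H l j)"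
    "\<And>p v w. p \<in> tdom t \<Longrightarrow> v \<in> fibre E p \<Longrightarrow> w \<in> fibre E p \<Longrightarrow> fmetric E p v w =
        (\<Sum>l<trank t. \<Sum>j<trank t. H l j p * tmap t p v l * cnj (tmap t p w j))"
proof -
  have "\<exists>H :: nat \<Rightarrow> nat \<Rightarrow> 'p \<Rightarrow> complex.
      (\<forall>l j. smooth_fun (catlas C) (tdom t) (H l j)) \<and>
      (\<forall>p\<in>tdom t. \<forall>v\<in>fibre E p. \<forall>w\<in>fibre E p. fmetric E p v w =
        (\<Sum>l<trank t. \<Sum>j<trank t. H l j p * tmap t p v l * cnj (tmap t p w j)))"
    using metric assms by (simp add: metric_bundle_def bundle_metric_def)
  then show ?thesis using that by blast
qed

text \<open>The fibre metric has smooth components up to the boundary, so it turns sections with smooth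
  coordinates into a smooth function.\<close>

lemma metric_smooth:
  assumes t: "t \<in> trivs E" and W: "W \<subseteq> tdom t"
    and a: "\<And>p. p \<in> W \<Longrightarrow> a p \<in> fibre E p" "\<And>l. l < trank t \<Longrightarrow> smooth_fun (catlas C) W (\<lambda>p. tmap t p (a p) l)"
    and b: "\<And>p. p \<in> W \<Longrightarrow> b p \<in> fibre E p" "\<And>l. l < trank t \<Longrightarrow> smooth_fun (catlas C) W (\<lambda>p. tmap t p (b p) l)"
  shows "smooth_fun (catlas C) W (\<lambda>p. fmetric E p (a p) (b p))"
proof -
  obtain H where H: "\<And>l j. smooth_fun (catlas C) (tdom t) (H l j)"
    "\<And>p v w. p \<in> tdom t \<Longrightarrow> v \<in> fibre E p \<Longrightarrow> w \<in> fibre E p \<Longrightarrow> fmetric E p v w =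
        (\<Sum>l<trank t. \<Sum>j<trank t. H l j p * tmap t p v l * cnj (tmap t p w j))"
    using metric_coord[OF t] by blast
  have "smooth_fun (catlas C) W
    (\<lambda>p. \<Sum>l<trank t. \<Sum>j<trank t. H l j p * tmap t p (a p) l * cnj (tmap t p (b p) j))"
    by (intro smooth_fun_sum smooth_fun_mult smooth_fun_cnj a(2) b(2)
        smooth_fun_subset[OF H(1) W]) auto
  then show ?thesis
    by (rule smooth_fun_cong) (use H(2) W a(1) b(1) in auto)
qed

text \<open>The first \<open>m\<close> steps of Gram--Schmidt orthogonalisation of the frame of a local trivialisation.  The
  vanishing coordinates say that the basis change is triangular, which keeps the next vector nonzero;
  the last clause says that the new vectors span at least what the first \<open>m\<close> frame vectors span, in a
  form that avoids speaking of spans.\<close>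

definition orth_frame :: "'p triv \<Rightarrow> nat \<Rightarrow> (nat \<Rightarrow> 'p \<Rightarrow> cvec) \<Rightarrow> bool"
  where "orth_frame t m \<epsilon> \<longleftrightarrow>
    (\<forall>j<m. \<forall>p\<in>tdom t. \<epsilon> j p \<in> fibre E p \<and> \<epsilon> j p \<noteq> (\<lambda>i. 0)) \<and>
    (\<forall>j<m. \<forall>p\<in>tdom t. \<forall>l>j. tmap t p (\<epsilon> j p) l = 0) \<and>
    (\<forall>j<m. \<forall>l. smooth_fun (catlas C) (tdom t) (\<lambda>p. tmap t p (\<epsilon> j p) l)) \<and>
    (\<forall>i<m. \<forall>j<m. i \<noteq> j \<longrightarrow> (\<forall>p\<in>tdom t. fmetric E p (\<epsilon> i p) (\<epsilon> j p) = 0)) \<and>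
    (\<forall>p\<in>tdom t. \<forall>w\<in>fibre E p. (\<forall>j<m. fmetric E p w (\<epsilon> j p) = 0) \<longrightarrow>
      (\<forall>j<m. fmetric E p w (frame t j p) = 0))"

lemma orth_frameD:
  assumes "orth_frame t m \<epsilon>"
  shows "\<And>j p. j < m \<Longrightarrow> p \<in> tdom t \<Longrightarrow> \<epsilon> j p \<in> fibre E p"
    and "\<And>j p. j < m \<Longrightarrow> p \<in> tdom t \<Longrightarrow> \<epsilon> j p \<noteq> (\<lambda>i. 0)"
    and "\<And>j p l. j < m \<Longrightarrow> p \<in> tdom t \<Longrightarrow> j < l \<Longrightarrow> tmap t p (\<epsilon> j p) l = 0"
    and "\<And>j l. j < m \<Longrightarrow> smooth_fun (catlas C) (tdom t) (\<lambda>p. tmap t p (\<epsilon> j p) l)"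
    and "\<And>i j p. i < m \<Longrightarrow> j < m \<Longrightarrow> i \<noteq> j \<Longrightarrow> p \<in> tdom t \<Longrightarrow> fmetric E p (\<epsilon> i p) (\<epsilon> j p) = 0"
  using assms by (simp_all add: orth_frame_def)

lemma orth_frame_span:
  assumes "orth_frame t m \<epsilon>" "p \<in> tdom t" "w \<in> fibre E p"
    and "\<And>j. j < m \<Longrightarrow> fmetric E p w (\<epsilon> j p) = 0" "j < m"
  shows "fmetric E p w (frame t j p) = 0"
proof -
  have "\<forall>p\<in>tdom t. \<forall>w\<in>fibre E p. (\<forall>j<m. fmetric E p w (\<epsilon> j p) = 0) \<longrightarrow>
      (\<forall>j<m. fmetric E p w (frame t j p) = 0)"
    using assms(1) by (simp add: orth_frame_def)
  then show ?thesis using assms(2-5) by simp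
qed

text \<open>The next vector is \<open>\<delta> = e\<^sub>m - \<Sum>\<^sub>i (\<langle>e\<^sub>m, \<epsilon>\<^sub>i\<rangle> / \<langle>\<epsilon>\<^sub>i, \<epsilon>\<^sub>i\<rangle>) \<epsilon>\<^sub>i\<close>.  Only sums, products and quotients
  with nonzero denominators occur, so it is smooth up to the boundary.\<close>

lemma orth_frame_exists:
  assumes t: "t \<in> trivs E"
  shows "m \<le> trank t \<Longrightarrow> \<exists>\<epsilon>. orth_frame t m \<epsilon>"
proof (induction m)
  case 0
  then show ?case by (simp add: orth_frame_def)
next
  case (Suc m)
  have "m \<le> trank t" using Suc.prems by simp
  from Suc.IH[OF this] obtain \<epsilon> where \<epsilon>: "orth_frame t m \<epsilon>" ..
  note fib = orth_frameD(1)[OF \<epsilon>] and nz = orth_frameD(2)[OF \<epsilon>] and tri = orth_frameD(3)[OF \<epsilon>]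
    and sm = orth_frameD(4)[OF \<epsilon>] and orth = orth_frameD(5)[OF \<epsilon>] and spn = orth_frame_span[OF \<epsilon>]
  have m: "m < trank t" using Suc.prems by simp
  note ts = subsetD[OF triv_subset[OF t]]
  define c where "c = (\<lambda>i p. - (fmetric E p (frame t m p) (\<epsilon> i p) / fmetric E p (\<epsilon> i p) (\<epsilon> i p)))"
  define d where "d = (\<lambda>p j. \<Sum>i<m. c i p * \<epsilon> i p j)"
  define \<delta> where "\<delta> = (\<lambda>p j. frame t m p j + d p j)"
  have cK: "c i p \<in> K" if "i < m" "p \<in> tdom t" for i p
    unfolding c_def by (intro K_minus K_divide metric_K ts that frame_fibre t m fib)
  have dfib: "d p \<in> fibre E p" if "p \<in> tdom t" for p
    unfolding d_def using that by (intro fibre_sum ts fib cK) auto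
  have \<delta>fib: "\<delta> p \<in> fibre E p" if "p \<in> tdom t" for p
    unfolding \<delta>_def using that by (intro fibre_add ts frame_fibre t m dfib)
  have \<delta>coord: "tmap t p (\<delta> p) l = (if l = m then 1 else 0) + (\<Sum>i<m. c i p * tmap t p (\<epsilon> i p) l)"
    if "p \<in> tdom t" for p l
  proof -
    have "tmap t p (d p) = (\<lambda>l. \<Sum>i<m. c i p * tmap t p (\<epsilon> i p) l)"
      unfolding d_def using that by (intro triv_sum t cK fib) auto
    moreover have "tmap t p (\<delta> p) = (\<lambda>l. tmap t p (frame t m p) l + tmap t p (d p) l)"
      unfolding \<delta>_def by (intro triv_add t that frame_fibre m dfib)
    ultimately show ?thesis using tmap_frame[OF t that m] by simp
  qed
  have \<delta>nz: "\<delta> p \<noteq> (\<lambda>i. 0)" if "p \<in> tdom t" for p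
  proof
    assume "\<delta> p = (\<lambda>i. 0)"
    then have "tmap t p (\<delta> p) m = 0" using triv_zero[OF t that] by simp
    then show False using \<delta>coord[OF that, of m] tri[OF _ that] by simp
  qed
  have \<delta>orth: "fmetric E p (\<delta> p) (\<epsilon> j p) = 0" if p: "p \<in> tdom t" and j: "j < m" for p j
  proof -
    have "fmetric E p (d p) (\<epsilon> j p) = (\<Sum>i<m. c i p * fmetric E p (\<epsilon> i p) (\<epsilon> j p))"
      unfolding d_def using p j by (intro metric_sum ts fib cK) auto
    also have "\<dots> = (\<Sum>i<m. if i = j then c j p * fmetric E p (\<epsilon> j p) (\<epsilon> j p) else 0)"
      by (rule sum.cong) (use orth p j in auto)
    also have "\<dots> = c j p * fmetric E p (\<epsilon> j p) (\<epsilon> j p)" using j by simp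
    also have "\<dots> = - fmetric E p (frame t m p) (\<epsilon> j p)"
      using metric_pos[OF ts[OF p] fib[OF j p] nz[OF j p]] metric_self[OF ts[OF p] fib[OF j p]]
      by (simp add: c_def)
    finally show ?thesis
      unfolding \<delta>_def using metric_add[OF ts[OF p] frame_fibre[OF t p m] dfib[OF p] fib[OF j p]]
      by simp
  qed
  have frame_sm: "smooth_fun (catlas C) (tdom t) (\<lambda>p. tmap t p (frame t m p) l)" for l
    by (rule smooth_fun_cong[OF smooth_fun_const[of _ "if l = m then 1 else 0"]])
      (simp add: tmap_frame[OF t _ m])
  have c_sm: "smooth_fun (catlas C) (tdom t) (c i)" if i: "i < m" for i
  proof -
    have "smooth_fun (catlas C) (tdom t) (\<lambda>p. 0 - fmetric E p (frame t m p) (\<epsilon> i p) / fmetric E p (\<epsilon> i p) (\<epsilon> i p))"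
    proof (intro smooth_fun_diff smooth_fun_divide smooth_fun_const metric_smooth[OF t]
        frame_sm sm i order_refl frame_fibre[OF t _ m] fib[OF i])
      show "fmetric E p (\<epsilon> i p) (\<epsilon> i p) \<noteq> 0" if "p \<in> tdom t" for p
        using metric_pos[OF ts[OF that] fib[OF i that] nz[OF i that]]
          metric_self[OF ts[OF that] fib[OF i that]] by simp
    qed
    then show ?thesis by (simp add: c_def)
  qed
  have \<delta>sm: "smooth_fun (catlas C) (tdom t) (\<lambda>p. tmap t p (\<delta> p) l)" for l
  proof (rule smooth_fun_cong)
    show "smooth_fun (catlas C) (tdom t)
      (\<lambda>p. (if l = m then 1 else 0) + (\<Sum>i<m. c i p * tmap t p (\<epsilon> i p) l))"
      by (intro smooth_fun_add smooth_fun_const smooth_fun_sum smooth_fun_mult c_sm sm) auto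
  qed (simp add: \<delta>coord)
  have \<delta>spn: "fmetric E p w (frame t m p) = 0"
    if p: "p \<in> tdom t" and w: "w \<in> fibre E p" and 0: "\<And>j. j < m \<Longrightarrow> fmetric E p w (\<epsilon> j p) = 0"
      "fmetric E p w (\<delta> p) = 0" for p w
  proof -
    have "fmetric E p w (d p) = (\<Sum>i<m. cnj (c i p) * fmetric E p w (\<epsilon> i p))"
      unfolding d_def using p w by (intro metric_sum_right ts fib cK) auto
    also have "\<dots> = 0" using 0 by simp
    finally show ?thesis
      using metric_add_right[OF ts[OF p] frame_fibre[OF t p m] dfib[OF p] w] 0(2)
      by (simp add: \<delta>_def)
  qed
  have "orth_frame t (Suc m) (\<epsilon>(m := \<delta>))"
    unfolding orth_frame_def
  proof (intro conjI allI impI ballI)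
    fix j p assume "j < Suc m" "p \<in> tdom t"
    then show "(\<epsilon>(m := \<delta>)) j p \<in> fibre E p" using fib \<delta>fib by simp
    show "(\<epsilon>(m := \<delta>)) j p \<noteq> (\<lambda>i. 0)" using nz \<delta>nz \<open>j < Suc m\<close> \<open>p \<in> tdom t\<close> by simp
  next
    fix j p l assume *: "j < Suc m" "p \<in> tdom t" "j < l"
    then have "tmap t p (\<delta> p) l = 0" if "j = m"
      using that tri[OF _ *(2)] \<delta>coord[OF *(2), of l] by simp
    then show "tmap t p ((\<epsilon>(m := \<delta>)) j p) l = 0" using tri * by simp
  next
    fix j l assume "j < Suc m"
    then show "smooth_fun (catlas C) (tdom t) (\<lambda>p. tmap t p ((\<epsilon>(m := \<delta>)) j p) l)"
      using sm \<delta>sm by simp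
  next
    fix i j p assume *: "i < Suc m" "j < Suc m" "i \<noteq> j" "p \<in> tdom t"
    then have "fmetric E p (\<epsilon> i p) (\<delta> p) = 0" if "i < m"
      using metric_cnj[OF ts[OF *(4)] \<delta>fib[OF *(4)] fib[OF that *(4)]] \<delta>orth that by simp
    then show "fmetric E p ((\<epsilon>(m := \<delta>)) i p) ((\<epsilon>(m := \<delta>)) j p) = 0"
      using * orth \<delta>orth by (simp add: less_Suc_eq) blast
  next
    fix p w j assume *: "p \<in> tdom t" "w \<in> fibre E p"
      "\<forall>j<Suc m. fmetric E p w ((\<epsilon>(m := \<delta>)) j p) = 0" "j < Suc m"
    have 0: "fmetric E p w (\<epsilon> j p) = 0" if "j < m" for j
      using *(3)[rule_format, of j] that by simp
    have "fmetric E p w (\<delta> p) = 0" using *(3)[rule_format, of m] by simp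
    then show "fmetric E p w (frame t j p) = 0"
      using spn[OF *(1,2) 0] \<delta>spn[OF *(1,2) 0] *(4) by (cases "j = m") auto
  qed
  then show ?case by blast
qed

text \<open>The frame is not normalised: dividing by the squared norms in the expansion is as good, and needs no
  square roots.\<close>

lemma orthogonal_frame:
  assumes t: "t \<in> trivs E"
  obtains \<epsilon> :: "nat \<Rightarrow> 'p \<Rightarrow> cvec" where
    "\<And>j p. j < trank t \<Longrightarrow> p \<in> tdom t \<Longrightarrow> \<epsilon> j p \<in> fibre E p"
    "\<And>j p. j < trank t \<Longrightarrow> p \<in> tdom t \<Longrightarrow> 0 < nsq p (\<epsilon> j p)"
    "\<And>j l. j < trank t \<Longrightarrow> smooth_fun (catlas C) (tdom t) (\<lambda>p. tmap t p (\<epsilon> j p) l)"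
    "\<And>p v. p \<in> tdom t \<Longrightarrow> v \<in> fibre E p \<Longrightarrow>
      v = (\<lambda>i. \<Sum>j<trank t. (fmetric E p v (\<epsilon> j p) / of_real (nsq p (\<epsilon> j p))) * \<epsilon> j p i)"
proof -
  let ?k = "trank t"
  note ts = subsetD[OF triv_subset[OF t]]
  obtain \<epsilon> where \<epsilon>: "orth_frame t ?k \<epsilon>"
    using orth_frame_exists[OF t order_refl] by blast
  note fib = orth_frameD(1)[OF \<epsilon>] and nz = orth_frameD(2)[OF \<epsilon>] and tri = orth_frameD(3)[OF \<epsilon>]
    and sm = orth_frameD(4)[OF \<epsilon>] and orth = orth_frameD(5)[OF \<epsilon>] and spn = orth_frame_span[OF \<epsilon>]
  have pos: "0 < nsq p (\<epsilon> j p)" if "j < ?k" "p \<in> tdom t" for j p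
    using metric_pos ts fib nz that by blast
  have "v = (\<lambda>i. \<Sum>j<?k. (fmetric E p v (\<epsilon> j p) / of_real (nsq p (\<epsilon> j p))) * \<epsilon> j p i)"
    if p: "p \<in> tdom t" and v: "v \<in> fibre E p" for p v
  proof -
    define c where "c = (\<lambda>j. fmetric E p v (\<epsilon> j p) / of_real (nsq p (\<epsilon> j p)))"
    define u where "u = (\<lambda>i. \<Sum>j<?k. c j * \<epsilon> j p i)"
    define w where "w = (\<lambda>i. v i - u i)"
    have cK: "c j \<in> K" if "j < ?k" for j
      unfolding c_def by (intro K_divide metric_K K_of_real ts p v fib that)
    have u: "u \<in> fibre E p"
      unfolding u_def by (intro fibre_sum ts p cK fib) auto
    have w: "w \<in> fibre E p" unfolding w_def by (intro fibre_diff ts p v u)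
    have "fmetric E p w (\<epsilon> j p) = 0" if j: "j < ?k" for j
    proof -
      have "fmetric E p u (\<epsilon> j p) = (\<Sum>i<?k. c i * fmetric E p (\<epsilon> i p) (\<epsilon> j p))"
        unfolding u_def by (intro metric_sum ts p fib cK j) auto
      also have "\<dots> = (\<Sum>i<?k. if i = j then c j * fmetric E p (\<epsilon> j p) (\<epsilon> j p) else 0)"
        by (rule sum.cong) (use orth p j in auto)
      also have "\<dots> = fmetric E p v (\<epsilon> j p)"
        using pos[OF j p] j metric_self[OF ts[OF p] fib[OF j p]] by (simp add: c_def)
      finally have "fmetric E p u (\<epsilon> j p) = fmetric E p v (\<epsilon> j p)" .
      moreover have "fmetric E p (\<lambda>i. w i + u i) (\<epsilon> j p) = fmetric E p w (\<epsilon> j p) + fmetric E p u (\<epsilon> j p)"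
        by (intro metric_add ts p w u fib j)
      ultimately show ?thesis by (simp add: w_def)
    qed
    then have "fmetric E p w (frame t j p) = 0" if "j < ?k" for j
      using spn[OF p w _ that] by blast
    moreover have "fmetric E p w w = (\<Sum>j<?k. cnj (tmap t p w j) * fmetric E p w (frame t j p))"
      by (subst (2) frame_expansion[OF t p w], rule metric_sum_right)
        (auto simp: ts p w triv_coord_K[OF t p w] frame_fibre[OF t p])
    ultimately have "nsq p w = 0" by (simp add: nsq_def)
    then have "w = (\<lambda>j. 0)" using nsq_eq_0[OF ts[OF p] w] by simp
    then show ?thesis unfolding w_def u_def c_def by (metis (no_types, lifting) eq_iff_diff_eq_0 ext)
  qed
  then show ?thesis using that[of \<epsilon>] fib pos sm by blast
qed

end

section \<open>Diffeomorphisms and bundle homomorphisms\<close>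

context conical_mfd
begin

text \<open>The inverse is part of the data, so that the roles of \<open>f\<close> and \<open>h\<close> can be exchanged.\<close>

definition diffeo_pair :: "('p \<Rightarrow> 'p) \<Rightarrow> ('p \<Rightarrow> 'p) \<Rightarrow> bool"
  where "diffeo_pair f h \<longleftrightarrow> homeomorphic_maps (cres C) (cres C) f h \<and>
    smooth_map (cres C) (catlas C) (cres C) (catlas C) f \<and>
    smooth_map (cres C) (catlas C) (cres C) (catlas C) h"

lemma diffeo_pair_sym: "diffeo_pair f h \<Longrightarrow> diffeo_pair h f"
  using homeomorphic_maps_sym[of _ _ f h] unfolding diffeo_pair_def by blast

lemma diffeo_pair:
  assumes "diffeo_pair f h"
  shows diffeo_pair_smooth: "smooth_map (cres C) (catlas C) (cres C) (catlas C) f"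
    and diffeo_pair_continuous: "continuous_map (cres C) (cres C) f"
    and diffeo_pair_in: "p \<in> topspace (cres C) \<Longrightarrow> f p \<in> topspace (cres C)"
    and diffeo_pair_inv: "p \<in> topspace (cres C) \<Longrightarrow> h (f p) = p"
    and diffeo_pair_cint: "p \<in> cint C \<Longrightarrow> f p \<in> cint C"
proof -
  have hm: "homeomorphic_maps (cres C) (cres C) f h"
    using assms by (simp add: diffeo_pair_def)
  then show "continuous_map (cres C) (cres C) f" "p \<in> topspace (cres C) \<Longrightarrow> f p \<in> topspace (cres C)"
    "p \<in> topspace (cres C) \<Longrightarrow> h (f p) = p"
    by (auto simp: homeomorphic_maps_def continuous_map_def)
  show "p \<in> cint C \<Longrightarrow> f p \<in> cint C" by (rule homeomorphism_cint[OF hm])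
  show "smooth_map (cres C) (catlas C) (cres C) (catlas C) f"
    using assms by (simp add: diffeo_pair_def)
qed

lemma diffeo_pair_cint_iff:
  assumes "diffeo_pair f h" "p \<in> topspace (cres C)"
  shows "f p \<in> cint C \<longleftrightarrow> p \<in> cint C"
  using diffeo_pair_cint[OF assms(1)] diffeo_pair_cint[OF diffeo_pair_sym[OF assms(1)], of "f p"]
    diffeo_pair_inv[OF assms] by auto

lemma vimage_openin:
  assumes "continuous_map (cres C) (cres C) f" "openin (cres C) W"
  shows "openin (cres C) (f -` W \<inter> topspace (cres C))"
  using openin_continuous_map_preimage[OF assms] by (simp add: vimage_def Int_def conj_commute)

text \<open>Compactness up to the boundary turns local bounds into global ones.\<close>

lemma compact_uniform_bound:
  fixes Q :: "'p \<Rightarrow> real \<Rightarrow> bool"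
  assumes local: "\<And>p. p \<in> topspace (cres C) \<Longrightarrow> \<exists>V B. openin (cres C) V \<and> p \<in> V \<and> (\<forall>q\<in>V. Q q B)"
    and mono: "\<And>q B B'. q \<in> topspace (cres C) \<Longrightarrow> Q q B \<Longrightarrow> B \<le> B' \<Longrightarrow> Q q B'"
  shows "\<exists>B. \<forall>q\<in>topspace (cres C). Q q B"
proof -
  define \<U> where "\<U> = {V. openin (cres C) V \<and> (\<exists>B. \<forall>q\<in>V. Q q B)}"
  have "topspace (cres C) \<subseteq> \<Union>\<U>"
  proof
    fix p assume "p \<in> topspace (cres C)"
    from local[OF this] obtain V B where "openin (cres C) V" "p \<in> V" "\<forall>q\<in>V. Q q B" by auto
    then show "p \<in> \<Union>\<U>" unfolding \<U>_def by auto
  qed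
  moreover have "\<forall>U\<in>\<U>. openin (cres C) U" by (simp add: \<U>_def)
  ultimately obtain \<F> where \<F>: "finite \<F>" "\<F> \<subseteq> \<U>" "topspace (cres C) \<subseteq> \<Union>\<F>"
    using compact_res[unfolded compact_space_alt, THEN spec, of \<U>] by auto
  have "\<forall>V\<in>\<F>. \<exists>B. \<forall>q\<in>V. Q q B" using \<F>(2) by (auto simp: \<U>_def)
  then obtain b where b: "\<And>V q. V \<in> \<F> \<Longrightarrow> q \<in> V \<Longrightarrow> Q q (b V)" by metis
  have "Q q (Max (b ` \<F>))" if q: "q \<in> topspace (cres C)" for q
  proof -
    obtain V where "V \<in> \<F>" "q \<in> V" using q \<F>(3) by blast
    then show ?thesis using mono[OF q b] \<F>(1) by simp
  qed
  then show ?thesis by blast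
qed

lemma smooth_funs_locally_bounded:
  assumes "finite J" and u: "\<And>j. j \<in> J \<Longrightarrow> smooth_fun (catlas C) W (u j)"
    and W: "openin (cres C) W" and p: "p \<in> W"
  shows "\<exists>V B. openin (cres C) V \<and> p \<in> V \<and> V \<subseteq> W \<and> 0 < B \<and> (\<forall>j\<in>J. \<forall>q\<in>V. norm (u j q) \<le> B)"
  using assms(1,2)
proof (induction J)
  case empty
  then show ?case using W p by (intro exI[of _ W] exI[of _ 1]) simp
next
  case (insert i J)
  then obtain V B where V: "openin (cres C) V" "p \<in> V" "V \<subseteq> W" "0 < B" "\<forall>j\<in>J. \<forall>q\<in>V. norm (u j q) \<le> B"
    by (metis insert_iff)
  obtain V' B' where V': "openin (cres C) V'" "p \<in> V'" "V' \<subseteq> W" "\<forall>q\<in>V'. norm (u i q) \<le> B'"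
    using smooth_fun_locally_bounded[OF insert.prems[OF insertI1] W p] by metis
  show ?case
  proof (intro exI conjI ballI)
    show "openin (cres C) (V \<inter> V')" using V(1) V'(1) by blast
    show "p \<in> V \<inter> V'" "V \<inter> V' \<subseteq> W" "0 < max B B'" using V V' by auto
    fix j q assume "j \<in> insert i J" "q \<in> V \<inter> V'"
    then show "norm (u j q) \<le> max B B'"
      using V(5) V'(4) by (cases "j = i") (auto simp: le_max_iff_disj)
  qed
qed

lemma smooth_matrix_locally_bounded:
  assumes u: "\<And>i j. i < a \<Longrightarrow> j < b \<Longrightarrow> smooth_fun (catlas C) W (u i j)"
    and W: "openin (cres C) W" and p: "p \<in> W"
  obtains V B where "openin (cres C) V" "p \<in> V" "V \<subseteq> W" "0 < (B::real)"
    "\<forall>i<a::nat. \<forall>j<b::nat. \<forall>q\<in>V. norm (u i j q) \<le> B"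
proof -
  have "smooth_fun (catlas C) W (u (fst ij) (snd ij))" if "ij \<in> {..<a} \<times> {..<b}" for ij
    using that by (intro u) auto
  from smooth_funs_locally_bounded[of "{..<a} \<times> {..<b}" W "\<lambda>ij. u (fst ij) (snd ij)", OF _ this W p]
  obtain V B where V: "openin (cres C) V" "p \<in> V" "V \<subseteq> W" "0 < B"
    and B: "\<forall>ij\<in>{..<a} \<times> {..<b}. \<forall>q\<in>V. norm (u (fst ij) (snd ij) q) \<le> B" by auto
  have "norm (u i j q) \<le> B" if "i < a" "j < b" "q \<in> V" for i j q
    using bspec[OF bspec[OF B, of "(i, j)"], of q] that by simp
  then show ?thesis using that[OF V] by simp
qed

end

context metric_bundle_mfd
begin

subsection \<open>Comparison of the fibre metric with coordinates\<close>

text \<open>The metric is nondegenerate up to the boundary, so near any point, boundary points included, the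
  coordinates of a vector are controlled by its norm.  For an orthogonal frame \<open>\<epsilon>\<close> the vector is
  \<open>\<Sum>\<^sub>j (\<langle>v, \<epsilon>\<^sub>j\<rangle> / \<bar>\<epsilon>\<^sub>j\<bar>\<^sup>2) \<epsilon>\<^sub>j\<close>, and Cauchy--Schwarz bounds the coefficients.\<close>

lemma coord_le_nsq_locally:
  assumes t: "t \<in> trivs E" and p: "p \<in> tdom t"
  shows "\<exists>V B. openin (cres C) V \<and> p \<in> V \<and> V \<subseteq> tdom t \<and> 0 < B \<and>
    (\<forall>q\<in>V. \<forall>v\<in>fibre E q. \<forall>l. cmod (tmap t q v l) \<le> B * sqrt (nsq q v))"
proof -
  let ?k = "trank t"
  note ts = subsetD[OF triv_subset[OF t]]
  obtain \<epsilon> where \<epsilon>: "\<And>j p. j < ?k \<Longrightarrow> p \<in> tdom t \<Longrightarrow> \<epsilon> j p \<in> fibre E p"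
    "\<And>j p. j < ?k \<Longrightarrow> p \<in> tdom t \<Longrightarrow> 0 < nsq p (\<epsilon> j p)"
    "\<And>j l. j < ?k \<Longrightarrow> smooth_fun (catlas C) (tdom t) (\<lambda>p. tmap t p (\<epsilon> j p) l)"
    "\<And>p v. p \<in> tdom t \<Longrightarrow> v \<in> fibre E p \<Longrightarrow>
      v = (\<lambda>i. \<Sum>j<?k. (fmetric E p v (\<epsilon> j p) / of_real (nsq p (\<epsilon> j p))) * \<epsilon> j p i)"
    by (rule orthogonal_frame[OF t]) (use that in blast)
  define N where "N = (\<lambda>j p. fmetric E p (\<epsilon> j p) (\<epsilon> j p))"
  have N_sm: "smooth_fun (catlas C) (tdom t) (N j)" if "j < ?k" for j
    unfolding N_def by (intro metric_smooth[OF t order_refl] \<epsilon> that)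
  have N: "N j q = of_real (nsq q (\<epsilon> j q))" if "j < ?k" "q \<in> tdom t" for j q
    unfolding N_def using metric_self[OF ts \<epsilon>(1)] that by simp
  define c where "c = (\<lambda>j l q. tmap t q (\<epsilon> j q) l / N j q)"
  have "smooth_fun (catlas C) (tdom t) (c j l)" if j: "j < ?k" for j l
    unfolding c_def using \<epsilon>(2)[OF j] N[OF j]
    by (intro smooth_fun_divide \<epsilon>(3) N_sm j) (metis less_irrefl of_real_eq_0_iff)
  then obtain V1 B1 where V1: "openin (cres C) V1" "p \<in> V1" "V1 \<subseteq> tdom t" "0 < B1"
    "\<forall>j<?k. \<forall>l<?k. \<forall>q\<in>V1. cmod (c j l q) \<le> B1"
    by (rule smooth_matrix_locally_bounded[OF _ triv_openin[OF t] p, of ?k ?k c])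
  obtain V2 B2 where V2: "openin (cres C) V2" "p \<in> V2" "V2 \<subseteq> tdom t" "0 < B2"
    "\<forall>j<?k. \<forall>l<1::nat. \<forall>q\<in>V2. cmod (N j q) \<le> B2"
    by (rule smooth_matrix_locally_bounded[OF N_sm triv_openin[OF t] p, of ?k 1 "\<lambda>j l. j"])
  \<comment> \<open>The summand \<open>1\<close> makes the constant positive also for bundles of rank \<open>0\<close>.\<close>
  define B where "B = real ?k * (sqrt B2 * B1) + 1"
  have "cmod (tmap t q v l) \<le> B * sqrt (nsq q v)"
    if q: "q \<in> V1 \<inter> V2" and v: "v \<in> fibre E q" for q v l
  proof (cases "l < ?k")
    case True
    have qt: "q \<in> tdom t" using q V1 by blast
    have nn: "0 \<le> nsq q v" using nsq_nonneg[OF ts[OF qt] v] .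
    have "tmap t q v l = (\<Sum>j<?k. (fmetric E q v (\<epsilon> j q) / of_real (nsq q (\<epsilon> j q))) * tmap t q (\<epsilon> j q) l)"
      by (subst (1) \<epsilon>(4)[OF qt v], subst triv_sum[OF t qt])
        (auto intro!: K_divide metric_K ts qt v \<epsilon>)
    also have "\<dots> = (\<Sum>j<?k. fmetric E q v (\<epsilon> j q) * c j l q)"
      by (rule sum.cong) (auto simp: c_def N[OF _ qt])
    finally have "cmod (tmap t q v l) \<le> (\<Sum>j<?k. cmod (fmetric E q v (\<epsilon> j q)) * cmod (c j l q))"
      by (simp only: norm_mult[symmetric] norm_sum)
    also have "\<dots> \<le> (\<Sum>j<?k. (sqrt (nsq q v) * sqrt B2) * B1)"
    proof (intro sum_mono mult_mono)
      fix j assume j: "j \<in> {..<?k}"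
      have "nsq q (\<epsilon> j q) \<le> B2"
      proof -
        have "cmod (N j q) \<le> B2" using V2(5) j q by simp
        then show ?thesis using N[of j q] \<epsilon>(2)[of j q] j qt by simp
      qed
      then show "cmod (fmetric E q v (\<epsilon> j q)) \<le> sqrt (nsq q v) * sqrt B2"
        using metric_le[OF ts[OF qt] v \<epsilon>(1)[of j q]] j qt nn
        by (meson lessThan_iff mult_left_mono order_trans real_sqrt_ge_zero real_sqrt_le_mono)
      show "cmod (c j l q) \<le> B1" using V1(5) j True q by simp
    qed (use nn V2(4) in auto)
    also have "\<dots> \<le> B * sqrt (nsq q v)"
      using nn by (simp add: B_def algebra_simps)
    finally show ?thesis .
  next
    case False
    have qt: "q \<in> tdom t" using q V1 by blast
    have "0 \<le> B" using V1(4) V2(4) by (simp add: B_def)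
    then show ?thesis
      using triv_coord_0[OF t qt v] False nsq_nonneg[OF ts[OF qt] v] by simp
  qed
  moreover have "0 < B" using V1(4) V2(4) by (simp add: B_def add_nonneg_pos)
  ultimately show ?thesis
    using V1 V2 by (intro exI[of _ "V1 \<inter> V2"] exI[of _ B]) auto
qed

lemma nsq_le_coord_locally:
  assumes t: "t \<in> trivs E" and p: "p \<in> tdom t"
  shows "\<exists>V B. openin (cres C) V \<and> p \<in> V \<and> V \<subseteq> tdom t \<and> 0 < B \<and>
    (\<forall>q\<in>V. \<forall>v\<in>fibre E q. \<forall>b. (\<forall>l<trank t. cmod (tmap t q v l) \<le> b) \<longrightarrow> nsq q v \<le> B * b\<^sup>2)"
proof -
  let ?k = "trank t"
  obtain H where H: "\<And>l j. smooth_fun (catlas C) (tdom t) (H l j)"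
    "\<And>p v w. p \<in> tdom t \<Longrightarrow> v \<in> fibre E p \<Longrightarrow> w \<in> fibre E p \<Longrightarrow> fmetric E p v w =
        (\<Sum>l<?k. \<Sum>j<?k. H l j p * tmap t p v l * cnj (tmap t p w j))"
    using metric_coord[OF t] by blast
  obtain V B where V: "openin (cres C) V" "p \<in> V" "V \<subseteq> tdom t" "0 < B"
    "\<forall>l<?k. \<forall>j<?k. \<forall>q\<in>V. cmod (H l j q) \<le> B"
    by (rule smooth_matrix_locally_bounded[OF H(1) triv_openin[OF t] p,
          of ?k ?k "\<lambda>l j. l" "\<lambda>l j. j"])
  have "nsq q v \<le> (real ?k * real ?k * B + 1) * b\<^sup>2"
    if q: "q \<in> V" and v: "v \<in> fibre E q" and b: "\<forall>l<?k. cmod (tmap t q v l) \<le> b" for q v b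
  proof -
    have "nsq q v \<le> cmod (fmetric E q v v)" by (simp add: nsq_def complex_Re_le_cmod)
    also have "\<dots> \<le> (\<Sum>l<?k. \<Sum>j<?k. cmod (H l j q) * cmod (tmap t q v l) * cmod (tmap t q v j))"
      using q v V(3) by (subst H(2)) (auto intro!: sum_norm_le simp: norm_mult)
    also have "\<dots> \<le> (\<Sum>l<?k. \<Sum>j<?k. B * b * b)"
    proof (intro sum_mono mult_mono)
      fix l j assume lj: "l \<in> {..<?k}" "j \<in> {..<?k}"
      show "cmod (H l j q) \<le> B" using V(5) lj q by simp
      show "cmod (tmap t q v l) \<le> b" "cmod (tmap t q v j) \<le> b" using b lj by auto
      then show "0 \<le> B * b" using V(4) by (smt (verit) mult_nonneg_nonneg norm_ge_zero)
    qed (use V(4) in auto)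
    also have "\<dots> = real ?k * real ?k * B * b\<^sup>2" by (simp add: power2_eq_square)
    also have "\<dots> \<le> (real ?k * real ?k * B + 1) * b\<^sup>2" by (simp add: algebra_simps)
    finally show ?thesis .
  qed
  moreover have "0 < real ?k * real ?k * B + 1" using V(4) by (simp add: add_nonneg_pos)
  ultimately show ?thesis using V(1-3) by blast
qed

subsection \<open>Homomorphisms over a diffeomorphism\<close>

lemma bundle_hom_fibre:
  "bundle_hom_pullback K C f E \<phi> \<Longrightarrow> p \<in> topspace (cres C) \<Longrightarrow> v \<in> fibre E (f p) \<Longrightarrow> \<phi> p v \<in> fibre E p"
  and bundle_hom_linear:
  "bundle_hom_pullback K C f E \<phi> \<Longrightarrow> p \<in> topspace (cres C) \<Longrightarrow> K_linear_on K (fibre E (f p)) (\<phi> p)"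
  unfolding bundle_hom_pullback_def by blast+

lemma bundle_hom_coord:
  assumes "bundle_hom_pullback K C f E \<phi>" "t \<in> trivs E" "t' \<in> trivs E"
  obtains m :: "nat \<Rightarrow> nat \<Rightarrow> 'p \<Rightarrow> complex" where
    "\<And>l j. smooth_fun (catlas C) (f -` tdom t \<inter> tdom t') (m l j)"
    "\<And>p v l. p \<in> f -` tdom t \<Longrightarrow> p \<in> tdom t' \<Longrightarrow> v \<in> fibre E (f p) \<Longrightarrow> l < trank t' \<Longrightarrow>
        tmap t' p (\<phi> p v) l = (\<Sum>j<trank t. m l j p * tmap t (f p) v j)"
proof -
  have "\<exists>m :: nat \<Rightarrow> nat \<Rightarrow> 'p \<Rightarrow> complex.
      (\<forall>l j. smooth_fun (catlas C) (f -` tdom t \<inter> tdom t') (m l j)) \<and>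
      (\<forall>p\<in>f -` tdom t \<inter> tdom t'. \<forall>v\<in>fibre E (f p). \<forall>l<trank t'.
        tmap t' p (\<phi> p v) l = (\<Sum>j<trank t. m l j p * tmap t (f p) v j))"
    using assms by (simp add: bundle_hom_pullback_def)
  then show ?thesis using that by blast
qed

lemma section_fibre: "s \<in> sections C E \<Longrightarrow> p \<in> cint C \<Longrightarrow> s p \<in> fibre E p"
  and section_outside: "s \<in> sections C E \<Longrightarrow> p \<notin> cint C \<Longrightarrow> s p = (\<lambda>j. 0)"
  by (auto simp: sections_def)

lemma geom_op_sections:
  assumes f: "diffeo_pair f h" and \<phi>: "bundle_hom_pullback K C f E \<phi>" and s: "s \<in> sections C E"
  shows "geom_op C f \<phi> s \<in> sections C E"
  unfolding sections_def geom_op_def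
  using bundle_hom_fibre[OF \<phi>] section_fibre[OF s] diffeo_pair_cint[OF f] cint_subset by auto

text \<open>In local trivialisations the coordinates of \<open>\<phi> (s \<circ> f)\<close> are a smooth matrix times the coordinates of
  \<open>s \<circ> f\<close>, and the support is carried to its image under the inverse \<open>h\<close>, which lies in the interior.\<close>

lemma geom_op_Cc:
  assumes f: "diffeo_pair f h" and \<phi>: "bundle_hom_pullback K C f E \<phi>" and s: "s \<in> Cc_sections C E"
  shows "geom_op C f \<phi> s \<in> Cc_sections C E"
proof -
  have sec: "s \<in> sections C E" and
    sm: "\<And>t j. t \<in> trivs E \<Longrightarrow> j < trank t \<Longrightarrow> smooth_fun (catlas C) (tdom t \<inter> cint C) (\<lambda>p. tmap t p (s p) j)"
    using s by (auto simp: Cc_sections_def smooth_sections_def)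
  obtain Q where Q: "compactin (cres C) Q" "Q \<subseteq> cint C" "\<And>p. p \<notin> Q \<Longrightarrow> s p = (\<lambda>j. 0)"
    using s by (auto simp: Cc_sections_def)
  note h = diffeo_pair_sym[OF f]
  have "smooth_fun (catlas C) (tdom t' \<inter> cint C) (\<lambda>p. tmap t' p (geom_op C f \<phi> s p) l)"
    if t': "t' \<in> trivs E" and l: "l < trank t'" for t' l
  proof (rule smooth_fun_local)
    fix p assume "p \<in> tdom t' \<inter> cint C" "p \<in> topspace (cres C)"
    then obtain t where t: "t \<in> trivs E" "f p \<in> tdom t" using triv_exists diffeo_pair_in[OF f] by blast
    obtain m where m: "\<And>l j. smooth_fun (catlas C) (f -` tdom t \<inter> tdom t') (m l j)"
      "\<And>p v l. p \<in> f -` tdom t \<Longrightarrow> p \<in> tdom t' \<Longrightarrow> v \<in> fibre E (f p) \<Longrightarrow> l < trank t' \<Longrightarrow>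
        tmap t' p (\<phi> p v) l = (\<Sum>j<trank t. m l j p * tmap t (f p) v j)"
      using bundle_hom_coord[OF \<phi> t(1) t'] by blast
    define V where "V = f -` tdom t \<inter> topspace (cres C)"
    have V: "openin (cres C) V"
      unfolding V_def by (rule vimage_openin[OF diffeo_pair_continuous[OF f] triv_openin[OF t(1)]])
    let ?W = "tdom t' \<inter> cint C \<inter> V"
    have "smooth_fun (catlas C) ?W (\<lambda>p. tmap t (f p) (s (f p)) j)" if "j < trank t" for j
      by (rule smooth_fun_subset[OF smooth_fun_pullback[OF diffeo_pair_smooth[OF f] sm[OF t(1) that]]])
        (use diffeo_pair_cint[OF f] in \<open>auto simp: V_def\<close>)
    then have "smooth_fun (catlas C) ?W (\<lambda>p. \<Sum>j<trank t. m l j p * tmap t (f p) (s (f p)) j)"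
      by (intro smooth_fun_sum smooth_fun_mult smooth_fun_subset[OF m(1)]) (auto simp: V_def)
    then have "smooth_fun (catlas C) ?W (\<lambda>p. tmap t' p (geom_op C f \<phi> s p) l)"
      by (rule smooth_fun_cong)
        (use section_fibre[OF sec] diffeo_pair_cint[OF f] l in \<open>auto simp: geom_op_def m(2) V_def\<close>)
    moreover have "p \<in> V" using \<open>p \<in> topspace _\<close> t(2) by (simp add: V_def)
    ultimately show "\<exists>V. openin (cres C) V \<and> p \<in> V \<and>
        smooth_fun (catlas C) (tdom t' \<inter> cint C \<inter> V) (\<lambda>p. tmap t' p (geom_op C f \<phi> s p) l)"
      using V by blast
  qed
  moreover have "compactin (cres C) (h ` Q)"
    by (rule image_compactin[OF Q(1) diffeo_pair_continuous[OF h]])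
  moreover have "h ` Q \<subseteq> cint C" using Q(2) diffeo_pair_cint[OF h] by blast
  moreover have "geom_op C f \<phi> s p = (\<lambda>j. 0)" if p: "p \<notin> h ` Q" for p
  proof (cases "p \<in> cint C")
    case True
    then have pt: "p \<in> topspace (cres C)" using cint_subset by blast
    have "f p \<notin> Q" using p diffeo_pair_inv[OF f pt] by (metis imageI)
    then show ?thesis
      using Q(3) linear_zero[OF bundle_hom_linear[OF \<phi> pt] fibre_zero] diffeo_pair_in[OF f pt]
      by (simp add: geom_op_def)
  qed (simp add: geom_op_def)
  ultimately show ?thesis
    using geom_op_sections[OF f \<phi> sec] unfolding Cc_sections_def smooth_sections_def by blast
qed

text \<open>Locally, the norm of \<open>v\<close> bounds its coordinates, the smooth matrix of \<open>\<phi>\<close> bounds the coordinates of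
  \<open>\<phi> v\<close>, and these bound the norm of \<open>\<phi> v\<close>; compactness makes the constant uniform.\<close>

lemma bundle_hom_bounded:
  assumes f: "diffeo_pair f h" and \<phi>: "bundle_hom_pullback K C f E \<phi>"
  shows "\<exists>B. \<forall>p\<in>topspace (cres C). \<forall>v\<in>fibre E (f p). nsq p (\<phi> p v) \<le> B * nsq (f p) v"
proof (rule compact_uniform_bound)
  fix p assume p: "p \<in> topspace (cres C)"
  obtain t' where t': "t' \<in> trivs E" "p \<in> tdom t'" using triv_exists p by blast
  obtain t where t: "t \<in> trivs E" "f p \<in> tdom t" using triv_exists diffeo_pair_in[OF f p] by blast
  obtain m where m: "\<And>l j. smooth_fun (catlas C) (f -` tdom t \<inter> tdom t') (m l j)"
    "\<And>p v l. p \<in> f -` tdom t \<Longrightarrow> p \<in> tdom t' \<Longrightarrow> v \<in> fibre E (f p) \<Longrightarrow> l < trank t' \<Longrightarrow>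
      tmap t' p (\<phi> p v) l = (\<Sum>j<trank t. m l j p * tmap t (f p) v j)"
    using bundle_hom_coord[OF \<phi> t(1) t'(1)] by blast
  obtain V1 B1 where V1: "openin (cres C) V1" "f p \<in> V1" "V1 \<subseteq> tdom t" "0 < B1"
    "\<forall>q\<in>V1. \<forall>v\<in>fibre E q. \<forall>l. cmod (tmap t q v l) \<le> B1 * sqrt (nsq q v)"
    using coord_le_nsq_locally[OF t] by blast
  obtain V2 B2 where V2: "openin (cres C) V2" "p \<in> V2" "V2 \<subseteq> tdom t'" "0 < B2"
    "\<forall>q\<in>V2. \<forall>v\<in>fibre E q. \<forall>b. (\<forall>l<trank t'. cmod (tmap t' q v l) \<le> b) \<longrightarrow> nsq q v \<le> B2 * b\<^sup>2"
    using nsq_le_coord_locally[OF t'] by blast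
  have W: "openin (cres C) (f -` tdom t \<inter> topspace (cres C) \<inter> tdom t')"
    by (intro openin_Int vimage_openin diffeo_pair_continuous[OF f] triv_openin t t')
  have m_sm: "smooth_fun (catlas C) (f -` tdom t \<inter> topspace (cres C) \<inter> tdom t') (m l j)" for l j
    by (rule smooth_fun_subset[OF m(1)]) auto
  have pW: "p \<in> f -` tdom t \<inter> topspace (cres C) \<inter> tdom t'" using p t(2) t'(2) by simp
  obtain V3 B3 where V3: "openin (cres C) V3" "p \<in> V3"
    "V3 \<subseteq> f -` tdom t \<inter> topspace (cres C) \<inter> tdom t'" "0 < B3"
    "\<forall>l<trank t'. \<forall>j<trank t. \<forall>q\<in>V3. cmod (m l j q) \<le> B3"
    by (rule smooth_matrix_locally_bounded[OF m_sm W pW,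
          of "trank t'" "trank t" "\<lambda>l j. l" "\<lambda>l j. j"])
  let ?V = "V3 \<inter> V2 \<inter> (f -` V1 \<inter> topspace (cres C))"
  have "nsq q (\<phi> q v) \<le> (B2 * (real (trank t) * (B3 * B1))\<^sup>2) * nsq (f q) v"
    if q: "q \<in> ?V" and v: "v \<in> fibre E (f q)" for q v
  proof -
    have qs: "q \<in> topspace (cres C)" using q by blast
    have nn: "0 \<le> nsq (f q) v" using nsq_nonneg[OF diffeo_pair_in[OF f qs] v] .
    have "cmod (tmap t' q (\<phi> q v) l) \<le> real (trank t) * (B3 * B1) * sqrt (nsq (f q) v)"
      if l: "l < trank t'" for l
    proof -
      have "cmod (tmap t' q (\<phi> q v) l) \<le> (\<Sum>j<trank t. cmod (m l j q) * cmod (tmap t (f q) v j))"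
        using q V3(3) v l by (subst m(2)) (auto intro!: sum_norm_le simp: norm_mult)
      also have "\<dots> \<le> (\<Sum>j<trank t. B3 * (B1 * sqrt (nsq (f q) v)))"
      proof (intro sum_mono mult_mono)
        fix j assume "j \<in> {..<trank t}"
        then show "cmod (m l j q) \<le> B3" using V3(5) q l by simp
        show "cmod (tmap t (f q) v j) \<le> B1 * sqrt (nsq (f q) v)" using V1(5) q v by blast
      qed (use V3 V1 in auto)
      finally show ?thesis by (simp add: mult.assoc)
    qed
    then have "nsq q (\<phi> q v) \<le> B2 * (real (trank t) * (B3 * B1) * sqrt (nsq (f q) v))\<^sup>2"
      using V2(5) q bundle_hom_fibre[OF \<phi> qs v] by blast
    then show ?thesis using nn by (simp add: power_mult_distrib mult.assoc)
  qed
  moreover have "openin (cres C) ?V" "p \<in> ?V"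
    using V1 V2 V3 p by (auto intro!: openin_Int vimage_openin diffeo_pair_continuous[OF f])
  ultimately show "\<exists>V B. openin (cres C) V \<and> p \<in> V \<and>
      (\<forall>q\<in>V. \<forall>v\<in>fibre E (f q). nsq q (\<phi> q v) \<le> B * nsq (f q) v)" by blast
next
  fix q and B B' :: real assume q: "q \<in> topspace (cres C)" and *: "\<forall>v\<in>fibre E (f q). nsq q (\<phi> q v) \<le> B * nsq (f q) v" "B \<le> B'"
  show "\<forall>v\<in>fibre E (f q). nsq q (\<phi> q v) \<le> B' * nsq (f q) v"
  proof
    fix v assume v: "v \<in> fibre E (f q)"
    then have "B * nsq (f q) v \<le> B' * nsq (f q) v"
      using \<open>B \<le> B'\<close> nsq_nonneg[OF diffeo_pair_in[OF f q] v] mult_right_mono by blast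
    then show "nsq q (\<phi> q v) \<le> B' * nsq (f q) v" using * v by force
  qed
qed

text \<open>The adjoint of \<open>\<phi>\<close> is again a homomorphism over a diffeomorphism, namely over the inverse \<open>h\<close>: for
  \<open>q = f p\<close> it maps the fibre over \<open>p = h q\<close> to the fibre over \<open>q\<close>.\<close>

definition is_adjoint_at :: "('p \<Rightarrow> 'p) \<Rightarrow> ('p \<Rightarrow> cvec \<Rightarrow> cvec) \<Rightarrow> 'p \<Rightarrow> cvec \<Rightarrow> cvec \<Rightarrow> bool"
  where "is_adjoint_at h \<phi> q w u \<longleftrightarrow> u \<in> fibre E q \<and>
    (\<forall>v\<in>fibre E q. fmetric E (h q) (\<phi> (h q) v) w = fmetric E q v u)"

definition adjoint_hom :: "('p \<Rightarrow> 'p) \<Rightarrow> ('p \<Rightarrow> cvec \<Rightarrow> cvec) \<Rightarrow> 'p \<Rightarrow> cvec \<Rightarrow> cvec"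
  where "adjoint_hom h \<phi> q w = (SOME u. is_adjoint_at h \<phi> q w u)"

lemma is_adjoint_at_unique:
  assumes q: "q \<in> topspace (cres C)" and u: "is_adjoint_at h \<phi> q w u" "is_adjoint_at h \<phi> q w u'"
  shows "u = u'"
proof -
  have uf: "u \<in> fibre E q" "u' \<in> fibre E q" using u by (auto simp: is_adjoint_at_def)
  define d where "d = (\<lambda>j. u j - u' j)"
  have d: "d \<in> fibre E q" unfolding d_def by (intro fibre_diff q uf)
  have "fmetric E q d u = fmetric E q d u'"
    using u d unfolding is_adjoint_at_def by metis
  moreover have "fmetric E q d (\<lambda>j. d j + u' j) = fmetric E q d d + fmetric E q d u'"
    by (intro metric_add_right q d uf)
  ultimately have "nsq q d = 0" by (simp add: d_def nsq_def)
  then have "d = (\<lambda>j. 0)" using nsq_eq_0[OF q d] by simp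
  then have "d j = 0" for j by simp
  then show "u = u'" by (simp add: d_def fun_eq_iff)
qed

text \<open>The adjoint exists because it can be written down in an orthogonal frame of the fibre over \<open>q\<close>: its
  coefficients are \<open>\<langle>w, \<phi> \<epsilon>\<^sub>j\<rangle> / \<bar>\<epsilon>\<^sub>j\<bar>\<^sup>2\<close>.  The same formula gives its smoothness later.\<close>

lemma is_adjoint_at_frame:
  assumes f: "diffeo_pair f h" and \<phi>: "bundle_hom_pullback K C f E \<phi>"
    and t: "t \<in> trivs E" and q: "q \<in> tdom t" and w: "w \<in> fibre E (h q)"
    and \<epsilon>: "\<And>j. j < trank t \<Longrightarrow> \<epsilon> j \<in> fibre E q"
      "\<And>v. v \<in> fibre E q \<Longrightarrow> v = (\<lambda>i. \<Sum>j<trank t. (fmetric E q v (\<epsilon> j) / of_real (nsq q (\<epsilon> j))) * \<epsilon> j i)"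
  shows "is_adjoint_at h \<phi> q w
    (\<lambda>i. \<Sum>j<trank t. (fmetric E (h q) w (\<phi> (h q) (\<epsilon> j)) / of_real (nsq q (\<epsilon> j))) * \<epsilon> j i)"
  unfolding is_adjoint_at_def
proof (intro conjI ballI)
  have qs: "q \<in> topspace (cres C)" using q t triv_subset by blast
  note h = diffeo_pair_sym[OF f]
  have hq: "h q \<in> topspace (cres C)" "f (h q) = q"
    using diffeo_pair_in[OF h qs] diffeo_pair_inv[OF h qs] by auto
  have \<phi>\<epsilon>: "\<phi> (h q) (\<epsilon> j) \<in> fibre E (h q)" if "j < trank t" for j
    using bundle_hom_fibre[OF \<phi> hq(1)] \<epsilon>(1)[OF that] hq(2) by simp
  have cK: "fmetric E (h q) w (\<phi> (h q) (\<epsilon> j)) / of_real (nsq q (\<epsilon> j)) \<in> K" if "j < trank t" for j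
    by (intro K_divide metric_K K_of_real hq w \<phi>\<epsilon> that)
  show "(\<lambda>i. \<Sum>j<trank t. (fmetric E (h q) w (\<phi> (h q) (\<epsilon> j)) / of_real (nsq q (\<epsilon> j))) * \<epsilon> j i) \<in> fibre E q"
    by (rule fibre_sum[OF qs]) (auto simp: cK \<epsilon>(1))
  fix v assume v: "v \<in> fibre E q"
  have vK: "fmetric E q v (\<epsilon> j) / of_real (nsq q (\<epsilon> j)) \<in> K" if "j < trank t" for j
    by (intro K_divide metric_K K_of_real qs v \<epsilon>(1) that)
  have "\<phi> (h q) v = \<phi> (h q) (\<lambda>i. \<Sum>j<trank t. (fmetric E q v (\<epsilon> j) / of_real (nsq q (\<epsilon> j))) * \<epsilon> j i)"
    using \<epsilon>(2)[OF v] by simp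
  also have "\<dots> = (\<lambda>i. \<Sum>j<trank t. (fmetric E q v (\<epsilon> j) / of_real (nsq q (\<epsilon> j))) * \<phi> (h q) (\<epsilon> j) i)"
    using bundle_hom_linear[OF \<phi> hq(1)] hq(2) by (intro linear_sum[OF qs]) (auto simp: vK \<epsilon>(1))
  finally have expand: "\<phi> (h q) v =
      (\<lambda>i. \<Sum>j<trank t. (fmetric E q v (\<epsilon> j) / of_real (nsq q (\<epsilon> j))) * \<phi> (h q) (\<epsilon> j) i)" .
  have "fmetric E (h q) (\<phi> (h q) v) w =
      (\<Sum>j<trank t. (fmetric E q v (\<epsilon> j) / of_real (nsq q (\<epsilon> j))) * fmetric E (h q) (\<phi> (h q) (\<epsilon> j)) w)"
    unfolding expand by (rule metric_sum[OF hq(1) w]) (auto simp: vK \<phi>\<epsilon>)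
  also have "\<dots> = (\<Sum>j<trank t. cnj (fmetric E (h q) w (\<phi> (h q) (\<epsilon> j)) / of_real (nsq q (\<epsilon> j))) * fmetric E q v (\<epsilon> j))"
    by (rule sum.cong) (auto simp: metric_cnj[OF hq(1) w \<phi>\<epsilon>])
  also have "\<dots> = fmetric E q v
      (\<lambda>i. \<Sum>j<trank t. (fmetric E (h q) w (\<phi> (h q) (\<epsilon> j)) / of_real (nsq q (\<epsilon> j))) * \<epsilon> j i)"
    by (rule metric_sum_right[symmetric, OF qs v]) (auto simp: cK \<epsilon>(1))
  finally show "fmetric E (h q) (\<phi> (h q) v) w = fmetric E q v
      (\<lambda>i. \<Sum>j<trank t. (fmetric E (h q) w (\<phi> (h q) (\<epsilon> j)) / of_real (nsq q (\<epsilon> j))) * \<epsilon> j i)" .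
qed

lemma adjoint_hom_eq:
  assumes "q \<in> topspace (cres C)" "is_adjoint_at h \<phi> q w u"
  shows "adjoint_hom h \<phi> q w = u"
  using is_adjoint_at_unique[OF assms(1) someI[of "is_adjoint_at h \<phi> q w", OF assms(2)] assms(2)]
  by (simp add: adjoint_hom_def)

lemma adjoint_hom:
  assumes f: "diffeo_pair f h" and \<phi>: "bundle_hom_pullback K C f E \<phi>"
    and q: "q \<in> topspace (cres C)" and w: "w \<in> fibre E (h q)"
  shows "is_adjoint_at h \<phi> q w (adjoint_hom h \<phi> q w)"
proof -
  obtain t where t: "t \<in> trivs E" "q \<in> tdom t" using triv_exists q by blast
  obtain \<epsilon> where \<epsilon>: "\<And>j p. j < trank t \<Longrightarrow> p \<in> tdom t \<Longrightarrow> \<epsilon> j p \<in> fibre E p"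
    "\<And>p v. p \<in> tdom t \<Longrightarrow> v \<in> fibre E p \<Longrightarrow>
      v = (\<lambda>i. \<Sum>j<trank t. (fmetric E p v (\<epsilon> j p) / of_real (nsq p (\<epsilon> j p))) * \<epsilon> j p i)"
    by (rule orthogonal_frame[OF t(1)]) (use that in blast)
  have "is_adjoint_at h \<phi> q w (\<lambda>i. \<Sum>j<trank t.
      (fmetric E (h q) w (\<phi> (h q) (\<epsilon> j q)) / of_real (nsq q (\<epsilon> j q))) * \<epsilon> j q i)"
    by (rule is_adjoint_at_frame[OF f \<phi> t w \<epsilon>(1)[OF _ t(2)] \<epsilon>(2)[OF t(2)]])
  then show ?thesis unfolding adjoint_hom_def by (rule someI[of "is_adjoint_at h \<phi> q w"])
qed

lemma adjoint_hom_metric: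
  assumes f: "diffeo_pair f h" and \<phi>: "bundle_hom_pullback K C f E \<phi>"
    and p: "p \<in> topspace (cres C)" and v: "v \<in> fibre E (f p)" and w: "w \<in> fibre E p"
  shows "fmetric E p (\<phi> p v) w = fmetric E (f p) v (adjoint_hom h \<phi> (f p) w)"
  using adjoint_hom[OF f \<phi> diffeo_pair_in[OF f p], of w] v w
  by (simp add: diffeo_pair_inv[OF f p] is_adjoint_at_def)

text \<open>Linearity follows from uniqueness.  For smoothness, the formula in a smooth orthogonal frame over the
  target is expressed by the component functions of the metric, of \<open>\<phi>\<close> and of the frame.\<close>

lemma adjoint_hom_pullback:
  assumes f: "diffeo_pair f h" and \<phi>: "bundle_hom_pullback K C f E \<phi>"
  shows "bundle_hom_pullback K C h E (adjoint_hom h \<phi>)"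
  unfolding bundle_hom_pullback_def
proof (intro conjI ballI)
  note h = diffeo_pair_sym[OF f]
  fix q assume q: "q \<in> topspace (cres C)"
  note hq = diffeo_pair_in[OF h q]
  note adj = adjoint_hom[OF f \<phi> q, unfolded is_adjoint_at_def]
  have fib: "adjoint_hom h \<phi> q w \<in> fibre E q" if "w \<in> fibre E (h q)" for w
    using adj[OF that] by blast
  then show "adjoint_hom h \<phi> q ` fibre E (h q) \<subseteq> fibre E q" by blast
  have \<phi>f: "\<phi> (h q) v \<in> fibre E (h q)" if "v \<in> fibre E q" for v
    using bundle_hom_fibre[OF \<phi> hq] that by (simp add: diffeo_pair_inv[OF h q])
  show "K_linear_on K (fibre E (h q)) (adjoint_hom h \<phi> q)"
    unfolding K_linear_on_def
  proof (intro conjI ballI)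
    fix v w assume v: "v \<in> fibre E (h q)" and w: "w \<in> fibre E (h q)"
    show "adjoint_hom h \<phi> q (\<lambda>j. v j + w j) = (\<lambda>j. adjoint_hom h \<phi> q v j + adjoint_hom h \<phi> q w j)"
      by (rule adjoint_hom_eq[OF q])
        (use adj v w in \<open>auto simp: is_adjoint_at_def fibre_add q metric_add_right hq \<phi>f\<close>)
  next
    fix a v assume "a \<in> K" and v: "v \<in> fibre E (h q)"
    then show "adjoint_hom h \<phi> q (\<lambda>j. a * v j) = (\<lambda>j. a * adjoint_hom h \<phi> q v j)"
      by (intro adjoint_hom_eq[OF q])
        (use adj v in \<open>auto simp: is_adjoint_at_def fibre_scale q metric_scale_right hq \<phi>f\<close>)
  qed
next
  note h = diffeo_pair_sym[OF f]
  fix t t' assume t: "t \<in> trivs E" and t': "t' \<in> trivs E"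
  let ?k = "trank t" and ?k' = "trank t'"
  note ts' = subsetD[OF triv_subset[OF t']]
  obtain \<epsilon> where \<epsilon>: "\<And>j p. j < ?k' \<Longrightarrow> p \<in> tdom t' \<Longrightarrow> \<epsilon> j p \<in> fibre E p"
    "\<And>j p. j < ?k' \<Longrightarrow> p \<in> tdom t' \<Longrightarrow> 0 < nsq p (\<epsilon> j p)"
    "\<And>j l. j < ?k' \<Longrightarrow> smooth_fun (catlas C) (tdom t') (\<lambda>p. tmap t' p (\<epsilon> j p) l)"
    "\<And>p v. p \<in> tdom t' \<Longrightarrow> v \<in> fibre E p \<Longrightarrow>
      v = (\<lambda>i. \<Sum>j<?k'. (fmetric E p v (\<epsilon> j p) / of_real (nsq p (\<epsilon> j p))) * \<epsilon> j p i)"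
    by (rule orthogonal_frame[OF t']) (use that in blast)
  obtain H where H: "\<And>l j. smooth_fun (catlas C) (tdom t) (H l j)"
    "\<And>p v w. p \<in> tdom t \<Longrightarrow> v \<in> fibre E p \<Longrightarrow> w \<in> fibre E p \<Longrightarrow> fmetric E p v w =
        (\<Sum>l<?k. \<Sum>j<?k. H l j p * tmap t p v l * cnj (tmap t p w j))"
    using metric_coord[OF t] by blast
  obtain m where m: "\<And>l j. smooth_fun (catlas C) (f -` tdom t' \<inter> tdom t) (m l j)"
    "\<And>p v l. p \<in> f -` tdom t' \<Longrightarrow> p \<in> tdom t \<Longrightarrow> v \<in> fibre E (f p) \<Longrightarrow> l < ?k \<Longrightarrow>
        tmap t p (\<phi> p v) l = (\<Sum>j<?k'. m l j p * tmap t' (f p) v j)"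
    using bundle_hom_coord[OF \<phi> t' t] by blast
  let ?W = "h -` tdom t \<inter> tdom t'"
  have W: "h p \<in> topspace (cres C)" "f (h p) = p" "h p \<in> tdom t" "p \<in> tdom t'" "p \<in> topspace (cres C)"
    if "p \<in> ?W" for p
  proof -
    show "h p \<in> tdom t" "p \<in> tdom t'" using that by auto
    then show ps: "p \<in> topspace (cres C)" using ts' by blast
    show "h p \<in> topspace (cres C)" "f (h p) = p"
      using diffeo_pair_in[OF h ps] diffeo_pair_inv[OF h ps] by auto
  qed
  define N where "N = (\<lambda>i p. fmetric E p (\<epsilon> i p) (\<epsilon> i p))"
  \<comment> \<open>\<open>x b i\<close> are the coordinates of \<open>\<phi> \<epsilon>\<^sub>i\<close>, and \<open>y a i\<close> are the coefficients of the linear form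
    \<open>w \<mapsto> \<langle>w, \<phi> \<epsilon>\<^sub>i\<rangle>\<close>; together they give the matrix \<open>M\<close> of the adjoint.\<close>
  define x where "x = (\<lambda>b i p. \<Sum>c<?k'. m b c (h p) * tmap t' p (\<epsilon> i p) c)"
  define y where "y = (\<lambda>a i p. \<Sum>b<?k. H a b (h p) * cnj (x b i p))"
  define M where "M = (\<lambda>l a p. \<Sum>i<?k'. y a i p / N i p * tmap t' p (\<epsilon> i p) l)"
  have N: "N i p = of_real (nsq p (\<epsilon> i p))" if "i < ?k'" "p \<in> ?W" for i p
    unfolding N_def using metric_self[OF W(5) \<epsilon>(1)] that by simp
  have H_sm: "smooth_fun (catlas C) ?W (\<lambda>p. H a b (h p))" for a b
    by (rule smooth_fun_subset[OF smooth_fun_pullback[OF diffeo_pair_smooth[OF h] H(1)]]) auto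
  have m_sm: "smooth_fun (catlas C) ?W (\<lambda>p. m b c (h p))" for b c
  proof (rule smooth_fun_subset[OF smooth_fun_pullback[OF diffeo_pair_smooth[OF h] m(1)]], rule subsetI)
    fix p assume p: "p \<in> ?W"
    show "p \<in> h -` (f -` tdom t' \<inter> tdom t)" using W(2,3,4)[OF p] by simp
  qed
  have \<epsilon>_sm: "smooth_fun (catlas C) ?W (\<lambda>p. tmap t' p (\<epsilon> i p) l)" if "i < ?k'" for i l
    by (rule smooth_fun_subset[OF \<epsilon>(3)[OF that]]) auto
  have N_sm: "smooth_fun (catlas C) ?W (N i)" if "i < ?k'" for i
    unfolding N_def using that by (intro metric_smooth[OF t' _ \<epsilon>(1) \<epsilon>_sm \<epsilon>(1) \<epsilon>_sm]) auto
  have N_nz: "N i p \<noteq> 0" if "i < ?k'" "p \<in> ?W" for i p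
    using N[OF that] \<epsilon>(2)[OF that(1) W(4)[OF that(2)]] by simp
  have M_sm: "smooth_fun (catlas C) ?W (M l a)" for l a
    unfolding M_def y_def x_def
  proof (intro smooth_fun_sum smooth_fun_mult smooth_fun_divide smooth_fun_cnj H_sm m_sm \<epsilon>_sm N_sm)
    show "N i p \<noteq> 0" if "i \<in> {..<?k'}" "p \<in> ?W" for i p using that by (intro N_nz) simp
  qed simp_all
  have "tmap t' p (adjoint_hom h \<phi> p w) l = (\<Sum>a<?k. M l a p * tmap t (h p) w a)"
    if p: "p \<in> ?W" and w: "w \<in> fibre E (h p)" for p w l
  proof -
    have \<phi>\<epsilon>: "\<phi> (h p) (\<epsilon> i p) \<in> fibre E (h p)" if "i < ?k'" for i
      using bundle_hom_fibre[OF \<phi> W(1)[OF p]] W(2)[OF p] \<epsilon>(1)[OF that W(4)[OF p]] by simp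
    have x: "tmap t (h p) (\<phi> (h p) (\<epsilon> i p)) b = x b i p" if "i < ?k'" "b < ?k" for i b
      using m(2)[of "h p" "\<epsilon> i p" b] W[OF p] \<epsilon>(1) that by (simp add: x_def)
    define c where "c = (\<lambda>i. fmetric E (h p) w (\<phi> (h p) (\<epsilon> i p)) / of_real (nsq p (\<epsilon> i p)))"
    have "adjoint_hom h \<phi> p w = (\<lambda>j. \<Sum>i<?k'. c i * \<epsilon> i p j)"
      unfolding c_def
      by (rule adjoint_hom_eq[OF W(5)[OF p] is_adjoint_at_frame[OF f \<phi> t' W(4)[OF p] w
            \<epsilon>(1)[OF _ W(4)[OF p]] \<epsilon>(4)[OF W(4)[OF p]]]])
    moreover have "c i \<in> K" if "i < ?k'" for i
      unfolding c_def by (intro K_divide metric_K K_of_real W(1)[OF p] w \<phi>\<epsilon> that)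
    then have "tmap t' p (\<lambda>j. \<Sum>i<?k'. c i * \<epsilon> i p j) = (\<lambda>j. \<Sum>i<?k'. c i * tmap t' p (\<epsilon> i p) j)"
      by (intro triv_sum t' W(4)[OF p] \<epsilon>(1)) auto
    ultimately have "tmap t' p (adjoint_hom h \<phi> p w) l = (\<Sum>i<?k'. c i * tmap t' p (\<epsilon> i p) l)"
      by simp
    also have "\<dots> = (\<Sum>i<?k'. \<Sum>a<?k. y a i p / N i p * tmap t' p (\<epsilon> i p) l * tmap t (h p) w a)"
    proof (rule sum.cong)
      fix i assume "i \<in> {..<?k'}"
      then have i: "i < ?k'" by simp
      have "fmetric E (h p) w (\<phi> (h p) (\<epsilon> i p)) = (\<Sum>a<?k. \<Sum>b<?k. H a b (h p) * tmap t (h p) w a * cnj (x b i p))"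
        by (subst H(2)[OF W(3)[OF p] w \<phi>\<epsilon>[OF i]]) (simp add: x i)
      also have "\<dots> = (\<Sum>a<?k. y a i p * tmap t (h p) w a)"
        unfolding y_def sum_distrib_right by (intro sum.cong) auto
      finally show "c i * tmap t' p (\<epsilon> i p) l =
          (\<Sum>a<?k. y a i p / N i p * tmap t' p (\<epsilon> i p) l * tmap t (h p) w a)"
        by (simp add: c_def N[OF i p] sum_divide_distrib sum_distrib_left sum_distrib_right mult_ac)
    qed simp
    also have "\<dots> = (\<Sum>a<?k. M l a p * tmap t (h p) w a)"
      unfolding M_def by (subst sum.swap) (simp add: sum_distrib_right)
    finally show ?thesis .
  qed
  then show "\<exists>m :: nat \<Rightarrow> nat \<Rightarrow> 'p \<Rightarrow> complex. (\<forall>l j. smooth_fun (catlas C) ?W (m l j)) \<and>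
      (\<forall>p\<in>?W. \<forall>v\<in>fibre E (h p). \<forall>l<?k'.
        tmap t' p (adjoint_hom h \<phi> p v) l = (\<Sum>j<?k. m l j p * tmap t (h p) v j))"
    using M_sm by (intro exI[of _ M]) simp
qed

end

section \<open>Determinants and change of variables\<close>

lemma det_nth: "det M = (\<Sum>\<sigma> | \<sigma> permutes UNIV. of_int (sign \<sigma>) * (\<Prod>i\<in>UNIV. M $ i $ \<sigma> i))"
  by (simp add: det_def)

lemma smooth_on_det:
  fixes M :: "real^'m \<Rightarrow> real^'n^'n"
  assumes "\<And>i j. smooth_on S (\<lambda>x. M x $ i $ j)"
  shows "smooth_on S (\<lambda>x. det (M x))"
  unfolding det_nth by (intro smooth_on_sum smooth_on_mult smooth_on_const smooth_on_prod assms)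

lemma abs_det_le:
  fixes M :: "real^'n^'n"
  assumes "\<And>i j. \<bar>M $ i $ j\<bar> \<le> b"
  shows "\<bar>det M\<bar> \<le> fact CARD('n) * b ^ CARD('n)"
proof -
  have "\<bar>det M\<bar> \<le> (\<Sum>\<sigma> | \<sigma> permutes (UNIV :: 'n set). \<bar>of_int (sign \<sigma>) * (\<Prod>i\<in>UNIV. M $ i $ \<sigma> i)\<bar>)"
    unfolding det_nth by (rule sum_abs)
  also have "\<dots> \<le> (\<Sum>\<sigma> | \<sigma> permutes (UNIV :: 'n set). b ^ CARD('n))"
  proof (rule sum_mono)
    fix \<sigma> :: "'n \<Rightarrow> 'n"
    have "\<bar>of_int (sign \<sigma>) :: real\<bar> = 1" by (simp add: sign_def)
    moreover have "\<bar>\<Prod>i\<in>UNIV. M $ i $ \<sigma> i\<bar> \<le> (\<Prod>i\<in>(UNIV :: 'n set). b)"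
      unfolding abs_prod by (intro prod_mono conjI assms) auto
    ultimately show "\<bar>of_int (sign \<sigma>) * (\<Prod>i\<in>UNIV. M $ i $ \<sigma> i)\<bar> \<le> b ^ CARD('n)"
      by (simp add: abs_mult)
  qed
  also have "\<dots> = fact CARD('n) * b ^ CARD('n)"
    by (simp add: card_permutations[OF refl finite])
  finally show ?thesis .
qed

text \<open>The segment from the identity to a positive definite matrix consists of positive definite,
  hence invertible matrices, so the determinant cannot change its sign along it.\<close>

lemma positive_definite_det_pos:
  fixes M :: "real^'n^'n"
  assumes "\<And>v. v \<noteq> 0 \<Longrightarrow> 0 < v \<bullet> (M *v v)"
  shows "0 < det M"
proof (rule ccontr)
  assume neg: "\<not> 0 < det M"
  define A where "A = (\<lambda>t::real. (1 - t) *\<^sub>R mat 1 + t *\<^sub>R M)"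
  have "continuous_on {0..1} (\<lambda>t. det (A t))"
    unfolding det_nth A_def by (intro continuous_intros)
  moreover have "det (A 1) \<le> 0" "0 \<le> det (A 0)" using neg by (simp_all add: A_def)
  ultimately obtain t where t: "0 \<le> t" "t \<le> 1" "det (A t) = 0"
    using IVT2'[of "\<lambda>t. det (A t)" 1 0 0] by auto
  then have "\<not> invertible (A t)" by (simp add: invertible_det_nz)
  then obtain v where v: "v \<noteq> 0" "A t *v v = 0"
    using matrix_left_invertible_ker[of "A t"] invertible_left_inverse[of "A t"] by blast
  have "v \<bullet> (A t *v v) = (1 - t) * (v \<bullet> v) + t * (v \<bullet> (M *v v))"
    by (simp add: A_def matrix_vector_mult_add_rdistrib scaleR_matrix_vector_assoc[symmetric] inner_add_right)
  moreover have "0 < v \<bullet> v" "0 < v \<bullet> (M *v v)" using v(1) assms by simp_all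
  then have "0 < (1 - t) * (v \<bullet> v) + t * (v \<bullet> (M *v v))"
    using t by (cases "t = 0") (auto intro: add_nonneg_pos)
  ultimately show False using v(2) by simp
qed

text \<open>A bridge to the change of variables theorem, which speaks of absolutely integrable functions instead
  of nonnegative ones.\<close>

lemma nn_integral_eq_iff_absolutely_integrable:
  fixes \<phi> :: "'a::euclidean_space \<Rightarrow> real"
  assumes m: "set_borel_measurable borel S \<phi>" and nonneg: "\<And>x. x \<in> S \<Longrightarrow> 0 \<le> \<phi> x"
  shows "(0 \<le> b \<and> (\<integral>\<^sup>+x\<in>S. \<phi> x \<partial>lborel) = ennreal b) \<longleftrightarrow>
    (\<phi> absolutely_integrable_on S \<and> integral S \<phi> = b)"
proof
  assume *: "0 \<le> b \<and> (\<integral>\<^sup>+x\<in>S. \<phi> x \<partial>lborel) = ennreal b"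
  have "(\<integral>\<^sup>+x. ennreal (indicator S x * \<phi> x) \<partial>lborel) = (\<integral>\<^sup>+x\<in>S. \<phi> x \<partial>lborel)"
    by (intro nn_integral_cong) (auto simp: indicator_def)
  then have "integrable lborel (\<lambda>x. indicator S x * \<phi> x)"
    using m nonneg * by (intro integrableI_nonneg) (auto simp: set_borel_measurable_def indicator_def)
  then have "\<phi> absolutely_integrable_on S"
    using m by (simp add: set_integrable_def set_borel_measurable_def integrable_completion)
  moreover have "(\<integral>\<^sup>+x\<in>S. \<phi> x \<partial>lborel) = integral S \<phi>"
    by (rule set_nn_integral_lborel_eq_integral[OF m nonneg]) (use * in auto)
  then have "integral S \<phi> = b"
    using * integral_nonneg[of \<phi> S] nonneg by (metis ennreal_inj not_integrable_integral order_refl)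
  ultimately show "\<phi> absolutely_integrable_on S \<and> integral S \<phi> = b" ..
next
  assume *: "\<phi> absolutely_integrable_on S \<and> integral S \<phi> = b"
  then have hi: "(\<phi> has_integral b) S"
    using set_lebesgue_integral_eq_integral(1) by blast
  then show "0 \<le> b \<and> (\<integral>\<^sup>+x\<in>S. \<phi> x \<partial>lborel) = ennreal b"
    using nn_integral_has_integral_lebesgue'[OF nonneg hi] has_integral_nonneg[OF hi nonneg] by simp
qed

text \<open>For nonnegative integrands the formula also holds when both sides are infinite: every finite value of
  one side is the value of the other.\<close>

lemma nn_integral_change_of_variables:
  fixes F :: "real^'n::{finite,wellorder} \<Rightarrow> real^'n::_" and \<phi> :: "real^'n::_ \<Rightarrow> real"
  assumes S: "S \<in> sets borel" and D: "\<And>x. x \<in> S \<Longrightarrow> (F has_derivative F' x) (at x within S)"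
    and inj: "inj_on F S" and nonneg: "\<And>y. y \<in> F ` S \<Longrightarrow> 0 \<le> \<phi> y"
    and m: "set_borel_measurable borel (F ` S) \<phi>"
      "set_borel_measurable borel S (\<lambda>x. \<bar>det (matrix (F' x))\<bar> * \<phi> (F x))"
  shows "(\<integral>\<^sup>+y\<in>F ` S. \<phi> y \<partial>lborel) = (\<integral>\<^sup>+x\<in>S. \<bar>det (matrix (F' x))\<bar> * \<phi> (F x) \<partial>lborel)"
    (is "?L = ?R")
proof -
  have "S \<in> sets lebesgue" using S by simp
  note cv = has_absolute_integral_change_of_variables[OF this D inj, of "\<lambda>y. vec (\<phi> y) :: real^1"]
  have iff: "((\<lambda>x. \<bar>det (matrix (F' x))\<bar> * \<phi> (F x)) absolutely_integrable_on S \<and>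
      integral S (\<lambda>x. \<bar>det (matrix (F' x))\<bar> * \<phi> (F x)) = b) \<longleftrightarrow>
    (\<phi> absolutely_integrable_on F ` S \<and> integral (F ` S) \<phi> = b)" for b
    using cv[of "vec b"] unfolding absolutely_integrable_on_1_iff integral_on_1_eq
    by (simp add: vec_eq_iff)
  have LR: "(0 \<le> b \<and> ?R = ennreal b) \<longleftrightarrow> (0 \<le> b \<and> ?L = ennreal b)" for b
    using iff nn_integral_eq_iff_absolutely_integrable[OF m(1) nonneg, of b]
      nn_integral_eq_iff_absolutely_integrable[OF m(2), of b] nonneg by simp
  show ?thesis
  proof (cases ?L)
    case (real r)
    then show ?thesis using LR[of r] by simp
  next
    case top
    then show ?thesis using LR by (cases ?R) auto
  qed
qed

text \<open>Measures that agree on the measurable subsets of countably many sets covering the space are equal,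
  since the cover can be made disjoint.\<close>

lemma measure_eqI_countable_cover:
  assumes sets: "sets M = sets N"
    and V: "\<And>i::nat. V i \<in> sets M" "(\<Union>i. V i) = space M"
    and eq: "\<And>i A. A \<in> sets M \<Longrightarrow> A \<subseteq> V i \<Longrightarrow> emeasure M A = emeasure N A"
  shows "M = N"
proof (rule measure_eqI[OF sets])
  fix A assume A: "A \<in> sets M"
  define B where "B = (\<lambda>i. A \<inter> disjointed V i)"
  have "range (disjointed V) \<subseteq> sets M" using V(1) by (intro sets.range_disjointed_sets) auto
  then have B: "range B \<subseteq> sets M" unfolding B_def using A by auto
  have dB: "disjoint_family B"
    using disjoint_family_disjointed[of V] unfolding B_def disjoint_family_on_def by blast
  have UB: "(\<Union>i. B i) = A"
    unfolding B_def using UN_disjointed_eq[of V] V(2) sets.sets_into_space[OF A] by auto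
  have "emeasure M (B i) = emeasure N (B i)" for i
    using eq[of "B i" i] B disjointed_subset[of V i] by (auto simp: B_def)
  then show "emeasure M A = emeasure N A"
    using suminf_emeasure[OF B dB] suminf_emeasure[of B N] B dB sets UB by simp
qed

section \<open>The Riemannian volume\<close>

context conical_mfd
begin

lemma smooth_fun_det:
  fixes M :: "'p \<Rightarrow> real^'m^'m"
  assumes "\<And>i j. smooth_fun (catlas C) W (\<lambda>p. M p $ i $ j)"
  shows "smooth_fun (catlas C) W (\<lambda>p. det (M p))"
  unfolding smooth_fun_def o_def
proof
  fix c assume "c \<in> catlas C"
  then show "smooth_on (snd c ` (fst c \<inter> W)) (\<lambda>x. det (M (chart_inv c x)))"
    using assms by (intro smooth_on_det) (simp add: smooth_fun_def o_def)
qed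

text \<open>Second countability reduces statements about open sets to countably many small pieces, of any kind
  \<open>Q\<close> that is available locally.\<close>

lemma countable_open_cover:
  assumes W: "openin (cres C) W"
    and local: "\<And>p. p \<in> W \<Longrightarrow> \<exists>V. openin (cres C) V \<and> p \<in> V \<and> V \<subseteq> W \<and> Q V" and "Q {}"
  obtains V :: "nat \<Rightarrow> 'p set" where "\<And>i. openin (cres C) (V i)" "\<And>i. V i \<subseteq> W" "\<And>i. Q (V i)"
    "(\<Union>i. V i) = W"
proof -
  have "second_countable (cres C)" using manifold_res by (simp add: manifold_def)
  then have L: "Lindelof_space (subtopology (cres C) (W))"
    by (intro second_countable_imp_Lindelof_space second_countable_subtopology)
  define \<U> where "\<U> = {V. openin (cres C) V \<and> V \<subseteq> W \<and> Q V}"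
  have "openin (subtopology (cres C) (W)) U" if "U \<in> \<U>" for U
    using that by (auto simp: \<U>_def openin_open_subtopology[OF W])
  moreover have "\<Union>\<U> = topspace (subtopology (cres C) (W))"
  proof
    show "\<Union>\<U> \<subseteq> topspace (subtopology (cres C) (W))"
      using openin_subset[OF W] by (auto simp: \<U>_def)
    show "topspace (subtopology (cres C) (W)) \<subseteq> \<Union>\<U>"
    proof
      fix p assume "p \<in> topspace (subtopology (cres C) (W))"
      then have "p \<in> W" by simp
      from local[OF this] show "p \<in> \<Union>\<U>" by (auto simp: \<U>_def)
    qed
  qed
  ultimately obtain \<V> where \<V>: "countable \<V>" "\<V> \<subseteq> \<U>" "\<Union>\<V> = topspace (subtopology (cres C) (W))"
    using Lindelof_spaceD[OF L, of \<U>] by auto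
  define \<X> where "\<X> = insert {} \<V>"
  have "countable \<X>" "\<X> \<noteq> {}" "\<X> \<subseteq> \<U>"
    using \<V> \<open>Q {}\<close> by (auto simp: \<X>_def \<U>_def)
  moreover have "\<Union>\<X> = W"
    using \<V>(3) openin_subset[OF W] by (auto simp: \<X>_def)
  ultimately have "from_nat_into \<X> i \<in> \<U>" "(\<Union>i. from_nat_into \<X> i) = W" for i
    using from_nat_into[of \<X>] range_from_nat_into[of \<X>] by auto
  then show ?thesis using that[of "from_nat_into \<X>"] by (auto simp: \<U>_def)
qed

text \<open>The Jacobi matrix is meaningful over the interior only, where the chart image is open.\<close>

definition jac :: "('p \<Rightarrow> 'p) \<Rightarrow> ('p, 'n) chart \<Rightarrow> ('p, 'n) chart \<Rightarrow> 'p \<Rightarrow> 'n rmat"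
  where "jac a c d p = matrix (frechet_derivative (snd d \<circ> a \<circ> chart_inv c) (at (snd c p)))"

lemma jacobian_eq_jac: "jacobian c d p = jac id c d p"
  by (simp add: jacobian_def jac_def)

lemma diffeo_pair_id: "diffeo_pair id id"
proof -
  have "smooth_map (cres C) (catlas C) (cres C) (catlas C) id"
    unfolding smooth_map_def using chart_compatible by auto
  then show ?thesis by (simp add: diffeo_pair_def homeomorphic_maps_def)
qed

definition repr_domain :: "('p \<Rightarrow> 'p) \<Rightarrow> ('p, 'n) chart \<Rightarrow> ('p, 'n) chart \<Rightarrow> 'p set"
  where "repr_domain a c d = fst c \<inter> (a -` fst d \<inter> topspace (cres C)) \<inter> cint C"

lemma repr_domain:
  assumes a: "diffeo_pair a b" and c: "c \<in> catlas C" and d: "d \<in> catlas C"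
  shows repr_domain_openin: "openin (cres C) (repr_domain a c d)"
    and repr_domain_open: "open (snd c ` repr_domain a c d)"
    and repr_domain_smooth: "smooth_on (snd c ` repr_domain a c d) (snd d \<circ> a \<circ> chart_inv c)"
proof -
  show o: "openin (cres C) (repr_domain a c d)"
    unfolding repr_domain_def
    by (intro openin_Int chart_openin c d vimage_openin diffeo_pair_continuous[OF a] cint_openin)
  show "open (snd c ` repr_domain a c d)"
    by (rule chart_image_open[OF c o]) (auto simp: repr_domain_def)
  have "smooth_on (snd c ` (fst c \<inter> a -` fst d)) (snd d \<circ> a \<circ> chart_inv c)"
    using diffeo_pair_smooth[OF a] c d by (simp add: smooth_map_def)
  then show "smooth_on (snd c ` repr_domain a c d) (snd d \<circ> a \<circ> chart_inv c)"
    by (rule smooth_on_subset) (auto simp: repr_domain_def)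
qed

lemma jac_has_derivative:
  assumes a: "diffeo_pair a b" and c: "c \<in> catlas C" and d: "d \<in> catlas C" and p: "p \<in> repr_domain a c d"
  shows "((snd d \<circ> a \<circ> chart_inv c) has_derivative (\<lambda>v. jac a c d p *v v)) (at (snd c p))"
proof -
  let ?F = "snd d \<circ> a \<circ> chart_inv c"
  have D: "(?F has_derivative frechet_derivative ?F (at (snd c p))) (at (snd c p))"
    using smooth_on_has_derivative[OF repr_domain_open[OF a c d] repr_domain_smooth[OF a c d]] p by blast
  then have "linear (frechet_derivative ?F (at (snd c p)))" by (rule has_derivative_linear)
  then have "frechet_derivative ?F (at (snd c p)) = (\<lambda>v. jac a c d p *v v)"
    unfolding jac_def by (simp add: fun_eq_iff matrix_works)
  then show ?thesis using D by simp
qed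

lemma jac_entry:
  assumes "c \<in> catlas C" "p \<in> fst c"
  shows "jac a c d p $ i $ j = pd j (snd d \<circ> a \<circ> chart_inv c) (snd c p) $ i"
  by (simp add: jac_def matrix_def pd_def)

lemma jac_chain:
  assumes a: "diffeo_pair a a'" and b: "diffeo_pair b b'"
    and c: "c \<in> catlas C" and d: "d \<in> catlas C" and e: "e \<in> catlas C"
    and p: "p \<in> cint C" "p \<in> fst c" "a p \<in> fst d" "b (a p) \<in> fst e"
    and e': "\<And>q. q \<in> topspace (cres C) \<Longrightarrow> m q = b (a q)"
  shows "jac m c e p = jac b d e (a p) ** jac a c d p"
proof -
  have ps: "p \<in> topspace (cres C)" using p cint_subset by blast
  have pc: "p \<in> repr_domain a c d" using p ps by (auto simp: repr_domain_def)
  have ap: "a p \<in> repr_domain b d e"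
    using p diffeo_pair_in[OF a ps] diffeo_pair_cint[OF a] by (auto simp: repr_domain_def)
  let ?F = "snd d \<circ> a \<circ> chart_inv c" and ?G = "snd e \<circ> b \<circ> chart_inv d"
  have Fp: "?F (snd c p) = snd d (a p)" using p by (simp add: chart_inv_chart[OF c])
  have "((?G \<circ> ?F) has_derivative (\<lambda>v. jac b d e (a p) *v v) \<circ> (\<lambda>v. jac a c d p *v v)) (at (snd c p))"
    using jac_has_derivative[OF b d e ap]
    by (intro diff_chain_at jac_has_derivative[OF a c d pc]) (simp only: Fp)
  moreover have "(\<lambda>v. jac b d e (a p) *v v) \<circ> (\<lambda>v. jac a c d p *v v) =
      (\<lambda>v. (jac b d e (a p) ** jac a c d p) *v v)"
    by (simp add: o_def matrix_vector_mul_assoc)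
  ultimately have D: "((?G \<circ> ?F) has_derivative (\<lambda>v. (jac b d e (a p) ** jac a c d p) *v v)) (at (snd c p))"
    by simp
  have "((snd e \<circ> m \<circ> chart_inv c) has_derivative (\<lambda>v. (jac b d e (a p) ** jac a c d p) *v v)) (at (snd c p))"
  proof (rule has_derivative_transform_within_open[OF D repr_domain_open[OF a c d]])
    show "snd c p \<in> snd c ` repr_domain a c d" using pc by blast
    show "(?G \<circ> ?F) x = (snd e \<circ> m \<circ> chart_inv c) x" if "x \<in> snd c ` repr_domain a c d" for x
      using that e' by (auto simp: repr_domain_def chart_inv_chart[OF c] chart_inv_chart[OF d])
  qed
  then show ?thesis
    unfolding jac_def[of m] using frechet_derivative_at matrix_of_matrix_vector_mul by metis
qed

lemma jac_id: "c \<in> catlas C \<Longrightarrow> p \<in> fst c \<Longrightarrow> p \<in> cint C \<Longrightarrow> jac id c c p = mat 1"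
proof -
  assume c: "c \<in> catlas C" and p: "p \<in> fst c" "p \<in> cint C"
  have ps: "p \<in> topspace (cres C)" using p cint_subset by blast
  have pc: "p \<in> repr_domain id c c" using p ps by (auto simp: repr_domain_def)
  have "((snd c \<circ> id \<circ> chart_inv c) has_derivative (\<lambda>v. v)) (at (snd c p))"
  proof (rule has_derivative_transform_within_open[OF has_derivative_ident repr_domain_open[OF diffeo_pair_id c c]])
    show "snd c p \<in> snd c ` repr_domain id c c" using pc by blast
    show "x = (snd c \<circ> id \<circ> chart_inv c) x" if "x \<in> snd c ` repr_domain id c c" for x
      using that by (auto simp: repr_domain_def chart_inv_chart[OF c])
  qed
  then have "frechet_derivative (snd c \<circ> id \<circ> chart_inv c) (at (snd c p)) = (\<lambda>v. v)"
    using frechet_derivative_at by metis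
  then show ?thesis unfolding jac_def using matrix_id_mat_1[unfolded id_def] by metis
qed

lemma det_jac_nonzero:
  assumes a: "diffeo_pair a b" and c: "c \<in> catlas C" and d: "d \<in> catlas C"
    and p: "p \<in> cint C" "p \<in> fst c" "a p \<in> fst d"
  shows "det (jac a c d p) \<noteq> 0"
proof -
  have ps: "p \<in> topspace (cres C)" using p cint_subset by blast
  have "jac id c c p = jac b d c (a p) ** jac a c d p"
    by (rule jac_chain[OF a diffeo_pair_sym[OF a] c d c])
      (use p ps in \<open>auto simp: diffeo_pair_inv[OF a]\<close>)
  then have "det (jac b d c (a p)) * det (jac a c d p) = 1"
    using jac_id[OF c p(2,1)] by (metis det_I det_mul)
  then show ?thesis by auto
qed

lemma jac_smooth:
  assumes a: "diffeo_pair a b" and c: "c \<in> catlas C" and d: "d \<in> catlas C"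
  shows "smooth_fun (catlas C) (repr_domain a c d) (\<lambda>p. det (jac a c d p))"
proof (rule smooth_fun_det, rule smooth_fun_of_chart[OF c])
  show sub: "repr_domain a c d \<subseteq> fst c" by (auto simp: repr_domain_def)
  fix i j
  have "smooth_on (snd c ` repr_domain a c d) (\<lambda>x. pd j (snd d \<circ> a \<circ> chart_inv c) x $ i)"
    by (intro smooth_on_linear[OF bounded_linear_vec_nth] smooth_on_pd repr_domain_open[OF a c d] repr_domain_smooth[OF a c d])
  then show "smooth_on (snd c ` repr_domain a c d) (\<lambda>x. jac a c d (chart_inv c x) $ i $ j)"
    by (rule smooth_on_cong) (use sub in \<open>auto simp: chart_inv_chart[OF c] jac_entry[OF c]\<close>)
qed

end

locale volume_mfd = conical_mfd C for C :: "('x, 'l, 'p, 'n::{finite,wellorder}) conical" +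
  fixes g :: "('p, 'n) chart \<Rightarrow> 'p \<Rightarrow> 'n rmat" and vol :: "'p measure"
  assumes conic: "conic_metric C g" and vol: "riemannian_volume C g vol"
begin

lemma riemannian: "riemannian_metric C g"
  using conic by (simp add: conic_metric_def)

lemma riemannianD:
  assumes "c \<in> catlas C"
  shows "smooth_fun (catlas C) (fst c \<inter> cint C) (g c)"
    and "p \<in> fst c \<inter> cint C \<Longrightarrow> v \<noteq> 0 \<Longrightarrow> 0 < v \<bullet> (g c p *v v)"
    and "d \<in> catlas C \<Longrightarrow> p \<in> fst c \<inter> fst d \<inter> cint C \<Longrightarrow>
      g c p = transpose (jacobian c d p) ** g d p ** jacobian c d p"
  using riemannian[unfolded riemannian_metric_def, THEN bspec, OF assms] by blast+

lemma metric_det_pos: "c \<in> catlas C \<Longrightarrow> p \<in> fst c \<Longrightarrow> p \<in> cint C \<Longrightarrow> 0 < det (g c p)"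
  by (intro positive_definite_det_pos riemannianD(2)) simp_all

lemma metric_det_smooth: "c \<in> catlas C \<Longrightarrow> smooth_fun (catlas C) (fst c \<inter> cint C) (\<lambda>p. det (g c p))"
  by (intro smooth_fun_det smooth_fun_nth riemannianD(1))

lemma metric_det_transform:
  assumes "c \<in> catlas C" "d \<in> catlas C" "p \<in> fst c" "p \<in> fst d" "p \<in> cint C"
  shows "det (g c p) = (det (jac id c d p))\<^sup>2 * det (g d p)"
proof -
  have "g c p = transpose (jacobian c d p) ** g d p ** jacobian c d p"
    using assms by (intro riemannianD(3)) simp_all
  then show ?thesis
    by (simp add: det_mul det_transpose jacobian_eq_jac power2_eq_square)
qed

lemma space_vol: "space vol = cint C"
  and sets_vol: "sets vol = sigma_sets (cint C) {W. openin (cres C) W \<and> W \<subseteq> cint C}"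
  and emeasure_vol: "c \<in> catlas C \<Longrightarrow> A \<in> sets vol \<Longrightarrow> A \<subseteq> fst c \<Longrightarrow> emeasure vol A =
    (\<integral>\<^sup>+x. ennreal (sqrt (det (g c (chart_inv c x)))) * indicator (snd c ` A) x \<partial>lborel)"
  using vol unfolding riemannian_volume_def by blast+

lemma openin_sets_vol: "openin (cres C) W \<Longrightarrow> W \<subseteq> cint C \<Longrightarrow> W \<in> sets vol"
  unfolding sets_vol by (rule sigma_sets.Basic) simp

lemma diffeo_measurable:
  assumes f: "diffeo_pair f h"
  shows "f \<in> measurable vol vol"
proof (rule measurable_sigma_sets[OF sets_vol])
  show "f \<in> space vol \<rightarrow> cint C" using diffeo_pair_cint[OF f] by (simp add: space_vol)
  fix W assume "W \<in> {W. openin (cres C) W \<and> W \<subseteq> cint C}"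
  then have "openin (cres C) (f -` W \<inter> topspace (cres C))"
    using vimage_openin[OF diffeo_pair_continuous[OF f]] by blast
  then have "openin (cres C) (f -` W \<inter> topspace (cres C) \<inter> cint C)"
    using cint_openin by blast
  moreover have "f -` W \<inter> topspace (cres C) \<inter> cint C = f -` W \<inter> space vol"
    using cint_subset by (auto simp: space_vol)
  ultimately have "openin (cres C) (f -` W \<inter> space vol)" by simp
  then show "f -` W \<inter> space vol \<in> sets vol" by (rule openin_sets_vol) (auto simp: space_vol)
qed auto

lemma smooth_fun_measurable:
  fixes u :: "'p \<Rightarrow> 'b::real_normed_vector"
  assumes "smooth_fun (catlas C) W u" "openin (cres C) W" "W \<subseteq> cint C"
  shows "u \<in> borel_measurable (restrict_space vol W)"
proof (rule borel_measurableI)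
  fix S :: "'b set" assume "open S"
  then have "openin (cres C) {p \<in> W. u p \<in> S}" by (rule smooth_fun_vimage_openin[OF assms(1,2)])
  then have "{p \<in> W. u p \<in> S} \<in> sets vol" by (rule openin_sets_vol) (use assms(3) in auto)
  moreover have "u -` S \<inter> space (restrict_space vol W) = W \<inter> {p \<in> W. u p \<in> S}"
    using assms(3) by (auto simp: space_restrict_space space_vol)
  ultimately show "u -` S \<inter> space (restrict_space vol W) \<in> sets (restrict_space vol W)"
    by (simp add: sets_restrict_space)
qed

subsection \<open>Integration in a chart\<close>

text \<open>The density of the Riemannian volume in a chart, set to \<open>0\<close> outside the image of the interior, which
  makes it Borel measurable on the whole space.\<close>

definition chart_dens :: "('p, 'n) chart \<Rightarrow> (real, 'n) vec \<Rightarrow> real"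
  where "chart_dens c x = indicator (snd c ` (fst c \<inter> cint C)) x * sqrt (det (g c (chart_inv c x)))"

lemma chart_dens_measurable:
  assumes c: "c \<in> catlas C"
  shows "chart_dens c \<in> borel_measurable borel"
proof -
  have o: "open (snd c ` (fst c \<inter> cint C))"
    by (rule chart_image_open[OF c]) (auto intro!: chart_openin[OF c] cint_openin)
  have "smooth_fun (catlas C) (fst c \<inter> cint C) (\<lambda>p. sqrt (det (g c p)))"
    by (rule smooth_fun_sqrt[OF metric_det_smooth[OF c]]) (use metric_det_pos[OF c] in auto)
  then have "smooth_on (snd c ` (fst c \<inter> (fst c \<inter> cint C))) ((\<lambda>p. sqrt (det (g c p))) \<circ> chart_inv c)"
    using c unfolding smooth_fun_def by blast
  then have "continuous_on (snd c ` (fst c \<inter> cint C)) (\<lambda>x. sqrt (det (g c (chart_inv c x))))"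
    using smooth_on_continuous by (fastforce simp: o_def)
  from borel_measurable_continuous_on_indicator[OF _ this] o show ?thesis
    by (simp add: chart_dens_def[abs_def])
qed

lemma chart_inv_measurable:
  assumes c: "c \<in> catlas C"
  shows "chart_inv c \<in> measurable (restrict_space borel (snd c ` (fst c \<inter> cint C))) vol"
proof (rule measurable_sigma_sets[OF sets_vol])
    show "chart_inv c \<in> space (restrict_space borel (snd c ` (fst c \<inter> cint C))) \<rightarrow> cint C"
      by (auto simp: space_restrict_space chart_inv_chart[OF c])
    fix W assume "W \<in> {W. openin (cres C) W \<and> W \<subseteq> cint C}"
    then have "open (snd c ` (fst c \<inter> W))"
      by (intro chart_image_open[OF c] openin_Int chart_openin[OF c]) auto
    moreover have "chart_inv c -` W \<inter> space (restrict_space borel (snd c ` (fst c \<inter> cint C))) =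
        snd c ` (fst c \<inter> W) \<inter> snd c ` (fst c \<inter> cint C)"
      by (auto simp: space_restrict_space chart_inv_chart[OF c] inj_on_eq_iff[OF chart_inj[OF c]])
    ultimately show "chart_inv c -` W \<inter> space (restrict_space borel (snd c ` (fst c \<inter> cint C))) \<in> sets (restrict_space borel (snd c ` (fst c \<inter> cint C)))"
      unfolding sets_restrict_space
      by (intro image_eqI[where x = "snd c ` (fst c \<inter> W)"]) auto
qed auto

lemma chart_image_borel:
  assumes c: "c \<in> catlas C" and A: "A \<in> sets vol" "A \<subseteq> fst c"
  shows "snd c ` A \<in> sets borel"
proof -
  let ?O = "snd c ` (fst c \<inter> cint C)"
  have o: "open ?O"
    by (rule chart_image_open[OF c]) (auto intro!: chart_openin[OF c] cint_openin)
  from measurable_sets[OF chart_inv_measurable[OF c] A(1)]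
  have "chart_inv c -` A \<inter> ?O \<in> sets (restrict_space borel ?O)"
    by (simp add: space_restrict_space)
  moreover have "chart_inv c -` A \<inter> ?O = snd c ` A"
    using A sets.sets_into_space[OF A(1)] by (auto simp: chart_inv_chart[OF c] space_vol)
  ultimately show ?thesis using o by (auto simp: sets_restrict_space_iff)
qed

text \<open>The Riemannian volume is given on measurable sets.  Over the domain of a chart it therefore is the
  image, under the inverse chart, of Lebesgue measure with density \<open>\<surd>det g\<close>, and this identity of measures
  integrates arbitrary functions.\<close>

lemma nn_integral_chart:
  assumes c: "c \<in> catlas C" and A: "A \<in> sets vol" "A \<subseteq> fst c" and u: "u \<in> borel_measurable vol"
  shows "(\<integral>\<^sup>+p. u p * indicator A p \<partial>vol) =
    (\<integral>\<^sup>+x. u (chart_inv c x) * ennreal (sqrt (det (g c (chart_inv c x)))) * indicator (snd c ` A) x \<partial>lborel)"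
proof -
  let ?V = "fst c \<inter> cint C" and ?\<rho> = "\<lambda>x. ennreal (sqrt (det (g c (chart_inv c x))))"
  let ?O = "snd c ` ?V"
  have V: "?V \<in> sets vol"
    by (rule openin_sets_vol) (auto intro!: chart_openin[OF c] cint_openin)
  have AV: "A \<subseteq> ?V" using A sets.sets_into_space[OF A(1)] by (auto simp: space_vol)
  have o: "open ?O"
    by (rule chart_image_open[OF c]) (auto intro!: chart_openin[OF c] cint_openin)
  define L where "L = restrict_space lborel ?O"
  have spL: "space L = ?O" by (simp add: L_def space_restrict_space)
  have "measurable L vol = measurable (restrict_space borel ?O) vol"
    unfolding L_def by (intro measurable_cong_sets sets_restrict_space_cong) simp_all
  then have \<kappa>: "chart_inv c \<in> measurable L vol"
    using chart_inv_measurable[OF c] by simp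
  have "chart_dens c \<in> borel_measurable L"
    using chart_dens_measurable[OF c] unfolding L_def by (intro measurable_restrict_space1) simp
  then have "(\<lambda>x. ennreal (chart_dens c x)) \<in> borel_measurable L" by measurable
  then have \<rho>: "?\<rho> \<in> borel_measurable L"
    by (rule measurable_cong[THEN iffD1, rotated]) (auto simp: chart_dens_def spL)
  have inj: "x \<in> snd c ` B \<longleftrightarrow> chart_inv c x \<in> B" if "x \<in> ?O" "B \<subseteq> fst c" for x B
    using that by (auto simp: chart_inv_chart[OF c] subset_iff)
  have key: "density vol (indicator ?V) = distr (density L ?\<rho>) vol (chart_inv c)"
  proof (rule measure_eqI)
    fix B assume "B \<in> sets (density vol (indicator ?V))"
    then have B: "B \<in> sets vol" by simp
    have "emeasure (density vol (indicator ?V)) B = emeasure vol (?V \<inter> B)"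
      using B V by (simp add: emeasure_density indicator_inter_arith[symmetric] sets.Int)
    also have "\<dots> = (\<integral>\<^sup>+x. ?\<rho> x * indicator (snd c ` (?V \<inter> B)) x \<partial>lborel)"
      using B V by (intro emeasure_vol[OF c]) auto
    also have "\<dots> = (\<integral>\<^sup>+x. (?\<rho> x * indicator (chart_inv c -` B \<inter> ?O) x) * indicator ?O x \<partial>lborel)"
    proof (intro nn_integral_cong)
      fix x
      have "x \<in> snd c ` (?V \<inter> B) \<longleftrightarrow> x \<in> ?O \<and> chart_inv c x \<in> B"
        by (auto simp: chart_inv_chart[OF c])
      then show "?\<rho> x * indicator (snd c ` (?V \<inter> B)) x = (?\<rho> x * indicator (chart_inv c -` B \<inter> ?O) x) * indicator ?O x"
        by (auto simp: indicator_def)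
    qed
    also have "\<dots> = (\<integral>\<^sup>+x. ?\<rho> x * indicator (chart_inv c -` B \<inter> ?O) x \<partial>L)"
      using o unfolding L_def by (subst nn_integral_restrict_space) auto
    also have "\<dots> = emeasure (density L ?\<rho>) (chart_inv c -` B \<inter> ?O)"
      using measurable_sets[OF \<kappa> B] by (subst emeasure_density[OF \<rho>]) (auto simp: spL)
    also have "\<dots> = emeasure (distr (density L ?\<rho>) vol (chart_inv c)) B"
      using B \<kappa> by (subst emeasure_distr) (auto simp: spL)
    finally show "emeasure (density vol (indicator ?V)) B = emeasure (distr (density L ?\<rho>) vol (chart_inv c)) B" .
  qed simp
  have uA: "(\<lambda>p. u p * indicator A p) \<in> borel_measurable vol" using u A by measurable
  have "(\<integral>\<^sup>+p. u p * indicator A p \<partial>vol) = (\<integral>\<^sup>+p. indicator ?V p * (u p * indicator A p) \<partial>vol)"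
    using AV by (intro nn_integral_cong) (auto simp: indicator_def)
  also have "\<dots> = (\<integral>\<^sup>+p. u p * indicator A p \<partial>density vol (indicator ?V))"
    using V uA by (subst nn_integral_density) auto
  also have "\<dots> = (\<integral>\<^sup>+x. u (chart_inv c x) * indicator A (chart_inv c x) \<partial>density L ?\<rho>)"
    unfolding key using \<kappa> uA by (subst nn_integral_distr) auto
  also have "\<dots> = (\<integral>\<^sup>+x. ?\<rho> x * (u (chart_inv c x) * indicator A (chart_inv c x)) \<partial>L)"
    using measurable_compose[OF \<kappa> uA] \<rho> by (subst nn_integral_density) auto
  also have "\<dots> = (\<integral>\<^sup>+x. (?\<rho> x * (u (chart_inv c x) * indicator A (chart_inv c x))) * indicator ?O x \<partial>lborel)"
    using o unfolding L_def by (subst nn_integral_restrict_space) auto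
  also have "\<dots> = (\<integral>\<^sup>+x. u (chart_inv c x) * ?\<rho> x * indicator (snd c ` A) x \<partial>lborel)"
  proof (intro nn_integral_cong)
    fix x
    have "x \<in> snd c ` A \<longleftrightarrow> x \<in> ?O \<and> chart_inv c x \<in> A"
      using AV by (auto simp: chart_inv_chart[OF c] subset_iff)
    then show "(?\<rho> x * (u (chart_inv c x) * indicator A (chart_inv c x))) * indicator ?O x =
        u (chart_inv c x) * ?\<rho> x * indicator (snd c ` A) x"
      by (auto simp: indicator_def mult_ac)
  qed
  finally show ?thesis .
qed

subsection \<open>The distortion of volume by a diffeomorphism\<close>

text \<open>The Jacobian of \<open>h\<close> with respect to the Riemannian volume on both sides, computed in charts \<open>c\<close> around
  \<open>p\<close> and \<open>d\<close> around \<open>h p\<close>.\<close>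

definition dens_in :: "('p \<Rightarrow> 'p) \<Rightarrow> ('p, 'n) chart \<Rightarrow> ('p, 'n) chart \<Rightarrow> 'p \<Rightarrow> real"
  where "dens_in h c d p = \<bar>det (jac h c d p)\<bar> * sqrt (det (g d (h p))) / sqrt (det (g c p))"

definition dens :: "('p \<Rightarrow> 'p) \<Rightarrow> 'p \<Rightarrow> real"
  where "dens h p = dens_in h (SOME c. c \<in> catlas C \<and> p \<in> fst c) (SOME d. d \<in> catlas C \<and> h p \<in> fst d) p"

text \<open>The transformation law of the metric contributes the determinants of the coordinate changes, which
  cancel those coming from the chain rule.\<close>

lemma dens_in_indep:
  assumes h: "diffeo_pair h f" and c: "c \<in> catlas C" "c' \<in> catlas C" and d: "d \<in> catlas C" "d' \<in> catlas C"
    and p: "p \<in> cint C" "p \<in> fst c" "p \<in> fst c'" "h p \<in> fst d" "h p \<in> fst d'"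
  shows "dens_in h c' d' p = dens_in h c d p"
proof -
  have hp: "h p \<in> cint C" using diffeo_pair_cint[OF h p(1)] .
  have "jac h c' d' p = jac h c d' p ** jac id c' c p"
    using jac_chain[OF diffeo_pair_id h c(2,1) d(2), of p h] p by simp
  moreover have "jac h c d' p = jac id d d' (h p) ** jac h c d p"
    using jac_chain[OF h diffeo_pair_id c(1) d(1) d(2), of p h] p by simp
  ultimately have "\<bar>det (jac h c' d' p)\<bar> =
      \<bar>det (jac id d d' (h p))\<bar> * \<bar>det (jac h c d p)\<bar> * \<bar>det (jac id c' c p)\<bar>"
    by (simp add: det_mul abs_mult)
  moreover have "sqrt (det (g c' p)) = \<bar>det (jac id c' c p)\<bar> * sqrt (det (g c p))"
    using metric_det_transform[OF c(2,1) p(3,2,1)] by (simp add: real_sqrt_mult)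
  moreover have "sqrt (det (g d (h p))) = \<bar>det (jac id d d' (h p))\<bar> * sqrt (det (g d' (h p)))"
    using metric_det_transform[OF d p(4,5) hp] by (simp add: real_sqrt_mult)
  moreover have "\<bar>det (jac id c' c p)\<bar> \<noteq> 0"
    using det_jac_nonzero[OF diffeo_pair_id c(2,1) p(1,3)] p(2) by simp
  ultimately show ?thesis by (simp add: dens_in_def)
qed

lemma dens_eq:
  assumes h: "diffeo_pair h f" and c: "c \<in> catlas C" and d: "d \<in> catlas C"
    and p: "p \<in> cint C" "p \<in> fst c" "h p \<in> fst d"
  shows "dens h p = dens_in h c d p"
proof -
  have "(SOME c. c \<in> catlas C \<and> p \<in> fst c) \<in> catlas C \<and> p \<in> fst (SOME c. c \<in> catlas C \<and> p \<in> fst c)"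
    by (rule someI[of "\<lambda>c. c \<in> catlas C \<and> p \<in> fst c"]) (use c p in simp)
  moreover have "(SOME d. d \<in> catlas C \<and> h p \<in> fst d) \<in> catlas C \<and> h p \<in> fst (SOME d. d \<in> catlas C \<and> h p \<in> fst d)"
    by (rule someI[of "\<lambda>d. d \<in> catlas C \<and> h p \<in> fst d"]) (use d p in simp)
  ultimately show ?thesis
    unfolding dens_def using dens_in_indep[OF h c _ d _ p(1,2) _ p(3)] by blast
qed

lemma chart_at:
  assumes h: "diffeo_pair h f" and p: "p \<in> cint C"
  obtains c d where "c \<in> catlas C" "d \<in> catlas C" "p \<in> repr_domain h c d"
proof -
  have ps: "p \<in> topspace (cres C)" using p cint_subset by blast
  obtain c where "c \<in> catlas C" "p \<in> fst c" using chart_exists[OF ps] by blast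
  moreover obtain d where "d \<in> catlas C" "h p \<in> fst d"
    using chart_exists[OF diffeo_pair_in[OF h ps]] by blast
  ultimately show ?thesis using that p ps by (auto simp: repr_domain_def)
qed

lemma dens_pos:
  assumes h: "diffeo_pair h f" and p: "p \<in> cint C"
  shows "0 < dens h p"
proof -
  obtain c d where c: "c \<in> catlas C" and d: "d \<in> catlas C" and pc: "p \<in> repr_domain h c d"
    by (rule chart_at[OF h p])
  then have p': "p \<in> fst c" "h p \<in> fst d" by (auto simp: repr_domain_def)
  show ?thesis
    unfolding dens_eq[OF h c d p p'] dens_in_def
    using det_jac_nonzero[OF h c d p p'] metric_det_pos[OF c p'(1) p]
      metric_det_pos[OF d p'(2) diffeo_pair_cint[OF h p]] by simp
qed

text \<open>The absolute value of the determinant is written as the square root of its square, which is smooth as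
  the determinant does not vanish.\<close>

lemma dens_smooth:
  assumes h: "diffeo_pair h f"
  shows "smooth_fun (catlas C) (cint C) (dens h)"
proof (rule smooth_fun_local)
  fix p assume p: "p \<in> cint C"
  obtain c d where c: "c \<in> catlas C" and d: "d \<in> catlas C" and pc: "p \<in> repr_domain h c d"
    by (rule chart_at[OF h p])
  let ?W = "repr_domain h c d"
  have W: "q \<in> cint C" "q \<in> fst c" "h q \<in> fst d" "h q \<in> cint C" if "q \<in> ?W" for q
    using that diffeo_pair_cint[OF h] by (auto simp: repr_domain_def)
  have 1: "smooth_fun (catlas C) ?W (\<lambda>q. det (g d (h q)))"
    by (rule smooth_fun_subset[OF smooth_fun_pullback[OF diffeo_pair_smooth[OF h] metric_det_smooth[OF d]]])
      (use W in blast)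
  have 2: "smooth_fun (catlas C) ?W (\<lambda>q. det (g c q))"
    by (rule smooth_fun_subset[OF metric_det_smooth[OF c]]) (use W in blast)
  have pos: "0 < det (g d (h q))" "0 < det (g c q)" "0 < (det (jac h c d q))\<^sup>2" if "q \<in> ?W" for q
    using metric_det_pos[OF c W(2,1)[OF that]] metric_det_pos[OF d W(3,4)[OF that]]
      det_jac_nonzero[OF h c d W(1,2,3)[OF that]] by simp_all
  have "smooth_fun (catlas C) ?W
    (\<lambda>q. sqrt (det (jac h c d q) * det (jac h c d q) * det (g d (h q)) / det (g c q)))"
  proof (rule smooth_fun_sqrt)
    show "smooth_fun (catlas C) ?W (\<lambda>q. det (jac h c d q) * det (jac h c d q) * det (g d (h q)) / det (g c q))"
    proof (intro smooth_fun_divide smooth_fun_mult jac_smooth[OF h c d] 1 2)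
      show "det (g c q) \<noteq> 0" if "q \<in> ?W" for q using pos(2)[OF that] by simp
    qed
    show "0 < det (jac h c d q) * det (jac h c d q) * det (g d (h q)) / det (g c q)" if "q \<in> ?W" for q
      using pos[OF that] by (simp add: power2_eq_square)
  qed
  then have "smooth_fun (catlas C) ?W (dens h)"
  proof (rule smooth_fun_cong)
    fix q assume q: "q \<in> ?W"
    show "sqrt (det (jac h c d q) * det (jac h c d q) * det (g d (h q)) / det (g c q)) = dens h q"
      unfolding dens_eq[OF h c d W(1,2,3)[OF q]] dens_in_def
      by (simp add: real_sqrt_mult real_sqrt_divide)
  qed
  moreover have "cint C \<inter> ?W = ?W" using W by blast
  ultimately show "\<exists>V. openin (cres C) V \<and> p \<in> V \<and> smooth_fun (catlas C) (cint C \<inter> V) (dens h)"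
    using repr_domain_openin[OF h c d] pc by (intro exI[of _ ?W]) simp
qed

lemma smooth_fun_measurable_vol:
  fixes u :: "'p \<Rightarrow> 'b::real_normed_vector"
  assumes "smooth_fun (catlas C) (cint C) u"
  shows "u \<in> borel_measurable vol"
proof -
  have "sets (restrict_space vol (cint C)) = sets vol"
    unfolding sets_restrict_space space_vol[symmetric]
    by (metis (no_types, lifting) image_cong image_ident sets.Int_space_eq1)
  then have "measurable (restrict_space vol (cint C)) (borel :: 'b measure) = measurable vol borel"
    by (rule measurable_cong_sets) simp
  then show ?thesis using smooth_fun_measurable[OF assms cint_openin order_refl] by simp
qed

lemma dens_measurable: "diffeo_pair h f \<Longrightarrow> dens h \<in> borel_measurable vol"
  by (rule smooth_fun_measurable_vol[OF dens_smooth])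

text \<open>The volume of the preimage of \<open>A\<close> under \<open>f\<close> is the volume of \<open>h A\<close>.  For small \<open>A\<close> it is computed by the
  change of variables formula in two charts, and the small sets determine the measure.\<close>

lemma distr_eq_density:
  assumes f: "diffeo_pair f h"
  shows "distr vol vol f = density vol (\<lambda>p. ennreal (dens h p))"
proof -
  note h = diffeo_pair_sym[OF f]
  define Q where "Q = (\<lambda>V. \<exists>c\<in>catlas C. \<exists>d\<in>catlas C. V \<subseteq> repr_domain h c d)"
  have "\<exists>V. openin (cres C) V \<and> p \<in> V \<and> V \<subseteq> cint C \<and> Q V" if p: "p \<in> cint C" for p
  proof -
    obtain c d where c: "c \<in> catlas C" and d: "d \<in> catlas C" and pc: "p \<in> repr_domain h c d"
      by (rule chart_at[OF h p])
    then show ?thesis using repr_domain_openin[OF h c d]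
      by (intro exI[of _ "repr_domain h c d"]) (auto simp: Q_def repr_domain_def)
  qed
  moreover have "Q {}" if "cint C \<noteq> {}"
    using that chart_at[OF h] unfolding Q_def by (metis empty_subsetI ex_in_conv)
  ultimately have ex: "\<exists>V :: nat \<Rightarrow> 'p set. (\<forall>i. openin (cres C) (V i)) \<and> (\<forall>i. V i \<subseteq> cint C) \<and>
      (\<forall>i. Q (V i)) \<and> (\<Union>i. V i) = cint C" if "cint C \<noteq> {}"
    using countable_open_cover[OF cint_openin, of Q] that by metis
  show ?thesis
  proof (cases "cint C = {}")
    case True
    then have sp: "space vol = {}" by (simp add: space_vol)
    show ?thesis
    proof (rule measure_eqI)
      fix A assume "A \<in> sets (distr vol vol f)"
      then have "A = {}" using sets.sets_into_space[of A vol] sp by auto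
      then show "emeasure (distr vol vol f) A = emeasure (density vol (\<lambda>p. ennreal (dens h p))) A" by simp
    qed simp
  next
    case False
    then obtain V :: "nat \<Rightarrow> 'p set" where V: "\<forall>i. openin (cres C) (V i)" "\<forall>i. V i \<subseteq> cint C"
      "\<forall>i. Q (V i)" "(\<Union>i. V i) = cint C" using ex by blast
    show ?thesis
    proof (rule measure_eqI_countable_cover[of _ _ V])
      show "V i \<in> sets (distr vol vol f)" for i using V openin_sets_vol by simp
      show "(\<Union>i. V i) = space (distr vol vol f)" using V(4) by (simp add: space_vol)
      fix i A assume "A \<in> sets (distr vol vol f)" and AV: "A \<subseteq> V i"
      then have A: "A \<in> sets vol" by simp
      obtain c d where c: "c \<in> catlas C" and d: "d \<in> catlas C" and "V i \<subseteq> repr_domain h c d"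
        using V(3) unfolding Q_def by blast
      then have W: "p \<in> repr_domain h c d" "p \<in> cint C" "p \<in> topspace (cres C)" "p \<in> fst c" "h p \<in> fst d" "h p \<in> cint C" if "p \<in> A" for p
        using that AV diffeo_pair_cint[OF h] by (auto simp: repr_domain_def)
      let ?F = "snd d \<circ> h \<circ> chart_inv c"
      define S where "S = snd c ` A"
      have S: "S \<in> sets borel" unfolding S_def by (rule chart_image_borel[OF c A]) (use W in blast)
      have hA: "f -` A \<inter> space vol = h ` A"
        using W diffeo_pair_inv[OF f] diffeo_pair_inv[OF h] cint_subset
        by (auto simp: space_vol image_iff) (metis subsetD)
      then have hA_sets: "h ` A \<in> sets vol"
        using measurable_sets[OF diffeo_measurable[OF f] A] by simp
      have FS: "?F ` S = snd d ` h ` A"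
        unfolding S_def image_image by (rule image_cong) (auto simp: chart_inv_chart[OF c] W)
      have FS_borel: "?F ` S \<in> sets borel"
        unfolding FS by (rule chart_image_borel[OF d hA_sets]) (use W in blast)
      let ?\<phi> = "\<lambda>y. sqrt (det (g d (chart_inv d y)))"
      have m1: "set_borel_measurable borel (?F ` S) ?\<phi>"
      proof -
        have "(\<lambda>y. indicator (?F ` S) y * chart_dens d y) \<in> borel_measurable borel"
          using chart_dens_measurable[OF d] FS_borel by measurable
        moreover have "(\<lambda>y. indicator (?F ` S) y * chart_dens d y) = (\<lambda>y. indicator (?F ` S) y *\<^sub>R ?\<phi> y)"
          unfolding FS chart_dens_def using W by (auto simp: indicator_def fun_eq_iff)
        ultimately show ?thesis unfolding set_borel_measurable_def by simp
      qed
      have eq: "\<bar>det (jac h c d p)\<bar> * sqrt (det (g d (h p))) = dens h p * sqrt (det (g c p))" if "p \<in> A" for p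
      proof -
        have "0 < det (g c p)" using metric_det_pos[OF c] W[OF that] by blast
        then show ?thesis by (simp add: dens_eq[OF h c d W(2,4,5)[OF that]] dens_in_def)
      qed
      have eqx: "\<bar>det (matrix (\<lambda>v. jac h c d (chart_inv c x) *v v))\<bar> * ?\<phi> (?F x) =
          dens h (chart_inv c x) * sqrt (det (g c (chart_inv c x)))" if "x \<in> S" for x
        using that eq by (auto simp: S_def chart_inv_chart[OF c] chart_inv_chart[OF d] W)
      have m2: "set_borel_measurable borel S
        (\<lambda>x. \<bar>det (matrix (\<lambda>v. jac h c d (chart_inv c x) *v v))\<bar> * ?\<phi> (?F x))"
      proof -
        have o: "open (snd c ` (fst c \<inter> cint C))"
          by (rule chart_image_open[OF c]) (auto intro!: chart_openin[OF c] cint_openin)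
        have "continuous_on (snd c ` (fst c \<inter> cint C)) (dens h \<circ> chart_inv c)"
          using dens_smooth[OF h] c smooth_on_continuous unfolding smooth_fun_def by blast
        from borel_measurable_continuous_on_indicator[OF _ this] o
        have "(\<lambda>x. indicator (snd c ` (fst c \<inter> cint C)) x * dens h (chart_inv c x)) \<in> borel_measurable borel"
          by simp
        then have "(\<lambda>x. indicator S x * ((indicator (snd c ` (fst c \<inter> cint C)) x * dens h (chart_inv c x)) * chart_dens c x)) \<in> borel_measurable borel"
          using S chart_dens_measurable[OF c] by measurable
        moreover have "(\<lambda>x. indicator S x * ((indicator (snd c ` (fst c \<inter> cint C)) x * dens h (chart_inv c x)) * chart_dens c x)) =
            (\<lambda>x. indicator S x *\<^sub>R (\<bar>det (matrix (\<lambda>v. jac h c d (chart_inv c x) *v v))\<bar> * ?\<phi> (?F x)))"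
        proof
          fix x show "indicator S x * ((indicator (snd c ` (fst c \<inter> cint C)) x * dens h (chart_inv c x)) * chart_dens c x) =
            indicator S x *\<^sub>R (\<bar>det (matrix (\<lambda>v. jac h c d (chart_inv c x) *v v))\<bar> * ?\<phi> (?F x))"
          proof (cases "x \<in> S")
            case True
            then have "x \<in> snd c ` (fst c \<inter> cint C)" using W by (auto simp: S_def)
            then show ?thesis using eqx[OF True] True by (simp add: chart_dens_def)
          qed simp
        qed
        ultimately show ?thesis unfolding set_borel_measurable_def by (simp only:)
      qed
      have inj: "inj_on ?F S"
      proof (rule inj_onI)
        fix x y assume xy: "x \<in> S" "y \<in> S" "?F x = ?F y"
        then obtain a b where ab: "x = snd c a" "y = snd c b" "a \<in> A" "b \<in> A" by (auto simp: S_def)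
        then have "snd d (h a) = snd d (h b)" using xy(3) W by (simp add: chart_inv_chart[OF c])
        then have "h a = h b" using inj_onD[OF chart_inj[OF d]] W ab by blast
        then have "a = b" using diffeo_pair_inv[OF h] W ab by metis
        then show "x = y" using ab by simp
      qed
      have D: "(?F has_derivative (\<lambda>v. jac h c d (chart_inv c x) *v v)) (at x within S)" if x: "x \<in> S" for x
      proof -
        obtain a where a: "x = snd c a" "a \<in> A" using x by (auto simp: S_def)
        have "(?F has_derivative (\<lambda>v. jac h c d a *v v)) (at (snd c a))"
          by (rule jac_has_derivative[OF h c d W(1)[OF a(2)]])
        then show ?thesis using a W by (simp add: chart_inv_chart[OF c] has_derivative_at_withinI)
      qed
      have "emeasure (distr vol vol f) A = emeasure vol (h ` A)"
        using A hA diffeo_measurable[OF f] by (simp add: emeasure_distr)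
      also have "\<dots> = (\<integral>\<^sup>+y\<in>?F ` S. ?\<phi> y \<partial>lborel)"
        unfolding FS by (rule emeasure_vol[OF d hA_sets]) (use W in blast)
      also have "\<dots> = (\<integral>\<^sup>+x\<in>S. \<bar>det (matrix (\<lambda>v. jac h c d (chart_inv c x) *v v))\<bar> * ?\<phi> (?F x) \<partial>lborel)"
      proof (rule nn_integral_change_of_variables[OF S D inj _ m1 m2])
        show "0 \<le> ?\<phi> y" if "y \<in> ?F ` S" for y
          using that W metric_det_pos[OF d] unfolding FS by (auto simp: chart_inv_chart[OF d] less_imp_le)
      qed
      also have "\<dots> = (\<integral>\<^sup>+x. ennreal (dens h (chart_inv c x)) *
          ennreal (sqrt (det (g c (chart_inv c x)))) * indicator (snd c ` A) x \<partial>lborel)"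
      proof (rule nn_integral_cong)
        fix x
        show "ennreal (\<bar>det (matrix (\<lambda>v. jac h c d (chart_inv c x) *v v))\<bar> * ?\<phi> (?F x)) * indicator S x =
          ennreal (dens h (chart_inv c x)) * ennreal (sqrt (det (g c (chart_inv c x)))) * indicator (snd c ` A) x"
        proof (cases "x \<in> S")
          case True
          then obtain a where a: "x = snd c a" "a \<in> A" by (auto simp: S_def)
          have "0 \<le> dens h (chart_inv c x)" "0 \<le> sqrt (det (g c (chart_inv c x)))"
            using dens_pos[OF h] metric_det_pos[OF c] W[OF a(2)] a
            by (simp_all add: chart_inv_chart[OF c] less_imp_le)
          then show ?thesis unfolding eqx[OF True] using True by (simp add: S_def ennreal_mult)
        qed (simp add: S_def)
      qed
      also have "\<dots> = (\<integral>\<^sup>+p. ennreal (dens h p) * indicator A p \<partial>vol)"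
        by (rule nn_integral_chart[symmetric, OF c A]) (use W dens_measurable[OF h] in auto)
      also have "\<dots> = emeasure (density vol (\<lambda>p. ennreal (dens h p))) A"
        using A dens_measurable[OF h] by (simp add: emeasure_density)
      finally show "emeasure (distr vol vol f) A = emeasure (density vol (\<lambda>p. ennreal (dens h p))) A" .
    qed simp
  qed
qed

end

section \<open>Boundedness of the volume distortion up to the singularities\<close>

text \<open>At boundary points a smooth function is handled through a smooth extension to a full ball; on a
  slightly smaller ball the derivatives of the extension are bounded.\<close>

lemma smooth_on_local_extension:
  fixes F :: "real^'n \<Rightarrow> 'b::real_normed_vector"
  assumes F: "smooth_on S F" and x: "x \<in> S" and O: "open V" "x \<in> V"
  obtains e M G where "0 < (e::real)" "0 \<le> (M::real)" "ball x e \<subseteq> V" "smooth_open (ball x e) G"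
    "\<forall>y\<in>S \<inter> ball x e. G y = F y" "\<forall>y\<in>ball x e. \<forall>j. norm (pd j G y) \<le> M"
proof -
  obtain U G where U: "x \<in> U" "smooth_open U G" "\<forall>y\<in>S \<inter> U. G y = F y"
    using F x unfolding smooth_on_def by blast
  have "open (U \<inter> V)" using U(2) O by (auto simp: smooth_open_def)
  then obtain e where e: "0 < e" "cball x e \<subseteq> U \<inter> V" using U(1) O(2) open_contains_cball by blast
  have "\<exists>b. \<forall>y\<in>cball x e. norm (pd j G y) \<le> b" for j
  proof -
    have "open U" using U(2) by (simp add: smooth_open_def)
    then have "smooth_on U (pd j G)" using smooth_on_pd U(2) smooth_on_open_iff by blast
    then have "continuous_on (cball x e) (pd j G)"
      by (rule continuous_on_subset[OF smooth_on_continuous]) (use e in blast)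
    then have "bounded (pd j G ` cball x e)"
      by (intro compact_imp_bounded compact_continuous_image compact_cball)
    then show ?thesis by (auto simp: bounded_iff)
  qed
  then obtain b where b: "\<And>j y. y \<in> cball x e \<Longrightarrow> norm (pd j G y) \<le> b j" by metis
  define M where "M = (\<Sum>j\<in>UNIV. \<bar>b j\<bar>)"
  have "norm (pd j G y) \<le> M" if "y \<in> ball x e" for j y
  proof -
    have "norm (pd j G y) \<le> \<bar>b j\<bar>" using b[of y j] that by (simp add: less_imp_le)
    also have "\<dots> \<le> M" unfolding M_def by (rule member_le_sum) auto
    finally show ?thesis .
  qed
  moreover have "smooth_open (ball x e) G"
    by (rule smooth_open_subset[OF U(2)]) (use e ball_subset_cball in blast)+
  moreover have "0 \<le> M" by (simp add: M_def sum_nonneg)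
  moreover have "ball x e \<subseteq> V" "\<forall>y\<in>S \<inter> ball x e. G y = F y"
    using e U(3) ball_subset_cball[of x e] by blast+
  ultimately show ?thesis using that e(1) by blast
qed

lemma smooth_open_ball_Lipschitz:
  fixes G :: "real^'n \<Rightarrow> 'b::real_normed_vector"
  assumes G: "smooth_open (ball x e) G" and M: "\<forall>y\<in>ball x e. \<forall>j. norm (pd j G y) \<le> M"
    and y: "y \<in> ball x e" "z \<in> ball x e"
  shows "norm (G y - G z) \<le> real CARD('n) * M * norm (y - z)"
proof (rule differentiable_bound[of "ball x e" _ "\<lambda>w. frechet_derivative G (at w)"])
  fix w assume w: "w \<in> ball x e"
  have D: "(G has_derivative frechet_derivative G (at w)) (at w)"
    by (rule smooth_on_has_derivative[OF _ smooth_open_imp_smooth_on[OF G] w]) simp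
  then show "(G has_derivative frechet_derivative G (at w)) (at w within ball x e)"
    by (rule has_derivative_at_withinI)
  have lin: "linear (frechet_derivative G (at w))" using D by (rule has_derivative_linear)
  show "onorm (frechet_derivative G (at w)) \<le> real CARD('n) * M"
  proof (rule onorm_le)
    fix v
    have "frechet_derivative G (at w) v =
      frechet_derivative G (at w) (\<Sum>j\<in>UNIV. v $ j *\<^sub>R axis j 1)"
      by (simp add: basis_expansion flip: scalar_mult_eq_scaleR)
    also have "\<dots> = (\<Sum>j\<in>UNIV. v $ j *\<^sub>R pd j G w)"
      by (simp add: linear_sum[OF lin] linear_scale[OF lin] pd_def)
    also have "norm \<dots> \<le> (\<Sum>j\<in>(UNIV :: 'n set). norm v * M)"
      using M w by (intro sum_norm_le) (auto intro!: mult_mono component_le_norm_cart)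
    finally show "norm (frechet_derivative G (at w) v) \<le> real CARD('n) * M * norm v"
      by (simp add: mult_ac)
  qed
qed (use y in auto)

lemma tangential_props:
  fixes x :: "real^'n::{finite,wellorder}"
  shows "tangential x $ rad = 0" "tangential x \<in> hyperplane" "x - tangential x = axis rad (x $ rad)"
    "i \<noteq> rad \<Longrightarrow> tangential x $ i = x $ i" "v \<in> hyperplane \<Longrightarrow> tangential (axis rad r + v) = v"
  by (simp_all add: tangential_def hyperplane_def axis_def vec_eq_iff)

lemma norm_axis_real: "norm (axis i r :: real^'n) = \<bar>r\<bar>"
proof -
  have "axis i r = r *\<^sub>R (axis i 1 :: real^'n)" by (simp add: vec_eq_iff axis_def)
  then show ?thesis by simp
qed

lemma tangential_closer:
  fixes x y :: "real^'n::{finite,wellorder}"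
  assumes "y $ rad = 0"
  shows "dist y (tangential x) \<le> dist y x"
  unfolding dist_norm
proof (rule norm_le_componentwise_cart)
  show "norm ((y - tangential x) $ i) \<le> norm ((y - x) $ i)" for i
    by (cases "i = rad") (simp_all add: tangential_props assms)
qed

text \<open>The matrix of \<open>dr\<^sup>2 + r\<^sup>2 h\<close> is \<open>D G D\<close> with \<open>D = diag(1, r, \<dots>, r)\<close> and \<open>G\<close> the matrix of
  \<open>dr\<^sup>2 + h\<close>, which remains positive definite at \<open>r = 0\<close>.\<close>

definition warp :: "'n rmat \<Rightarrow> 'n::{finite,wellorder} rmat"
  where "warp H = (\<chi> i j. if i = rad \<and> j = rad then 1 else if i = rad \<or> j = rad then 0 else H $ i $ j)"

lemma warp_bilinear:
  fixes u v :: "real^'n::{finite,wellorder}"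
  shows "u \<bullet> (warp H *v v) = u $ rad * v $ rad + tangential u \<bullet> (H *v tangential v)"
proof -
  have t: "tangential w $ i = (if i = rad then 0 else w $ i)" for w :: "(real, 'n) vec" and i
    by (simp add: tangential_def axis_def)
  have "u \<bullet> (warp H *v v) = (\<Sum>i\<in>UNIV. \<Sum>j\<in>UNIV. u $ i * (warp H $ i $ j * v $ j))"
    by (simp add: inner_vec_def matrix_vector_mult_def sum_distrib_left)
  also have "\<dots> = (\<Sum>i\<in>UNIV. \<Sum>j\<in>UNIV. (if i = rad then if j = rad then u $ i * v $ j else 0 else 0) +
      tangential u $ i * (H $ i $ j * tangential v $ j))"
    by (intro sum.cong) (auto simp: warp_def t)
  also have "\<dots> = (\<Sum>i\<in>UNIV. \<Sum>j\<in>UNIV. (if i = rad then if j = rad then u $ i * v $ j else 0 else 0)) +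
      tangential u \<bullet> (H *v tangential v)"
    by (simp add: sum.distrib inner_vec_def matrix_vector_mult_def sum_distrib_left)
  also have "(\<Sum>i\<in>UNIV. \<Sum>j\<in>UNIV. (if i = rad then if j = rad then u $ i * v $ j else 0 else 0)) =
      (\<Sum>i\<in>UNIV. if i = rad then u $ i * v $ rad else 0)"
    by (intro sum.cong) auto
  also have "\<dots> = u $ rad * v $ rad" by simp
  finally show ?thesis .
qed

lemma warp_det_pos:
  fixes H :: "'n::{finite,wellorder} rmat"
  assumes "\<And>v. v \<in> hyperplane \<Longrightarrow> v \<noteq> 0 \<Longrightarrow> 0 < v \<bullet> (H *v v)"
  shows "0 < det (warp H)"
proof (rule positive_definite_det_pos)
  fix v :: "(real, 'n) vec" assume v: "v \<noteq> 0"
  show "0 < v \<bullet> (warp H *v v)"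
  proof (cases "tangential v = 0")
    case True
    then have "v = axis rad (v $ rad)" using tangential_props(3)[of v] by simp
    then have "v $ rad \<noteq> 0" using v by (metis axis_eq_0_iff)
    then have "0 < v $ rad * v $ rad" by (metis not_real_square_gt_zero)
    then show ?thesis using True by (simp add: warp_bilinear)
  next
    case False
    then show ?thesis
      unfolding warp_bilinear by (intro add_nonneg_pos assms tangential_props) simp_all
  qed
qed

text \<open>The hypothesis says \<open>A = D G D\<close> with \<open>D = diag(1, r, \<dots>, r)\<close> and \<open>G = warp H\<close>, whence the power of \<open>r\<close>.\<close>

lemma conic_det:
  fixes A H :: "'n::{finite,wellorder} rmat"
  assumes "\<And>u v. u \<bullet> (A *v v) = u $ rad * v $ rad + r\<^sup>2 * (tangential u \<bullet> (H *v tangential v))"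
  shows "det A = (r ^ (CARD('n) - 1))\<^sup>2 * det (warp H)"
proof -
  define D :: "'n rmat" where "D = (\<chi> i j. if i = j then if i = rad then 1 else r else 0)"
  have Dvi: "(D *v x) $ i = (if i = rad then 1 else r) * x $ i" for x :: "(real, 'n) vec" and i
    by (simp add: matrix_vector_mult_def D_def if_distrib[of "\<lambda>t. t * _"] cong: if_cong)
  have "A $ i $ j = (D ** warp H ** D) $ i $ j" for i j
  proof -
    have ax: "axis i 1 \<bullet> (B *v axis j 1) = B $ i $ j" for B :: "'n rmat" and i j
      by (simp add: matrix_vector_mult_basis column_def inner_axis' )
    have Dv: "D *v axis j 1 = (if j = rad then 1 else r) *\<^sub>R axis j 1" for j
      unfolding vec_eq_iff Dvi by (simp add: axis_def)
    have Dt: "transpose D = D" by (simp add: transpose_def D_def vec_eq_iff)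
    have "(D ** warp H ** D) $ i $ j = axis i 1 \<bullet> (D *v (warp H *v (D *v axis j 1)))"
      by (simp add: ax[symmetric] matrix_vector_mul_assoc matrix_mul_assoc)
    also have "\<dots> = (D *v axis i 1) \<bullet> (warp H *v (D *v axis j 1))"
      by (metis Dt dot_lmul_matrix vector_transpose_matrix)
    also have "\<dots> = (D *v axis i 1) $ rad * (D *v axis j 1) $ rad +
        tangential (D *v axis i 1) \<bullet> (H *v tangential (D *v axis j 1))"
      by (rule warp_bilinear)
    also have "\<dots> = axis i 1 $ rad * axis j 1 $ rad +
        r\<^sup>2 * (tangential (axis i 1) \<bullet> (H *v tangential (axis j 1)))"
    proof -
      have "tangential (D *v axis j 1) = r *\<^sub>R tangential (axis j 1)" for j
        unfolding Dv by (simp add: tangential_def axis_def vec_eq_iff)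
      moreover have "(D *v axis j 1) $ rad = axis j 1 $ rad" for j
        unfolding Dv by (simp add: axis_def)
      ultimately show ?thesis by (simp add: matrix_vector_mult_scaleR power2_eq_square)
    qed
    also have "\<dots> = axis i 1 \<bullet> (A *v axis j 1)" by (rule assms[symmetric])
    finally show ?thesis by (simp add: ax)
  qed
  then have "A = D ** warp H ** D" by (simp add: vec_eq_iff)
  moreover have "det D = r ^ (CARD('n) - 1)"
  proof -
    have "det D = (\<Prod>i\<in>UNIV. D $ i $ i)" by (rule det_diagonal) (simp add: D_def)
    also have "\<dots> = (\<Prod>i\<in>UNIV - {rad :: 'n}. r)"
      by (subst prod.remove[of _ rad]) (auto simp: D_def intro!: prod.cong)
    finally show ?thesis by (simp add: card_Diff_singleton)
  qed
  ultimately show ?thesis by (simp add: det_mul power2_eq_square)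
qed

context conical_mfd
begin

lemma chart_in_atlasI:
  assumes "chart_of halfspace (cres C) c" "\<And>d. d \<in> catlas C \<Longrightarrow> compatible c d"
  shows "c \<in> catlas C"
proof -
  have "\<forall>c. chart_of halfspace (cres C) c \<and> (\<forall>d\<in>catlas C. compatible c d) \<longrightarrow> c \<in> catlas C"
    using manifold_res unfolding manifold_def by (elim conjE)
  from this[THEN spec, of c] show ?thesis using assms by simp
qed

lemma link_manifold: "q \<in> csing C \<Longrightarrow> manifold hyperplane (clink C q) (clatlas C q)"
  using conical unfolding conical_manifold_def conical_singularities_def by blast

text \<open>The metric has its conic form in charts obtained from a collar and a chart of the link.  They belong
  to the atlas by its maximality, once they are seen to be homeomorphisms onto relatively open subsets
  of the half-space and to be compatible with all charts; the latter is what it means that the collar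
  map is a diffeomorphism.\<close>

lemma collar_chart:
  assumes q: "q \<in> csing C" and k: "collar C q \<epsilon> k" and l: "l \<in> clatlas C q"
  shows collar_chart_in_atlas: "collar_chart \<epsilon> k l \<in> catlas C"
    and collar_chart_dom: "fst (collar_chart \<epsilon> k l) = k ` ({0..<\<epsilon>} \<times> fst l)"
proof -
  define I where "I = {0..<\<epsilon>}"
  define L where "L = clink C q"
  define W where "W = k ` (I \<times> topspace L)"
  define D where "D = I \<times> fst l"
  define \<Phi> where "\<Phi> = snd (cyl_chart I l)"
  define c where "c = collar_chart \<epsilon> k l"
  have \<Phi>: "\<Phi> (r, y) = axis rad r + snd l y" for r y by (simp add: \<Phi>_def cyl_chart_def)
  have W: "openin (cres C) W" and dk: "diffeo (cyl_top I L) (cyl_atlas I (clatlas C q))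
       (subtopology (cres C) W) (restrict_atlas W (catlas C)) k"
    using k unfolding collar_def Let_def W_def I_def L_def by blast+
  obtain k' where k': "homeomorphic_maps (cyl_top I L) (subtopology (cres C) W) k k'"
    and sk: "smooth_map (cyl_top I L) (cyl_atlas I (clatlas C q)) (subtopology (cres C) W) (restrict_atlas W (catlas C)) k"
    and sk': "smooth_map (subtopology (cres C) W) (restrict_atlas W (catlas C)) (cyl_top I L) (cyl_atlas I (clatlas C q)) k'"
    using dk unfolding diffeo_def by blast
  have mL: "manifold hyperplane L (clatlas C q)" unfolding L_def by (rule link_manifold[OF q])
  then have cl: "chart_of hyperplane L l" using l by (simp add: manifold_def)
  then have ol: "openin L (fst l)" and il: "openin (top_of_set hyperplane) (snd l ` fst l)"
    and hl: "homeomorphic_map (subtopology L (fst l)) (top_of_set (snd l ` fst l)) (snd l)"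
    unfolding chart_of_def by blast+
  have lY: "fst l \<subseteq> topspace L" using openin_subset[OF ol] .
  have hyp: "snd l y \<in> hyperplane" if "y \<in> fst l" for y
    using il that openin_imp_subset by blast
  have injl: "inj_on (snd l) (fst l)"
    using homeomorphic_imp_injective_map[OF hl] lY by (metis topspace_subtopology_subset)
  have li: "chart_inv l (snd l y) = y" if "y \<in> fst l" for y
    using that injl by (simp add: chart_inv_def)
  have topcyl: "topspace (cyl_top I L) = I \<times> topspace L" by (simp add: cyl_top_def)
  have Dsub: "D \<subseteq> I \<times> topspace L" using lY by (auto simp: D_def)
  have kk: "k' (k z) = z" if "z \<in> D" for z
    using k' that Dsub by (auto simp: homeomorphic_maps_def topcyl)
  have kW: "k z \<in> W" if "z \<in> D" for z using that Dsub by (auto simp: W_def)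
  have injk: "inj_on k D" by (metis inj_onI kk)
  have \<Phi>rad: "\<Phi> (r, y) $ rad = r" "tangential (\<Phi> (r, y)) = snd l y" if "y \<in> fst l" for r y
    using hyp[OF that] tangential_props(5)[of "snd l y" r] by (auto simp: \<Phi> hyperplane_def axis_def)
  have inj\<Phi>: "inj_on \<Phi> D"
  proof (rule inj_onI)
    fix z w assume "z \<in> D" "w \<in> D" "\<Phi> z = \<Phi> w"
    then show "z = w"
      using \<Phi>rad inj_onD[OF injl] by (cases z; cases w) (metis D_def mem_Sigma_iff)
  qed
  have fc: "fst c = k ` D" by (simp add: c_def collar_chart_def D_def I_def)
  then show "fst (collar_chart \<epsilon> k l) = k ` ({0..<\<epsilon>} \<times> fst l)" by (simp add: c_def D_def I_def)
  have sc: "snd c (k z) = \<Phi> z" if "z \<in> D" for z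
    using that injk by (simp add: c_def collar_chart_def D_def I_def \<Phi>_def)
  have imc: "snd c ` fst c = \<Phi> ` D" unfolding fc image_image by (rule image_cong) (simp_all add: sc)
  have injc: "inj_on (snd c) (fst c)"
    unfolding fc by (rule inj_onI) (auto simp: sc inj_on_eq_iff[OF inj\<Phi>])
  have ci: "chart_inv c (\<Phi> z) = k z" if "z \<in> D" for z
    using inv_into_f_f[OF injc, of "k z"] that by (simp add: chart_inv_def fc sc)
  have oD: "openin (cyl_top I L) D"
    using ol by (simp add: D_def cyl_top_def openin_prod_Times_iff)
  have okD: "openin (cres C) (k ` D)"
  proof -
    have "homeomorphic_map (cyl_top I L) (subtopology (cres C) W) k"
      using k' homeomorphic_maps_map by blast
    then have "openin (subtopology (cres C) W) (k ` D)"
      using homeomorphic_map_openness_eq oD by blast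
    then show ?thesis using W openin_trans_full by blast
  qed
  obtain O' where O': "open O'" "snd l ` fst l = hyperplane \<inter> O'"
    using il by (auto simp: openin_open)
  have im: "\<Phi> ` D = halfspace \<inter> ({x. x $ rad < \<epsilon>} \<inter> tangential -` O')"
  proof
    show "\<Phi> ` D \<subseteq> halfspace \<inter> ({x. x $ rad < \<epsilon>} \<inter> tangential -` O')"
    proof
      fix x assume "x \<in> \<Phi> ` D"
      then obtain r y where ry: "x = \<Phi> (r, y)" "r \<in> I" "y \<in> fst l" by (auto simp: D_def)
      then have "snd l y \<in> O'" using O'(2) by blast
      then show "x \<in> halfspace \<inter> ({x. x $ rad < \<epsilon>} \<inter> tangential -` O')"
        using ry \<Phi>rad[OF ry(3), of r] by (simp add: halfspace_def I_def)
    qed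
    show "halfspace \<inter> ({x. x $ rad < \<epsilon>} \<inter> tangential -` O') \<subseteq> \<Phi> ` D"
    proof
      fix x :: "(real, 'n) vec" assume x: "x \<in> halfspace \<inter> ({x. x $ rad < \<epsilon>} \<inter> tangential -` O')"
      then have "tangential x \<in> snd l ` fst l" using O'(2) tangential_props(2)[of x] by blast
      then obtain y where y: "y \<in> fst l" "tangential x = snd l y" by blast
      have "x = \<Phi> (x $ rad, y)" using tangential_props(3)[of x] y(2) by (simp add: \<Phi> algebra_simps)
      moreover have "(x $ rad, y) \<in> D" using x y by (simp add: D_def I_def halfspace_def)
      ultimately show "x \<in> \<Phi> ` D" by blast
    qed
  qed
  have ct: "continuous_on UNIV (tangential :: (real, 'n) vec \<Rightarrow> _)"
  proof -
    have eq: "tangential = (\<lambda>x :: (real, 'n) vec. x - (x $ rad) *\<^sub>R axis rad 1)"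
      by (simp add: fun_eq_iff tangential_def vec_eq_iff axis_def)
    show ?thesis by (subst eq) (intro continuous_intros)
  qed
  have oim: "openin (top_of_set halfspace) (\<Phi> ` D)"
  proof -
    have "open {x :: (real, 'n) vec. x $ rad < \<epsilon>}" by (intro open_Collect_less continuous_intros)
    moreover have "open (tangential -` O' :: (real, 'n) vec set)" using ct O'(1) by (simp add: open_vimage)
    ultimately show ?thesis unfolding im by (simp add: openin_open_Int open_Int)
  qed
  \<comment> \<open>The inverse chart sends a point of the half-space to its radial and tangential parts, the latter
    being read as a point of the link.\<close>
  define \<kappa> where "\<kappa> = (\<lambda>x :: (real, 'n) vec. k (x $ rad, chart_inv l (tangential x)))"
  have \<kappa>: "\<kappa> (\<Phi> z) = k z" if "z \<in> D" for z
    using that \<Phi>rad li by (cases z) (auto simp: \<kappa>_def D_def)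
  have "homeomorphic_maps (subtopology (cres C) (fst c)) (top_of_set (snd c ` fst c)) (snd c) \<kappa>"
    unfolding homeomorphic_maps_def
  proof (intro conjI ballI)
    have kc: "continuous_map (subtopology (cres C) (k ` D)) (cyl_top I L) k'"
    proof -
      have "k ` D \<subseteq> W" using kW by blast
      moreover have "continuous_map (subtopology (cres C) W) (cyl_top I L) k'"
        using k' by (simp add: homeomorphic_maps_def)
      ultimately show ?thesis by (metis continuous_map_from_subtopology_mono)
    qed
    have "continuous_map (subtopology (cyl_top I L) D) euclidean \<Phi>"
    proof -
      have f1: "continuous_map (cyl_top I L) euclideanreal fst"
        unfolding cyl_top_def using continuous_map_fst continuous_map_into_fulltopology by blast
      have "continuous_map (subtopology (cyl_top I L) D) (subtopology L (fst l)) snd"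
        unfolding cyl_top_def D_def
        by (auto simp: continuous_map_in_subtopology intro: continuous_map_from_subtopology continuous_map_snd)
      moreover have "continuous_map (subtopology L (fst l)) euclidean (snd l)"
        using homeomorphic_imp_continuous_map[OF hl] continuous_map_into_fulltopology by blast
      ultimately have "continuous_map (subtopology (cyl_top I L) D) euclidean (snd l \<circ> snd)"
        by (rule continuous_map_compose)
      moreover have "continuous_map (subtopology (cyl_top I L) D) euclidean (\<lambda>z. fst z *\<^sub>R (axis rad 1 :: (real, 'n) vec))"
      proof -
        have "continuous_map euclideanreal euclidean (\<lambda>r. r *\<^sub>R (axis rad 1 :: (real, 'n) vec))"
          by (simp add: continuous_intros)
        from continuous_map_compose[OF continuous_map_from_subtopology[OF f1] this]
        show ?thesis by (simp add: o_def)
      qed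
      ultimately have "continuous_map (subtopology (cyl_top I L) D) euclidean
          (\<lambda>z. fst z *\<^sub>R (axis rad 1 :: (real, 'n) vec) + (snd l \<circ> snd) z)"
        by (intro continuous_map_add)
      moreover have "fst z *\<^sub>R (axis rad 1 :: (real, 'n) vec) + (snd l \<circ> snd) z = \<Phi> z" for z
        by (cases z) (simp add: \<Phi> vec_eq_iff axis_def)
      ultimately show ?thesis by simp
    qed
    moreover have "continuous_map (subtopology (cres C) (k ` D)) (subtopology (cyl_top I L) D) k'"
      using kc by (auto simp: continuous_map_in_subtopology kk)
    ultimately have "continuous_map (subtopology (cres C) (k ` D)) euclidean (\<Phi> \<circ> k')"
      using continuous_map_compose by blast
    then have "continuous_map (subtopology (cres C) (fst c)) euclidean (snd c)"
      unfolding fc by (rule continuous_map_eq) (auto simp: kk sc)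
    then show "continuous_map (subtopology (cres C) (fst c)) (top_of_set (snd c ` fst c)) (snd c)"
      by (auto simp: continuous_map_in_subtopology)
    have lc: "continuous_map (top_of_set (snd l ` fst l)) L (chart_inv l)"
    proof -
      obtain m where m: "homeomorphic_maps (subtopology L (fst l)) (top_of_set (snd l ` fst l)) (snd l) m"
        using hl homeomorphic_map_maps by blast
      then have "continuous_map (top_of_set (snd l ` fst l)) L m"
        by (auto simp: homeomorphic_maps_def continuous_map_into_fulltopology)
      then show ?thesis
        by (rule continuous_map_eq) (use m lY li in \<open>auto simp: homeomorphic_maps_def\<close>)
    qed
    have tc: "continuous_map (top_of_set (\<Phi> ` D)) (top_of_set (snd l ` fst l)) tangential"
      unfolding continuous_map_in_subtopology
      using continuous_on_subset[OF ct] \<Phi>rad by (auto simp: D_def)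
    have "continuous_map (top_of_set (\<Phi> ` D)) (top_of_set I) (\<lambda>x. x $ rad)"
      unfolding continuous_map_in_subtopology
      using \<Phi>rad by (auto simp: D_def intro!: continuous_intros)
    then have "continuous_map (top_of_set (\<Phi> ` D)) (cyl_top I L) (\<lambda>x. (x $ rad, (chart_inv l \<circ> tangential) x))"
      unfolding cyl_top_def using continuous_map_compose[OF tc lc] by (rule continuous_map_pairedI)
    moreover have "continuous_map (cyl_top I L) (cres C) k"
      using k' by (auto simp: homeomorphic_maps_def continuous_map_in_subtopology)
    ultimately have "continuous_map (top_of_set (\<Phi> ` D)) (cres C) \<kappa>"
      using continuous_map_compose by (fastforce simp: o_def \<kappa>_def)
    then show "continuous_map (top_of_set (snd c ` fst c)) (subtopology (cres C) (fst c)) \<kappa>"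
      unfolding imc by (auto simp: continuous_map_in_subtopology \<kappa> fc)
    show "\<kappa> (snd c p) = p" if "p \<in> topspace (subtopology (cres C) (fst c))" for p
      using that by (auto simp: fc sc \<kappa>)
    show "snd c (\<kappa> x) = x" if "x \<in> topspace (top_of_set (snd c ` fst c))" for x
      using that by (auto simp: imc \<kappa> sc)
  qed
  then have "homeomorphic_map (subtopology (cres C) (fst c)) (top_of_set (snd c ` fst c)) (snd c)"
    using homeomorphic_maps_map by blast
  then have chart: "chart_of halfspace (cres C) c"
    unfolding chart_of_def using oim okD imc[unfolded fc] by (simp add: fc)
  have "compatible c e" if e: "e \<in> catlas C" for e
    unfolding compatible_def
  proof
    have cy: "cyl_chart I l \<in> cyl_atlas I (clatlas C q)" using l by (simp add: cyl_atlas_def)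
    have re: "(fst e \<inter> W, snd e) \<in> restrict_atlas W (catlas C)" using e by (auto simp: restrict_atlas_def)
    have dcy: "fst (cyl_chart I l) = D" by (simp add: cyl_chart_def D_def)
    have cyi: "chart_inv (cyl_chart I l) (\<Phi> z) = z" if "z \<in> D" for z
      using that inj\<Phi> by (simp add: chart_inv_def dcy flip: \<Phi>_def)
    have "smooth_on (\<Phi> ` (D \<inter> k -` (fst e \<inter> W))) (snd e \<circ> k \<circ> chart_inv (cyl_chart I l))"
      using sk cy re unfolding smooth_map_def by (fastforce simp: dcy \<Phi>_def)
    then have "smooth_on (snd c ` (fst c \<inter> fst e)) (snd e \<circ> k \<circ> chart_inv (cyl_chart I l))"
      by (rule smooth_on_subset) (auto simp: fc sc kW)
    then show "smooth_on (snd c ` (fst c \<inter> fst e)) (snd e \<circ> chart_inv c)"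
      by (rule smooth_on_cong) (auto simp: fc sc cyi ci)
    have ei: "chart_inv (fst e \<inter> W, snd e) (snd e p) = p" if "p \<in> fst e" "p \<in> W" for p
      using that inj_on_subset[OF chart_inj[OF e], of "fst e \<inter> W"] by (simp add: chart_inv_def)
    have "smooth_on (snd e ` ((fst e \<inter> W) \<inter> k' -` D)) (\<Phi> \<circ> k' \<circ> chart_inv (fst e \<inter> W, snd e))"
      using sk' cy re unfolding smooth_map_def by (fastforce simp: dcy \<Phi>_def)
    then have "smooth_on (snd e ` (fst c \<inter> fst e)) (\<Phi> \<circ> k' \<circ> chart_inv (fst e \<inter> W, snd e))"
      by (rule smooth_on_subset) (auto simp: fc kW kk)
    then show "smooth_on (snd e ` (fst c \<inter> fst e)) (snd c \<circ> chart_inv e)"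
      by (rule smooth_on_cong) (auto simp: fc ei kW kk sc chart_inv_chart[OF e])
  qed
  then show "collar_chart \<epsilon> k l \<in> catlas C"
    using chart_in_atlasI[OF chart] by (simp add: c_def)
qed

lemma collar_chart_rad:
  assumes q: "q \<in> csing C" and k: "collar C q \<epsilon> k" and p: "p \<in> topspace (cres C)" "cblow C p = q"
  obtains l where "l \<in> clatlas C q" "p \<in> fst (collar_chart \<epsilon> k l)"
proof -
  have "k ` ({0} \<times> topspace (clink C q)) = {p \<in> topspace (cres C). cblow C p = q}"
    using k unfolding collar_def Let_def by blast
  then obtain y where y: "y \<in> topspace (clink C q)" "p = k (0, y)" using p by blast
  have "(\<Union>c\<in>clatlas C q. fst c) = topspace (clink C q)"
    using link_manifold[OF q] unfolding manifold_def by (elim conjE)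
  then obtain l where l: "l \<in> clatlas C q" "y \<in> fst l" using y by blast
  have "0 < \<epsilon>" using k by (simp add: collar_def)
  then have "p \<in> fst (collar_chart \<epsilon> k l)"
    using y l by (auto simp: collar_chart_dom[OF q k l(1)])
  then show ?thesis using that l by blast
qed

lemma boundary_blow_down: "p \<in> topspace (cres C) \<Longrightarrow> p \<notin> cint C \<Longrightarrow> cblow C p \<in> csing C"
proof -
  have "\<forall>p\<in>topspace (cres C) - cint C. cblow C p \<in> csing C"
    using conical unfolding conical_manifold_def resolution_def by (elim conjE)
  then show "p \<in> topspace (cres C) \<Longrightarrow> p \<notin> cint C \<Longrightarrow> cblow C p \<in> csing C" by simp
qed

lemma rad_nonneg: "c \<in> catlas C \<Longrightarrow> p \<in> fst c \<Longrightarrow> 0 \<le> snd c p $ rad"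
  using chart_halfspace[of c] by (auto simp: halfspace_def)

lemma boundary_rad: "c \<in> catlas C \<Longrightarrow> p \<in> fst c \<Longrightarrow> p \<notin> cint C \<Longrightarrow> snd c p $ rad = 0"
  using rad_nonneg[of c p] cint_iff[of c p] by simp

text \<open>A diffeomorphism preserves the boundary, so in local coordinates its radial component vanishes
  at \<open>r = 0\<close>; hence it is bounded by a multiple of \<open>r\<close>, by the mean value theorem.\<close>

lemma local_Jacobian_and_radius_bound:
  assumes a: "diffeo_pair a b" and c: "c \<in> catlas C" and d: "d \<in> catlas C"
    and p: "p \<in> topspace (cres C)" "p \<notin> cint C" "p \<in> fst c" "a p \<in> fst d"
  obtains V M where "openin (cres C) V" "p \<in> V" "V \<subseteq> fst c \<inter> a -` fst d" "0 \<le> (M::real)"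
    "\<forall>q\<in>V \<inter> cint C. \<bar>det (jac a c d q)\<bar> \<le> M" "\<forall>q\<in>V \<inter> cint C. snd d (a q) $ rad \<le> M * snd c q $ rad"
proof -
  let ?F = "snd d \<circ> a \<circ> chart_inv c"
  define V0 where "V0 = a -` fst d \<inter> topspace (cres C)"
  have V0: "openin (cres C) V0"
    unfolding V0_def by (rule vimage_openin[OF diffeo_pair_continuous[OF a] chart_openin[OF d]])
  define S where "S = snd c ` (fst c \<inter> V0)"
  have "smooth_on (snd c ` (fst c \<inter> a -` fst d)) ?F"
    using diffeo_pair_smooth[OF a] c d by (simp add: smooth_map_def)
  then have F: "smooth_on S ?F" by (rule smooth_on_subset) (auto simp: S_def V0_def)
  obtain O' where O: "open O'" "S = halfspace \<inter> O'"
    using chart_image_openin[OF c V0] by (auto simp: openin_open S_def)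
  define x0 where "x0 = snd c p"
  have x0: "x0 \<in> S" using p by (auto simp: x0_def S_def V0_def)
  then have "x0 \<in> O'" using O by blast
  then obtain e M G where e: "0 < e" and M: "0 \<le> M" and ballO: "ball x0 e \<subseteq> O'" and G: "smooth_open (ball x0 e) G"
    and GF: "\<forall>y\<in>S \<inter> ball x0 e. G y = ?F y" and GM: "\<forall>y\<in>ball x0 e. \<forall>j. norm (pd j G y) \<le> M"
    using smooth_on_local_extension[OF F x0 O(1)] by metis
  define V where "V = {q \<in> fst c \<inter> V0. snd c q \<in> ball x0 e}"
  define n where "n = real CARD('n)"
  \<comment> \<open>The first entry bounds a determinant with entries at most \<open>M\<close>, the second one is a Lipschitz
    constant of \<open>G\<close>.\<close>
  define M' where "M' = max (fact CARD('n) * M ^ CARD('n)) (n * M)"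
  have V: "openin (cres C) V" unfolding V_def by (rule chart_vimage_openin[OF c open_ball V0])
  have pV: "p \<in> V" using p e by (auto simp: V_def V0_def x0_def)
  have det: "\<bar>det (jac a c d q)\<bar> \<le> M'" if q: "q \<in> V \<inter> cint C" for q
  proof -
    have qc: "q \<in> repr_domain a c d" using q by (auto simp: V_def V0_def repr_domain_def)
    let ?W = "snd c ` repr_domain a c d \<inter> ball x0 e"
    have oW: "open ?W" using repr_domain_open[OF a c d] by blast
    have "?W \<subseteq> S \<inter> ball x0 e" by (auto simp: S_def repr_domain_def V0_def)
    then have "pd j ?F (snd c q) = pd j G (snd c q)" for j
      by (intro pd_eq_on[OF oW]) (use q qc GF in \<open>auto simp: V_def\<close>)
    then have "\<bar>jac a c d q $ i $ j\<bar> \<le> M" for i j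
    proof -
      have "jac a c d q $ i $ j = pd j G (snd c q) $ i"
        using q \<open>pd j ?F (snd c q) = pd j G (snd c q)\<close> by (subst jac_entry[OF c]) (auto simp: V_def)
      then have "\<bar>jac a c d q $ i $ j\<bar> \<le> norm (pd j G (snd c q))"
        by (simp add: component_le_norm_cart)
      also have "\<dots> \<le> M" using GM q by (simp add: V_def)
      finally show ?thesis .
    qed
    then have "\<bar>det (jac a c d q)\<bar> \<le> fact CARD('n) * M ^ CARD('n)" by (rule abs_det_le)
    then show ?thesis by (simp add: M'_def)
  qed
  have rad: "snd d (a q) $ rad \<le> M' * snd c q $ rad" if q: "q \<in> V \<inter> cint C" for q
  proof -
    define x where "x = snd c q"
    have xb: "x \<in> ball x0 e" and qc: "q \<in> fst c" and qV: "q \<in> V0" using q by (auto simp: x_def V_def)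
    have xS: "x \<in> S" using qc qV by (simp add: x_def S_def)
    have "x0 $ rad = 0" unfolding x0_def by (rule boundary_rad[OF c p(3,2)])
    \<comment> \<open>The foot \<open>tangential x\<close> of \<open>x\<close> on the boundary stays in the ball since the centre \<open>x0\<close> lies on the
      boundary, too; it is mapped to the boundary, and its distance from \<open>x\<close> is the radius of \<open>x\<close>.\<close>
    then have yb: "tangential x \<in> ball x0 e"
      using tangential_closer[of x0 x] xb by simp
    have "tangential x \<in> S"
      using yb ballO by (auto simp: O(2) halfspace_def tangential_props)
    then obtain q' where q': "tangential x = snd c q'" "q' \<in> fst c" "q' \<in> V0" by (auto simp: S_def)
    have "q' \<notin> cint C" using cint_iff[OF c q'(2)] q'(1) by (metis less_irrefl tangential_props(1))
    then have "a q' \<notin> cint C" using diffeo_pair_cint_iff[OF a] q'(3) by (simp add: V0_def)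
    then have "snd d (a q') $ rad = 0" using boundary_rad[OF d] q'(3) by (simp add: V0_def)
    moreover have "?F (tangential x) = snd d (a q')" using q' by (simp add: chart_inv_chart[OF c])
    moreover have "G (tangential x) = ?F (tangential x)" using GF yb \<open>tangential x \<in> S\<close> by blast
    ultimately have Gy: "G (tangential x) $ rad = 0" by simp
    have Gx: "G x = snd d (a q)"
      using GF xb xS qc by (auto simp: x_def chart_inv_chart[OF c])
    have r: "0 \<le> x $ rad" unfolding x_def by (rule rad_nonneg[OF c qc])
    have "snd d (a q) $ rad = (G x - G (tangential x)) $ rad" using Gx Gy by simp
    also have "\<dots> \<le> norm (G x - G (tangential x))"
      by (meson abs_le_D1 component_le_norm_cart)
    also have "\<dots> \<le> n * M * norm (x - tangential x)"
      unfolding n_def by (rule smooth_open_ball_Lipschitz[OF G GM xb yb])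
    also have "\<dots> = n * M * x $ rad" using r by (simp add: tangential_props norm_axis_real)
    also have "\<dots> \<le> M' * x $ rad" using r by (intro mult_right_mono) (simp_all add: M'_def)
    finally show ?thesis by (simp add: x_def)
  qed
  have "0 \<le> M'" using M by (simp add: M'_def n_def le_max_iff_disj)
  then show ?thesis using that[OF V pV _ _ ballI ballI] det rad by (auto simp: V_def V0_def)
qed

end

context volume_mfd
begin

definition conic_form :: "('p, 'n) chart \<Rightarrow> ('p \<Rightarrow> 'n rmat) \<Rightarrow> bool"
  where "conic_form c H \<longleftrightarrow> smooth_fun (catlas C) (fst c) H \<and>
    (\<forall>p\<in>fst c. transpose (H p) = H p \<and> (\<forall>v\<in>hyperplane. v \<noteq> 0 \<longrightarrow> 0 < v \<bullet> (H p *v v))) \<and>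
    (\<forall>p\<in>fst c \<inter> cint C. \<forall>u v. u \<bullet> (g c p *v v) =
      u $ rad * v $ rad + (snd c p $ rad)\<^sup>2 * (tangential u \<bullet> (H p *v tangential v)))"

lemma conic_collar:
  assumes "q \<in> csing C"
  shows "\<exists>\<epsilon> k. collar C q \<epsilon> k \<and> (\<forall>l\<in>clatlas C q. \<exists>H. conic_form (collar_chart \<epsilon> k l) H)"
proof -
  have "\<forall>q\<in>csing C. \<exists>\<epsilon> k. collar C q \<epsilon> k \<and> (\<forall>l\<in>clatlas C q. \<exists>H. conic_form (collar_chart \<epsilon> k l) H)"
    using conic unfolding conic_metric_def Let_def conic_form_def by (elim conjE)
  then show ?thesis using assms by (rule bspec)
qed

text \<open>Near a boundary point the volume density is \<open>r\<^sup>n\<^sup>-\<^sup>1\<close> times a positive function that is smooth up to the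
  boundary.\<close>

lemma conic_chart:
  assumes p: "p \<in> topspace (cres C)" "p \<notin> cint C"
  obtains c and H :: "'p \<Rightarrow> 'n rmat" where "c \<in> catlas C" "p \<in> fst c" "smooth_fun (catlas C) (fst c) (\<lambda>q. det (warp (H q)))"
    "\<forall>q\<in>fst c. 0 < det (warp (H q))"
    "\<forall>q\<in>fst c \<inter> cint C. sqrt (det (g c q)) = (snd c q $ rad) ^ (CARD('n) - 1) * sqrt (det (warp (H q)))"
proof -
  have q: "cblow C p \<in> csing C" by (rule boundary_blow_down[OF p])
  obtain \<epsilon> k where k: "collar C (cblow C p) \<epsilon> k"
    and loc: "\<forall>l\<in>clatlas C (cblow C p). \<exists>H. conic_form (collar_chart \<epsilon> k l) H"
    using conic_collar[OF q] by blast
  obtain l where l: "l \<in> clatlas C (cblow C p)" "p \<in> fst (collar_chart \<epsilon> k l)"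
    by (rule collar_chart_rad[OF q k p(1) refl])
  define c where "c = collar_chart \<epsilon> k l"
  have c: "c \<in> catlas C" unfolding c_def by (rule collar_chart_in_atlas[OF q k l(1)])
  obtain H where cf: "conic_form c H"
    using loc l(1) unfolding c_def by blast
  note H = cf[unfolded conic_form_def, THEN conjunct1]
    and pos = cf[unfolded conic_form_def, THEN conjunct2, THEN conjunct1]
    and form = cf[unfolded conic_form_def, THEN conjunct2, THEN conjunct2]
  have "smooth_fun (catlas C) (fst c) (\<lambda>q. det (warp (H q)))"
  proof (rule smooth_fun_det)
    fix i j
    have "smooth_fun (catlas C) (fst c) (\<lambda>q. H q $ i $ j)" by (intro smooth_fun_nth H)
    then show "smooth_fun (catlas C) (fst c) (\<lambda>q. warp (H q) $ i $ j)"
      by (cases "i = rad"; cases "j = rad") (simp_all add: warp_def smooth_fun_const)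
  qed
  moreover have "0 < det (warp (H q))" if "q \<in> fst c" for q
    using pos that by (intro warp_det_pos) blast
  moreover have "sqrt (det (g c q)) = (snd c q $ rad) ^ (CARD('n) - 1) * sqrt (det (warp (H q)))"
    if q: "q \<in> fst c \<inter> cint C" for q
  proof -
    have "det (g c q) = ((snd c q $ rad) ^ (CARD('n) - 1))\<^sup>2 * det (warp (H q))"
      by (rule conic_det) (use form q in blast)
    then show ?thesis using rad_nonneg[OF c, of q] q by (simp add: real_sqrt_mult)
  qed
  moreover have "p \<in> fst c" using l(2) by (simp add: c_def)
  ultimately show ?thesis by (intro that[of c H] c ballI)
qed

text \<open>Near a boundary point, in charts with conic form on both sides, the distortion is the product of three
  bounded factors: the Jacobian of \<open>h\<close> in coordinates, the \<open>n - 1\<close>st power of the quotient of the radii of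
  \<open>h p\<close> and \<open>p\<close>, and a quotient \<open>s\<close> of functions that are positive and smooth up to the boundary.\<close>

lemma dens_bounded:
  assumes h: "diffeo_pair h f"
  shows "\<exists>B. \<forall>p\<in>cint C. dens h p \<le> B"
proof -
  have "\<exists>B. \<forall>p\<in>topspace (cres C). p \<in> cint C \<longrightarrow> dens h p \<le> B"
  proof (rule compact_uniform_bound)
    fix p assume p: "p \<in> topspace (cres C)"
    show "\<exists>V B. openin (cres C) V \<and> p \<in> V \<and> (\<forall>q\<in>V. q \<in> cint C \<longrightarrow> dens h q \<le> B)"
    proof (cases "p \<in> cint C")
      case True
      from smooth_fun_locally_bounded[OF dens_smooth[OF h] cint_openin True]
      obtain V B where V: "openin (cres C) V" "p \<in> V" "\<forall>q\<in>V. norm (dens h q) \<le> B" by metis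
      have "dens h q \<le> B" if "q \<in> V" for q using V(3) that by (metis abs_le_D1 real_norm_def)
      then show ?thesis using V by blast
    next
      case False
      obtain c and H :: "'p \<Rightarrow> 'n rmat" where c: "c \<in> catlas C" "p \<in> fst c" and Hs: "smooth_fun (catlas C) (fst c) (\<lambda>q. det (warp (H q)))"
        and Hp: "\<forall>q\<in>fst c. 0 < det (warp (H q))"
        and gc: "\<forall>q\<in>fst c \<inter> cint C. sqrt (det (g c q)) = (snd c q $ rad) ^ (CARD('n) - 1) * sqrt (det (warp (H q)))"
        by (rule conic_chart[OF p False])
      have hp: "h p \<in> topspace (cres C)" "h p \<notin> cint C"
        using diffeo_pair_in[OF h p] diffeo_pair_cint_iff[OF h p] False by auto
      obtain d and H' :: "'p \<Rightarrow> 'n rmat" where d: "d \<in> catlas C" "h p \<in> fst d" and Hs': "smooth_fun (catlas C) (fst d) (\<lambda>q. det (warp (H' q)))"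
        and Hp': "\<forall>q\<in>fst d. 0 < det (warp (H' q))"
        and gd: "\<forall>q\<in>fst d \<inter> cint C. sqrt (det (g d q)) = (snd d q $ rad) ^ (CARD('n) - 1) * sqrt (det (warp (H' q)))"
        by (rule conic_chart[OF hp])
      obtain V M where V: "openin (cres C) V" "p \<in> V" "V \<subseteq> fst c \<inter> h -` fst d" and M: "0 \<le> M"
        and det: "\<forall>q\<in>V \<inter> cint C. \<bar>det (jac h c d q)\<bar> \<le> M"
        and rad: "\<forall>q\<in>V \<inter> cint C. snd d (h q) $ rad \<le> M * snd c q $ rad"
        by (rule local_Jacobian_and_radius_bound[OF h c(1) d(1) p False c(2) d(2)])
      define s where "s = (\<lambda>q. sqrt (det (warp (H' (h q)))) / sqrt (det (warp (H q))))"
      have "smooth_fun (catlas C) V s"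
        unfolding s_def
      proof (intro smooth_fun_divide smooth_fun_sqrt)
        show "smooth_fun (catlas C) V (\<lambda>q. det (warp (H' (h q))))"
          by (rule smooth_fun_subset[OF smooth_fun_pullback[OF diffeo_pair_smooth[OF h] Hs']]) (use V in blast)
        show "smooth_fun (catlas C) V (\<lambda>q. det (warp (H q)))"
          by (rule smooth_fun_subset[OF Hs]) (use V in blast)
        show "0 < det (warp (H' (h q)))" "0 < det (warp (H q))" "sqrt (det (warp (H q))) \<noteq> 0" if "q \<in> V" for q
          using that V Hp Hp' by (auto simp: less_imp_neq[symmetric] dest!: subsetD)
      qed
      from smooth_fun_locally_bounded[OF this V(1,2)]
      obtain V' B where V': "openin (cres C) V'" "p \<in> V'" "V' \<subseteq> V" "\<forall>q\<in>V'. norm (s q) \<le> B" by metis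
      let ?m = "CARD('n) - 1"
      have "dens h q \<le> M * M ^ ?m * B" if q: "q \<in> V'" "q \<in> cint C" for q
      proof -
        have qV: "q \<in> V \<inter> cint C" and qc: "q \<in> fst c" and qd: "h q \<in> fst d" and hq: "h q \<in> cint C"
          using q V V' diffeo_pair_cint[OF h q(2)] by auto
        define r where "r = snd c q $ rad"
        define r' where "r' = snd d (h q) $ rad"
        have r: "0 < r" unfolding r_def using cint_iff[OF c(1) qc] q by simp
        have r': "0 \<le> r'" unfolding r'_def by (rule rad_nonneg[OF d(1) qd])
        have s0: "0 \<le> s q" using Hp Hp' qc qd by (simp add: s_def less_imp_le)
        have "r' \<le> M * r" using rad qV by (simp add: r_def r'_def)
        then have rr: "r' ^ ?m / r ^ ?m \<le> M ^ ?m"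
          using power_mono[of r' "M * r" ?m] r r' by (simp add: power_mult_distrib divide_le_eq)
        have "dens h q = \<bar>det (jac h c d q)\<bar> * (r' ^ ?m / r ^ ?m) * s q"
          unfolding dens_eq[OF h c(1) d(1) q(2) qc qd] dens_in_def
          using gc gd qc q(2) qd hq by (simp add: s_def r_def r'_def)
        also have "\<dots> \<le> M * M ^ ?m * B"
          using det qV rr M s0 V'(4) q(1) r r' by (intro mult_mono) auto
        finally show ?thesis .
      qed
      then show ?thesis using V' by blast
    qed
  qed auto
  then show ?thesis using cint_subset by blast
qed

end

section \<open>Square integrable sections\<close>

locale L2_mfd = metric_bundle_mfd C K E + volume_mfd C g vol
  for C :: "('x, 'l, 'p, 'n::{finite,wellorder}) conical" and K E g vol
begin

text \<open>Measurability is local, because countably many of the small open sets suffice to cover.\<close>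

lemma measurable_glue:
  assumes W: "openin (cres C) W" "W \<subseteq> cint C"
    and local: "\<And>p. p \<in> W \<Longrightarrow> \<exists>V. openin (cres C) V \<and> p \<in> V \<and> V \<subseteq> W \<and> u \<in> measurable (restrict_space vol V) N"
  shows "u \<in> measurable (restrict_space vol W) N"
proof -
  have sW: "space (restrict_space vol W) = W"
    using W(2) by (simp add: space_restrict_space space_vol inf.absorb1)
  have "u \<in> measurable (restrict_space vol {}) N" by (simp add: measurable_def space_restrict_space)
  then obtain V :: "nat \<Rightarrow> 'p set" where V: "\<And>i. openin (cres C) (V i)" "\<And>i. V i \<subseteq> W"
    "\<And>i. u \<in> measurable (restrict_space vol (V i)) N" "(\<Union>i. V i) = W"
    using countable_open_cover[OF W(1), of "\<lambda>V. u \<in> measurable (restrict_space vol V) N", OF local] by metis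
  show ?thesis
  proof (rule measurable_piecewise_restrict[of "range V"])
    show "space (restrict_space vol W) \<subseteq> \<Union> (range V)" using V(4) sW by simp
    fix \<Omega> assume "\<Omega> \<in> range V"
    then obtain i where i: "\<Omega> = V i" by blast
    have o: "W \<inter> V i \<in> sets vol" by (rule openin_sets_vol) (use V W in auto)
    then show "\<Omega> \<inter> space (restrict_space vol W) \<in> sets (restrict_space vol W)"
    proof -
      have "W \<inter> space vol \<in> sets vol" using openin_sets_vol[OF W] W(2) by (simp add: space_vol inf.absorb1)
      then show ?thesis using o unfolding i sW by (simp add: sets_restrict_space_iff Int_commute)
    qed
    have "restrict_space (restrict_space vol W) (V i) = restrict_space vol (V i)"
    proof -
      have "U \<inter> space vol \<in> sets vol" if "openin (cres C) U" "U \<subseteq> W" for U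
        using openin_sets_vol[of U] that W(2) by (simp add: space_vol inf.absorb1)
      then have "restrict_space (restrict_space vol W) (V i) = restrict_space vol (W \<inter> V i)"
        using V(1,2)[of i] W(1) by (intro restrict_restrict_space) auto
      then show ?thesis using V(2)[of i] by (simp add: inf.absorb2)
    qed
    then show "u \<in> measurable (restrict_space (restrict_space vol W) \<Omega>) N" using V(3) i by simp
  qed simp
qed

definition msec :: "('p \<Rightarrow> cvec) set"
  where "msec = {s \<in> sections C E. \<forall>t\<in>trivs E. \<forall>j<trank t. (\<lambda>p. tmap t p (s p) j) \<in>
      borel_measurable (restrict_space vol (tdom t \<inter> cint C))}"

lemma msec_sections: "s \<in> msec \<Longrightarrow> s \<in> sections C E"
  and msec_coord: "s \<in> msec \<Longrightarrow> t \<in> trivs E \<Longrightarrow> j < trank t \<Longrightarrow>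
    (\<lambda>p. tmap t p (s p) j) \<in> borel_measurable (restrict_space vol (tdom t \<inter> cint C))"
  by (simp_all add: msec_def)

lemma msec_fibre: "s \<in> msec \<Longrightarrow> p \<in> cint C \<Longrightarrow> s p \<in> fibre E p"
  using section_fibre[OF msec_sections] .

lemma cint_top: "p \<in> cint C \<Longrightarrow> p \<in> topspace (cres C)"
  using cint_subset by blast

lemma triv_cint_openin: "t \<in> trivs E \<Longrightarrow> openin (cres C) (tdom t \<inter> cint C)"
  by (intro openin_Int triv_openin cint_openin)

lemma space_triv: "t \<in> trivs E \<Longrightarrow> space (restrict_space vol (tdom t \<inter> cint C)) = tdom t \<inter> cint C"
  by (auto simp: space_restrict_space space_vol)

lemma restrict_measurable: "u \<in> measurable vol N \<Longrightarrow> u \<in> measurable (restrict_space vol W) N"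
  by (rule measurable_restrict_space1)

lemma measurable_cintI:
  assumes "u \<in> measurable (restrict_space vol (cint C)) N"
  shows "u \<in> measurable vol N"
proof -
  have "sets (restrict_space vol (cint C)) = sets vol"
    unfolding sets_restrict_space space_vol[symmetric]
    by (metis (no_types, lifting) image_cong image_ident sets.Int_space_eq1)
  then have "measurable (restrict_space vol (cint C)) N = measurable vol N"
    by (rule measurable_cong_sets) simp
  then show ?thesis using assms by simp
qed

lemma measurable_localI:
  assumes "\<And>t. t \<in> trivs E \<Longrightarrow> u \<in> measurable (restrict_space vol (tdom t \<inter> cint C)) N"
  shows "u \<in> measurable vol N"
proof (rule measurable_cintI, rule measurable_glue)
  fix p assume p: "p \<in> cint C"
  then obtain t where "t \<in> trivs E" "p \<in> tdom t" using triv_exists cint_top by blast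
  then show "\<exists>V. openin (cres C) V \<and> p \<in> V \<and> V \<subseteq> cint C \<and> u \<in> measurable (restrict_space vol V) N"
    using assms triv_cint_openin p by (intro exI[of _ "tdom t \<inter> cint C"]) auto
qed (auto intro: cint_openin)

lemma metric_measurable:
  assumes s: "s \<in> msec" and u: "u \<in> msec"
  shows "(\<lambda>p. fmetric E p (s p) (u p)) \<in> borel_measurable vol"
proof (rule measurable_localI)
  fix t assume t: "t \<in> trivs E"
  let ?W = "tdom t \<inter> cint C"
  obtain H where H: "\<And>l j. smooth_fun (catlas C) (tdom t) (H l j)"
    "\<And>p v w. p \<in> tdom t \<Longrightarrow> v \<in> fibre E p \<Longrightarrow> w \<in> fibre E p \<Longrightarrow> fmetric E p v w =
        (\<Sum>l<trank t. \<Sum>j<trank t. H l j p * tmap t p v l * cnj (tmap t p w j))"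
    using metric_coord[OF t] by blast
  have Hm: "H l j \<in> borel_measurable (restrict_space vol ?W)" for l j
    by (rule smooth_fun_measurable[OF smooth_fun_subset[OF H(1)] triv_cint_openin[OF t]]) auto
  have "(\<lambda>p. \<Sum>l<trank t. \<Sum>j<trank t. H l j p * tmap t p (s p) l * cnj (tmap t p (u p) j))
      \<in> borel_measurable (restrict_space vol ?W)"
    using msec_coord[OF s t] msec_coord[OF u t]
    by (intro borel_measurable_sum borel_measurable_times Hm
        borel_measurable_continuous_on[OF continuous_on_cnj[OF continuous_on_id], simplified]) auto
  then show "(\<lambda>p. fmetric E p (s p) (u p)) \<in> borel_measurable (restrict_space vol ?W)"
    by (rule measurable_cong[THEN iffD1, rotated])
      (auto simp: space_triv[OF t] H(2) msec_fibre[OF s] msec_fibre[OF u])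
qed

text \<open>The squared norm with values in \<open>[0, \<infinity>]\<close>: a measurable section is square integrable if and only if it
  is finite, and it can be estimated before finiteness is known.\<close>

definition N2 :: "('p \<Rightarrow> cvec) \<Rightarrow> ennreal"
  where "N2 s = (\<integral>\<^sup>+p. ennreal (nsq p (s p)) \<partial>vol)"

lemma nsq_measurable: "s \<in> msec \<Longrightarrow> (\<lambda>p. nsq p (s p)) \<in> borel_measurable vol"
  unfolding nsq_def using metric_measurable[of s s] by measurable

lemma nsq_nonneg_sec: "s \<in> msec \<Longrightarrow> p \<in> cint C \<Longrightarrow> 0 \<le> nsq p (s p)"
  using nsq_nonneg msec_fibre cint_top by blast

lemma integrable_metric_self:
  assumes "s \<in> msec"
  shows "integrable vol (\<lambda>p. fmetric E p (s p) (s p)) \<longleftrightarrow> integrable vol (\<lambda>p. nsq p (s p))"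
proof -
  have "integrable vol (\<lambda>p. fmetric E p (s p) (s p)) \<longleftrightarrow>
      integrable vol (\<lambda>p. complex_of_real (nsq p (s p)))"
    by (rule Bochner_Integration.integrable_cong)
      (auto simp: space_vol metric_self[OF cint_top msec_fibre[OF assms]])
  also have "\<dots> \<longleftrightarrow> integrable vol (\<lambda>p. nsq p (s p))"
    using integrable_Re[of vol "\<lambda>p. complex_of_real (nsq p (s p))"]
      integrable_of_real[of vol "\<lambda>p. nsq p (s p)"] by auto
  finally show ?thesis .
qed

lemma integrable_nsq_iff: "s \<in> msec \<Longrightarrow> integrable vol (\<lambda>p. nsq p (s p)) \<longleftrightarrow> N2 s < \<infinity>"
proof -
  assume s: "s \<in> msec"
  have "(\<integral>\<^sup>+p. ennreal (norm (nsq p (s p))) \<partial>vol) = N2 s"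
    unfolding N2_def using nsq_nonneg_sec[OF s] by (intro nn_integral_cong) (simp add: space_vol)
  then show ?thesis using nsq_measurable[OF s] by (simp add: integrable_iff_bounded)
qed

lemma L2_iff: "s \<in> L2_sections C vol E \<longleftrightarrow> s \<in> msec \<and> N2 s < \<infinity>"
proof -
  have "s \<in> L2_sections C vol E \<longleftrightarrow> s \<in> msec \<and> integrable vol (\<lambda>p. fmetric E p (s p) (s p))"
    unfolding L2_sections_def msec_def by blast
  then show ?thesis using integrable_metric_self integrable_nsq_iff by blast
qed

lemma L2_norm_square:
  assumes "s \<in> L2_sections C vol E"
  shows "N2 s = ennreal ((L2_norm vol E s)\<^sup>2)" "0 \<le> L2_norm vol E s"
proof -
  have s: "s \<in> msec" "N2 s < \<infinity>" using assms L2_iff by auto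
  have int: "integrable vol (\<lambda>p. nsq p (s p))" using s integrable_nsq_iff by blast
  have "L2_inner vol E s s = (\<integral>p. complex_of_real (nsq p (s p)) \<partial>vol)"
    unfolding L2_inner_def
    by (rule Bochner_Integration.integral_cong)
      (auto simp: space_vol metric_self[OF cint_top msec_fibre[OF s(1)]])
  then have L: "Re (L2_inner vol E s s) = (\<integral>p. nsq p (s p) \<partial>vol)" by simp
  have nn: "0 \<le> (\<integral>p. nsq p (s p) \<partial>vol)"
    using nsq_nonneg_sec[OF s(1)] by (intro integral_nonneg_AE) (auto simp: space_vol)
  have "N2 s = ennreal (\<integral>p. nsq p (s p) \<partial>vol)"
    unfolding N2_def using nsq_nonneg_sec[OF s(1)]
    by (intro nn_integral_eq_integral int) (auto simp: space_vol)
  then show "N2 s = ennreal ((L2_norm vol E s)\<^sup>2)" "0 \<le> L2_norm vol E s"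
    using nn by (simp_all add: L2_norm_def L)
qed

lemma msec_add:
  assumes s: "s \<in> msec" and u: "u \<in> msec"
  shows "(\<lambda>p j. s p j + u p j) \<in> msec"
  unfolding msec_def
proof (intro CollectI conjI ballI allI impI)
  show "(\<lambda>p j. s p j + u p j) \<in> sections C E"
    unfolding sections_def using fibre_add[OF cint_top] msec_fibre[OF s] msec_fibre[OF u]
      section_outside[OF msec_sections[OF s]] section_outside[OF msec_sections[OF u]] by auto
  fix t j assume t: "t \<in> trivs E" and j: "j < trank t"
  have "(\<lambda>p. tmap t p (s p) j + tmap t p (u p) j) \<in> borel_measurable (restrict_space vol (tdom t \<inter> cint C))"
    by (intro borel_measurable_add msec_coord s u t j)
  then show "(\<lambda>p. tmap t p (\<lambda>j. s p j + u p j) j) \<in> borel_measurable (restrict_space vol (tdom t \<inter> cint C))"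
    by (rule measurable_cong[THEN iffD1, rotated])
      (auto simp: space_triv[OF t] triv_add[OF t] msec_fibre[OF s] msec_fibre[OF u])
qed

lemma msec_mult:
  assumes s: "s \<in> msec" and a: "a \<in> borel_measurable vol" "\<And>p. p \<in> cint C \<Longrightarrow> a p \<in> K"
  shows "(\<lambda>p j. a p * s p j) \<in> msec"
  unfolding msec_def
proof (intro CollectI conjI ballI allI impI)
  show "(\<lambda>p j. a p * s p j) \<in> sections C E"
    unfolding sections_def using fibre_scale[OF cint_top] msec_fibre[OF s] a(2)
      section_outside[OF msec_sections[OF s]] by auto
  fix t j assume t: "t \<in> trivs E" and j: "j < trank t"
  have "(\<lambda>p. a p * tmap t p (s p) j) \<in> borel_measurable (restrict_space vol (tdom t \<inter> cint C))"
    by (intro borel_measurable_times restrict_measurable a msec_coord s t j)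
  then show "(\<lambda>p. tmap t p (\<lambda>j. a p * s p j) j) \<in> borel_measurable (restrict_space vol (tdom t \<inter> cint C))"
    by (rule measurable_cong[THEN iffD1, rotated])
      (auto simp: space_triv[OF t] triv_scale[OF t] msec_fibre[OF s] a(2))
qed

definition rmult :: "('p \<Rightarrow> real) \<Rightarrow> ('p \<Rightarrow> cvec) \<Rightarrow> 'p \<Rightarrow> cvec"
  where "rmult u s = (\<lambda>p j. complex_of_real (u p) * s p j)"

lemma msec_rmult: "s \<in> msec \<Longrightarrow> u \<in> borel_measurable vol \<Longrightarrow> rmult u s \<in> msec"
  unfolding rmult_def by (rule msec_mult) auto

lemma nsq_rmult: "s \<in> msec \<Longrightarrow> p \<in> cint C \<Longrightarrow> nsq p (rmult u s p) = (u p)\<^sup>2 * nsq p (s p)"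
  unfolding rmult_def using nsq_scale[OF cint_top K_of_real msec_fibre] by simp

lemma N2_rmult: "s \<in> msec \<Longrightarrow> N2 (rmult u s) = (\<integral>\<^sup>+p. ennreal ((u p)\<^sup>2 * nsq p (s p)) \<partial>vol)"
  unfolding N2_def by (intro nn_integral_cong) (simp add: nsq_rmult space_vol)

lemma N2_mono:
  assumes "\<And>p. p \<in> cint C \<Longrightarrow> nsq p (s p) \<le> b * nsq p (u p)" "0 \<le> b" "u \<in> msec"
  shows "N2 s \<le> ennreal b * N2 u"
proof -
  have "N2 s \<le> (\<integral>\<^sup>+p. ennreal b * ennreal (nsq p (u p)) \<partial>vol)"
    unfolding N2_def using assms(1,2)
    by (intro nn_integral_mono) (auto simp: space_vol simp flip: ennreal_mult' intro!: ennreal_leI)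
  also have "\<dots> = ennreal b * N2 u"
    unfolding N2_def using nsq_measurable[OF assms(3)] by (intro nn_integral_cmult) measurable
  finally show ?thesis .
qed

lemma N2_add_le:
  assumes s: "s \<in> msec" and u: "u \<in> msec"
  shows "N2 (\<lambda>p j. s p j + u p j) \<le> 2 * N2 s + 2 * N2 u"
proof -
  have "N2 (\<lambda>p j. s p j + u p j) \<le> (\<integral>\<^sup>+p. 2 * ennreal (nsq p (s p)) + 2 * ennreal (nsq p (u p)) \<partial>vol)"
    unfolding N2_def
  proof (rule nn_integral_mono)
    fix p assume "p \<in> space vol"
    then have p: "p \<in> cint C" by (simp add: space_vol)
    have "ennreal (nsq p (\<lambda>j. s p j + u p j)) \<le> ennreal (2 * nsq p (s p) + 2 * nsq p (u p))"
      by (intro ennreal_leI nsq_add_le cint_top p msec_fibre s u)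
    also have "\<dots> = 2 * ennreal (nsq p (s p)) + 2 * ennreal (nsq p (u p))"
      using nsq_nonneg_sec[OF s p] nsq_nonneg_sec[OF u p] by (simp add: ennreal_mult')
    finally show "ennreal (nsq p (\<lambda>j. s p j + u p j)) \<le> 2 * ennreal (nsq p (s p)) + 2 * ennreal (nsq p (u p))" .
  qed
  also have "\<dots> = 2 * N2 s + 2 * N2 u"
    unfolding N2_def using nsq_measurable[OF s] nsq_measurable[OF u]
    by (subst nn_integral_add) (auto simp: nn_integral_cmult)
  finally show ?thesis .
qed

lemma L2_add: "s \<in> L2_sections C vol E \<Longrightarrow> u \<in> L2_sections C vol E \<Longrightarrow>
    (\<lambda>p j. s p j + u p j) \<in> L2_sections C vol E"
  unfolding L2_iff
proof (elim conjE, intro conjI)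
  assume s: "s \<in> msec" "N2 s < \<infinity>" and u: "u \<in> msec" "N2 u < \<infinity>"
  show "(\<lambda>p j. s p j + u p j) \<in> msec" by (rule msec_add[OF s(1) u(1)])
  have "2 * N2 s + 2 * N2 u < \<infinity>"
    using s(2) u(2) by (simp add: ennreal_mult_less_top ennreal_add_eq_top less_top)
  then show "N2 (\<lambda>p j. s p j + u p j) < \<infinity>" using N2_add_le[OF s(1) u(1)] by (rule order_le_less_trans[rotated])
qed

lemma N2_scale:
  assumes "s \<in> msec" "a \<in> K"
  shows "N2 (\<lambda>p j. a * s p j) = ennreal ((cmod a)\<^sup>2) * N2 s"
proof -
  have "N2 (\<lambda>p j. a * s p j) = (\<integral>\<^sup>+p. ennreal ((cmod a)\<^sup>2) * ennreal (nsq p (s p)) \<partial>vol)"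
    unfolding N2_def using nsq_scale[OF cint_top assms(2) msec_fibre[OF assms(1)]]
    by (intro nn_integral_cong) (simp add: space_vol flip: ennreal_mult')
  also have "\<dots> = ennreal ((cmod a)\<^sup>2) * N2 s"
    unfolding N2_def using nsq_measurable[OF assms(1)] by (intro nn_integral_cmult) measurable
  finally show ?thesis .
qed

lemma L2_scale: "s \<in> L2_sections C vol E \<Longrightarrow> a \<in> K \<Longrightarrow> (\<lambda>p j. a * s p j) \<in> L2_sections C vol E"
  unfolding L2_iff using N2_scale[of s a] msec_mult[of s "\<lambda>p. a"]
  by (simp add: ennreal_mult_less_top less_top)

lemma L2_diff: "s \<in> L2_sections C vol E \<Longrightarrow> u \<in> L2_sections C vol E \<Longrightarrow>
    (\<lambda>p j. s p j - u p j) \<in> L2_sections C vol E"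
  using L2_add[OF _ L2_scale[OF _ K_minus[OF K_1]], of s u] by simp

lemma N2_diff_le:
  assumes s: "s \<in> msec" and u: "u \<in> msec"
  shows "N2 (\<lambda>p j. s p j - u p j) \<le> 2 * N2 s + 2 * N2 u"
proof -
  have m: "(\<lambda>p j. (-1) * u p j) \<in> msec" by (rule msec_mult[OF u]) (auto intro: K_minus)
  show ?thesis using N2_add_le[OF s m] N2_scale[OF u K_minus[OF K_1]] by simp
qed

lemma N2_zero_imp:
  assumes s: "s \<in> msec" and "N2 s = 0"
  shows "AE p in vol. s p = (\<lambda>j. 0)"
proof -
  have "AE p in vol. ennreal (nsq p (s p)) = 0"
    using assms nsq_measurable[OF s] unfolding N2_def by (subst (asm) nn_integral_0_iff_AE) auto
  then show ?thesis
  proof (rule AE_mp, intro AE_I2 impI)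
    fix p assume "p \<in> space vol" and 0: "ennreal (nsq p (s p)) = 0"
    then have p: "p \<in> cint C" by (simp add: space_vol)
    have "nsq p (s p) = 0" using 0 nsq_nonneg_sec[OF s p] by simp
    then show "s p = (\<lambda>j. 0)" using nsq_eq_0[OF cint_top[OF p] msec_fibre[OF s p]] by simp
  qed
qed

lemma N2_cong_AE:
  assumes "AE p in vol. s p = u p"
  shows "N2 s = N2 u"
  unfolding N2_def by (rule nn_integral_cong_AE) (use assms in auto)

text \<open>All approximations below are of this kind: the section is fixed and only a scalar factor varies.
  Dominated convergence applies with majorant \<open>4 u\<^sup>2 \<bar>e\<bar>\<^sup>2\<close>, as \<open>\<bar>u - v\<^sub>i\<bar> \<le> 2 \<bar>u\<bar>\<close>.\<close>

lemma N2_dominated: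
  assumes e: "e \<in> msec" and u: "u \<in> borel_measurable vol" "\<And>i. v i \<in> borel_measurable vol"
    and dom: "\<And>i p. p \<in> cint C \<Longrightarrow> \<bar>v i p\<bar> \<le> \<bar>u p\<bar>"
    and lim: "\<And>p. p \<in> cint C \<Longrightarrow> (\<lambda>i. v i p) \<longlonglongrightarrow> u p"
    and fin: "N2 (rmult u e) < \<infinity>"
  shows "(\<lambda>i. N2 (\<lambda>p j. rmult u e p j - rmult (v i) e p j)) \<longlonglongrightarrow> 0"
proof -
  have eq: "N2 (\<lambda>p j. rmult u e p j - rmult (v i) e p j) = (\<integral>\<^sup>+p. ennreal ((u p - v i p)\<^sup>2 * nsq p (e p)) \<partial>vol)" for i
    using N2_rmult[OF e, of "\<lambda>p. u p - v i p"] by (simp add: rmult_def left_diff_distrib)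
  have nm: "(\<lambda>p. nsq p (e p)) \<in> borel_measurable vol" by (rule nsq_measurable[OF e])
  have "(\<lambda>i. \<integral>\<^sup>+p. ennreal ((u p - v i p)\<^sup>2 * nsq p (e p)) \<partial>vol) \<longlonglongrightarrow> (\<integral>\<^sup>+p. 0 \<partial>vol)"
  proof (rule nn_integral_dominated_convergence[where w = "\<lambda>p. ennreal (4 * ((u p)\<^sup>2 * nsq p (e p)))"])
    show "(\<lambda>p. ennreal ((u p - v i p)\<^sup>2 * nsq p (e p))) \<in> borel_measurable vol" for i
      using u nm by measurable
    show "(\<lambda>p. ennreal (4 * ((u p)\<^sup>2 * nsq p (e p)))) \<in> borel_measurable vol" using u nm by measurable
    have "(\<integral>\<^sup>+p. ennreal (4 * ((u p)\<^sup>2 * nsq p (e p))) \<partial>vol) = 4 * N2 (rmult u e)"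
      unfolding N2_rmult[OF e] using u nm by (subst nn_integral_cmult[symmetric]) (auto simp: ennreal_mult')
    then show "(\<integral>\<^sup>+p. ennreal (4 * ((u p)\<^sup>2 * nsq p (e p))) \<partial>vol) < \<infinity>"
      using fin by (simp add: ennreal_mult_less_top)
    show "AE p in vol. ennreal ((u p - v i p)\<^sup>2 * nsq p (e p)) \<le> ennreal (4 * ((u p)\<^sup>2 * nsq p (e p)))" for i
    proof (intro AE_I2 ennreal_leI)
      fix p assume "p \<in> space vol"
      then have p: "p \<in> cint C" by (simp add: space_vol)
      have "\<bar>u p - v i p\<bar> \<le> 2 * \<bar>u p\<bar>" using dom[OF p, of i] by linarith
      then have "\<bar>u p - v i p\<bar>\<^sup>2 \<le> (2 * \<bar>u p\<bar>)\<^sup>2" by (rule power_mono) simp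
      then have "(u p - v i p)\<^sup>2 \<le> 4 * (u p)\<^sup>2" by (simp add: power_mult_distrib)
      then show "(u p - v i p)\<^sup>2 * nsq p (e p) \<le> 4 * ((u p)\<^sup>2 * nsq p (e p))"
        using mult_right_mono[OF _ nsq_nonneg_sec[OF e p]] by (metis mult.assoc)
    qed
    show "AE p in vol. (\<lambda>i. ennreal ((u p - v i p)\<^sup>2 * nsq p (e p))) \<longlonglongrightarrow> 0"
    proof (intro AE_I2)
      fix p assume "p \<in> space vol"
      then have p: "p \<in> cint C" by (simp add: space_vol)
      have "(\<lambda>i. (u p - v i p)\<^sup>2 * nsq p (e p)) \<longlonglongrightarrow> (u p - u p)\<^sup>2 * nsq p (e p)"
        by (intro tendsto_intros lim p)
      then show "(\<lambda>i. ennreal ((u p - v i p)\<^sup>2 * nsq p (e p))) \<longlonglongrightarrow> 0"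
        using tendsto_ennrealI by fastforce
    qed
  qed auto
  then show ?thesis unfolding eq by simp
qed

subsection \<open>Bounded operators\<close>

lemma bounded_operatorD:
  assumes "L2_bounded_operator K C vol E T"
  shows "s \<in> L2_sections C vol E \<Longrightarrow> T s \<in> L2_sections C vol E"
    and "s \<in> L2_sections C vol E \<Longrightarrow> u \<in> L2_sections C vol E \<Longrightarrow>
      AE p in vol. T (\<lambda>p j. s p j + u p j) p = (\<lambda>j. T s p j + T u p j)"
    and "a \<in> K \<Longrightarrow> s \<in> L2_sections C vol E \<Longrightarrow> AE p in vol. T (\<lambda>p j. a * s p j) p = (\<lambda>j. a * T s p j)"
  using assms unfolding L2_bounded_operator_def L2_eq_def by blast+

lemma bounded_operator_N2:
  assumes "L2_bounded_operator K C vol E T"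
  obtains b where "0 \<le> b" "\<And>s. s \<in> L2_sections C vol E \<Longrightarrow> N2 (T s) \<le> ennreal b * N2 s"
proof -
  obtain b where b: "\<And>s. s \<in> L2_sections C vol E \<Longrightarrow> L2_norm vol E (T s) \<le> b * L2_norm vol E s"
    using assms unfolding L2_bounded_operator_def by blast
  have "N2 (T s) \<le> ennreal (b\<^sup>2) * N2 s" if s: "s \<in> L2_sections C vol E" for s
  proof -
    note Ts = bounded_operatorD(1)[OF assms s]
    have "(L2_norm vol E (T s))\<^sup>2 \<le> (b * L2_norm vol E s)\<^sup>2"
      using b[OF s] L2_norm_square(2)[OF Ts] by (rule power_mono)
    then show ?thesis
      unfolding L2_norm_square(1)[OF s] L2_norm_square(1)[OF Ts]
      by (simp add: power_mult_distrib flip: ennreal_mult)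
  qed
  then show ?thesis using that[of "b\<^sup>2"] by simp
qed

lemma bounded_operatorI:
  assumes lin: "\<And>s u. s \<in> L2_sections C vol E \<Longrightarrow> u \<in> L2_sections C vol E \<Longrightarrow>
      T (\<lambda>p j. s p j + u p j) = (\<lambda>p j. T s p j + T u p j)"
    "\<And>a s. a \<in> K \<Longrightarrow> s \<in> L2_sections C vol E \<Longrightarrow> T (\<lambda>p j. a * s p j) = (\<lambda>p j. a * T s p j)"
    and m: "\<And>s. s \<in> L2_sections C vol E \<Longrightarrow> T s \<in> msec"
    and b: "0 \<le> b" "\<And>s. s \<in> L2_sections C vol E \<Longrightarrow> N2 (T s) \<le> ennreal b * N2 s"
  shows "L2_bounded_operator K C vol E T"
proof -
  have L2: "T s \<in> L2_sections C vol E" if s: "s \<in> L2_sections C vol E" for s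
  proof -
    have "ennreal b * N2 s < \<infinity>" using s by (simp add: L2_iff ennreal_mult_less_top)
    then have "N2 (T s) < \<infinity>" using b(2)[OF s] by (rule order_le_less_trans[rotated])
    then show ?thesis using m[OF s] L2_iff by blast
  qed
  have "L2_norm vol E (T s) \<le> sqrt b * L2_norm vol E s" if s: "s \<in> L2_sections C vol E" for s
  proof -
    have "ennreal ((L2_norm vol E (T s))\<^sup>2) \<le> ennreal (b * (L2_norm vol E s)\<^sup>2)"
      using b(2)[OF s] b(1)
      unfolding L2_norm_square(1)[OF s] L2_norm_square(1)[OF L2[OF s]] by (simp add: ennreal_mult)
    then have "(L2_norm vol E (T s))\<^sup>2 \<le> b * (L2_norm vol E s)\<^sup>2" using b(1) by (simp add: ennreal_le_iff)
    then have "sqrt ((L2_norm vol E (T s))\<^sup>2) \<le> sqrt (b * (L2_norm vol E s)\<^sup>2)" by (rule real_sqrt_le_mono)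
    then show ?thesis using L2_norm_square(2)[OF s] L2_norm_square(2)[OF L2[OF s]] by (simp add: real_sqrt_mult)
  qed
  then have "\<exists>b. \<forall>s\<in>L2_sections C vol E. L2_norm vol E (T s) \<le> b * L2_norm vol E s" by blast
  moreover have "AE p in vol. T (\<lambda>p j. s p j + u p j) p = (\<lambda>j. T s p j + T u p j)"
    if "s \<in> L2_sections C vol E" "u \<in> L2_sections C vol E" for s u
  proof -
    have "T (\<lambda>p j. s p j + u p j) = (\<lambda>p j. T s p j + T u p j)" by (rule lin(1)[OF that])
    then show ?thesis by (simp only:) (rule AE_I2, rule refl)
  qed
  moreover have "AE p in vol. T (\<lambda>p j. a * s p j) p = (\<lambda>j. a * T s p j)"
    if "a \<in> K" "s \<in> L2_sections C vol E" for a s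
  proof -
    have "T (\<lambda>p j. a * s p j) = (\<lambda>p j. a * T s p j)" by (rule lin(2)[OF that])
    then show ?thesis by (simp only:) (rule AE_I2, rule refl)
  qed
  ultimately show ?thesis
    unfolding L2_bounded_operator_def L2_eq_def using L2 by (intro conjI ballI)
qed

end

section \<open>Density of the compactly supported smooth sections\<close>

subsection \<open>Smooth approximations of the indicator function of an open set\<close>

text \<open>As \<open>i\<close> grows, the support exhausts the box and the arguments of the flat function tend to infinity,
  where the flat function tends to \<open>1\<close>.\<close>

definition box_bump :: "real^'n \<Rightarrow> real^'n \<Rightarrow> nat \<Rightarrow> real^'n \<Rightarrow> real"
  where "box_bump a b i x =
    (\<Prod>j\<in>UNIV. flat (real (Suc i) * (x $ j - a $ j) - 1) * flat (real (Suc i) * (b $ j - x $ j) - 1))"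

lemma flat_nonneg: "0 \<le> flat x" and flat_le_1: "flat x \<le> 1"
  by (cases "0 < x"; simp add: flat_pos flat_nonpos)+

lemma box_bump_smooth: "smooth_on S (box_bump a b i)"
  unfolding box_bump_def[abs_def]
  by (intro smooth_on_prod smooth_on_mult smooth_on_flat smooth_on_diff smooth_on_const smooth_on_nth smooth_on_id)

lemma box_bump_bounds: "0 \<le> box_bump a b i x" "box_bump a b i x \<le> 1"
  unfolding box_bump_def
  by (auto intro!: prod_nonneg prod_le_1 mult_nonneg_nonneg mult_le_one simp: flat_nonneg flat_le_1)

lemma box_bump_support:
  "box_bump a b i x \<noteq> 0 \<Longrightarrow> x \<in> cbox (\<chi> j. a $ j + 1 / real (Suc i)) (\<chi> j. b $ j - 1 / real (Suc i))"
proof -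
  assume nz: "box_bump a b i x \<noteq> 0"
  have "flat (real (Suc i) * (x $ j - a $ j) - 1) \<noteq> 0" "flat (real (Suc i) * (b $ j - x $ j) - 1) \<noteq> 0" for j
    using nz by (simp_all add: box_bump_def)
  then have "0 < real (Suc i) * (x $ j - a $ j) - 1" "0 < real (Suc i) * (b $ j - x $ j) - 1" for j
    using flat_nonpos by (meson linorder_not_less)+
  then show ?thesis by (simp add: mem_box_cart field_simps less_imp_le)
qed

lemma shrunk_box_subset:
  "cbox (\<chi> j. a $ j + 1 / real (Suc i)) (\<chi> j. b $ j - 1 / real (Suc i)) \<subseteq> box a (b :: real^'n)"
proof
  fix x assume x: "x \<in> cbox (\<chi> j. a $ j + 1 / real (Suc i)) (\<chi> j. b $ j - 1 / real (Suc i))"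
  have "0 < 1 / real (Suc i)" by simp
  moreover have "a $ j + 1 / real (Suc i) \<le> x $ j" "x $ j \<le> b $ j - 1 / real (Suc i)" for j
    using x by (simp_all add: mem_box_cart)
  ultimately have "a $ j < x $ j" "x $ j < b $ j" for j by (smt (verit))+
  then show "x \<in> box a b" by (simp add: mem_box_cart)
qed

lemma flat_tendsto: "0 < t \<Longrightarrow> (\<lambda>i. flat (real (Suc i) * t - 1)) \<longlonglongrightarrow> 1"
proof -
  assume t: "0 < t"
  have "filterlim (\<lambda>i. real (Suc i) * t - 1) at_top sequentially"
    using t by real_asymp
  then have "(\<lambda>i. exp (- (1 / (real (Suc i) * t - 1)))) \<longlonglongrightarrow> exp (- 0)"
    by (intro tendsto_intros tendsto_divide_0[OF tendsto_const] filterlim_at_top_imp_at_infinity)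
  moreover have "\<forall>\<^sub>F i in sequentially. exp (- (1 / (real (Suc i) * t - 1))) = flat (real (Suc i) * t - 1)"
    using \<open>filterlim _ at_top sequentially\<close>
    by (auto simp: filterlim_at_top_dense flat_pos elim!: allE[of _ 0] eventually_mono)
  ultimately show ?thesis using Lim_transform_eventually by fastforce
qed

lemma box_bump_tendsto: "x \<in> box a b \<Longrightarrow> (\<lambda>i. box_bump a b i x) \<longlonglongrightarrow> 1"
proof -
  assume "x \<in> box a b"
  then have "(\<lambda>i. box_bump a b i x) \<longlonglongrightarrow> (\<Prod>j\<in>(UNIV :: 'a set). 1 * 1)"
    unfolding box_bump_def
    by (intro tendsto_prod tendsto_mult flat_tendsto) (auto simp: mem_box_cart)
  then show ?thesis by simp
qed

text \<open>If \<open>b\<^sub>0, b\<^sub>1, \<dots>\<close> are bump functions for countably many boxes whose union is the open set, then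
  \<open>1 - (1 - b\<^sub>0) \<cdots> (1 - b\<^sub>n\<^sub>-\<^sub>1)\<close> has compact support in the set.  At a point of the set, one of the
  factors \<open>1 - b\<^sub>m\<close> tends to \<open>0\<close> while the others are at most \<open>1\<close>.\<close>

lemma open_indicator_limit:
  fixes S :: "(real^'n) set"
  assumes "open S"
  obtains w :: "nat \<Rightarrow> real^'n \<Rightarrow> real" and Q :: "nat \<Rightarrow> (real^'n) set" where
    "\<And>i T. smooth_on T (w i)" "\<And>i x. 0 \<le> w i x" "\<And>i x. w i x \<le> 1"
    "\<And>i. compact (Q i)" "\<And>i. Q i \<subseteq> S" "\<And>i x. x \<notin> Q i \<Longrightarrow> w i x = 0"
    "\<And>x. (\<lambda>i. w i x) \<longlonglongrightarrow> indicator S x"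
proof -
  obtain \<D> where \<D>: "countable \<D>" "\<D> \<subseteq> Pow S" "\<And>X. X \<in> \<D> \<Longrightarrow> \<exists>a b. X = box a b" "\<Union>\<D> = S"
    using open_countable_Union_open_box[OF assms] by metis
  define \<D>' where "\<D>' = insert {} \<D>"
  have ne: "\<D>' \<noteq> {}" "countable \<D>'" using \<D>(1) by (auto simp: \<D>'_def)
  have empty: "\<exists>a b. {} = box a (b :: real^'n)" by (intro exI[of _ 0]) (auto simp: mem_box_cart set_eq_iff)
  have "\<forall>m. \<exists>a b. from_nat_into \<D>' m = box a b"
    using from_nat_into[OF ne(1)] \<D>(3) empty unfolding \<D>'_def by blast
  then obtain a b where ab: "\<And>m. from_nat_into \<D>' m = box (a m) (b m)" by metis
  have U: "(\<Union>m. box (a m) (b m)) = S"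
    using range_from_nat_into[OF ne] \<D>(4) by (simp add: ab[symmetric] \<D>'_def)
  define w where "w = (\<lambda>i x. 1 - (\<Prod>m<i. 1 - box_bump (a m) (b m) i x))"
  define Q where "Q = (\<lambda>i. \<Union>m<i. cbox (\<chi> j. a m $ j + 1 / real (Suc i)) (\<chi> j. b m $ j - 1 / real (Suc i)))"
  have prod: "0 \<le> (\<Prod>m<i. 1 - box_bump (a m) (b m) i x)" "(\<Prod>m<i. 1 - box_bump (a m) (b m) i x) \<le> 1" for i x
    by (auto intro!: prod_nonneg prod_le_1 simp: box_bump_bounds)
  have w0: "w i x = 0" if "x \<notin> Q i" for i x
  proof -
    have "box_bump (a m) (b m) i x = 0" if "m < i" for m
      using box_bump_support \<open>x \<notin> Q i\<close> that unfolding Q_def by blast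
    then show ?thesis by (simp add: w_def)
  qed
  have QS: "Q i \<subseteq> S" for i
    using shrunk_box_subset U unfolding Q_def by fastforce
  have lim: "(\<lambda>i. w i x) \<longlonglongrightarrow> indicator S x" for x
  proof (cases "x \<in> S")
    case True
    then obtain m where m: "x \<in> box (a m) (b m)" using U by blast
    have "(\<lambda>i. \<Prod>m<i. 1 - box_bump (a m) (b m) i x) \<longlonglongrightarrow> 0"
    proof (rule tendsto_sandwich)
      show "\<forall>\<^sub>F i in sequentially. 0 \<le> (\<Prod>m<i. 1 - box_bump (a m) (b m) i x)" using prod by simp
      show "\<forall>\<^sub>F i in sequentially. (\<Prod>m<i. 1 - box_bump (a m) (b m) i x) \<le> 1 - box_bump (a m) (b m) i x"
      proof (rule eventually_mono[OF eventually_gt_at_top[of m]])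
        fix i assume "m < i"
        then have "(\<Prod>m<i. 1 - box_bump (a m) (b m) i x) =
            (1 - box_bump (a m) (b m) i x) * (\<Prod>m\<in>{..<i} - {m}. 1 - box_bump (a m) (b m) i x)"
          by (intro prod.remove) auto
        also have "\<dots> \<le> (1 - box_bump (a m) (b m) i x) * 1"
          by (intro mult_left_mono prod_le_1) (auto simp: box_bump_bounds)
        finally show "(\<Prod>m<i. 1 - box_bump (a m) (b m) i x) \<le> 1 - box_bump (a m) (b m) i x" by simp
      qed
      have "(\<lambda>i. 1 - box_bump (a m) (b m) i x) \<longlonglongrightarrow> 1 - 1"
        by (intro tendsto_intros box_bump_tendsto m)
      then show "(\<lambda>i. 1 - box_bump (a m) (b m) i x) \<longlonglongrightarrow> 0" by simp
    qed simp
    then have "(\<lambda>i. w i x) \<longlonglongrightarrow> 1 - 0" unfolding w_def by (intro tendsto_intros)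
    then show ?thesis using True by simp
  next
    case False
    then have "w i x = 0" for i using w0 QS by blast
    then show ?thesis using False by simp
  qed
  show ?thesis
  proof (rule that[of w Q])
    show "smooth_on T (w i)" for i T
      unfolding w_def by (intro smooth_on_diff smooth_on_const smooth_on_prod box_bump_smooth)
    show "0 \<le> w i x" "w i x \<le> 1" for i x using prod by (simp_all add: w_def)
    show "compact (Q i)" for i unfolding Q_def by (intro compact_UN) auto
  qed (use QS w0 lim in auto)
qed

context L2_mfd
begin

subsection \<open>Local sections\<close>

lemma vol_locally_finite:
  assumes p: "p \<in> W" and W: "openin (cres C) W" "W \<subseteq> cint C"
  shows "\<exists>V c. openin (cres C) V \<and> p \<in> V \<and> V \<subseteq> W \<and> c \<in> catlas C \<and> V \<subseteq> fst c \<and> emeasure vol V < \<infinity>"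
proof -
  obtain c where c: "c \<in> catlas C" "p \<in> fst c" using chart_exists cint_top p W by blast
  have o: "openin (cres C) (fst c \<inter> W)" by (intro openin_Int chart_openin c W)
  have "smooth_fun (catlas C) (fst c \<inter> W) (\<lambda>p. det (g c p))"
    by (rule smooth_fun_subset[OF metric_det_smooth[OF c(1)]]) (use W in auto)
  from smooth_fun_locally_bounded[OF this o] c p
  obtain V1 B where V1: "openin (cres C) V1" "p \<in> V1" "V1 \<subseteq> fst c \<inter> W" "\<forall>q\<in>V1. norm (det (g c q)) \<le> B"
    by (metis IntI)
  define V where "V = {q \<in> fst c \<inter> V1. snd c q \<in> ball (snd c p) 1}"
  have V: "openin (cres C) V" unfolding V_def by (rule chart_vimage_openin[OF c(1) open_ball V1(1)])
  have "emeasure vol V = (\<integral>\<^sup>+x. ennreal (sqrt (det (g c (chart_inv c x)))) * indicator (snd c ` V) x \<partial>lborel)"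
    by (rule emeasure_vol[OF c(1) openin_sets_vol[OF V]]) (use V1 W in \<open>auto simp: V_def\<close>)
  also have "\<dots> \<le> (\<integral>\<^sup>+x. ennreal (sqrt B) * indicator (ball (snd c p) 1) x \<partial>lborel)"
  proof (rule nn_integral_mono)
    fix x
    show "ennreal (sqrt (det (g c (chart_inv c x)))) * indicator (snd c ` V) x \<le>
      ennreal (sqrt B) * indicator (ball (snd c p) 1) x"
    proof (cases "x \<in> snd c ` V")
      case True
      then obtain q where q: "x = snd c q" "q \<in> V" by blast
      then have "det (g c (chart_inv c x)) \<le> B"
        using V1(4) by (auto simp: V_def chart_inv_chart[OF c(1)])
      then show ?thesis using q by (auto simp: V_def intro: ennreal_leI)
    qed simp
  qed
  also have "\<dots> = ennreal (sqrt B) * emeasure lborel (ball (snd c p) 1)"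
    by (rule nn_integral_cmult_indicator) simp
  also have "\<dots> < \<infinity>"
    using emeasure_bounded_finite[of "ball (snd c p) 1"] by (simp add: ennreal_mult_less_top)
  finally have "emeasure vol V < \<infinity>" .
  moreover have "p \<in> V" "V \<subseteq> W" "V \<subseteq> fst c" using V1 c p by (auto simp: V_def)
  ultimately show ?thesis using V c(1) by blast
qed

lemma Cc_msec: "s \<in> Cc_sections C E \<Longrightarrow> s \<in> msec"
  unfolding Cc_sections_def smooth_sections_def msec_def
  by (intro CollectI conjI ballI allI impI smooth_fun_measurable[OF _ triv_cint_openin]) simp_all

text \<open>The support is covered by finitely many open sets of finite volume on which the section is bounded.\<close>

lemma Cc_L2:
  assumes s: "s \<in> Cc_sections C E"
  shows "s \<in> L2_sections C vol E"
proof -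
  have m: "s \<in> msec" by (rule Cc_msec[OF s])
  obtain Q where Q: "compactin (cres C) Q" "Q \<subseteq> cint C" "\<And>p. p \<notin> Q \<Longrightarrow> s p = (\<lambda>j. 0)"
    using s by (auto simp: Cc_sections_def)
  define \<U> where "\<U> = {V. openin (cres C) V \<and> V \<subseteq> cint C \<and> emeasure vol V < \<infinity> \<and> (\<exists>B\<ge>0. \<forall>q\<in>V. nsq q (s q) \<le> B)}"
  have "Q \<subseteq> \<Union>\<U>"
  proof
    fix p assume "p \<in> Q"
    then have p: "p \<in> cint C" using Q by blast
    obtain t where t: "t \<in> trivs E" "p \<in> tdom t" using triv_exists cint_top[OF p] by blast
    let ?W = "tdom t \<inter> cint C"
    have "smooth_fun (catlas C) ?W (\<lambda>p. fmetric E p (s p) (s p))"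
      using s t(1) by (intro metric_smooth[OF t(1)]) (auto simp: Cc_sections_def smooth_sections_def sections_def)
    from smooth_fun_locally_bounded[OF this triv_cint_openin[OF t(1)], of p] t p
    obtain V1 B where V1: "openin (cres C) V1" "p \<in> V1" "V1 \<subseteq> ?W" "\<forall>q\<in>V1. cmod (fmetric E q (s q) (s q)) \<le> B"
      by (metis IntI)
    obtain V c where V: "openin (cres C) V" "p \<in> V" "V \<subseteq> V1" "emeasure vol V < \<infinity>"
      using vol_locally_finite[OF V1(2,1)] V1(3) by blast
    have "nsq q (s q) \<le> max B 0" if "q \<in> V" for q
      using V1(4) V(3) that complex_Re_le_cmod[of "fmetric E q (s q) (s q)"] by (force simp: nsq_def)
    then have "V \<in> \<U>" using V V1(3) unfolding \<U>_def by (auto intro!: exI[of _ "max B 0"])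
    then show "p \<in> \<Union>\<U>" using V(2) by blast
  qed
  moreover have "\<forall>U\<in>\<U>. openin (cres C) U" by (simp add: \<U>_def)
  ultimately obtain \<F> where \<F>: "finite \<F>" "\<F> \<subseteq> \<U>" "Q \<subseteq> \<Union>\<F>"
    using Q(1)[unfolded compactin_def, THEN conjunct2, THEN spec, of \<U>] by auto
  have "\<forall>V\<in>\<F>. \<exists>B\<ge>0. \<forall>q\<in>V. nsq q (s q) \<le> B" using \<F>(2) unfolding \<U>_def by blast
  then obtain b where b: "\<And>V. V \<in> \<F> \<Longrightarrow> 0 \<le> b V" "\<And>V q. V \<in> \<F> \<Longrightarrow> q \<in> V \<Longrightarrow> nsq q (s q) \<le> b V" by metis
  have sets: "V \<in> sets vol" "emeasure vol V < \<infinity>" if "V \<in> \<F>" for V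
    using \<F>(2) that openin_sets_vol by (auto simp: \<U>_def)
  have "N2 s \<le> (\<integral>\<^sup>+p. (\<Sum>V\<in>\<F>. ennreal (b V) * indicator V p) \<partial>vol)"
    unfolding N2_def
  proof (rule nn_integral_mono)
    fix p assume "p \<in> space vol"
    then have p: "p \<in> cint C" by (simp add: space_vol)
    show "ennreal (nsq p (s p)) \<le> (\<Sum>V\<in>\<F>. ennreal (b V) * indicator V p)"
    proof (cases "p \<in> Q")
      case True
      then obtain V where V: "V \<in> \<F>" "p \<in> V" using \<F>(3) by blast
      have "ennreal (nsq p (s p)) \<le> ennreal (b V) * indicator V p"
        using b(2)[OF V] V by (simp add: ennreal_leI)
      also have "\<dots> \<le> (\<Sum>V\<in>\<F>. ennreal (b V) * indicator V p)"
        by (rule member_le_sum) (use V \<F>(1) in auto)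
      finally show ?thesis .
    qed (simp add: Q(3) nsq_zero cint_top[OF p])
  qed
  also have "\<dots> = (\<Sum>V\<in>\<F>. ennreal (b V) * emeasure vol V)"
    using sets by (subst nn_integral_sum) (auto intro!: sum.cong nn_integral_cmult_indicator)
  also have "\<dots> < \<infinity>"
    using sets \<F>(1) by (auto simp: ennreal_mult_less_top intro!: sum_Pinfty[THEN iffD2])
  finally show ?thesis using m L2_iff by blast
qed

lemma transition:
  assumes "t \<in> trivs E" "t' \<in> trivs E"
  obtains G :: "nat \<Rightarrow> nat \<Rightarrow> 'p \<Rightarrow> complex" where
    "\<And>l j. smooth_fun (catlas C) (tdom t \<inter> tdom t') (G l j)"
    "\<And>p v l. p \<in> tdom t \<inter> tdom t' \<Longrightarrow> v \<in> fibre E p \<Longrightarrow> l < trank t' \<Longrightarrow>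
        tmap t' p v l = (\<Sum>j<trank t. G l j p * tmap t p v j)"
proof -
  have "\<forall>t\<in>trivs E. \<forall>t'\<in>trivs E. \<exists>G :: nat \<Rightarrow> nat \<Rightarrow> 'p \<Rightarrow> complex.
      (\<forall>l j. smooth_fun (catlas C) (tdom t \<inter> tdom t') (G l j)) \<and>
      (\<forall>p\<in>tdom t \<inter> tdom t'. \<forall>v\<in>fibre E p. \<forall>l<trank t'.
        tmap t' p v l = (\<Sum>j<trank t. G l j p * tmap t p v j))"
    using metric unfolding metric_bundle_def vector_bundle_def by (elim conjE)
  from bspec[OF bspec[OF this assms(1)] assms(2)] show ?thesis using that by blast
qed

text \<open>The frame vectors are extended by \<open>0\<close> to make them sections over the interior.  They are measurable,
  and smooth where the trivialisation is defined.\<close>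

definition fsec :: "'p triv \<Rightarrow> nat \<Rightarrow> 'p \<Rightarrow> cvec"
  where "fsec t j p = (if p \<in> tdom t \<inter> cint C then frame t j p else (\<lambda>i. 0))"

lemma tmap_frame_transition:
  assumes "t \<in> trivs E" "t' \<in> trivs E" "j < trank t"
  obtains G :: "nat \<Rightarrow> 'p \<Rightarrow> complex" where
    "\<And>l. smooth_fun (catlas C) (tdom t \<inter> tdom t') (G l)"
    "\<And>p l. p \<in> tdom t \<inter> tdom t' \<Longrightarrow> l < trank t' \<Longrightarrow> tmap t' p (frame t j p) l = G l p"
proof -
  obtain G :: "nat \<Rightarrow> nat \<Rightarrow> 'p \<Rightarrow> complex" where G:
    "\<And>l j. smooth_fun (catlas C) (tdom t \<inter> tdom t') (G l j)"
    "\<And>p v l. p \<in> tdom t \<inter> tdom t' \<Longrightarrow> v \<in> fibre E p \<Longrightarrow> l < trank t' \<Longrightarrow>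
        tmap t' p v l = (\<Sum>j<trank t. G l j p * tmap t p v j)"
    using transition[OF assms(1,2)] by blast
  have "tmap t' p (frame t j p) l = G l j p" if "p \<in> tdom t \<inter> tdom t'" "l < trank t'" for p l
  proof -
    have "tmap t' p (frame t j p) l = (\<Sum>i<trank t. G l i p * (if i = j then 1 else 0))"
      using that assms by (subst G(2)) (auto simp: frame_fibre tmap_frame)
    also have "\<dots> = (\<Sum>i<trank t. if i = j then G l j p else 0)" by (intro sum.cong) auto
    finally show ?thesis using assms(3) by simp
  qed
  then show ?thesis using that[of "\<lambda>l. G l j"] G(1) by blast
qed

lemma fsec_sections: "t \<in> trivs E \<Longrightarrow> j < trank t \<Longrightarrow> fsec t j \<in> sections C E"
  unfolding sections_def fsec_def using frame_fibre fibre_zero[OF cint_top] by auto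

lemma fsec_msec:
  assumes t: "t \<in> trivs E" and j: "j < trank t"
  shows "fsec t j \<in> msec"
  unfolding msec_def
proof (intro CollectI conjI ballI allI impI fsec_sections[OF t j])
  fix t' l assume t': "t' \<in> trivs E" and l: "l < trank t'"
  obtain G :: "nat \<Rightarrow> 'p \<Rightarrow> complex" where G:
    "\<And>l. smooth_fun (catlas C) (tdom t \<inter> tdom t') (G l)"
    "\<And>p l. p \<in> tdom t \<inter> tdom t' \<Longrightarrow> l < trank t' \<Longrightarrow> tmap t' p (frame t j p) l = G l p"
    using tmap_frame_transition[OF t t' j] by blast
  let ?W = "tdom t \<inter> tdom t' \<inter> cint C"
  have W: "openin (cres C) ?W" by (intro openin_Int triv_openin t t' cint_openin)
  then have "?W \<inter> space vol \<in> sets vol" by (simp add: space_vol openin_sets_vol)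
  moreover have "G l \<in> borel_measurable (restrict_space vol ?W)"
    by (rule smooth_fun_measurable[OF smooth_fun_subset[OF G(1)] W]) auto
  ultimately have "(\<lambda>p. indicator ?W p *\<^sub>R G l p) \<in> borel_measurable vol"
    by (simp add: borel_measurable_restrict_space_iff)
  then have "(\<lambda>p. indicator ?W p *\<^sub>R G l p) \<in> borel_measurable (restrict_space vol (tdom t' \<inter> cint C))"
    by (rule restrict_measurable)
  then show "(\<lambda>p. tmap t' p (fsec t j p) l) \<in> borel_measurable (restrict_space vol (tdom t' \<inter> cint C))"
    by (rule measurable_cong[THEN iffD1, rotated])
      (auto simp: space_triv[OF t'] fsec_def G(2) l triv_zero[OF t'])
qed

text \<open>The product is smooth on \<open>W\<close>, and it vanishes on the complement of a compact subset of \<open>W\<close>; this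
  complement is open because compact subsets of a Hausdorff space are closed.\<close>

lemma bump_section_Cc:
  assumes t: "t \<in> trivs E" and j: "j < trank t" and c: "c \<in> catlas C"
    and W: "openin (cres C) W" "W \<subseteq> fst c" "W \<subseteq> tdom t" "W \<subseteq> cint C"
    and w: "smooth_on (snd c ` W) w" and Q: "compact Q" "Q \<subseteq> snd c ` W" "\<And>x. x \<notin> Q \<Longrightarrow> w x = 0"
  shows "rmult (\<lambda>p. if p \<in> W then w (snd c p) else 0) (fsec t j) \<in> Cc_sections C E"
proof -
  let ?u = "\<lambda>p. if p \<in> W then w (snd c p) else 0"
  define R where "R = chart_inv c ` Q"
  have "compactin (top_of_set (snd c ` fst c)) Q"
    using Q(1,2) W(2) by (auto simp: compactin_subtopology)
  then have R: "compactin (cres C) R"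
    unfolding R_def using chart_inv_continuous[OF c] image_compactin by blast
  have RW: "R \<subseteq> W" using Q(2) W(2) by (auto simp: R_def chart_inv_chart[OF c] subset_iff)
  have uR: "?u p = 0" if "p \<notin> R" for p
    using that Q(3)[of "snd c p"] W(2) chart_inv_chart[OF c, of p] by (force simp: R_def)
  have "Hausdorff_space (cres C)" using manifold_res by (simp add: manifold_def)
  then have cR: "closedin (cres C) R" using R compactin_imp_closedin by blast
  have sec: "rmult ?u (fsec t j) \<in> sections C E"
    unfolding sections_def rmult_def using fibre_scale[OF cint_top K_of_real]
      section_fibre[OF fsec_sections[OF t j]] section_outside[OF fsec_sections[OF t j]] by auto
  have "smooth_fun (catlas C) (tdom t' \<inter> cint C) (\<lambda>p. tmap t' p (rmult ?u (fsec t j) p) l)"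
    if t': "t' \<in> trivs E" and l: "l < trank t'" for t' l
  proof (rule smooth_fun_local)
    fix p assume p: "p \<in> tdom t' \<inter> cint C" "p \<in> topspace (cres C)"
    show "\<exists>V. openin (cres C) V \<and> p \<in> V \<and>
      smooth_fun (catlas C) (tdom t' \<inter> cint C \<inter> V) (\<lambda>p. tmap t' p (rmult ?u (fsec t j) p) l)"
    proof (cases "p \<in> W")
      case True
      obtain G :: "nat \<Rightarrow> 'p \<Rightarrow> complex" where G:
        "\<And>l. smooth_fun (catlas C) (tdom t \<inter> tdom t') (G l)"
        "\<And>p l. p \<in> tdom t \<inter> tdom t' \<Longrightarrow> l < trank t' \<Longrightarrow> tmap t' p (frame t j p) l = G l p"
        using tmap_frame_transition[OF t t' j] by blast
      have "smooth_fun (catlas C) W (\<lambda>p. w (snd c p))"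
      proof (rule smooth_fun_of_chart[OF c W(2)])
        show "smooth_on (snd c ` W) (\<lambda>x. w (snd c (chart_inv c x)))"
          by (rule smooth_on_cong[OF w]) (use W(2) in \<open>auto simp: chart_inv_chart[OF c]\<close>)
      qed
      then have "smooth_fun (catlas C) (tdom t' \<inter> cint C \<inter> W) (\<lambda>p. complex_of_real (w (snd c p)) * G l p)"
        by (intro smooth_fun_mult smooth_fun_of_real smooth_fun_subset[OF G(1)])
          (use W in \<open>auto intro: smooth_fun_subset\<close>)
      then have "smooth_fun (catlas C) (tdom t' \<inter> cint C \<inter> W) (\<lambda>p. tmap t' p (rmult ?u (fsec t j) p) l)"
      proof (rule smooth_fun_cong)
        fix q assume q: "q \<in> tdom t' \<inter> cint C \<inter> W"
        then have qt: "q \<in> tdom t \<inter> tdom t'" "q \<in> W" "q \<in> cint C" using W by auto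
        then show "complex_of_real (w (snd c q)) * G l q = tmap t' q (rmult ?u (fsec t j) q) l"
          using G(2)[OF qt(1) l]
            triv_scale[OF t' IntD2[OF qt(1)] K_of_real frame_fibre[OF t IntD1[OF qt(1)] j]]
          by (simp add: rmult_def fsec_def)
      qed
      then show ?thesis using True W(1) by blast
    next
      case False
      have "openin (cres C) (topspace (cres C) - R)" using cR by (simp add: closedin_def)
      moreover have "smooth_fun (catlas C) (tdom t' \<inter> cint C \<inter> (topspace (cres C) - R))
          (\<lambda>p. tmap t' p (rmult ?u (fsec t j) p) l)"
      proof (rule smooth_fun_cong[OF smooth_fun_const[of _ 0]])
        fix q assume "q \<in> tdom t' \<inter> cint C \<inter> (topspace (cres C) - R)"
        then have "?u q = 0" "q \<in> tdom t'" using uR by auto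
        then show "0 = tmap t' q (rmult ?u (fsec t j) q) l"
          unfolding rmult_def by (simp only: of_real_0 mult_zero_left triv_zero[OF t'])
      qed
      ultimately show ?thesis using False RW p(2) by blast
    qed
  qed
  moreover have "rmult ?u (fsec t j) p = (\<lambda>j. 0)" if "p \<notin> R" for p
    using uR[OF that] unfolding rmult_def by (simp only: of_real_0 mult_zero_left)
  ultimately show ?thesis
    unfolding Cc_sections_def smooth_sections_def using sec R RW W(4) by blast
qed

lemma N2_rmult_mono:
  assumes e: "e \<in> msec" and "\<And>p. p \<in> cint C \<Longrightarrow> \<bar>u p\<bar> \<le> \<bar>v p\<bar>"
  shows "N2 (rmult u e) \<le> N2 (rmult v e)"
  unfolding N2_rmult[OF e]
proof (intro nn_integral_mono ennreal_leI mult_right_mono)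
  fix p assume "p \<in> space vol"
  then show "(u p)\<^sup>2 \<le> (v p)\<^sup>2" "0 \<le> nsq p (e p)"
    using assms(2) nsq_nonneg_sec[OF e] by (auto simp: space_vol abs_le_square_iff)
qed

definition zero_sec :: "'p \<Rightarrow> cvec"
  where "zero_sec = (\<lambda>p j. 0)"

lemma zero_sec_Cc: "zero_sec \<in> Cc_sections C E"
  unfolding Cc_sections_def smooth_sections_def sections_def zero_sec_def
  using fibre_zero[OF cint_top]
  by (auto simp: triv_zero intro!: exI[of _ "{}"] smooth_fun_cong[OF smooth_fun_const[of _ 0]])

subsection \<open>Operators agreeing on compactly supported sections\<close>

context
  fixes T0 T1 :: "('p \<Rightarrow> cvec) \<Rightarrow> 'p \<Rightarrow> cvec"
  assumes T0: "L2_bounded_operator K C vol E T0" and T1: "L2_bounded_operator K C vol E T1"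
    and agree: "\<And>s. s \<in> Cc_sections C E \<Longrightarrow> AE p in vol. T0 s p = T1 s p"
begin

definition agree_set :: "('p \<Rightarrow> cvec) set"
  where "agree_set = {s \<in> L2_sections C vol E. AE p in vol. T0 s p = T1 s p}"

lemma agree_L2: "s \<in> agree_set \<Longrightarrow> s \<in> L2_sections C vol E"
  by (simp add: agree_set_def)

lemma agree_Cc: "s \<in> Cc_sections C E \<Longrightarrow> s \<in> agree_set"
  using agree Cc_L2 by (simp add: agree_set_def)

lemma agree_add:
  assumes "s \<in> agree_set" "u \<in> agree_set"
  shows "(\<lambda>p j. s p j + u p j) \<in> agree_set"
  unfolding agree_set_def
proof (intro CollectI conjI L2_add agree_L2 assms)
  have "AE p in vol. T0 s p = T1 s p" "AE p in vol. T0 u p = T1 u p"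
    using assms by (simp_all add: agree_set_def)
  with bounded_operatorD(2)[OF T0 agree_L2[OF assms(1)] agree_L2[OF assms(2)]]
    bounded_operatorD(2)[OF T1 agree_L2[OF assms(1)] agree_L2[OF assms(2)]]
  show "AE p in vol. T0 (\<lambda>p j. s p j + u p j) p = T1 (\<lambda>p j. s p j + u p j) p"
    by eventually_elim simp
qed

lemma agree_scale:
  assumes "s \<in> agree_set" "a \<in> K"
  shows "(\<lambda>p j. a * s p j) \<in> agree_set"
  unfolding agree_set_def
proof (intro CollectI conjI L2_scale agree_L2 assms)
  have "AE p in vol. T0 s p = T1 s p" using assms by (simp add: agree_set_def)
  with bounded_operatorD(3)[OF T0 assms(2) agree_L2[OF assms(1)]]
    bounded_operatorD(3)[OF T1 assms(2) agree_L2[OF assms(1)]]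
  show "AE p in vol. T0 (\<lambda>p j. a * s p j) p = T1 (\<lambda>p j. a * s p j) p"
    by eventually_elim simp
qed

lemma agree_diff: "s \<in> agree_set \<Longrightarrow> u \<in> agree_set \<Longrightarrow> (\<lambda>p j. s p j - u p j) \<in> agree_set"
  using agree_add[OF _ agree_scale[OF _ K_minus[OF K_1]], of s u] by simp

lemma agree_zero: "(\<lambda>p j. 0) \<in> agree_set"
  using agree_Cc[OF zero_sec_Cc] by (simp add: zero_sec_def)

lemma agree_sum:
  assumes "finite J" "\<And>i. i \<in> J \<Longrightarrow> s i \<in> agree_set"
  shows "(\<lambda>p j. \<Sum>i\<in>J. s i p j) \<in> agree_set"
  using assms
proof (induction J rule: finite_induct)
  case (insert i J)
  have "(\<lambda>p j. s i p j + (\<Sum>i\<in>J. s i p j)) \<in> agree_set"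
    by (intro agree_add insert.prems insert.IH) auto
  then show ?case using insert.hyps by simp
qed (simp add: agree_zero)

text \<open>If \<open>s = d + s\<^sub>i\<close>, both operators do the same to \<open>s\<^sub>i\<close>, so the difference of their values at \<open>s\<close> is that
  at \<open>d\<close>, and it is as small as \<open>d\<close>.\<close>

lemma agree_limit:
  assumes s: "s \<in> L2_sections C vol E" and sn: "\<And>i. sn i \<in> agree_set"
    and lim: "(\<lambda>i. N2 (\<lambda>p j. s p j - sn i p j)) \<longlonglongrightarrow> 0"
  shows "s \<in> agree_set"
proof -
  obtain b0 where b0: "0 \<le> b0" "\<And>s. s \<in> L2_sections C vol E \<Longrightarrow> N2 (T0 s) \<le> ennreal b0 * N2 s"
    by (rule bounded_operator_N2[OF T0]) (use that in blast)
  obtain b1 where b1: "0 \<le> b1" "\<And>s. s \<in> L2_sections C vol E \<Longrightarrow> N2 (T1 s) \<le> ennreal b1 * N2 s"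
    by (rule bounded_operator_N2[OF T1]) (use that in blast)
  define D where "D = (\<lambda>p j. T0 s p j - T1 s p j)"
  have le: "N2 D \<le> ennreal (2 * b0 + 2 * b1) * N2 (\<lambda>p j. s p j - sn i p j)" for i
  proof -
    define d where "d = (\<lambda>p j. s p j - sn i p j)"
    have d: "d \<in> L2_sections C vol E" unfolding d_def by (rule L2_diff[OF s agree_L2[OF sn]])
    have sum: "s = (\<lambda>p j. d p j + sn i p j)" by (simp add: d_def)
    have "AE p in vol. T0 (sn i) p = T1 (sn i) p" using sn by (simp add: agree_set_def)
    moreover have "AE p in vol. T0 s p = (\<lambda>j. T0 d p j + T0 (sn i) p j)"
      using bounded_operatorD(2)[OF T0 d agree_L2[OF sn[of i]]] by (simp flip: sum)
    moreover have "AE p in vol. T1 s p = (\<lambda>j. T1 d p j + T1 (sn i) p j)"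
      using bounded_operatorD(2)[OF T1 d agree_L2[OF sn[of i]]] by (simp flip: sum)
    ultimately have "AE p in vol. D p = (\<lambda>j. T0 d p j - T1 d p j)"
      by eventually_elim (simp add: D_def)
    then have "N2 D = N2 (\<lambda>p j. T0 d p j - T1 d p j)" by (rule N2_cong_AE)
    also have "\<dots> \<le> 2 * N2 (T0 d) + 2 * N2 (T1 d)"
      using bounded_operatorD(1)[OF T0 d] bounded_operatorD(1)[OF T1 d] L2_iff by (intro N2_diff_le) auto
    also have "\<dots> \<le> 2 * (ennreal b0 * N2 d) + 2 * (ennreal b1 * N2 d)"
      using b0(2)[OF d] b1(2)[OF d] by (intro add_mono mult_left_mono) auto
    also have "\<dots> = ennreal (2 * b0 + 2 * b1) * N2 d"
      using b0(1) b1(1) by (simp add: ennreal_mult' distrib_right mult.assoc)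
    finally show ?thesis by (simp add: d_def)
  qed
  have "(\<lambda>i. ennreal (2 * b0 + 2 * b1) * N2 (\<lambda>p j. s p j - sn i p j)) \<longlonglongrightarrow> ennreal (2 * b0 + 2 * b1) * 0"
    by (intro ennreal_tendsto_cmult lim) simp
  then have "N2 D \<le> ennreal (2 * b0 + 2 * b1) * 0"
    by (rule LIMSEQ_le_const) (use le in auto)
  then have "N2 D = 0" by simp
  moreover have "D \<in> msec"
    unfolding D_def using L2_diff[OF bounded_operatorD(1)[OF T0 s] bounded_operatorD(1)[OF T1 s]] L2_iff by blast
  ultimately have "AE p in vol. D p = (\<lambda>j. 0)" using N2_zero_imp by blast
  then have "AE p in vol. T0 s p = T1 s p"
    by eventually_elim (auto simp: D_def fun_eq_iff)
  then show ?thesis using s by (simp add: agree_set_def)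
qed

lemma agree_dominated:
  assumes e: "e \<in> msec" and u: "u \<in> borel_measurable vol" "\<And>i. v i \<in> borel_measurable vol"
    and dom: "\<And>i p. p \<in> cint C \<Longrightarrow> \<bar>v i p\<bar> \<le> \<bar>u p\<bar>"
    and lim: "\<And>p. p \<in> cint C \<Longrightarrow> (\<lambda>i. v i p) \<longlonglongrightarrow> u p"
    and fin: "N2 (rmult u e) < \<infinity>" and v: "\<And>i. rmult (v i) e \<in> agree_set"
  shows "rmult u e \<in> agree_set"
proof (rule agree_limit)
  show "rmult u e \<in> L2_sections C vol E" using msec_rmult[OF e u(1)] fin L2_iff by blast
  show "(\<lambda>i. N2 (\<lambda>p j. rmult u e p j - rmult (v i) e p j)) \<longlonglongrightarrow> 0"
    by (rule N2_dominated[OF e u dom lim fin])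
qed (rule v)

lemma indicator_vol: "A \<in> sets vol \<Longrightarrow> (indicator A :: 'p \<Rightarrow> real) \<in> borel_measurable vol"
  by (rule borel_measurable_indicator)

text \<open>Bump functions approximating the indicator function from below give smooth approximations with compact
  support.\<close>

lemma agree_open:
  assumes t: "t \<in> trivs E" and j: "j < trank t" and c: "c \<in> catlas C"
    and W: "openin (cres C) W" "W \<subseteq> fst c" "W \<subseteq> tdom t" "W \<subseteq> cint C"
    and fin: "N2 (rmult (indicator W) (fsec t j)) < \<infinity>"
  shows "rmult (indicator W) (fsec t j) \<in> agree_set"
proof -
  have Ws: "W \<in> sets vol" by (rule openin_sets_vol[OF W(1,4)])
  have "open (snd c ` W)" by (rule chart_image_open[OF c W(1)]) (use W in blast)
  then obtain w :: "nat \<Rightarrow> (real, 'n) vec \<Rightarrow> real" and Q where w: "\<And>i T. smooth_on T (w i)" "\<And>i x. 0 \<le> w i x" "\<And>i x. w i x \<le> 1"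
    "\<And>i. compact (Q i)" "\<And>i. Q i \<subseteq> snd c ` W" "\<And>i x. x \<notin> Q i \<Longrightarrow> w i x = 0"
    "\<And>x. (\<lambda>i. w i x) \<longlonglongrightarrow> indicator (snd c ` W) x"
    by (rule open_indicator_limit) (use that in blast)
  define v where "v = (\<lambda>i p. if p \<in> W then w i (snd c p) else 0)"
  show ?thesis
  proof (rule agree_dominated[OF fsec_msec[OF t j] indicator_vol[OF Ws], of v])
    fix i
    show "rmult (v i) (fsec t j) \<in> agree_set"
      unfolding v_def by (intro agree_Cc bump_section_Cc[OF t j c W w(1,4,5,6)])
    have "smooth_fun (catlas C) W (\<lambda>p. w i (snd c p))"
    proof (rule smooth_fun_of_chart[OF c W(2)])
      show "smooth_on (snd c ` W) (\<lambda>x. w i (snd c (chart_inv c x)))"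
        by (rule smooth_on_cong[OF w(1)]) (use W(2) in \<open>auto simp: chart_inv_chart[OF c]\<close>)
    qed
    then have "(\<lambda>p. w i (snd c p)) \<in> borel_measurable (restrict_space vol W)"
      by (rule smooth_fun_measurable[OF _ W(1,4)])
    then have "(\<lambda>p. indicator W p *\<^sub>R w i (snd c p)) \<in> borel_measurable vol"
      using Ws W(4) by (simp add: borel_measurable_restrict_space_iff space_vol inf.absorb1)
    moreover have "(\<lambda>p. indicator W p *\<^sub>R w i (snd c p)) = v i"
      by (auto simp: v_def indicator_def)
    ultimately show "v i \<in> borel_measurable vol" by simp
    fix p
    show "\<bar>v i p\<bar> \<le> \<bar>indicator W p\<bar>" using w(2,3) by (simp add: v_def)
  next
    fix p
    show "(\<lambda>i. v i p) \<longlonglongrightarrow> indicator W p"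
      using w(7)[of "snd c p"] by (cases "p \<in> W") (auto simp: v_def)
  qed (rule fin)
qed

text \<open>The open sets form an intersection-stable generator, and the sets for which the claim holds are closed
  under complements and countable disjoint unions.\<close>

lemma agree_indicator:
  assumes t: "t \<in> trivs E" and j: "j < trank t" and c: "c \<in> catlas C"
    and W: "openin (cres C) W" "W \<subseteq> fst c" "W \<subseteq> tdom t" "W \<subseteq> cint C"
    and fin: "N2 (rmult (indicator W) (fsec t j)) < \<infinity>" and A: "A \<in> sets vol"
  shows "rmult (indicator (A \<inter> W)) (fsec t j) \<in> agree_set"
proof -
  let ?e = "fsec t j" and ?G = "{V. openin (cres C) V \<and> V \<subseteq> cint C}"
  have e: "?e \<in> msec" by (rule fsec_msec[OF t j])
  have Ws: "W \<in> sets vol" by (rule openin_sets_vol[OF W(1,4)])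
  have sub: "N2 (rmult (indicator B) ?e) < \<infinity>" if "B \<subseteq> W" for B
    by (rule order_le_less_trans[OF N2_rmult_mono[OF e] fin]) (use that in \<open>auto simp: indicator_def\<close>)
  have "Int_stable ?G" by (auto simp: Int_stable_def)
  moreover have "?G \<subseteq> Pow (cint C)" by blast
  moreover have "A \<in> sigma_sets (cint C) ?G" using A by (simp add: sets_vol)
  ultimately show ?thesis
  proof (induction rule: sigma_sets_induct_disjoint)
    case (basic V)
    then show ?case
      by (intro agree_open[OF t j c] sub openin_Int W) (use W in auto)
  next
    case empty
    then show ?case using agree_zero by (simp add: rmult_def)
  next
    case (compl B)
    have "rmult (indicator W) ?e \<in> agree_set" by (rule agree_open[OF t j c W fin])
    from agree_diff[OF this compl(2)]
    have "(\<lambda>p i. rmult (indicator W) ?e p i - rmult (indicator (B \<inter> W)) ?e p i) \<in> agree_set" .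
    moreover have "(\<lambda>p i. rmult (indicator W) ?e p i - rmult (indicator (B \<inter> W)) ?e p i) =
        rmult (indicator ((cint C - B) \<inter> W)) ?e"
      using W(4) by (intro ext) (auto simp: rmult_def indicator_def)
    ultimately show ?case by simp
  next
    case (union B)
    have Bs: "B i \<in> sets vol" for i using union(2) by (auto simp: sets_vol)
    define v where "v = (\<lambda>n::nat. indicator (\<Union>i<n. B i \<inter> W) :: 'p \<Rightarrow> real)"
    show ?case
    proof (rule agree_dominated[OF e, of _ v])
      show "(indicator (\<Union> (range B) \<inter> W) :: 'p \<Rightarrow> real) \<in> borel_measurable vol"
        using Bs Ws by (intro indicator_vol sets.Int sets.countable_UN) auto
      show "v n \<in> borel_measurable vol" for n
        unfolding v_def using Bs Ws by (intro indicator_vol sets.finite_UN) auto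
      show "\<bar>v n p\<bar> \<le> \<bar>indicator (\<Union> (range B) \<inter> W) p\<bar>" for n p
        by (auto simp: v_def indicator_def)
      have "(\<lambda>n. v n p) \<longlonglongrightarrow> indicator (\<Union>i. B i \<inter> W) p" for p
        unfolding v_def by (rule LIMSEQ_indicator_UN)
      moreover have "(\<Union>i. B i \<inter> W) = \<Union> (range B) \<inter> W" by auto
      ultimately show "(\<lambda>n. v n p) \<longlonglongrightarrow> indicator (\<Union> (range B) \<inter> W) p" for p by simp
      show "N2 (rmult (indicator (\<Union> (range B) \<inter> W)) ?e) < \<infinity>" by (rule sub) auto
      show "rmult (v n) ?e \<in> agree_set" for n
      proof (induction n)
        case 0
        then show ?case using agree_zero by (simp add: rmult_def v_def)
      next
        case (Suc n)
        have "v (Suc n) p = v n p + indicator (B n \<inter> W) p" for p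
        proof -
          have "\<not> (p \<in> B n \<and> (\<exists>i<n. p \<in> B i))"
            using union(1) unfolding disjoint_family_on_def by (metis IntI UNIV_I empty_iff less_irrefl)
          then show ?thesis by (auto simp: v_def indicator_def less_Suc_eq)
        qed
        then have "rmult (v (Suc n)) ?e = (\<lambda>p i. rmult (v n) ?e p i + rmult (indicator (B n \<inter> W)) ?e p i)"
          by (intro ext) (simp add: rmult_def algebra_simps)
        then show ?case using agree_add[OF Suc union(3)] by simp
      qed
    qed
  qed
qed

text \<open>Induction on the measurable function: indicator functions, scalar multiples, sums, and increasing
  limits.  Finiteness is inherited by the parts because all functions involved are nonnegative.\<close>

lemma agree_nonneg:
  assumes t: "t \<in> trivs E" and j: "j < trank t" and c: "c \<in> catlas C"
    and W: "openin (cres C) W" "W \<subseteq> fst c" "W \<subseteq> tdom t" "W \<subseteq> cint C"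
    and fin: "N2 (rmult (indicator W) (fsec t j)) < \<infinity>"
    and u: "u \<in> borel_measurable vol" "\<And>p. 0 \<le> u p"
  shows "N2 (rmult (\<lambda>p. u p * indicator W p) (fsec t j)) < \<infinity> \<Longrightarrow>
    rmult (\<lambda>p. u p * indicator W p) (fsec t j) \<in> agree_set"
  using u
proof (induction rule: borel_measurable_induct_real)
  case (set A)
  have "(\<lambda>p. indicator A p * indicator W p :: real) = indicator (A \<inter> W)"
    by (auto simp: indicator_def)
  then show ?case using agree_indicator[OF t j c W fin set(1)] by simp
next
  case (mult v a)
  have e: "fsec t j \<in> msec" by (rule fsec_msec[OF t j])
  have Ws: "W \<in> sets vol" by (rule openin_sets_vol[OF W(1,4)])
  have eq: "rmult (\<lambda>p. a * v p * indicator W p) (fsec t j) =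
      (\<lambda>p i. complex_of_real a * rmult (\<lambda>p. v p * indicator W p) (fsec t j) p i)"
    by (intro ext) (simp add: rmult_def mult.assoc)
  show ?case
  proof (cases "a = 0")
    case True
    then show ?thesis using agree_zero by (simp add: rmult_def)
  next
    case False
    have m: "rmult (\<lambda>p. v p * indicator W p) (fsec t j) \<in> msec"
      by (intro msec_rmult[OF e] borel_measurable_times mult(2) indicator_vol Ws)
    have "ennreal (a\<^sup>2) * N2 (rmult (\<lambda>p. v p * indicator W p) (fsec t j)) < \<infinity>"
      using mult.prems N2_scale[OF m K_of_real, of a] unfolding eq by simp
    then have "N2 (rmult (\<lambda>p. v p * indicator W p) (fsec t j)) < \<infinity>"
      using False by (auto simp: ennreal_mult_less_top)
    then show ?thesis unfolding eq by (intro agree_scale mult.IH K_of_real)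
  qed
next
  case (add u v)
  have e: "fsec t j \<in> msec" by (rule fsec_msec[OF t j])
  have "N2 (rmult (\<lambda>p. v p * indicator W p) (fsec t j)) < \<infinity>" "N2 (rmult (\<lambda>p. u p * indicator W p) (fsec t j)) < \<infinity>"
    by (rule order_le_less_trans[OF N2_rmult_mono[OF e] add.prems];
        use add(2,4) in \<open>simp add: indicator_def\<close>)+
  then have "(\<lambda>p i. rmult (\<lambda>p. v p * indicator W p) (fsec t j) p i + rmult (\<lambda>p. u p * indicator W p) (fsec t j) p i) \<in> agree_set"
    by (intro agree_add add.IH)
  moreover have "(\<lambda>p i. rmult (\<lambda>p. v p * indicator W p) (fsec t j) p i + rmult (\<lambda>p. u p * indicator W p) (fsec t j) p i) =
      rmult (\<lambda>p. (v p + u p) * indicator W p) (fsec t j)"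
    by (intro ext) (simp add: rmult_def algebra_simps)
  ultimately show ?case by simp
next
  case (seq U)
  have e: "fsec t j \<in> msec" by (rule fsec_msec[OF t j])
  have Ws: "W \<in> sets vol" by (rule openin_sets_vol[OF W(1,4)])
  have le: "U i p \<le> u p" if "p \<in> cint C" for i p
    using seq.hyps(3) seq.hyps(4)[of p] that by (intro incseq_le) (auto simp: incseq_def le_fun_def space_vol)
  have um: "u \<in> borel_measurable vol"
    by (rule borel_measurable_LIMSEQ_real[OF seq.hyps(4) seq.hyps(1)])
  have dom: "\<bar>U i p * indicator W p\<bar> \<le> \<bar>u p * indicator W p\<bar>" if "p \<in> cint C" for i p
    using le[OF that, of i] seq(2)[of i p] by (simp add: indicator_def)
  show ?case
  proof (rule agree_dominated[OF e, of _ "\<lambda>i p. U i p * indicator W p"])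
    show "(\<lambda>p. u p * indicator W p) \<in> borel_measurable vol" by (intro borel_measurable_times um indicator_vol Ws)
    show "(\<lambda>p. U i p * indicator W p) \<in> borel_measurable vol" for i by (intro borel_measurable_times seq(1) indicator_vol Ws)
    show "(\<lambda>i. U i p * indicator W p) \<longlonglongrightarrow> u p * indicator W p" if "p \<in> cint C" for p
      using that seq.hyps(4) by (intro tendsto_intros) (simp add: space_vol)
    show "rmult (\<lambda>p. U i p * indicator W p) (fsec t j) \<in> agree_set" for i
      by (rule seq.IH, rule order_le_less_trans[OF N2_rmult_mono[OF e dom] seq.prems])
  qed (use dom seq.prems in auto)
qed

lemma agree_real:
  assumes t: "t \<in> trivs E" and j: "j < trank t" and c: "c \<in> catlas C"
    and W: "openin (cres C) W" "W \<subseteq> fst c" "W \<subseteq> tdom t" "W \<subseteq> cint C"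
    and fin: "N2 (rmult (indicator W) (fsec t j)) < \<infinity>"
    and u: "u \<in> borel_measurable vol" and finu: "N2 (rmult (\<lambda>p. u p * indicator W p) (fsec t j)) < \<infinity>"
  shows "rmult (\<lambda>p. u p * indicator W p) (fsec t j) \<in> agree_set"
proof -
  have e: "fsec t j \<in> msec" by (rule fsec_msec[OF t j])
  \<comment> \<open>For \<open>a = 1\<close> and \<open>a = -1\<close> these are the positive and the negative part of \<open>u\<close>.\<close>
  have *: "rmult (\<lambda>p. max 0 (a * u p) * indicator W p) (fsec t j) \<in> agree_set" if "\<bar>a\<bar> = 1" for a
  proof (rule agree_nonneg[OF t j c W fin])
    show "(\<lambda>p. max 0 (a * u p)) \<in> borel_measurable vol" using u by measurable
    have le: "max 0 (a * u p) \<le> \<bar>u p\<bar>" for p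
    proof -
      have "a * u p \<le> \<bar>a * u p\<bar>" by simp
      then show ?thesis using that by (simp add: abs_mult)
    qed
    show "N2 (rmult (\<lambda>p. max 0 (a * u p) * indicator W p) (fsec t j)) < \<infinity>"
      by (rule order_le_less_trans[OF N2_rmult_mono[OF e] finu]) (use le in \<open>simp add: indicator_def\<close>)
  qed simp
  have "(\<lambda>p i. rmult (\<lambda>p. max 0 (1 * u p) * indicator W p) (fsec t j) p i -
      rmult (\<lambda>p. max 0 ((-1) * u p) * indicator W p) (fsec t j) p i) \<in> agree_set"
    by (intro agree_diff *) auto
  moreover have "(\<lambda>p i. rmult (\<lambda>p. max 0 (1 * u p) * indicator W p) (fsec t j) p i -
      rmult (\<lambda>p. max 0 ((-1) * u p) * indicator W p) (fsec t j) p i) = rmult (\<lambda>p. u p * indicator W p) (fsec t j)"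
    by (intro ext) (auto simp: rmult_def max_def)
  ultimately show ?thesis by simp
qed

definition agree_within :: "'p set \<Rightarrow> bool"
  where "agree_within V \<longleftrightarrow> (\<forall>s\<in>L2_sections C vol E. \<forall>A\<in>sets vol. A \<subseteq> V \<longrightarrow> rmult (indicator A) s \<in> agree_set)"

text \<open>On a small open set of finite volume the section is a finite combination of frame sections.  Real and
  imaginary parts of the coefficients are treated separately, as scalar factors are real so far.  Each
  of the resulting sections is square integrable because the coordinates are bounded by the norm of the
  section, and the norms of the frame vectors are bounded.\<close>

lemma agree_within_locally:
  assumes p: "p \<in> cint C"
  shows "\<exists>V. openin (cres C) V \<and> p \<in> V \<and> V \<subseteq> cint C \<and> agree_within V"
proof -
  obtain t where t: "t \<in> trivs E" "p \<in> tdom t" using triv_exists cint_top[OF p] by blast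
  obtain V1 B1 where V1: "openin (cres C) V1" "p \<in> V1" "V1 \<subseteq> tdom t" "0 < B1"
    "\<forall>q\<in>V1. \<forall>v\<in>fibre E q. \<forall>l. cmod (tmap t q v l) \<le> B1 * sqrt (nsq q v)"
    using coord_le_nsq_locally[OF t] by blast
  obtain V2 B2 where V2: "openin (cres C) V2" "p \<in> V2" "V2 \<subseteq> tdom t" "0 < B2"
    "\<forall>q\<in>V2. \<forall>v\<in>fibre E q. \<forall>b. (\<forall>l<trank t. cmod (tmap t q v l) \<le> b) \<longrightarrow> nsq q v \<le> B2 * b\<^sup>2"
    using nsq_le_coord_locally[OF t] by blast
  have "openin (cres C) (V1 \<inter> V2 \<inter> cint C)" by (intro openin_Int V1 V2 cint_openin)
  from vol_locally_finite[OF _ this, of p] V1(2) V2(2) p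
  obtain W c where W0: "openin (cres C) W" "p \<in> W" "W \<subseteq> V1 \<inter> V2 \<inter> cint C" "c \<in> catlas C" "W \<subseteq> fst c" "emeasure vol W < \<infinity>"
    by blast
  then have c: "c \<in> catlas C" and W: "openin (cres C) W" "W \<subseteq> fst c" "W \<subseteq> tdom t" "W \<subseteq> cint C" using V1(3) by auto
  have Ws: "W \<in> sets vol" by (rule openin_sets_vol[OF W(1,4)])
  have fr: "nsq q (fsec t j q) \<le> B2" if "q \<in> W" "j < trank t" for q j
  proof -
    have q: "q \<in> V2" "q \<in> tdom t" "q \<in> cint C" using that W0(3) W by auto
    have "\<forall>l<trank t. cmod (tmap t q (frame t j q) l) \<le> 1"
      by (simp add: tmap_frame[OF t(1) q(2) that(2)])
    then have "nsq q (frame t j q) \<le> B2 * 1\<^sup>2"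
      using V2(5) q frame_fibre[OF t(1) q(2) that(2)] by blast
    then show ?thesis using q by (simp add: fsec_def)
  qed
  have fin: "N2 (rmult (indicator W) (fsec t j)) < \<infinity>" if j: "j < trank t" for j
  proof -
    have "N2 (rmult (indicator W) (fsec t j)) \<le> (\<integral>\<^sup>+q. ennreal B2 * indicator W q \<partial>vol)"
      unfolding N2_rmult[OF fsec_msec[OF t(1) j]]
      by (intro nn_integral_mono) (use fr j in \<open>auto simp: indicator_def intro: ennreal_leI\<close>)
    also have "\<dots> = ennreal B2 * emeasure vol W" by (rule nn_integral_cmult_indicator[OF Ws])
    also have "\<dots> < \<infinity>" using W0(6) by (simp add: ennreal_mult_less_top)
    finally show ?thesis .
  qed
  have "rmult (indicator A) s \<in> agree_set" if s: "s \<in> L2_sections C vol E" and A: "A \<in> sets vol" "A \<subseteq> W" for s A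
  proof -
    have sm: "s \<in> msec" "N2 s < \<infinity>" using s L2_iff by auto
    define a where "a = (\<lambda>j q. indicator (tdom t \<inter> cint C) q *\<^sub>R tmap t q (s q) j)"
    have am: "a j \<in> borel_measurable vol" if "j < trank t" for j
    proof -
      have "tdom t \<inter> cint C \<inter> space vol \<in> sets vol"
        using openin_sets_vol[OF triv_cint_openin[OF t(1)]] by (simp add: space_vol)
      then show ?thesis
        using msec_coord[OF sm(1) t(1) that] unfolding a_def by (simp add: borel_measurable_restrict_space_iff)
    qed
    have a_eq: "a j q = tmap t q (s q) j" if "q \<in> W" for j q
    proof -
      have "q \<in> tdom t \<inter> cint C" using that W by blast
      then show ?thesis by (simp add: a_def)
    qed
    have coord: "rmult (\<lambda>q. (u (a j q) * indicator A q) * indicator W q) (fsec t j) \<in> agree_set"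
      if u: "u \<in> borel_measurable borel" "\<And>z. \<bar>u z\<bar> \<le> cmod z" and j: "j < trank t" for u :: "complex \<Rightarrow> real" and j
    proof (rule agree_real[OF t(1) j c W fin[OF j]])
      have "(\<lambda>q. u (a j q)) \<in> borel_measurable vol" using am[OF j] u(1) by (rule measurable_compose)
      then show "(\<lambda>q. u (a j q) * indicator A q) \<in> borel_measurable vol"
        by (intro borel_measurable_times indicator_vol A(1))
      have "N2 (rmult (\<lambda>q. (u (a j q) * indicator A q) * indicator W q) (fsec t j)) \<le>
          (\<integral>\<^sup>+q. ennreal (B1\<^sup>2 * B2) * ennreal (nsq q (s q)) \<partial>vol)"
        unfolding N2_rmult[OF fsec_msec[OF t(1) j]]
      proof (rule nn_integral_mono)
        fix q assume "q \<in> space vol"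
        then have q: "q \<in> cint C" by (simp add: space_vol)
        have nn: "0 \<le> nsq q (s q)" by (rule nsq_nonneg_sec[OF sm(1) q])
        have "(u (a j q) * indicator A q * indicator W q)\<^sup>2 * nsq q (fsec t j q) \<le> B1\<^sup>2 * B2 * nsq q (s q)"
        proof (cases "q \<in> A")
          case True
          then have qW: "q \<in> W" using A by blast
          have "q \<in> V1" using W0(3) qW by blast
          then have "cmod (tmap t q (s q) j) \<le> B1 * sqrt (nsq q (s q))"
            using V1(5)[rule_format, OF _ msec_fibre[OF sm(1) q]] by simp
          then have "\<bar>u (a j q)\<bar> \<le> B1 * sqrt (nsq q (s q))"
            using u(2)[of "a j q"] unfolding a_eq[OF qW, of j] by (rule order_trans[rotated])
          then have "\<bar>u (a j q)\<bar>\<^sup>2 \<le> (B1 * sqrt (nsq q (s q)))\<^sup>2" by (rule power_mono) simp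
          then have "(u (a j q))\<^sup>2 \<le> B1\<^sup>2 * nsq q (s q)" using nn by (simp add: power_mult_distrib)
          then have "(u (a j q))\<^sup>2 * nsq q (fsec t j q) \<le> (B1\<^sup>2 * nsq q (s q)) * B2"
            using fr[OF qW j] nn nsq_nonneg_sec[OF fsec_msec[OF t(1) j] q] by (intro mult_mono) auto
          then show ?thesis using True qW by (simp add: mult_ac)
        next
          case False
          then show ?thesis using nn V2(4) by simp
        qed
        then show "ennreal ((u (a j q) * indicator A q * indicator W q)\<^sup>2 * nsq q (fsec t j q)) \<le>
            ennreal (B1\<^sup>2 * B2) * ennreal (nsq q (s q))"
          using nn V2(4) by (simp add: ennreal_leI flip: ennreal_mult)
      qed
      also have "\<dots> = ennreal (B1\<^sup>2 * B2) * N2 s"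
        unfolding N2_def using nsq_measurable[OF sm(1)] by (intro nn_integral_cmult) measurable
      also have "\<dots> < \<infinity>" using sm(2) by (simp add: ennreal_mult_less_top)
      finally show "N2 (rmult (\<lambda>q. (u (a j q) * indicator A q) * indicator W q) (fsec t j)) < \<infinity>" .
    qed
    have re: "rmult (\<lambda>q. (Re (a j q) * indicator A q) * indicator W q) (fsec t j) \<in> agree_set" if "j < trank t" for j
      by (rule coord[OF _ _ that]) (auto intro: abs_Re_le_cmod)
    have im: "rmult (\<lambda>q. (Im (a j q) * indicator A q) * indicator W q) (fsec t j) \<in> agree_set" if "j < trank t" for j
      by (rule coord[OF _ _ that]) (auto intro: abs_Im_le_cmod)
    \<comment> \<open>For a real bundle, multiplication by \<open>\<i>\<close> leaves the fibres, but then the imaginary parts vanish.\<close>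
    have iim: "(\<lambda>q i. \<i> * rmult (\<lambda>q. (Im (a j q) * indicator A q) * indicator W q) (fsec t j) q i) \<in> agree_set"
      if j: "j < trank t" for j
    proof (cases "K = UNIV")
      case True
      then show ?thesis using agree_scale[OF im[OF j], of \<i>] by simp
    next
      case False
      then have R: "K = \<real>" using K by blast
      have "Im (a j q) * indicator A q = 0" for q
      proof (cases "q \<in> A")
        case True
        then have "q \<in> W" using A by blast
        moreover from this have "q \<in> tdom t" "q \<in> cint C" using W by auto
        ultimately have "a j q \<in> \<real>"
          using a_eq triv_coord_K[OF t(1) _ msec_fibre[OF sm(1)]] unfolding R by metis
        then show ?thesis by (simp add: complex_is_Real_iff)
      qed simp
      then have "(\<lambda>q i. \<i> * rmult (\<lambda>q. (Im (a j q) * indicator A q) * indicator W q) (fsec t j) q i) = (\<lambda>q i. 0)"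
        by (simp add: rmult_def fun_eq_iff del: mult_eq_0_iff)
      then show ?thesis using agree_zero by simp
    qed
    have "(\<lambda>q i. \<Sum>j<trank t. rmult (\<lambda>q. (Re (a j q) * indicator A q) * indicator W q) (fsec t j) q i +
        \<i> * rmult (\<lambda>q. (Im (a j q) * indicator A q) * indicator W q) (fsec t j) q i) \<in> agree_set"
      by (intro agree_sum agree_add re iim) auto
    moreover have "(\<Sum>j<trank t. rmult (\<lambda>q. (Re (a j q) * indicator A q) * indicator W q) (fsec t j) q i +
        \<i> * rmult (\<lambda>q. (Im (a j q) * indicator A q) * indicator W q) (fsec t j) q i) = rmult (indicator A) s q i" for q i
    proof (cases "q \<in> A")
      case True
      then have q: "q \<in> W" "q \<in> tdom t" "q \<in> cint C" using A W by auto
      have "(\<Sum>j<trank t. rmult (\<lambda>q. (Re (a j q) * indicator A q) * indicator W q) (fsec t j) q i +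
          \<i> * rmult (\<lambda>q. (Im (a j q) * indicator A q) * indicator W q) (fsec t j) q i) =
        (\<Sum>j<trank t. tmap t q (s q) j * frame t j q i)"
      proof (rule sum.cong)
        fix j
        have "a j q = complex_of_real (Re (a j q)) + \<i> * complex_of_real (Im (a j q))" by (rule complex_eq)
        then show "rmult (\<lambda>q. (Re (a j q) * indicator A q) * indicator W q) (fsec t j) q i +
          \<i> * rmult (\<lambda>q. (Im (a j q) * indicator A q) * indicator W q) (fsec t j) q i = tmap t q (s q) j * frame t j q i"
          using True q unfolding a_eq[OF q(1), symmetric]
          by (simp add: rmult_def fsec_def flip: distrib_right mult.assoc)
      qed simp
      also have "\<dots> = s q i" using fun_cong[OF frame_expansion[OF t(1) q(2) msec_fibre[OF sm(1) q(3)]], of i] by simp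
      finally show ?thesis using True by (simp add: rmult_def)
    next
      case False
      then show ?thesis by (simp add: rmult_def)
    qed
    ultimately show ?thesis by simp
  qed
  then have "agree_within W" by (simp add: agree_within_def)
  then show ?thesis using W0(2) W by blast
qed

text \<open>Countably many small sets as above cover the interior; the section is the limit of its restrictions to
  finite unions of them, and such a restriction is a finite sum of restrictions to disjoint pieces.\<close>

lemma agree_all:
  assumes s: "s \<in> L2_sections C vol E"
  shows "AE p in vol. T0 s p = T1 s p"
proof -
  have "agree_within {}"
  proof -
    have "rmult (indicator {}) s = (\<lambda>p j. 0)" for s by (simp add: rmult_def)
    then show ?thesis using agree_zero unfolding agree_within_def by (metis subset_empty)
  qed
  then obtain V :: "nat \<Rightarrow> 'p set" where V: "\<And>i. openin (cres C) (V i)" "\<And>i. V i \<subseteq> cint C" "\<And>i. agree_within (V i)"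
    "(\<Union>i. V i) = cint C"
    using countable_open_cover[OF cint_openin, of agree_within, OF agree_within_locally] by metis
  have Vs: "V i \<in> sets vol" for i by (rule openin_sets_vol[OF V(1,2)])
  have sm: "s \<in> msec" "N2 s < \<infinity>" using s L2_iff by auto
  define v where "v = (\<lambda>n::nat. indicator (\<Union>i<n. V i) :: 'p \<Rightarrow> real)"
  have one: "rmult (\<lambda>p. 1) s = s" by (simp add: rmult_def)
  have "rmult (\<lambda>p. 1) s \<in> agree_set"
  proof (rule agree_dominated[OF sm(1), of _ v])
    show "v n \<in> borel_measurable vol" for n
      unfolding v_def using Vs by (intro indicator_vol sets.finite_UN) auto
    show "\<bar>v n p\<bar> \<le> \<bar>1\<bar>" for n p by (simp add: v_def indicator_def)
    have "(\<lambda>n. v n p) \<longlonglongrightarrow> indicator (\<Union>i. V i) p" for p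
      unfolding v_def by (rule LIMSEQ_indicator_UN)
    then show "(\<lambda>n. v n p) \<longlonglongrightarrow> 1" if "p \<in> cint C" for p
      using that V(4) by (metis indicator_simps(1))
    show "N2 (rmult (\<lambda>p. 1) s) < \<infinity>" using sm(2) by (simp add: one)
    show "rmult (v n) s \<in> agree_set" for n
    proof (induction n)
      case 0
      then show ?case using agree_zero by (simp add: rmult_def v_def)
    next
      case (Suc n)
      let ?A = "V n - (\<Union>i<n. V i)"
      have "?A \<in> sets vol" using Vs by (intro sets.Diff sets.finite_UN) auto
      then have "rmult (indicator ?A) s \<in> agree_set"
        using V(3)[of n] s unfolding agree_within_def by blast
      moreover have "rmult (v (Suc n)) s = (\<lambda>p i. rmult (v n) s p i + rmult (indicator ?A) s p i)"
        by (intro ext) (auto simp: rmult_def v_def indicator_def less_Suc_eq)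
      ultimately show ?case using agree_add[OF Suc] by simp
    qed
  qed simp
  then show ?thesis by (simp add: one agree_set_def)
qed

end

end

section \<open>Geometric endomorphisms on square integrable sections\<close>

context L2_mfd
begin

lemma nn_integral_diffeo:
  assumes f: "diffeo_pair f h" and u: "u \<in> borel_measurable vol"
  shows "(\<integral>\<^sup>+p. u (f p) \<partial>vol) = (\<integral>\<^sup>+p. ennreal (dens h p) * u p \<partial>vol)"
proof -
  have "(\<integral>\<^sup>+p. u (f p) \<partial>vol) = (\<integral>\<^sup>+p. u p \<partial>distr vol vol f)"
    using diffeo_measurable[OF f] u by (simp add: nn_integral_distr)
  also have "\<dots> = (\<integral>\<^sup>+p. ennreal (dens h p) * u p \<partial>vol)"
    unfolding distr_eq_density[OF f]
    using u dens_measurable[OF diffeo_pair_sym[OF f]] by (intro nn_integral_density) auto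
  finally show ?thesis .
qed

lemma integral_diffeo:
  fixes u :: "'p \<Rightarrow> complex"
  assumes f: "diffeo_pair f h" and u: "u \<in> borel_measurable vol"
  shows "(\<integral>p. u (f p) \<partial>vol) = (\<integral>p. of_real (dens h p) * u p \<partial>vol)"
proof -
  note h = diffeo_pair_sym[OF f]
  have "(\<integral>p. u (f p) \<partial>vol) = (\<integral>p. u p \<partial>distr vol vol f)"
    using diffeo_measurable[OF f] u by (simp add: integral_distr)
  also have "\<dots> = (\<integral>p. dens h p *\<^sub>R u p \<partial>vol)"
    unfolding distr_eq_density[OF f]
    using u dens_measurable[OF h] dens_pos[OF h]
    by (intro integral_density) (auto simp: space_vol less_imp_le)
  finally show ?thesis by (simp add: scaleR_conv_of_real)
qed

lemma geom_op_msec: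
  assumes f: "diffeo_pair f h" and \<phi>: "bundle_hom_pullback K C f E \<phi>" and s: "s \<in> msec"
  shows "geom_op C f \<phi> s \<in> msec"
  unfolding msec_def
proof (intro CollectI conjI ballI allI impI geom_op_sections[OF f \<phi> msec_sections[OF s]])
  fix t' l assume t': "t' \<in> trivs E" and l: "l < trank t'"
  show "(\<lambda>p. tmap t' p (geom_op C f \<phi> s p) l) \<in> borel_measurable (restrict_space vol (tdom t' \<inter> cint C))"
  proof (rule measurable_glue[OF triv_cint_openin[OF t']])
    fix p assume p: "p \<in> tdom t' \<inter> cint C"
    then have ps: "p \<in> topspace (cres C)" using cint_top by blast
    obtain t where t: "t \<in> trivs E" "f p \<in> tdom t" using triv_exists diffeo_pair_in[OF f ps] by blast
    obtain m where m: "\<And>l j. smooth_fun (catlas C) (f -` tdom t \<inter> tdom t') (m l j)"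
      "\<And>p v l. p \<in> f -` tdom t \<Longrightarrow> p \<in> tdom t' \<Longrightarrow> v \<in> fibre E (f p) \<Longrightarrow> l < trank t' \<Longrightarrow>
        tmap t' p (\<phi> p v) l = (\<Sum>j<trank t. m l j p * tmap t (f p) v j)"
      using bundle_hom_coord[OF \<phi> t(1) t'] by blast
    let ?V = "(f -` tdom t \<inter> topspace (cres C)) \<inter> (tdom t' \<inter> cint C)"
    have V: "openin (cres C) ?V"
      by (intro openin_Int vimage_openin diffeo_pair_continuous[OF f] triv_openin t t' cint_openin)
    have spV: "space (restrict_space vol ?V) = ?V" by (auto simp: space_restrict_space space_vol)
    have fV: "f \<in> measurable (restrict_space vol ?V) (restrict_space vol (tdom t \<inter> cint C))"
      by (rule measurable_restrict_space3[OF diffeo_measurable[OF f]])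
        (use diffeo_pair_cint[OF f] in auto)
    have "(\<lambda>q. \<Sum>j<trank t. m l j q * tmap t (f q) (s (f q)) j) \<in> borel_measurable (restrict_space vol ?V)"
    proof (intro borel_measurable_sum borel_measurable_times)
      fix j assume "j \<in> {..<trank t}"
      then have "(\<lambda>q. tmap t q (s q) j) \<in> borel_measurable (restrict_space vol (tdom t \<inter> cint C))"
        using msec_coord[OF s t(1)] by simp
      from measurable_compose[OF fV this]
      show "(\<lambda>q. tmap t (f q) (s (f q)) j) \<in> borel_measurable (restrict_space vol ?V)" .
      show "m l j \<in> borel_measurable (restrict_space vol ?V)"
        by (rule smooth_fun_measurable[OF smooth_fun_subset[OF m(1)] V]) auto
    qed
    then have "(\<lambda>q. tmap t' q (geom_op C f \<phi> s q) l) \<in> borel_measurable (restrict_space vol ?V)"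
      by (rule measurable_cong[THEN iffD1, rotated])
        (use spV l m(2) msec_fibre[OF s] diffeo_pair_cint[OF f] in \<open>auto simp: geom_op_def\<close>)
    moreover have "p \<in> ?V" using p ps t(2) by simp
    ultimately show "\<exists>V. openin (cres C) V \<and> p \<in> V \<and> V \<subseteq> tdom t' \<inter> cint C \<and>
        (\<lambda>p. tmap t' p (geom_op C f \<phi> s p) l) \<in> borel_measurable (restrict_space vol V)"
      using V by (intro exI[of _ ?V] conjI) auto
  qed simp
qed

text \<open>The square of the norm of \<open>\<phi> (s \<circ> f)\<close> is at most the integral of \<open>B\<^sub>1 \<bar>s\<bar>\<^sup>2 \<circ> f\<close>, which is the integral of
  \<open>B\<^sub>1 \<delta> \<bar>s\<bar>\<^sup>2\<close> with the volume distortion \<open>\<delta> \<le> B\<^sub>2\<close> of \<open>h\<close>.\<close>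

lemma geom_op_bounded:
  assumes f: "diffeo_pair f h" and \<phi>: "bundle_hom_pullback K C f E \<phi>"
  shows "L2_bounded_operator K C vol E (geom_op C f \<phi>)"
proof -
  note h = diffeo_pair_sym[OF f]
  obtain B1 where B1: "\<forall>p\<in>topspace (cres C). \<forall>v\<in>fibre E (f p). nsq p (\<phi> p v) \<le> B1 * nsq (f p) v"
    using bundle_hom_bounded[OF f \<phi>] by blast
  obtain B2 where B2: "\<forall>p\<in>cint C. dens h p \<le> B2" using dens_bounded[OF h] by blast
  \<comment> \<open>The bounds may be negative if all fibres are zero or the interior is empty.\<close>
  define b1 where "b1 = max B1 0"
  define b2 where "b2 = max B2 0"
  show ?thesis
  proof (rule bounded_operatorI)
    fix s u assume "s \<in> L2_sections C vol E" "u \<in> L2_sections C vol E"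
    then have su: "s \<in> msec" "u \<in> msec" using L2_iff by auto
    show "geom_op C f \<phi> (\<lambda>p j. s p j + u p j) = (\<lambda>p j. geom_op C f \<phi> s p j + geom_op C f \<phi> u p j)"
    proof (intro ext)
      fix p j
      show "geom_op C f \<phi> (\<lambda>p j. s p j + u p j) p j = geom_op C f \<phi> s p j + geom_op C f \<phi> u p j"
      proof (cases "p \<in> cint C")
        case True
        have "\<phi> p (\<lambda>j. s (f p) j + u (f p) j) = (\<lambda>j. \<phi> p (s (f p)) j + \<phi> p (u (f p)) j)"
          using bundle_hom_linear[OF \<phi> cint_top[OF True]] msec_fibre[OF su(1)] msec_fibre[OF su(2)]
            diffeo_pair_cint[OF f True] unfolding K_linear_on_def by blast
        then show ?thesis using True by (simp add: geom_op_def)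
      qed (simp add: geom_op_def)
    qed
  next
    fix a s assume a: "a \<in> K" and "s \<in> L2_sections C vol E"
    then have s: "s \<in> msec" using L2_iff by auto
    show "geom_op C f \<phi> (\<lambda>p j. a * s p j) = (\<lambda>p j. a * geom_op C f \<phi> s p j)"
    proof (intro ext)
      fix p j
      show "geom_op C f \<phi> (\<lambda>p j. a * s p j) p j = a * geom_op C f \<phi> s p j"
      proof (cases "p \<in> cint C")
        case True
        have "\<phi> p (\<lambda>j. a * s (f p) j) = (\<lambda>j. a * \<phi> p (s (f p)) j)"
          using bundle_hom_linear[OF \<phi> cint_top[OF True]] msec_fibre[OF s] a
            diffeo_pair_cint[OF f True] unfolding K_linear_on_def by blast
        then show ?thesis using True by (simp add: geom_op_def)
      qed (simp add: geom_op_def)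
    qed
  next
    fix s assume "s \<in> L2_sections C vol E"
    then have s: "s \<in> msec" using L2_iff by auto
    then show "geom_op C f \<phi> s \<in> msec" by (rule geom_op_msec[OF f \<phi>])
    have nm: "(\<lambda>p. ennreal (nsq p (s p))) \<in> borel_measurable vol" using nsq_measurable[OF s] by measurable
    have "N2 (geom_op C f \<phi> s) \<le> (\<integral>\<^sup>+p. ennreal b1 * ennreal (nsq (f p) (s (f p))) \<partial>vol)"
      unfolding N2_def
    proof (rule nn_integral_mono)
      fix p assume "p \<in> space vol"
      then have p: "p \<in> cint C" "f p \<in> cint C" using diffeo_pair_cint[OF f] by (auto simp: space_vol)
      have nn: "0 \<le> nsq (f p) (s (f p))" by (rule nsq_nonneg_sec[OF s p(2)])
      have "nsq p (geom_op C f \<phi> s p) \<le> B1 * nsq (f p) (s (f p))"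
        using B1 cint_top[OF p(1)] msec_fibre[OF s p(2)] p(1) by (simp add: geom_op_def)
      also have "\<dots> \<le> b1 * nsq (f p) (s (f p))" using nn by (intro mult_right_mono) (simp_all add: b1_def)
      finally show "ennreal (nsq p (geom_op C f \<phi> s p)) \<le> ennreal b1 * ennreal (nsq (f p) (s (f p)))"
        using nn by (simp add: ennreal_leI b1_def flip: ennreal_mult)
    qed
    also have "\<dots> = ennreal b1 * (\<integral>\<^sup>+p. ennreal (nsq (f p) (s (f p))) \<partial>vol)"
      using measurable_compose[OF diffeo_measurable[OF f] nm] by (rule nn_integral_cmult)
    also have "(\<integral>\<^sup>+p. ennreal (nsq (f p) (s (f p))) \<partial>vol) = (\<integral>\<^sup>+p. ennreal (dens h p) * ennreal (nsq p (s p)) \<partial>vol)"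
      by (rule nn_integral_diffeo[OF f nm])
    also have "\<dots> \<le> (\<integral>\<^sup>+p. ennreal b2 * ennreal (nsq p (s p)) \<partial>vol)"
      using B2 by (intro nn_integral_mono mult_right_mono ennreal_leI) (auto simp: space_vol b2_def le_max_iff_disj)
    also have "\<dots> = ennreal b2 * N2 s" unfolding N2_def using nm by (rule nn_integral_cmult)
    finally show "N2 (geom_op C f \<phi> s) \<le> ennreal (b1 * b2) * N2 s"
      by (simp add: ennreal_mult b1_def b2_def mult.assoc mult_left_mono)
  qed (simp add: b1_def b2_def)
qed

subsection \<open>The adjoint\<close>

text \<open>Pointwise, \<open>\<langle>\<phi> (s \<circ> f), u\<rangle>\<close> equals \<open>\<langle>s, \<phi>\<^sup>* (u \<circ> h)\<rangle> \<circ> f\<close>; substituting \<open>h\<close> for the variable produces the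
  factor \<open>dens h\<close>.\<close>

definition geom_adjoint :: "('p \<Rightarrow> 'p) \<Rightarrow> ('p \<Rightarrow> cvec \<Rightarrow> cvec) \<Rightarrow> ('p \<Rightarrow> cvec) \<Rightarrow> 'p \<Rightarrow> cvec"
  where "geom_adjoint h \<phi> s = rmult (dens h) (geom_op C h (adjoint_hom h \<phi>) s)"

lemma geom_adjoint_bounded:
  assumes f: "diffeo_pair f h" and \<phi>: "bundle_hom_pullback K C f E \<phi>"
  shows "L2_bounded_operator K C vol E (geom_adjoint h \<phi>)"
proof -
  note h = diffeo_pair_sym[OF f]
  let ?T = "geom_op C h (adjoint_hom h \<phi>)"
  have T: "L2_bounded_operator K C vol E ?T"
    by (rule geom_op_bounded[OF h adjoint_hom_pullback[OF f \<phi>]])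
  obtain b where b: "0 \<le> b" "\<And>s. s \<in> L2_sections C vol E \<Longrightarrow> N2 (?T s) \<le> ennreal b * N2 s"
    by (rule bounded_operator_N2[OF T]) (use that in blast)
  obtain B2 where B2: "\<forall>p\<in>cint C. dens h p \<le> B2" using dens_bounded[OF h] by blast
  have le: "N2 (geom_adjoint h \<phi> s) \<le> ennreal (B2\<^sup>2 * b) * N2 s" and m: "geom_adjoint h \<phi> s \<in> msec"
    if s: "s \<in> L2_sections C vol E" for s
  proof -
    have Ts: "?T s \<in> msec" using bounded_operatorD(1)[OF T s] L2_iff by blast
    then show "geom_adjoint h \<phi> s \<in> msec"
      unfolding geom_adjoint_def by (rule msec_rmult[OF _ dens_measurable[OF h]])
    have "N2 (geom_adjoint h \<phi> s) \<le> ennreal (B2\<^sup>2) * N2 (?T s)"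
    proof (rule N2_mono[OF _ _ Ts])
      fix p assume p: "p \<in> cint C"
      have "(dens h p)\<^sup>2 \<le> B2\<^sup>2" using B2 dens_pos[OF h p] p by (intro power_mono) auto
      then show "nsq p (geom_adjoint h \<phi> s p) \<le> B2\<^sup>2 * nsq p (?T s p)"
        unfolding geom_adjoint_def nsq_rmult[OF Ts p]
        by (rule mult_right_mono) (rule nsq_nonneg_sec[OF Ts p])
    qed simp
    also have "\<dots> \<le> ennreal (B2\<^sup>2) * (ennreal b * N2 s)" by (intro mult_left_mono b(2) s) simp
    finally show "N2 (geom_adjoint h \<phi> s) \<le> ennreal (B2\<^sup>2 * b) * N2 s"
      using b(1) by (simp add: ennreal_mult mult.assoc)
  qed
  have lin: "adjoint_hom h \<phi> p (\<lambda>j. v j + w j) = (\<lambda>j. adjoint_hom h \<phi> p v j + adjoint_hom h \<phi> p w j)"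
    "a \<in> K \<Longrightarrow> adjoint_hom h \<phi> p (\<lambda>j. a * v j) = (\<lambda>j. a * adjoint_hom h \<phi> p v j)"
    if "p \<in> cint C" "v \<in> fibre E (h p)" "w \<in> fibre E (h p)" for p v w a
    using bundle_hom_linear[OF adjoint_hom_pullback[OF f \<phi>] cint_top[OF that(1)]] that(2,3)
    unfolding K_linear_on_def by blast+
  show ?thesis
  proof (rule bounded_operatorI[OF _ _ m _ le])
    fix s u assume "s \<in> L2_sections C vol E" "u \<in> L2_sections C vol E"
    then have su: "s \<in> msec" "u \<in> msec" using L2_iff by auto
    show "geom_adjoint h \<phi> (\<lambda>p j. s p j + u p j) = (\<lambda>p j. geom_adjoint h \<phi> s p j + geom_adjoint h \<phi> u p j)"
      using lin(1)[OF _ msec_fibre[OF su(1)] msec_fibre[OF su(2)]] diffeo_pair_cint[OF h]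
      by (intro ext) (auto simp: geom_adjoint_def geom_op_def rmult_def distrib_left)
  next
    fix a s assume a: "a \<in> K" and "s \<in> L2_sections C vol E"
    then have s: "s \<in> msec" using L2_iff by auto
    show "geom_adjoint h \<phi> (\<lambda>p j. a * s p j) = (\<lambda>p j. a * geom_adjoint h \<phi> s p j)"
      using lin(2)[OF _ msec_fibre[OF s] msec_fibre[OF s] a] diffeo_pair_cint[OF h]
      by (intro ext) (auto simp: geom_adjoint_def geom_op_def rmult_def)
  qed (assumption | rule mult_nonneg_nonneg[OF zero_le_power2 b(1)])+
qed

lemma geom_adjoint_inner:
  assumes f: "diffeo_pair f h" and \<phi>: "bundle_hom_pullback K C f E \<phi>"
    and s: "s \<in> L2_sections C vol E" and u: "u \<in> L2_sections C vol E"
  shows "L2_inner vol E (geom_op C f \<phi> s) u = L2_inner vol E s (geom_adjoint h \<phi> u)"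
proof -
  note h = diffeo_pair_sym[OF f]
  let ?T = "geom_op C h (adjoint_hom h \<phi>)"
  have sm: "s \<in> msec" and um: "u \<in> msec" using s u L2_iff by auto
  have Tu: "?T u \<in> msec" by (rule geom_op_msec[OF h adjoint_hom_pullback[OF f \<phi>] um])
  define w where "w = (\<lambda>q. fmetric E q (s q) (?T u q))"
  have wm: "w \<in> borel_measurable vol" unfolding w_def by (rule metric_measurable[OF sm Tu])
  have "L2_inner vol E (geom_op C f \<phi> s) u = (\<integral>p. w (f p) \<partial>vol)"
    unfolding L2_inner_def
  proof (rule Bochner_Integration.integral_cong)
    fix p assume "p \<in> space vol"
    then have p: "p \<in> cint C" "f p \<in> cint C" using diffeo_pair_cint[OF f] by (auto simp: space_vol)
    have "fmetric E p (\<phi> p (s (f p))) (u p) = fmetric E (f p) (s (f p)) (adjoint_hom h \<phi> (f p) (u p))"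
      by (rule adjoint_hom_metric[OF f \<phi> cint_top[OF p(1)] msec_fibre[OF sm p(2)] msec_fibre[OF um p(1)]])
    then show "fmetric E p (geom_op C f \<phi> s p) (u p) = w (f p)"
      using p diffeo_pair_inv[OF f cint_top[OF p(1)]] by (simp add: w_def geom_op_def)
  qed simp
  also have "\<dots> = (\<integral>p. of_real (dens h p) * w p \<partial>vol)" by (rule integral_diffeo[OF f wm])
  also have "\<dots> = L2_inner vol E s (geom_adjoint h \<phi> u)"
    unfolding L2_inner_def
  proof (rule Bochner_Integration.integral_cong)
    fix p assume "p \<in> space vol"
    then have p: "p \<in> cint C" by (simp add: space_vol)
    show "of_real (dens h p) * w p = fmetric E p (s p) (geom_adjoint h \<phi> u p)"
      using metric_scale_right[OF cint_top[OF p] msec_fibre[OF Tu p] msec_fibre[OF sm p] K_of_real]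
      by (simp add: w_def geom_adjoint_def rmult_def)
  qed simp
  finally show ?thesis .
qed

text \<open>The fibrewise adjoint is a bundle homomorphism over \<open>h\<close>, so it preserves smooth sections with compact
  support, and so does multiplication by the smooth function \<open>dens h\<close>.\<close>

lemma geom_adjoint_Cc:
  assumes f: "diffeo_pair f h" and \<phi>: "bundle_hom_pullback K C f E \<phi>" and s: "s \<in> Cc_sections C E"
  shows "geom_adjoint h \<phi> s \<in> Cc_sections C E"
proof -
  note h = diffeo_pair_sym[OF f]
  let ?u = "geom_op C h (adjoint_hom h \<phi>) s"
  have u: "?u \<in> Cc_sections C E" by (rule geom_op_Cc[OF h adjoint_hom_pullback[OF f \<phi>] s])
  then obtain Q where Q: "compactin (cres C) Q" "Q \<subseteq> cint C" "\<forall>p. p \<notin> Q \<longrightarrow> ?u p = (\<lambda>j. 0)"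
    by (auto simp: Cc_sections_def)
  have um: "?u \<in> msec" by (rule Cc_msec[OF u])
  have "rmult (dens h) ?u \<in> sections C E"
    by (rule msec_sections[OF msec_rmult[OF um dens_measurable[OF h]]])
  moreover have "smooth_fun (catlas C) (tdom t \<inter> cint C) (\<lambda>p. tmap t p (rmult (dens h) ?u p) j)"
    if t: "t \<in> trivs E" and j: "j < trank t" for t j
  proof (rule smooth_fun_cong)
    have "smooth_fun (catlas C) (tdom t \<inter> cint C) (\<lambda>p. tmap t p (?u p) j)"
      using u t j by (simp add: Cc_sections_def smooth_sections_def)
    then show "smooth_fun (catlas C) (tdom t \<inter> cint C) (\<lambda>p. complex_of_real (dens h p) * tmap t p (?u p) j)"
      by (intro smooth_fun_mult smooth_fun_of_real smooth_fun_subset[OF dens_smooth[OF h]]) auto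
    fix p assume "p \<in> tdom t \<inter> cint C"
    then show "complex_of_real (dens h p) * tmap t p (?u p) j = tmap t p (rmult (dens h) ?u p) j"
      using triv_scale[OF t _ K_of_real msec_fibre[OF um]] by (simp add: rmult_def)
  qed
  moreover have "rmult (dens h) ?u p = (\<lambda>j. 0)" if "p \<notin> Q" for p
    using Q(3) that by (simp add: rmult_def)
  ultimately show ?thesis
    unfolding geom_adjoint_def Cc_sections_def smooth_sections_def using Q(1,2) by blast
qed

lemma integrable_metric:
  assumes s: "s \<in> L2_sections C vol E" and u: "u \<in> L2_sections C vol E"
  shows "integrable vol (\<lambda>p. fmetric E p (s p) (u p))"
proof (rule Bochner_Integration.integrable_bound)
  have sm: "s \<in> msec" "N2 s < \<infinity>" and um: "u \<in> msec" "N2 u < \<infinity>" using s u L2_iff by auto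
  show "integrable vol (\<lambda>p. nsq p (s p) + nsq p (u p))"
    using integrable_nsq_iff sm um by (intro Bochner_Integration.integrable_add) auto
  show "(\<lambda>p. fmetric E p (s p) (u p)) \<in> borel_measurable vol" by (rule metric_measurable[OF sm(1) um(1)])
  show "AE p in vol. norm (fmetric E p (s p) (u p)) \<le> norm (nsq p (s p) + nsq p (u p))"
  proof (rule AE_I2)
    fix p assume "p \<in> space vol"
    then have p: "p \<in> cint C" by (simp add: space_vol)
    have nn: "0 \<le> nsq p (s p)" "0 \<le> nsq p (u p)" by (rule nsq_nonneg_sec[OF sm(1) p] nsq_nonneg_sec[OF um(1) p])+
    have "cmod (fmetric E p (s p) (u p)) \<le> sqrt (nsq p (s p)) * sqrt (nsq p (u p))"
      by (intro metric_le cint_top p msec_fibre sm um)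
    also have "\<dots> \<le> nsq p (s p) + nsq p (u p)"
      using arith_geo_mean_sqrt[OF nn] nn by (simp add: real_sqrt_mult)
    finally show "norm (fmetric E p (s p) (u p)) \<le> norm (nsq p (s p) + nsq p (u p))" using nn by simp
  qed
qed

text \<open>Adjoints are unique: the difference of two candidates is orthogonal to itself.\<close>

lemma L2_adjoint_unique:
  assumes A: "L2_adjoint K C vol E T A" and B: "L2_adjoint K C vol E T B"
    and u: "u \<in> L2_sections C vol E"
  shows "AE p in vol. A u p = B u p"
proof -
  have bA: "L2_bounded_operator K C vol E A" and bB: "L2_bounded_operator K C vol E B"
    using A B by (auto simp: L2_adjoint_def)
  note Au = bounded_operatorD(1)[OF bA u] and Bu = bounded_operatorD(1)[OF bB u]
  define d where "d = (\<lambda>p j. A u p j - B u p j)"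
  have d: "d \<in> L2_sections C vol E" unfolding d_def by (rule L2_diff[OF Au Bu])
  have dm: "d \<in> msec" "A u \<in> msec" "B u \<in> msec" using d Au Bu L2_iff by auto
  have "L2_inner vol E d (A u) = L2_inner vol E d (B u)"
    using A B d u unfolding L2_adjoint_def by metis
  moreover have "L2_inner vol E d (A u) = L2_inner vol E d d + L2_inner vol E d (B u)"
  proof -
    have "L2_inner vol E d (A u) = (\<integral>p. fmetric E p (d p) (d p) + fmetric E p (d p) (B u p) \<partial>vol)"
      unfolding L2_inner_def
    proof (rule Bochner_Integration.integral_cong)
      fix p assume "p \<in> space vol"
      then have p: "p \<in> cint C" by (simp add: space_vol)
      have "fmetric E p (d p) (\<lambda>j. d p j + B u p j) = fmetric E p (d p) (d p) + fmetric E p (d p) (B u p)"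
        by (intro metric_add_right cint_top p msec_fibre dm)
      then show "fmetric E p (d p) (A u p) = fmetric E p (d p) (d p) + fmetric E p (d p) (B u p)"
        by (simp add: d_def)
    qed simp
    then show ?thesis
      unfolding L2_inner_def by (simp add: integrable_metric[OF d d] integrable_metric[OF d Bu])
  qed
  ultimately have "L2_inner vol E d d = 0" by simp
  then have "L2_norm vol E d = 0" by (simp add: L2_norm_def)
  then have "N2 d = 0" using L2_norm_square(1)[OF d] by simp
  then have "AE p in vol. d p = (\<lambda>j. 0)" by (rule N2_zero_imp[OF dm(1)])
  then show ?thesis by eventually_elim (auto simp: d_def fun_eq_iff)
qed

text \<open>Any extension agrees almost everywhere with \<open>\<phi> (s \<circ> f)\<close>, hence has the same adjoint.\<close>

lemma geom_op_extension_adjoint: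
  assumes f: "diffeo_pair f h" and \<phi>: "bundle_hom_pullback K C f E \<phi>"
    and T: "L2_extension K C vol E (geom_op C f \<phi>) T"
  shows "L2_adjoint K C vol E T (geom_adjoint h \<phi>)"
  unfolding L2_adjoint_def
proof (intro conjI ballI)
  show "L2_bounded_operator K C vol E (geom_adjoint h \<phi>)" by (rule geom_adjoint_bounded[OF f \<phi>])
  have bT: "L2_bounded_operator K C vol E T"
    and eq: "\<And>s. s \<in> Cc_sections C E \<Longrightarrow> AE p in vol. T s p = geom_op C f \<phi> s p"
    using T by (auto simp: L2_extension_def L2_eq_def)
  fix s u assume s: "s \<in> L2_sections C vol E" and u: "u \<in> L2_sections C vol E"
  have bG: "L2_bounded_operator K C vol E (geom_op C f \<phi>)" by (rule geom_op_bounded[OF f \<phi>])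
  have ae: "AE p in vol. T s p = geom_op C f \<phi> s p" by (rule agree_all[OF bT bG eq s])
  have "T s \<in> msec" "geom_op C f \<phi> s \<in> msec" "u \<in> msec"
    using bounded_operatorD(1)[OF bT s] bounded_operatorD(1)[OF bG s] u L2_iff by auto
  then have "L2_inner vol E (T s) u = L2_inner vol E (geom_op C f \<phi> s) u"
    unfolding L2_inner_def using ae
    by (intro integral_cong_AE metric_measurable) auto
  then show "L2_inner vol E (T s) u = L2_inner vol E s (geom_adjoint h \<phi> u)"
    using geom_adjoint_inner[OF f \<phi> s u] by simp
qed

end

theorem lemma2:
  fixes K :: "complex set"
    and C :: "('x, 'l, 'p, 'n::{finite,wellorder}) conical"
    and Or :: "('x, 'n) chart set"
    and g :: "('p, 'n) chart \<Rightarrow> 'p \<Rightarrow> 'n rmat"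
    and vol :: "'p measure"
    and E :: "nat \<Rightarrow> 'p vbundle"
    and P :: "nat \<Rightarrow> ('p \<Rightarrow> cvec) \<Rightarrow> 'p \<Rightarrow> cvec"
    and f :: "'p \<Rightarrow> 'p"
    and \<phi> :: "nat \<Rightarrow> 'p \<Rightarrow> cvec \<Rightarrow> cvec"
    and \<mu> n :: nat and \<nu> :: real
  assumes "K = \<real> \<or> K = UNIV"
    and "conical_manifold C" and "orientation C Or"
    and "conic_metric C g" and "riemannian_volume C g vol"
    and "\<forall>i\<le>n. metric_bundle K C (E i)"
    and "0 < \<nu>" and "elliptic_cone_complex K C \<mu> \<nu> n E P"
    and "geometric_endomorphism K C n E P f \<phi>"
  shows "(\<forall>i\<le>n. \<forall>\<psi>\<in>Cc_sections C (E i). geom_op C f (\<phi> i) \<psi> \<in> Cc_sections C (E i)) \<and>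
    (\<forall>i\<le>n. \<exists>T. L2_extension K C vol (E i) (geom_op C f (\<phi> i)) T) \<and>
    (\<forall>i\<le>n. \<forall>T. L2_extension K C vol (E i) (geom_op C f (\<phi> i)) T \<longrightarrow>
      (\<exists>T'. L2_adjoint K C vol (E i) T T') \<and>
      (\<forall>T'. L2_adjoint K C vol (E i) T T' \<longrightarrow>
        (\<forall>\<psi>\<in>Cc_sections C (E i). \<exists>\<eta>\<in>Cc_sections C (E i). L2_eq vol (T' \<psi>) \<eta>)))"
proof -
  have L2: "L2_mfd C K (E i) g vol" if "i \<le> n" for i
    using assms(1,2,4,5,6) that by unfold_locales auto
  have cm: "conical_mfd C" using assms(2) by unfold_locales
  have "diffeo (cres C) (catlas C) (cres C) (catlas C) f"
    and \<phi>: "\<And>i. i \<le> n \<Longrightarrow> bundle_hom_pullback K C f (E i) (\<phi> i)"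
    using assms(9) unfolding geometric_endomorphism_def by blast+
  then obtain h where f: "conical_mfd.diffeo_pair C f h"
    unfolding diffeo_def conical_mfd.diffeo_pair_def[OF cm] by blast
  show ?thesis
  proof (intro conjI allI impI ballI)
    fix i \<psi> assume i: "i \<le> n" and \<psi>: "\<psi> \<in> Cc_sections C (E i)"
    interpret L2_mfd C K "E i" g vol by (rule L2[OF i])
    show "geom_op C f (\<phi> i) \<psi> \<in> Cc_sections C (E i)" by (rule geom_op_Cc[OF f \<phi>[OF i] \<psi>])
  next
    fix i assume i: "i \<le> n"
    interpret L2_mfd C K "E i" g vol by (rule L2[OF i])
    show "\<exists>T. L2_extension K C vol (E i) (geom_op C f (\<phi> i)) T"
      using geom_op_bounded[OF f \<phi>[OF i]]
      by (intro exI[of _ "geom_op C f (\<phi> i)"]) (simp add: L2_extension_def L2_eq_def)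
  next
    fix i T assume i: "i \<le> n" and T: "L2_extension K C vol (E i) (geom_op C f (\<phi> i)) T"
    interpret L2_mfd C K "E i" g vol by (rule L2[OF i])
    note adj = geom_op_extension_adjoint[OF f \<phi>[OF i] T]
    then show "\<exists>T'. L2_adjoint K C vol (E i) T T'" by blast
    fix T' \<psi> assume T': "L2_adjoint K C vol (E i) T T'" and \<psi>: "\<psi> \<in> Cc_sections C (E i)"
    have "L2_eq vol (T' \<psi>) (geom_adjoint h (\<phi> i) \<psi>)"
      unfolding L2_eq_def by (rule L2_adjoint_unique[OF T' adj Cc_L2[OF \<psi>]])
    then show "\<exists>\<eta>\<in>Cc_sections C (E i). L2_eq vol (T' \<psi>) \<eta>"
      using geom_adjoint_Cc[OF f \<phi>[OF i] \<psi>] by blast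
  qed
qed

end
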